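(* Suppose $\mathbb{P}_{\pi}(A_1=0)=0$ and $\mathbb{P}_{\pi}(B_1=0)<1$. Suppose that a fixed point $P\in\mathcal{P}(\mathcal S,\mathbb R)$ of $\Psi_1$ exists and let $R$ denote a random variable with conditional law $P(i,\cdot)$ given $M_0=i$ for each $i\in\mathcal S$. Then one of the following cases occurs: (C1) $\Pi_{\tau_n(i)}\to0$ a.s. and $\mathbb{E}_iJ_i(\log^+|B_1^i|)<\infty$ for all $i\in\mathcal S$. In this case, $P$ is the unique fixed point of $\Psi_1$ and $P(i,\cdot)$ equals the law of the perpetuity $Z_\infty=\sum_{n\ge1}\Pi_{n-1}B_n$ under $\mathbb{P}_i$. (C2) $\mathbb{P}_i(A_1^i=1)<\mathbb{P}_i(|A_1^i|=1)=1$ for all $i\in\mathcal S$. In this case, $\mathbb{P}_\pi(A_1c_{M_1}+B_1=c_{M_0})=1$ holds for a unique sequence $(c_i)_{i\in\mathcal S}$ of reals, and there exists a positive sequence $(a_i)_{i\in\mathcal S}$ such that $P(i,\cdot)$ equals the law of $a_iX+c_i$ for all $i$, for a random variable $X$ with symmetric distribution $F$ on $\mathbb R$. Equivalently, $R=a_{M_0}X+c_{M_0}$ for a symmetric random variable $X$ independent of $M_0$. (C3) $\mathbb{P}_i(A_1^i=1,B_1^i=0)=1$ for all $i\in\mathcal S$. In this case, there exist an infinite class $\mathcal C$ of real sequences $(c_i)_{i\in\mathcal S}$ that can be parametrized by the value of $c_{i_0}$ for any fixed $i_0\in\mathcal S$, a positive sequence $(a_i)_{i\in\mathcal S}$ and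 a $\{\pm1\}$-valued sequence $(\sigma_i)_{i\in\mathcal S}$ such that, for $(c_i)_{i\in\mathcal S}\in\mathcal C$, $P(i,\cdot)$ equals the law of $a_i\sigma_iX+c_i$ for all $i$, for a random variable $X$ with arbitrary distribution $F$ on $\mathbb R$. Equivalently, $R=a_{M_0}\sigma_{M_0}X+c_{M_0}$ for a random variable $X$ independent of $M_0$. (C4) $\limsup_{n\to\infty}|\Pi_{\tau_n(i)}|=\infty$ a.s. for all $i\in\mathcal S$. In this case, $\mathbb{P}_i(A_1^ic_i+B_1^i=c_i)=1$ for all $i\in\mathcal S$ for a unique sequence $(c_i)_{i\in\mathcal S}$, and $P(i,\cdot)=\delta_{c_i}$, $i\in\mathcal S$, is the unique fixed point of $\Psi_1$.
   Context: Setting: $(M_n)_{n\ge0}$ is an ergodic (irreducible, positive recurrent, aperiodic) Markov chain on a countable state space $\mathcal{S}$ with transition matrix $(p_{ij})$ and unique stationary law $\pi=(\pi_i)_{i\in\mathcal S}$. $(A_n,B_n)_{n\ge1}$ is a sequence of $\mathbb{R}^2$-valued random vectors modulated by $(M_n)_{n\ge0}$: given the whole sequence $(M_n)_{n\ge0}$, the $(A_n,B_n)$ are conditionally independent, and $\mathbb{P}((A_n,B_n)\in\cdot\,|M_{n-1}=i,M_n=j)=K_{ij}$ for a stochastic kernel $K$ from $\mathcal S^2$ to $\mathbb R^2$ not depending on $n$. Write $\mathbb{P}_i=\mathbb{P}(\cdot|M_0=i)$, $\mathbb{P}_\pi=\sum_i\pi_i\mathbb{P}_i$, with expectations $\mathbb{E}_i,\mathbb{E}_\pi$;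 "a.s." without qualifier means $\mathbb{P}_\pi$-a.s. Notation: $\Psi_n(x)=A_nx+B_n$; $\Psi_{1:n}=\Psi_1\circ\cdots\circ\Psi_n$; $\Pi_0=1$, $\Pi_n=A_1\cdots A_n$; $S_n=-\log|\Pi_n|$. For $i\in\mathcal S$: $\tau_0(i)=0$, $\tau_n(i)=\inf\{k>\tau_{n-1}(i):M_k=i\}$, $\tau(i)=\tau_1(i)$; $A_1^i=\Pi_{\tau(i)}$, $B_1^i=\sum_{k=1}^{\tau(i)}\Pi_{k-1}B_k$. $J_i(0)=1$ and, for $x>0$, $J_i(x)=x/\mathbb{E}_i(S_{\tau(i)}^+\wedge x)$ if $\mathbb{P}_i(S_{\tau(i)}\le0)<1$, and $J_i(x)=x$ otherwise. $\log^+0=0$. Fixed points: $\mathcal P(\mathcal S,\mathbb R)$ is the set of probability kernels from $\mathcal S$ to $\mathbb R$. $\Psi_1$ acts on $\mathcal P(\mathcal S,\mathbb R)$ by letting $\Psi_1P(i,\cdot)$ be the conditional law of $A_1R'+B_1$ given $M_0=i$, where $R'$ and $(A_1,B_1)$ are conditionally independent given $(M_0,M_1)$ and the conditional law of $R'$ given $M_0=i,M_1=j$ is $P(j,\cdot)$ for all $i,j$; that is, $\Psi_1P(i,E)=\sum_{j}p_{ij}\int K_{ij}(\{(a,b):ar+b\in E\})\,P(j,dr)$. $P$ is a fixed point of $\Psi_1$ if $\Psi_1P(i,\cdot)=P(i,\cdot)$ for all $i\in\mathcal S$. In (C1), the sum $Z_\infty$ is understood, under $\mathbb P_i$, as the a.s.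 limit of the partial sums $\sum_{k=1}^{\tau_n(i)}\Pi_{k-1}B_k$ along the return times as $n\to\infty$. *)

theory Defs
  imports "HOL-Probability.Probability"
begin

subsection \<open>Ergodic chains on a countable state space\<close>

primrec nstep :: "('s \<Rightarrow> 's pmf) \<Rightarrow> nat \<Rightarrow> 's \<Rightarrow> 's pmf" where
  "nstep p 0 i = return_pmf i"
| "nstep p (Suc n) i = bind_pmf (nstep p n i) p"

definition irreducible_chain :: "('s \<Rightarrow> 's pmf) \<Rightarrow> bool" where
  "irreducible_chain p \<longleftrightarrow> (\<forall>i j. \<exists>n. pmf (nstep p n i) j > 0)"

definition aperiodic_chain :: "('s \<Rightarrow> 's pmf) \<Rightarrow> bool" where
  "aperiodic_chain p \<longleftrightarrow> (\<forall>i. Gcd {n. 0 < n \<and> pmf (nstep p n i) i > 0} = 1)"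

text \<open>The conditional measure given that the chain starts in \<open>i\<close>.\<close>

definition start_at :: "'w measure \<Rightarrow> (nat \<Rightarrow> 'w \<Rightarrow> 's) \<Rightarrow> 's \<Rightarrow> 'w measure" where
  "start_at Pr M i = uniform_measure Pr {w \<in> space Pr. M 0 w = i}"

text \<open>The successive hitting times of \<open>i\<close> after time 0; the infimum of the empty set is \<open>\<infinity>\<close>.\<close>

primrec ret :: "(nat \<Rightarrow> 'w \<Rightarrow> 's) \<Rightarrow> 's \<Rightarrow> nat \<Rightarrow> 'w \<Rightarrow> enat" where
  "ret M i 0 w = 0"
| "ret M i (Suc n) w = Inf {enat k | k. ret M i n w < enat k \<and> M k w = i}"

definition positive_recurrent :: "'w measure \<Rightarrow> (nat \<Rightarrow> 'w \<Rightarrow> 's) \<Rightarrow> bool" where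
  "positive_recurrent Pr M \<longleftrightarrow>
     (\<forall>i. (\<integral>\<^sup>+ w. ennreal_of_enat (ret M i 1 w) \<partial>start_at Pr M i) < \<infinity>)"

text \<open>
  Under positive recurrence all hitting times are almost surely finite, so that the value of
  \<^const>\<open>the_enat\<close> at \<open>\<infinity>\<close> only matters on a null set.
\<close>

definition ret_nat :: "(nat \<Rightarrow> 'w \<Rightarrow> 's) \<Rightarrow> 's \<Rightarrow> nat \<Rightarrow> 'w \<Rightarrow> nat" where
  "ret_nat M i n w = the_enat (ret M i n w)"


subsection \<open>Modulated sequences\<close>

text \<open>
  \<open>Pr\<close> is the stationary measure: the chain \<open>M\<close> has initial law \<open>\<pi>\<close>. The conditional measures
  given the initial state are \<^term>\<open>start_at Pr M i\<close>; irreducibility and stationarity force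
  \<open>pmf \<pi> i > 0\<close> for all \<open>i\<close>.  The assumption \<open>conditional_law\<close> says that, given the
  \<open>\<sigma>\<close>-algebra generated by the whole sequence \<open>M\<close>, the vectors \<open>(A k, B k)\<close>, \<open>k \<ge> 1\<close>, are
  independent with respective laws \<open>K (M (k - 1)) (M k)\<close>.  The values \<open>A 0\<close> and \<open>B 0\<close> are
  irrelevant.
\<close>

locale markov_modulated = prob_space Pr
  for Pr :: "'w measure" +
  fixes M :: "nat \<Rightarrow> 'w \<Rightarrow> 's::countable"
    and A B :: "nat \<Rightarrow> 'w \<Rightarrow> real"
    and p :: "'s \<Rightarrow> 's pmf"
    and K :: "'s \<Rightarrow> 's \<Rightarrow> (real \<times> real) measure"
    and \<pi> :: "'s pmf"
  assumes M_measurable: "\<And>n. M n \<in> measurable Pr (count_space UNIV)"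
    and A_measurable: "\<And>n. 1 \<le> n \<Longrightarrow> A n \<in> borel_measurable Pr"
    and B_measurable: "\<And>n. 1 \<le> n \<Longrightarrow> B n \<in> borel_measurable Pr"
    and K_kernel: "\<And>i j. K i j \<in> space (prob_algebra borel)"
    and initial_law: "distr Pr (count_space UNIV) (M 0) = measure_pmf \<pi>"
    and markov: "\<And>n (x :: nat \<Rightarrow> 's).
      \<P>(w in Pr. \<forall>k\<le>Suc n. M k w = x k)
        = \<P>(w in Pr. \<forall>k\<le>n. M k w = x k) * pmf (p (x n)) (x (Suc n))"
    and conditional_law: "\<And>n (E :: nat \<Rightarrow> (real \<times> real) set).
      (\<And>k. E k \<in> sets borel) \<Longrightarrow>
      AE w in Pr.
        real_cond_exp Pr
          (vimage_algebra (space Pr) (\<lambda>w k. M k w) (PiM UNIV (\<lambda>_. count_space UNIV)))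
          (indicator {w \<in> space Pr. \<forall>k\<in>{1..n}. (A k w, B k w) \<in> E k}) w
        = (\<Prod>k=1..n. measure (K (M (k - 1) w) (M k w)) (E k))"
    and stationary: "bind_pmf \<pi> p = \<pi>"
    and irreducible: "irreducible_chain p"
    and aperiodic: "aperiodic_chain p"
    and pos_recurrent: "positive_recurrent Pr M"

definition Pi_prod :: "(nat \<Rightarrow> 'w \<Rightarrow> real) \<Rightarrow> nat \<Rightarrow> 'w \<Rightarrow> real" where
  "Pi_prod A n w = (\<Prod>k=1..n. A k w)"

definition perp_sum ::
    "(nat \<Rightarrow> 'w \<Rightarrow> real) \<Rightarrow> (nat \<Rightarrow> 'w \<Rightarrow> real) \<Rightarrow> nat \<Rightarrow> 'w \<Rightarrow> real" where
  "perp_sum A B n w = (\<Sum>k=1..n. Pi_prod A (k - 1) w * B k w)"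

definition cycle_A ::
    "(nat \<Rightarrow> 'w \<Rightarrow> 's) \<Rightarrow> (nat \<Rightarrow> 'w \<Rightarrow> real) \<Rightarrow> 's \<Rightarrow> 'w \<Rightarrow> real" where
  "cycle_A M A i w = Pi_prod A (ret_nat M i 1 w) w"

definition cycle_B ::
    "(nat \<Rightarrow> 'w \<Rightarrow> 's) \<Rightarrow> (nat \<Rightarrow> 'w \<Rightarrow> real) \<Rightarrow> (nat \<Rightarrow> 'w \<Rightarrow> real) \<Rightarrow> 's \<Rightarrow> 'w \<Rightarrow> real" where
  "cycle_B M A B i w = perp_sum A B (ret_nat M i 1 w) w"

text \<open>
  Since \<open>ln 0 = 0\<close>, the next definition deviates from the usual convention
  \<open>- ln 0 = \<infinity>\<close> where the product vanishes, a null set if \<open>A 1 \<noteq> 0\<close> almost surely.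
\<close>

definition S_walk :: "(nat \<Rightarrow> 'w \<Rightarrow> real) \<Rightarrow> nat \<Rightarrow> 'w \<Rightarrow> real" where
  "S_walk A n w = - ln \<bar>Pi_prod A n w\<bar>"

definition J_fun ::
    "'w measure \<Rightarrow> (nat \<Rightarrow> 'w \<Rightarrow> 's) \<Rightarrow> (nat \<Rightarrow> 'w \<Rightarrow> real) \<Rightarrow> 's \<Rightarrow> real \<Rightarrow> real" where
  "J_fun Pr M A i x =
     (if x = 0 then 1
      else if \<P>(w in start_at Pr M i. S_walk A (ret_nat M i 1 w) w \<le> 0) < 1
      then x / (\<integral>w. min (max 0 (S_walk A (ret_nat M i 1 w) w)) x \<partial>start_at Pr M i)
      else x)"

text \<open>Here \<open>ln 0 = 0\<close> gives the intended value at 0.\<close>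

definition log_plus :: "real \<Rightarrow> real" where
  "log_plus y = max 0 (ln y)"


subsection \<open>Fixed points\<close>

definition prob_kernels :: "('s \<Rightarrow> real measure) set" where
  "prob_kernels = {P. \<forall>i. P i \<in> space (prob_algebra borel)}"

definition Psi1 ::
    "('s \<Rightarrow> 's pmf) \<Rightarrow> ('s \<Rightarrow> 's \<Rightarrow> (real \<times> real) measure) \<Rightarrow> ('s \<Rightarrow> real measure) \<Rightarrow> 's \<Rightarrow> real measure"
  where
  "Psi1 p K P i =
     measure_pmf (p i) \<bind> (\<lambda>j. distr (P j \<Otimes>\<^sub>M K i j) borel (\<lambda>(r, a, b). a * r + b))"

definition fixed_point ::
    "('s \<Rightarrow> 's pmf) \<Rightarrow> ('s \<Rightarrow> 's \<Rightarrow> (real \<times> real) measure) \<Rightarrow> ('s \<Rightarrow> real measure) \<Rightarrow> bool" where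
  "fixed_point p K P \<longleftrightarrow> P \<in> prob_kernels \<and> (\<forall>i. Psi1 p K P i = P i)"

lemma emeasure_Psi1:
  assumes K: "\<And>i j. K i j \<in> space (prob_algebra borel)"
    and P: "P \<in> prob_kernels" and E: "E \<in> sets borel"
  shows "emeasure (Psi1 p K P i) E =
    (\<integral>\<^sup>+ j. (\<integral>\<^sup>+ r. emeasure (K i j) {(a, b). a * r + b \<in> E} \<partial>P j) \<partial>measure_pmf (p i))"
proof -
  have setsP: "sets (P j) = sets borel" and probP: "prob_space (P j)" for j
    using P by (auto simp: prob_kernels_def space_prob_algebra)
  have setsK: "sets (K i j) = sets borel" and probK: "prob_space (K i j)" for j
    using K by (auto simp: space_prob_algebra)
  have sets2: "sets (P j \<Otimes>\<^sub>M K i j) = sets borel" for j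
    using sets_pair_measure_cong[OF setsP[of j] setsK[of j]]
    by (simp only: borel_prod)
  have meas0: "(\<lambda>(r, a, b). a * r + b) \<in> borel_measurable (borel :: (real \<times> real \<times> real) measure)"
    unfolding split_beta by (intro borel_measurable_continuous_onI continuous_intros)
  have meas: "(\<lambda>(r, a, b). a * r + b) \<in> borel_measurable (P j \<Otimes>\<^sub>M K i j)" for j
    using meas0 measurable_cong_sets[OF sets2 refl] by blast
  have spP: "space (P j) = UNIV" and spK: "space (K i j) = UNIV" for j
    using sets_eq_imp_space_eq[OF setsP] sets_eq_imp_space_eq[OF setsK] by simp_all
  define D where "D j = distr (P j \<Otimes>\<^sub>M K i j) borel (\<lambda>(r, a, b). a * r + b)" for j
  have probD: "prob_space (D j)" for j
  proof -
    interpret pair_prob_space "P j" "K i j"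
      using probP probK
      by (simp add: pair_prob_space_def pair_sigma_finite_def prob_space_imp_sigma_finite)
    show ?thesis
      unfolding D_def by (rule prob_space_distr[OF meas])
  qed
  have D: "D \<in> measurable (measure_pmf (p i)) (subprob_algebra borel)"
    using probD
    by (auto simp: space_subprob_algebra D_def intro!: prob_space_imp_subprob_space)
  have val: "emeasure (D j) E = (\<integral>\<^sup>+ r. emeasure (K i j) {(a, b). a * r + b \<in> E} \<partial>P j)" for j
  proof -
    interpret sigma_finite_measure "K i j"
      using probK by (rule prob_space_imp_sigma_finite)
    have X: "(\<lambda>(r, a, b). a * r + b) -` E \<inter> space (P j \<Otimes>\<^sub>M K i j) \<in> sets (P j \<Otimes>\<^sub>M K i j)"
      using measurable_sets[OF meas E] .
    have "emeasure (D j) E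
        = emeasure (P j \<Otimes>\<^sub>M K i j) ((\<lambda>(r, a, b). a * r + b) -` E \<inter> space (P j \<Otimes>\<^sub>M K i j))"
      unfolding D_def by (rule emeasure_distr[OF meas E])
    also have "\<dots> = (\<integral>\<^sup>+ r. emeasure (K i j)
        (Pair r -` ((\<lambda>(r, a, b). a * r + b) -` E \<inter> space (P j \<Otimes>\<^sub>M K i j))) \<partial>P j)"
      by (rule emeasure_pair_measure_alt[OF X])
    also have "\<dots> = (\<integral>\<^sup>+ r. emeasure (K i j) {(a, b). a * r + b \<in> E} \<partial>P j)"
      by (intro nn_integral_cong arg_cong2[where f = emeasure] refl)
        (auto simp: space_pair_measure spP spK)
    finally show ?thesis .
  qed
  have "emeasure (Psi1 p K P i) E = (\<integral>\<^sup>+ j. emeasure (D j) E \<partial>measure_pmf (p i))"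
    unfolding Psi1_def D_def[symmetric]
    by (rule emeasure_bind[OF _ D E]) simp
  then show ?thesis
    by (simp add: val)
qed


subsection \<open>The four cases\<close>

definition contractive_case ::
    "'w measure \<Rightarrow> (nat \<Rightarrow> 'w \<Rightarrow> 's) \<Rightarrow> (nat \<Rightarrow> 'w \<Rightarrow> real) \<Rightarrow> (nat \<Rightarrow> 'w \<Rightarrow> real) \<Rightarrow> bool" where
  "contractive_case Pr M A B \<longleftrightarrow>
     (\<forall>i. (AE w in Pr. (\<lambda>n. Pi_prod A (ret_nat M i n w) w) \<longlonglongrightarrow> 0) \<and>
          (\<integral>\<^sup>+ w. ennreal (J_fun Pr M A i (log_plus \<bar>cycle_B M A B i w\<bar>)) \<partial>start_at Pr M i) < \<infinity>)"

definition reflection_case ::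
    "'w measure \<Rightarrow> (nat \<Rightarrow> 'w \<Rightarrow> 's) \<Rightarrow> (nat \<Rightarrow> 'w \<Rightarrow> real) \<Rightarrow> bool" where
  "reflection_case Pr M A \<longleftrightarrow>
     (\<forall>i. \<P>(w in start_at Pr M i. cycle_A M A i w = 1)
            < \<P>(w in start_at Pr M i. \<bar>cycle_A M A i w\<bar> = 1) \<and>
          \<P>(w in start_at Pr M i. \<bar>cycle_A M A i w\<bar> = 1) = 1)"

definition identity_case ::
    "'w measure \<Rightarrow> (nat \<Rightarrow> 'w \<Rightarrow> 's) \<Rightarrow> (nat \<Rightarrow> 'w \<Rightarrow> real) \<Rightarrow> (nat \<Rightarrow> 'w \<Rightarrow> real) \<Rightarrow> bool" where
  "identity_case Pr M A B \<longleftrightarrow>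
     (\<forall>i. \<P>(w in start_at Pr M i. cycle_A M A i w = 1 \<and> cycle_B M A B i w = 0) = 1)"

definition unbounded_case ::
    "'w measure \<Rightarrow> (nat \<Rightarrow> 'w \<Rightarrow> 's) \<Rightarrow> (nat \<Rightarrow> 'w \<Rightarrow> real) \<Rightarrow> bool" where
  "unbounded_case Pr M A \<longleftrightarrow>
     (\<forall>i. AE w in Pr. limsup (\<lambda>n. ereal \<bar>Pi_prod A (ret_nat M i n w) w\<bar>) = \<infinity>)"

definition symmetric_law :: "real measure \<Rightarrow> bool" where
  "symmetric_law F \<longleftrightarrow> F \<in> space (prob_algebra borel) \<and> distr F borel uminus = F"

definition conditional_law_given_start ::
    "'w measure \<Rightarrow> (nat \<Rightarrow> 'w \<Rightarrow> 's) \<Rightarrow> ('w \<Rightarrow> real) \<Rightarrow> ('s \<Rightarrow> real measure) \<Rightarrow> bool" where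
  "conditional_law_given_start Pr M R P \<longleftrightarrow>
     R \<in> borel_measurable Pr \<and> (\<forall>i. distr (start_at Pr M i) borel R = P i)"

text \<open>
  \<open>R = g (M 0) * X + c (M 0)\<close> almost surely for some random variable \<open>X\<close> with law \<open>F\<close>
  that is independent of \<open>M 0\<close>; \<^const>\<open>prob_space.indep_var\<close> would require both variables
  to have the same value type.
\<close>

definition affine_representation ::
    "'w measure \<Rightarrow> (nat \<Rightarrow> 'w \<Rightarrow> 's) \<Rightarrow> ('w \<Rightarrow> real) \<Rightarrow> ('s \<Rightarrow> real) \<Rightarrow> ('s \<Rightarrow> real) \<Rightarrow> real measure \<Rightarrow> bool"
  where
  "affine_representation Pr M R g c F \<longleftrightarrow>
     (\<exists>X \<in> borel_measurable Pr.
        distr Pr borel X = F \<and>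
        prob_space.indep_set Pr
          (sets (vimage_algebra (space Pr) (M 0) (count_space UNIV)))
          (sets (vimage_algebra (space Pr) X borel)) \<and>
        (AE w in Pr. R w = g (M 0 w) * X w + c (M 0 w)))"

end

theory Submission
  imports Defs
begin

text \<open>
  Let \<open>R\<close> have law \<open>P i\<close> under \<open>\<P>\<^sub>i\<close>, and let \<open>\<Psi>\<^sub>1\<^sub>:\<^sub>n\<close> be the random affine map along the first \<open>n\<close> steps.
  The mass that the image of \<open>P M\<^sub>n\<close> under \<open>\<Psi>\<^sub>1\<^sub>:\<^sub>n\<close> gives to a fixed set is a bounded martingale with mean
  \<open>P i E\<close>, so a maximal inequality controls these images at all times simultaneously. By recurrence and a zero-one law,
  the upper limit of \<open>|\<Pi>\<^sub>n|\<close> along the visits to \<open>i\<close> is almost surely \<open>0\<close>, almost surely \<open>\<infinity>\<close>, or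
  \<open>|\<Pi>\<^sub>n| = 1\<close> at every visit.

  If it is \<open>0\<close>, the maximal inequality bounds the perpetuity along the visits; the bound for the remainder after one
  visit then gives convergence, and \<open>P i\<close> is the law of the limit. Boundedness also yields
  \<open>log |B| \<le> S + C\<close> over consecutive independent cycles. With positive probability \<open>C\<close> is not random, and decomposing
  according to a large value of \<open>log |B|\<close> bounds the expected number of visits of the walk \<open>S\<close> below that value; Wald's
  identity bounds this number from below by \<open>J\<close>. If the upper limit is \<open>\<infinity>\<close>, maps of arbitrarily large slope
  send most of the mass of \<open>P i\<close> into one bounded interval, so \<open>P i\<close> is a point mass.

  If \<open>|\<Pi>\<^sub>n| = 1\<close> at all visits, \<open>|A|\<close> is a coboundary, and rescaling makes every map an isometry. By stationarity, the
  conditional variance of the characteristic functions then vanishes, so that \<open>\<Psi>\<^sub>1\<^sub>:\<^sub>n\<close> carries \<open>P M\<^sub>n\<close> exactly to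
  \<open>P M\<^sub>0\<close>. The maps along cycles are therefore isometries that preserve \<open>P i\<close>; no probability measure is invariant
  under a nontrivial translation, which leaves one reflection at most and the identity.
\<close>


subsection \<open>Path space\<close>

text \<open>No moment of \<open>log |A|\<close> is assumed, so the growth of \<open>|\<Pi>|\<close>
  cannot be read off from a drift. The substitute is one rigidity principle,
  \<open>isometric_fixed_point\<close>, which is used twice. Applied to the rescaled fixed point it
  yields the two isometric cases. Applied to the law of the logarithm of the upper limit of
  \<open>|\<Pi>|\<close> along the visits it yields the trichotomy: if this logarithm is finite, its
  laws form a fixed point of the random translations by \<open>ln |A|\<close>, and a translation
  along a loop that preserves a probability measure is zero.

  The trichotomy concerns one state at a time. Triviality of the cycle maps passes from one state to
  all others through coboundaries, and the upper limits 0 and infinity cannot occur at two different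
  states because a connecting path multiplies \<open>|\<Pi>|\<close> by a factor bounded away from
  zero with positive probability.

  \<open>Pr\<close> lives on an arbitrary space without a shift. Therefore all arguments take place
  on path space; only almost sure statements, laws and expectations are carried back.\<close>

text \<open>The marks \<open>(A, B)\<close> at time \<open>0\<close> are meaningless; they are fixed to be \<open>(0, 0)\<close>, so that \<open>shift\<close> maps paths to paths
  that again start with the dummy mark.\<close>

type_synonym 's path = "nat \<Rightarrow> 's \<times> real \<times> real"

definition path_space :: "'s::countable path measure" where
  "path_space = PiM UNIV (\<lambda>_. count_space UNIV \<Otimes>\<^sub>M borel)"

definition st :: "nat \<Rightarrow> 's path \<Rightarrow> 's" where "st k \<omega> = fst (\<omega> k)"
definition ca :: "nat \<Rightarrow> 's path \<Rightarrow> real" where "ca k \<omega> = fst (snd (\<omega> k))"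
definition cb :: "nat \<Rightarrow> 's path \<Rightarrow> real" where "cb k \<omega> = snd (snd (\<omega> k))"

definition shift :: "nat \<Rightarrow> 's path \<Rightarrow> 's path" where
  "shift n \<omega> k = (if k = 0 then (fst (\<omega> n), (0, 0)) else \<omega> (n + k))"

definition cyl :: "nat \<Rightarrow> (nat \<Rightarrow> 's) \<Rightarrow> (nat \<Rightarrow> (real \<times> real) set) \<Rightarrow> 's path set" where
  "cyl n x E = {\<omega>. \<forall>k\<le>n. fst (\<omega> k) = x k \<and> snd (\<omega> k) \<in> E k}"

text \<open>Cylinders over different words are disjoint, so the empty set arises as an intersection
  and is listed.\<close>

definition cyls :: "nat \<Rightarrow> 's path set set" where
  "cyls n = insert {} {cyl n x E | x E. \<forall>k. E k \<in> sets borel}"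

text \<open>The sigma-algebra of the first n + 1 coordinates, written as a measure so that
  \<open>measurable\<close> and product sigma-algebras apply to it. Generation by cylinders lets
  identities between finite measures be checked on \<open>cyls n\<close>.\<close>

definition hist :: "nat \<Rightarrow> 's path measure" where
  "hist n = sigma UNIV (cyls n)"

lemma st_shift: "st k (shift n \<omega>) = st (n + k) \<omega>"
  by (simp add: st_def shift_def)

lemma ca_shift: "0 < k \<Longrightarrow> ca k (shift n \<omega>) = ca (n + k) \<omega>"
  by (simp add: ca_def shift_def)

lemma cb_shift: "0 < k \<Longrightarrow> cb k (shift n \<omega>) = cb (n + k) \<omega>"
  by (simp add: cb_def shift_def)

lemma shift_shift: "shift m (shift n \<omega>) = shift (n + m) \<omega>"
  by (auto simp: shift_def fun_eq_iff add.assoc)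

lemma space_path_space [simp]: "space path_space = UNIV"
  by (auto simp: path_space_def space_PiM space_pair_measure)

lemma space_hist [simp]: "space (hist n) = UNIV"
  by (simp add: hist_def)

lemma sets_hist: "sets (hist n) = sigma_sets UNIV (cyls n)"
  by (simp add: hist_def)

lemma fst_path_measurable: "(\<lambda>\<omega>. fst (\<omega> k)) \<in> measurable path_space (count_space UNIV)"
  unfolding path_space_def by measurable

lemma snd_path_measurable: "(\<lambda>\<omega>. snd (\<omega> k)) \<in> measurable path_space borel"
  unfolding path_space_def by measurable

lemma st_measurable [measurable]: "st k \<in> measurable path_space (count_space UNIV)"
  unfolding st_def by (rule fst_path_measurable)

lemma ca_measurable [measurable]: "ca k \<in> borel_measurable path_space"
  unfolding ca_def by (intro measurable_compose[OF snd_path_measurable] borel_measurable_continuous_onI continuous_intros)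

lemma cb_measurable [measurable]: "cb k \<in> borel_measurable path_space"
  unfolding cb_def by (intro measurable_compose[OF snd_path_measurable] borel_measurable_continuous_onI continuous_intros)

lemma measurable_into_path_space:
  assumes "\<And>k. (\<lambda>w. fst (f w k)) \<in> measurable L (count_space UNIV)"
    and "\<And>k. (\<lambda>w. snd (f w k)) \<in> borel_measurable L"
  shows "f \<in> measurable L path_space"
proof -
  have "(\<lambda>w k. f w k) \<in> measurable L path_space"
    unfolding path_space_def
  proof (rule measurable_PiM_single')
    show "(\<lambda>w. f w k) \<in> measurable L (count_space UNIV \<Otimes>\<^sub>M borel)" for k
      using assms[of k] by (intro measurable_pair) (simp_all add: comp_def)
  qed (auto simp: space_pair_measure)
  then show ?thesis by simp
qed

lemma shift_measurable [measurable]: "shift n \<in> measurable path_space path_space"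
proof (rule measurable_into_path_space)
  show "(\<lambda>w. fst (shift n w k)) \<in> measurable path_space (count_space UNIV)" for k
    using fst_path_measurable[of n] fst_path_measurable[of "n + k"] by (cases k) (simp_all add: shift_def)
  show "(\<lambda>w. snd (shift n w k)) \<in> borel_measurable path_space" for k
    using snd_path_measurable[of "n + k"] by (cases k) (simp_all add: shift_def)
qed

section \<open>Cylinders as a generating family closed under intersection\<close>

lemma cyl_in_cyls: "(\<And>k. E k \<in> sets borel) \<Longrightarrow> cyl n x E \<in> cyls n"
  by (auto simp: cyls_def)

lemma cyl_sets:
  fixes x :: "nat \<Rightarrow> 's::countable"
  assumes "\<And>k. E k \<in> sets borel"
  shows "cyl n x E \<in> sets path_space"
proof -
  note [measurable] = fst_path_measurable snd_path_measurable assms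
  have "{\<omega>\<in>space path_space. \<forall>k\<le>n. fst (\<omega> k) = x k \<and> snd (\<omega> k) \<in> E k} \<in> sets path_space"
    by measurable
  then show ?thesis by (simp add: cyl_def)
qed

lemma cyls_sets: "X \<in> cyls n \<Longrightarrow> (X :: 's::countable path set) \<in> sets path_space"
  unfolding cyls_def using cyl_sets by blast

lemma cyls_Int:
  assumes "X \<in> cyls n" "Y \<in> cyls m" "n \<le> m"
  shows "X \<inter> Y \<in> cyls m"
proof (cases "X = {} \<or> Y = {}")
  case False
  with assms obtain x E y F where X: "X = cyl n x E" "\<forall>k. E k \<in> sets borel"
    and Y: "Y = cyl m y F" "\<forall>k. F k \<in> sets borel" by (auto simp: cyls_def)
  show ?thesis
  proof (cases "\<forall>k\<le>n. x k = y k")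
    case True
    then have "X \<inter> Y = cyl m y (\<lambda>k. if k \<le> n then E k \<inter> F k else F k)"
      using \<open>n \<le> m\<close> unfolding X Y by (auto simp: cyl_def split: if_splits)
    then show ?thesis using X Y by (simp add: cyl_in_cyls)
  next
    case neq: False
    then have "X \<inter> Y = {}" using \<open>n \<le> m\<close> unfolding X Y by (auto simp: cyl_def)
    then show ?thesis by (simp add: cyls_def)
  qed
qed (auto simp: cyls_def)

lemma Int_stable_cyls: "Int_stable (cyls n :: 's path set set)" "Int_stable (\<Union>n. cyls n :: 's path set set)"
proof -
  show "Int_stable (cyls n :: 's path set set)" by (auto simp: Int_stable_def intro: cyls_Int)
  show "Int_stable (\<Union>n. cyls n :: 's path set set)"
    unfolding Int_stable_def
  proof (intro ballI, elim UN_E)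
    fix X Y :: "'s path set" and n m assume XY: "X \<in> cyls n" "Y \<in> cyls m"
    show "X \<inter> Y \<in> (\<Union>n. cyls n)"
    proof (cases "n \<le> m")
      case True then show ?thesis using cyls_Int[OF XY] by auto
    next
      case False then have "Y \<inter> X \<in> cyls n" using cyls_Int[OF XY(2,1)] by simp
      then show ?thesis by (auto simp: Int_commute)
    qed
  qed
qed

text \<open>A countable cover of path space by cylinders, as the uniqueness theorem for measures
  requires. Words are lists because there are only countably many of them; the value of
  \<open>xs ! k\<close> beyond the end of a list is immaterial.\<close>

definition words :: "nat \<Rightarrow> 's path set set" where
  "words n = range (\<lambda>xs. cyl n (\<lambda>k. xs ! k) (\<lambda>_. UNIV))"

lemma words: "words n \<subseteq> (cyls n :: 's path set set)"
    "countable (words n :: 's::countable path set set)" "\<Union>(words n) = (UNIV :: 's path set)"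
proof -
  show "words n \<subseteq> (cyls n :: 's path set set)" by (auto simp: words_def intro!: cyl_in_cyls)
  show "countable (words n :: 's path set set)" unfolding words_def by simp
  have "\<omega> \<in> cyl n (\<lambda>k. map (\<lambda>k. fst (\<omega> k)) [0..<Suc n] ! k) (\<lambda>_. UNIV)" for \<omega> :: "'s path"
    unfolding cyl_def by (simp del: upt_Suc)
  then show "\<Union>(words n) = (UNIV :: 's path set)" unfolding words_def by blast
qed

text \<open>The other coordinates up to n are unconstrained, so the set is a countable union of
  cylinders over the words with y in position k.\<close>

lemma coordinate_sets:
  fixes n :: nat
  assumes "k \<le> n" "F \<in> sets borel"
  shows "{\<omega> :: 's::countable path. fst (\<omega> k) = y \<and> snd (\<omega> k) \<in> F} \<in> sigma_sets UNIV (cyls n)"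
proof -
  have "{\<omega> :: 's path. fst (\<omega> k) = y \<and> snd (\<omega> k) \<in> F} =
    (\<Union>xs\<in>{xs. xs ! k = y}. cyl n (\<lambda>k. xs ! k) (\<lambda>j. if j = k then F else UNIV))" (is "?L = ?R")
  proof (intro equalityI subsetI)
    fix \<omega> assume "\<omega> \<in> ?L"
    then have "\<omega> \<in> cyl n (\<lambda>k. map (\<lambda>k. fst (\<omega> k)) [0..<Suc n] ! k) (\<lambda>j. if j = k then F else UNIV)"
      "map (\<lambda>k. fst (\<omega> k)) [0..<Suc n] ! k = y"
      using assms unfolding cyl_def by (simp_all del: upt_Suc)
    then show "\<omega> \<in> ?R" by blast
  qed (use assms in \<open>auto simp: cyl_def\<close>)
  moreover have "?R \<in> sigma_sets UNIV (cyls n)"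
  proof -
    interpret sigma_algebra UNIV "sigma_sets UNIV (cyls n)"
      by (rule sigma_algebra_sigma_sets) simp
    show ?thesis
      using assms by (intro countable_UN') (auto intro!: sigma_sets.Basic cyl_in_cyls)
  qed
  ultimately show ?thesis by simp
qed

lemma coordinate_measurable:
  fixes k :: nat
  assumes "\<And>y F. F \<in> sets borel \<Longrightarrow> {\<omega> :: 's::countable path. fst (\<omega> k) = y \<and> snd (\<omega> k) \<in> F} \<in> sets L" "space L = UNIV"
  shows "(\<lambda>\<omega>. fst (\<omega> k)) \<in> measurable L (count_space UNIV)" "(\<lambda>\<omega>. snd (\<omega> k)) \<in> borel_measurable L"
proof -
  show "(\<lambda>\<omega>. fst (\<omega> k)) \<in> measurable L (count_space UNIV)"
    unfolding measurable_count_space_eq2_countable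
    using assms(1)[of UNIV] assms(2) by (auto simp: vimage_def)
  show "(\<lambda>\<omega>. snd (\<omega> k)) \<in> borel_measurable L"
  proof (rule measurableI)
    fix F :: "(real \<times> real) set" assume "F \<in> sets borel"
    then have "(\<Union>y::'s. {\<omega> :: 's::countable path. fst (\<omega> k) = y \<and> snd (\<omega> k) \<in> F}) \<in> sets L"
      using assms by (intro sets.countable_UN') auto
    moreover have "(\<Union>y::'s. {\<omega> :: 's::countable path. fst (\<omega> k) = y \<and> snd (\<omega> k) \<in> F}) = (\<lambda>\<omega>. snd (\<omega> k)) -` F \<inter> space L"
      using assms(2) by auto
    ultimately show "(\<lambda>\<omega>. snd (\<omega> k)) -` F \<inter> space L \<in> sets L" by simp
  qed simp
qed

lemma sets_path_space: "sets path_space = sigma_sets UNIV (\<Union>n. cyls n :: 's::countable path set set)"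
proof (intro equalityI)
  let ?G = "(\<Union>n. cyls n) :: 's path set set"
  define L where "L = sigma UNIV ?G"
  have "{\<omega> :: 's path. fst (\<omega> k) = y \<and> snd (\<omega> k) \<in> F} \<in> sets L" if "F \<in> sets borel" for k y F
    using coordinate_sets[OF order_refl that, of k y]
      sigma_sets_mono'[of "cyls k" ?G UNIV] unfolding L_def by auto
  then have "(\<lambda>\<omega>. \<omega>) \<in> measurable L path_space"
    by (intro measurable_into_path_space coordinate_measurable) (simp_all add: L_def)
  then show "sets path_space \<subseteq> sigma_sets UNIV ?G"
    using measurable_sets[of "\<lambda>\<omega>. \<omega>" L path_space] by (auto simp: L_def)
  show "sigma_sets UNIV ?G \<subseteq> sets path_space"
    using sets.sigma_sets_subset[of ?G path_space] cyls_sets by auto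
qed

lemma hist_le_path_space: "X \<in> sets (hist n) \<Longrightarrow> (X :: 's::countable path set) \<in> sets path_space"
  using sets.sigma_sets_subset[of "cyls n" path_space] cyls_sets by (auto simp: sets_hist)

lemma hist_coordinate:
  assumes "k \<le> n"
  shows "(\<lambda>\<omega>. fst (\<omega> k :: 's::countable \<times> _)) \<in> measurable (hist n) (count_space UNIV)"
    "(\<lambda>\<omega>. snd (\<omega> k :: 's::countable \<times> _)) \<in> borel_measurable (hist n)"
  by (intro coordinate_measurable; simp add: sets_hist coordinate_sets assms)+

lemma st_hist: "k \<le> n \<Longrightarrow> (st k :: 's::countable path \<Rightarrow> _) \<in> measurable (hist n) (count_space UNIV)"
  unfolding st_def by (rule hist_coordinate)

lemma ca_hist: "k \<le> n \<Longrightarrow> (ca k :: 's::countable path \<Rightarrow> _) \<in> borel_measurable (hist n)"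
  unfolding ca_def by (intro measurable_compose[OF hist_coordinate(2)] borel_measurable_continuous_onI continuous_intros)

lemma cb_hist: "k \<le> n \<Longrightarrow> (cb k :: 's::countable path \<Rightarrow> _) \<in> borel_measurable (hist n)"
  unfolding cb_def by (intro measurable_compose[OF hist_coordinate(2)] borel_measurable_continuous_onI continuous_intros)

lemma hist_mono:
  assumes "n \<le> m" "X \<in> sets (hist n)"
  shows "(X :: 's::countable path set) \<in> sets (hist m)"
proof -
  have "cyls n \<subseteq> sigma_sets UNIV (cyls m :: 's path set set)"
  proof
    fix X :: "'s path set" assume X: "X \<in> cyls n"
    show "X \<in> sigma_sets UNIV (cyls m)"
    proof (cases "X = {}")
      case False
      with X obtain x E where XE: "X = cyl n x E" "\<forall>k. E k \<in> sets borel" by (auto simp: cyls_def)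
      have "X = {\<omega>\<in>space (hist m). \<forall>k\<le>n. fst (\<omega> k) = x k \<and> snd (\<omega> k) \<in> E k}"
        by (auto simp: XE cyl_def)
      also have "\<dots> \<in> sets (hist m)"
      proof (intro sets.sets_Collect_countable_All)
        fix k
        show "{\<omega> \<in> space (hist m). k \<le> n \<longrightarrow> fst (\<omega> k) = x k \<and> snd (\<omega> k) \<in> E k} \<in> sets (hist m)"
          using XE(2) \<open>n \<le> m\<close> coordinate_sets[of k m "E k" "x k"]
          by (cases "k \<le> n") (simp_all add: sets_hist sigma_sets_top)
      qed
      finally show ?thesis by (simp add: sets_hist)
    qed (simp add: sigma_sets.Empty)
  qed
  then have "sigma_sets UNIV (cyls n) \<subseteq> sigma_sets UNIV (cyls m :: 's path set set)"
    by (rule sigma_sets_mono)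
  then show ?thesis using assms by (auto simp: sets_hist)
qed


subsection \<open>The chain on path space\<close>

text \<open>The canonical version of the modulated chain: one law of paths for each starting state,
  determined by its values on cylinders. The factor with \<open>E 0\<close> expresses that the mark
  at time 0 is the dummy \<open>(0, 0)\<close>. Recurrence is derived below from the stationary
  law.\<close>

locale path_chain =
  fixes Q :: "'s::countable \<Rightarrow> 's path measure"
    and p :: "'s \<Rightarrow> 's pmf"
    and K :: "'s \<Rightarrow> 's \<Rightarrow> (real \<times> real) measure"
    and \<pi> :: "'s pmf"
  assumes prob_Q: "\<And>i. prob_space (Q i)"
    and sets_Q [measurable_cong]: "\<And>i. sets (Q i) = sets path_space"
    and cyl_Q: "\<And>i n x E. (\<And>k. E k \<in> sets borel) \<Longrightarrow>
      emeasure (Q i) (cyl n x E) = (if x 0 = i \<and> (0, 0) \<in> E 0 then 1 else 0) *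
        (\<Prod>k<n. ennreal (pmf (p (x k)) (x (Suc k))) * emeasure (K (x k) (x (Suc k))) (E (Suc k)))"
    and K_kernel: "\<And>i j. K i j \<in> space (prob_algebra borel)"
    and stationary: "bind_pmf \<pi> p = \<pi>"
    and irreducible: "irreducible_chain p"
    and nonzero: "\<And>i. AE \<omega> in Q i. ca 1 \<omega> \<noteq> 0"
begin

sublocale Q: prob_space "Q i" for i by (rule prob_Q)

lemma sigma_finite_Q: "sigma_finite_measure (Q i)"
  by unfold_locales

lemma space_Q [simp]: "space (Q i) = UNIV"
  using sets_eq_imp_space_eq[OF sets_Q[of i]] by simp

lemma K_prob: "prob_space (K i j)" and K_sets [measurable_cong]: "sets (K i j) = sets borel"
  using K_kernel[of i j] by (auto simp: space_prob_algebra)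

lemma K_space [simp]: "space (K i j) = UNIV"
  using sets_eq_imp_space_eq[OF K_sets[of i j]] by simp

lemma st_0: "AE \<omega> in Q i. st 0 \<omega> = i"
proof -
  have "emeasure (Q i) {\<omega>\<in>space (Q i). st 0 \<omega> = i} = 1"
    using cyl_Q[of "\<lambda>_. UNIV" i 0 "\<lambda>_. i"] by (simp add: cyl_def st_def)
  then show ?thesis
    by (subst Q.AE_iff_emeasure_eq_1) simp_all
qed

text \<open>If the two words fit together at time n, the intersection is again a cylinder and its
  weight factorizes; otherwise both sides vanish. \<open>F 0\<close> is tested only at the dummy
  mark, because \<open>shift\<close> erases the mark at time n.\<close>

lemma markov_cyl:
  assumes E: "\<And>k. E k \<in> sets borel" and F: "\<And>k. F k \<in> sets borel"
  shows "emeasure (Q i) (cyl n x E \<inter> shift n -` cyl m y F) =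
    emeasure (Q i) (cyl n x E) * emeasure (Q (x n)) (cyl m y F)"
proof (cases "x n = y 0 \<and> (0, 0) \<in> F 0")
  case True
  define z where "z k = (if k \<le> n then x k else y (k - n))" for k
  define G where "G k = (if k \<le> n then E k else F (k - n))" for k
  define w where "w u H k = ennreal (pmf (p (u k)) (u (Suc k))) * emeasure (K (u k) (u (Suc k))) (H (Suc k))"
    for u :: "nat \<Rightarrow> 's" and H k
  have set_eq: "cyl n x E \<inter> shift n -` cyl m y F = cyl (n + m) z G"
  proof (intro equalityI subsetI)
    fix \<omega> assume a: "\<omega> \<in> cyl n x E \<inter> shift n -` cyl m y F"
    show "\<omega> \<in> cyl (n + m) z G"
      unfolding cyl_def
    proof (intro CollectI allI impI)
      fix k assume k: "k \<le> n + m"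
      show "fst (\<omega> k) = z k \<and> snd (\<omega> k) \<in> G k"
      proof (cases "k \<le> n")
        case True then show ?thesis using a by (simp add: cyl_def z_def G_def)
      next
        case False
        then have "k - n \<le> m" "0 < k - n" "n + (k - n) = k" using k by auto
        with a have "fst (shift n \<omega> (k - n)) = y (k - n) \<and> snd (shift n \<omega> (k - n)) \<in> F (k - n)"
          by (auto simp: cyl_def)
        with \<open>0 < k - n\<close> \<open>n + (k - n) = k\<close> False show ?thesis by (simp add: shift_def z_def G_def)
      qed
    qed
  next
    fix \<omega> assume a: "\<omega> \<in> cyl (n + m) z G"
    have "fst (\<omega> k) = x k \<and> snd (\<omega> k) \<in> E k" if "k \<le> n" for k
      using a that by (auto simp: cyl_def z_def G_def dest!: spec[of _ k])
    then have "\<omega> \<in> cyl n x E" by (simp add: cyl_def)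
    moreover have "fst (shift n \<omega> k) = y k \<and> snd (shift n \<omega> k) \<in> F k" if "k \<le> m" for k
      using a that True by (cases "k = 0") (auto simp: cyl_def z_def G_def shift_def dest!: spec[of _ "n + k"] split: if_splits)
    ultimately show "\<omega> \<in> cyl n x E \<inter> shift n -` cyl m y F" by (auto simp: cyl_def)
  qed
  have "(\<Prod>k<n + l. w z G k) = (\<Prod>k<n. w x E k) * (\<Prod>k<l. w y F k)" for l
  proof (induction l)
    case 0
    show ?case by (auto intro!: prod.cong simp: w_def z_def G_def)
  next
    case (Suc l)
    have "w z G (n + l) = w y F l"
      using True by (auto simp: w_def z_def G_def Suc_diff_le)
    then show ?case using Suc by (simp add: mult.assoc)
  qed
  moreover have "G k \<in> sets borel" for k using E F by (simp add: G_def)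
  moreover have "z 0 = x 0" "G 0 = E 0" by (simp_all add: z_def G_def)
  ultimately show ?thesis
    unfolding set_eq using E F True by (simp add: cyl_Q w_def[symmetric] mult.assoc)
next
  case False
  then have "cyl n x E \<inter> shift n -` cyl m y F = {}"
    by (auto simp: cyl_def shift_def)
  moreover have "emeasure (Q (x n)) (cyl m y F) = 0"
    using False F by (auto simp: cyl_Q)
  ultimately show ?thesis by simp
qed

lemma markov_cyl_future:
  assumes E: "\<And>k. E k \<in> sets borel" and B: "B \<in> sets path_space"
  shows "emeasure (Q i) (cyl n x E \<inter> shift n -` B) = emeasure (Q i) (cyl n x E) * emeasure (Q (x n)) B"
proof -
  define A where "A = cyl n x E"
  have A [measurable]: "A \<in> sets path_space" using E by (simp add: A_def cyl_sets)
  \<comment> \<open>As functions of B both sides are finite measures, and they agree on cylinders by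
    \<open>markov_cyl\<close>.\<close>
  define M1 where "M1 = distr (density (Q i) (indicator A)) path_space (shift n)"
  define M2 where "M2 = scale_measure (emeasure (Q i) A) (Q (x n))"
  have M1: "emeasure M1 B = emeasure (Q i) (A \<inter> shift n -` B)" if [measurable]: "B \<in> sets path_space" for B
  proof -
    have "shift n -` B \<in> sets (Q i)" using measurable_sets[OF shift_measurable that, of n] by (simp add: sets_Q)
    then show ?thesis
      unfolding M1_def by (subst emeasure_distr) (auto simp: emeasure_density sets_Q indicator_inter_arith[symmetric] A)
  qed
  have "M1 = M2"
  proof (rule measure_eqI_generator_eq_countable)
    show "Int_stable (\<Union>n. cyls n :: 's path set set)" by (rule Int_stable_cyls)
    show "emeasure M1 X = emeasure M2 X" if "X \<in> (\<Union>n. cyls n)" for X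
    proof -
      from that have "X \<in> sets path_space" using cyls_sets by auto
      moreover from that obtain m where "X \<in> cyls m" by auto
      ultimately show ?thesis
        using markov_cyl[OF E, where i = i and n = n and x = x and m = m] by (auto simp: M1 cyls_def M2_def A_def)
    qed
    show "sets M1 = sigma_sets UNIV (\<Union>n. cyls n)" "sets M2 = sigma_sets UNIV (\<Union>n. cyls n)"
      by (simp_all add: M1_def M2_def sets_Q sets_path_space)
    show "words 0 \<subseteq> (\<Union>n. cyls n :: 's path set set)" using words(1)[of 0] by auto
    show "emeasure M1 a \<noteq> \<infinity>" if "a \<in> words 0" for a
    proof -
      have "a \<in> sets path_space" using that words(1)[of 0] cyls_sets by blast
      then show ?thesis by (simp add: M1)
    qed
  qed (use words(2,3)[of 0] in auto)
  then show ?thesis using M1[OF B] by (simp add: M2_def A_def)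
qed

text \<open>The same uniqueness argument in the past variable. Fixing the state at time n turns the
  law of the future into a constant factor, so both sides are measures in A.\<close>

lemma markov_hist:
  assumes A: "A \<in> sets (hist n)" and B [measurable]: "B \<in> sets path_space"
  shows "emeasure (Q i) (A \<inter> {\<omega>. st n \<omega> = j} \<inter> shift n -` B) =
    emeasure (Q i) (A \<inter> {\<omega>. st n \<omega> = j}) * emeasure (Q j) B"
proof -
  have J [measurable]: "{\<omega>. st n \<omega> = j} \<in> sets path_space"
    using measurable_sets[OF st_measurable[of n], of "{j}"] by (simp add: vimage_def)
  have S [measurable]: "shift n -` B \<in> sets path_space"
    using measurable_sets[OF shift_measurable B, of n] by simp
  have [measurable]: "(\<lambda>x. x) \<in> measurable path_space (hist n)"
    by (rule measurableI) (auto dest: hist_le_path_space)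
  define M1 where "M1 = distr (density (Q i) (indicator ({\<omega>. st n \<omega> = j} \<inter> shift n -` B))) (hist n) (\<lambda>x. x)"
  define M2 where "M2 = distr (density (Q i) (\<lambda>\<omega>. indicator {\<omega>. st n \<omega> = j} \<omega> * emeasure (Q j) B)) (hist n) (\<lambda>x. x)"
  have M1: "emeasure M1 A = emeasure (Q i) (A \<inter> {\<omega>. st n \<omega> = j} \<inter> shift n -` B)" if "A \<in> sets (hist n)" for A
  proof -
    have [measurable]: "A \<in> sets path_space" using that by (rule hist_le_path_space)
    show ?thesis using that
      unfolding M1_def by (subst emeasure_distr)
        (simp_all add: emeasure_density sets_Q indicator_inter_arith[symmetric] Int_ac)
  qed
  have M2: "emeasure M2 A = emeasure (Q i) (A \<inter> {\<omega>. st n \<omega> = j}) * emeasure (Q j) B" if "A \<in> sets (hist n)" for A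
  proof -
    have [measurable]: "A \<in> sets path_space" using that by (rule hist_le_path_space)
    have "emeasure M2 A = (\<integral>\<^sup>+\<omega>. emeasure (Q j) B * indicator (A \<inter> {\<omega>. st n \<omega> = j}) \<omega> \<partial>Q i)"
      using that unfolding M2_def by (subst emeasure_distr)
        (auto simp: emeasure_density sets_Q indicator_inter_arith mult_ac intro!: nn_integral_cong)
    also have "\<dots> = emeasure (Q j) B * emeasure (Q i) (A \<inter> {\<omega>. st n \<omega> = j})"
      by (rule nn_integral_cmult_indicator) measurable
    finally show ?thesis by (simp add: mult.commute)
  qed
  have "M1 = M2"
  proof (rule measure_eqI_generator_eq_countable)
    show "Int_stable (cyls n :: 's path set set)" by (rule Int_stable_cyls)
    show "emeasure M1 X = emeasure M2 X" if X: "X \<in> cyls n" for X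
    proof -
      have hX: "X \<in> sets (hist n)" using X by (simp add: sets_hist)
      show ?thesis
      proof (cases "X \<inter> {\<omega>. st n \<omega> = j} = {}")
        case True then show ?thesis by (simp add: M1[OF hX] M2[OF hX])
      next
        case False
        then obtain x E where E: "X = cyl n x E" "\<forall>k. E k \<in> sets borel" using X by (auto simp: cyls_def)
        with False have "x n = j" "X \<inter> {\<omega>. st n \<omega> = j} = X" by (auto simp: cyl_def st_def)
        then show ?thesis using markov_cyl_future[OF _ B, of E i n x] E
          unfolding M1[OF hX] M2[OF hX] by simp
      qed
    qed
    show "sets M1 = sigma_sets UNIV (cyls n)" "sets M2 = sigma_sets UNIV (cyls n)"
      by (simp_all add: M1_def M2_def sets_hist)
    show "emeasure M1 a \<noteq> \<infinity>" if "a \<in> words n" for a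
    proof -
      have "a \<in> sets (hist n)" using that words(1)[of n] by (auto simp: sets_hist)
      then show ?thesis by (simp add: M1)
    qed
  qed (use words[of n] in auto)
  then show ?thesis using M1[OF A] M2[OF A] by simp
qed

lemma nn_integral_split_state:
  assumes [measurable]: "g \<in> borel_measurable path_space"
  shows "(\<integral>\<^sup>+\<omega>. g \<omega> \<partial>Q i) = (\<integral>\<^sup>+j. (\<integral>\<^sup>+\<omega>. indicator {\<omega>. st n \<omega> = j} \<omega> * g \<omega> \<partial>Q i) \<partial>count_space UNIV)"
proof -
  have [measurable]: "{\<omega>. st n \<omega> = j} \<in> sets path_space" for j
    using measurable_sets[OF st_measurable[of n], of "{j}"] by (simp add: vimage_def)
  have "(\<integral>\<^sup>+j. (\<integral>\<^sup>+\<omega>. indicator {\<omega>. st n \<omega> = j} \<omega> * g \<omega> \<partial>Q i) \<partial>count_space UNIV)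
    = (\<integral>\<^sup>+\<omega>. (\<integral>\<^sup>+j. indicator {\<omega>. st n \<omega> = j} \<omega> * g \<omega> \<partial>count_space UNIV) \<partial>Q i)"
    by (rule nn_integral_count_space_nn_integral[symmetric]) auto
  also have "\<dots> = (\<integral>\<^sup>+\<omega>. g \<omega> \<partial>Q i)"
  proof (rule nn_integral_cong)
    fix \<omega>
    have "(\<integral>\<^sup>+j. indicator {\<omega>. st n \<omega> = j} \<omega> * g \<omega> \<partial>count_space UNIV)
      = (\<integral>\<^sup>+j. g \<omega> * indicator {st n \<omega>} j \<partial>count_space UNIV)"
      by (intro nn_integral_cong) (auto simp: indicator_def)
    also have "\<dots> = g \<omega>" by (subst nn_integral_cmult_indicator) auto
    finally show "(\<integral>\<^sup>+j. indicator {\<omega>. st n \<omega> = j} \<omega> * g \<omega> \<partial>count_space UNIV) = g \<omega>" .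
  qed
  finally show ?thesis by simp
qed

lemma id_hist [measurable]: "(\<lambda>x. x) \<in> measurable path_space (hist n :: 's path measure)"
  by (rule measurableI) (auto dest: hist_le_path_space)

text \<open>On the event that the chain is in j at time n, the joint law of past and future is a
  product measure and Fubini applies; the countably many j are then summed. Measurability with
  respect to \<open>hist n\<close> is what confines the first argument of f to the past.\<close>

theorem markov:
  assumes f [measurable]: "(\<lambda>(\<omega>, \<omega>'). f \<omega> \<omega>') \<in> borel_measurable (hist n \<Otimes>\<^sub>M path_space)"
  shows "(\<integral>\<^sup>+\<omega>. f \<omega> (shift n \<omega>) \<partial>Q i) = (\<integral>\<^sup>+\<omega>. (\<integral>\<^sup>+\<omega>'. f \<omega> \<omega>' \<partial>Q (st n \<omega>)) \<partial>Q i)"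
proof -
  have J [measurable]: "{\<omega>. st n \<omega> = j} \<in> sets path_space" for j
    using measurable_sets[OF st_measurable[of n], of "{j}"] by (simp add: vimage_def)
  have pair: "(\<lambda>\<omega> :: 's path. (\<omega>, shift n \<omega>)) \<in> measurable path_space (hist n \<Otimes>\<^sub>M path_space)" by measurable
  have fm: "(\<lambda>\<omega>. f \<omega> (shift n \<omega>)) \<in> borel_measurable path_space"
    using measurable_compose[OF pair f] by simp
  have inner: "(\<lambda>\<omega>. \<integral>\<^sup>+\<omega>'. f \<omega> \<omega>' \<partial>Q j) \<in> borel_measurable (hist n)" for j
  proof -
    have "(\<lambda>(\<omega>, \<omega>'). f \<omega> \<omega>') \<in> borel_measurable (hist n \<Otimes>\<^sub>M Q j)"
      using f by (simp cong: measurable_cong_sets add: sets_pair_measure_cong[OF refl sets_Q])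
    from sigma_finite_measure.borel_measurable_nn_integral[OF sigma_finite_Q this] show ?thesis by simp
  qed
  have inner': "(\<lambda>\<omega>. \<integral>\<^sup>+\<omega>'. f \<omega> \<omega>' \<partial>Q j) \<in> borel_measurable path_space" for j
    using measurable_compose[OF id_hist inner] by simp
  have outer: "(\<lambda>\<omega>. \<integral>\<^sup>+\<omega>'. f \<omega> \<omega>' \<partial>Q (st n \<omega>)) \<in> borel_measurable path_space"
    by (rule measurable_compose_countable[OF inner' st_measurable])
  have main: "(\<integral>\<^sup>+\<omega>. indicator {\<omega>. st n \<omega> = j} \<omega> * f \<omega> (shift n \<omega>) \<partial>Q i) =
    (\<integral>\<^sup>+\<omega>. indicator {\<omega>. st n \<omega> = j} \<omega> * (\<integral>\<^sup>+\<omega>'. f \<omega> \<omega>' \<partial>Q (st n \<omega>)) \<partial>Q i)" for j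
  proof -
    define D where "D = density (Q i) (indicator {\<omega>. st n \<omega> = j})"
    have sD [measurable_cong]: "sets D = sets path_space" by (simp add: D_def sets_Q)
    have eD: "emeasure D X = emeasure (Q i) (X \<inter> {\<omega>. st n \<omega> = j})" if "X \<in> sets path_space" for X
      using that unfolding D_def by (simp add: emeasure_density sets_Q indicator_inter_arith[symmetric] Int_commute)
    define \<mu> where "\<mu> = distr D (hist n) (\<lambda>x. x)"
    define R where "R = distr D (hist n \<Otimes>\<^sub>M path_space) (\<lambda>\<omega>. (\<omega>, shift n \<omega>))"
    have e\<mu>: "emeasure \<mu> X = emeasure (Q i) (X \<inter> {\<omega>. st n \<omega> = j})" if "X \<in> sets (hist n)" for X
      using that hist_le_path_space[OF that] sets_eq_imp_space_eq[OF sD]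
      unfolding \<mu>_def by (subst emeasure_distr) (simp_all add: eD)
    have "finite_measure \<mu>"
    proof (rule finite_measureI)
      have "UNIV \<in> sets (hist n :: 's path measure)" using sets.top[of "hist n :: 's path measure"] by simp
      then show "emeasure \<mu> (space \<mu>) \<noteq> \<infinity>" using e\<mu>[of UNIV] by (simp add: \<mu>_def)
    qed
    then have sf: "sigma_finite_measure \<mu>" by (simp add: finite_measure_def)
    have eq: "\<mu> \<Otimes>\<^sub>M Q j = R"
    proof (rule pair_measure_eqI)
      show "sets (\<mu> \<Otimes>\<^sub>M Q j) = sets R"
        unfolding R_def by (simp add: \<mu>_def sets_Q cong: sets_pair_measure_cong)
      fix A B assume A: "A \<in> sets \<mu>" and B: "B \<in> sets (Q j)"
      then have A: "A \<in> sets (hist n)" and [measurable]: "B \<in> sets path_space" by (simp_all add: \<mu>_def sets_Q)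
      have "emeasure R (A \<times> B) = emeasure D (A \<inter> shift n -` B)"
        unfolding R_def using A sets_eq_imp_space_eq[OF sD]
        by (subst emeasure_distr) (auto intro!: arg_cong2[where f=emeasure])
      also have "\<dots> = emeasure (Q i) (A \<inter> {\<omega>. st n \<omega> = j} \<inter> shift n -` B)"
        using hist_le_path_space[OF A] measurable_sets[OF shift_measurable, of B n]
        by (subst eD) (auto simp: Int_ac)
      also have "\<dots> = emeasure (Q i) (A \<inter> {\<omega>. st n \<omega> = j}) * emeasure (Q j) B"
        by (rule markov_hist[OF A]) simp
      finally show "emeasure \<mu> A * emeasure (Q j) B = emeasure R (A \<times> B)"
        by (simp add: e\<mu>[OF A])
    qed (rule sf, rule sigma_finite_Q)
    have "(\<integral>\<^sup>+\<omega>. indicator {\<omega>. st n \<omega> = j} \<omega> * f \<omega> (shift n \<omega>) \<partial>Q i) = (\<integral>\<^sup>+\<omega>. f \<omega> (shift n \<omega>) \<partial>D)"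
      unfolding D_def by (subst nn_integral_density) (auto intro!: fm simp: measurable_cong_sets[OF sets_Q refl])
    also have "\<dots> = (\<integral>\<^sup>+z. (case z of (\<omega>, \<omega>') \<Rightarrow> f \<omega> \<omega>') \<partial>R)"
      unfolding R_def by (subst nn_integral_distr) (auto intro!: f simp: measurable_cong_sets[OF sD refl] pair)
    also have "\<dots> = (\<integral>\<^sup>+\<omega>. (\<integral>\<^sup>+\<omega>'. f \<omega> \<omega>' \<partial>Q j) \<partial>\<mu>)"
      unfolding eq[symmetric]
    proof (subst sigma_finite_measure.nn_integral_fst[OF sigma_finite_Q, symmetric])
      have "sets (\<mu> \<Otimes>\<^sub>M Q j) = sets (hist n \<Otimes>\<^sub>M path_space)"
        by (simp add: \<mu>_def sets_Q cong: sets_pair_measure_cong)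
      then show "(\<lambda>(\<omega>, \<omega>'). f \<omega> \<omega>') \<in> borel_measurable (\<mu> \<Otimes>\<^sub>M Q j)"
        using f by (simp cong: measurable_cong_sets)
    qed simp
    also have "\<dots> = (\<integral>\<^sup>+\<omega>. (\<integral>\<^sup>+\<omega>'. f \<omega> \<omega>' \<partial>Q j) \<partial>D)"
      unfolding \<mu>_def by (subst nn_integral_distr) (auto intro!: inner simp: measurable_cong_sets[OF sD refl])
    also have "\<dots> = (\<integral>\<^sup>+\<omega>. indicator {\<omega>. st n \<omega> = j} \<omega> * (\<integral>\<^sup>+\<omega>'. f \<omega> \<omega>' \<partial>Q j) \<partial>Q i)"
      unfolding D_def by (subst nn_integral_density) (auto intro!: inner' simp: measurable_cong_sets[OF sets_Q refl])
    also have "\<dots> = (\<integral>\<^sup>+\<omega>. indicator {\<omega>. st n \<omega> = j} \<omega> * (\<integral>\<^sup>+\<omega>'. f \<omega> \<omega>' \<partial>Q (st n \<omega>)) \<partial>Q i)"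
      by (intro nn_integral_cong) (simp split: split_indicator)
    finally show ?thesis .
  qed
  show ?thesis
    unfolding nn_integral_split_state[OF fm, of i n] nn_integral_split_state[OF outer, of i n] main ..
qed

text \<open>The first step of a path is a draw from \<open>p i\<close> followed by a draw from the
  kernel. This is the bridge between path laws and \<open>Psi1\<close>.\<close>

lemma one_step:
  assumes f [measurable]: "f \<in> borel_measurable (count_space UNIV \<Otimes>\<^sub>M borel)"
  shows "(\<integral>\<^sup>+\<omega>. f (st 1 \<omega>, ca 1 \<omega>, cb 1 \<omega>) \<partial>Q i) = (\<integral>\<^sup>+j. (\<integral>\<^sup>+z. f (j, z) \<partial>K i j) \<partial>measure_pmf (p i))"
proof -
  have J [measurable]: "{\<omega>. st 1 \<omega> = j} \<in> sets path_space" for j :: 's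
    using measurable_sets[OF st_measurable[of 1], of "{j}"] by (simp add: vimage_def)
  have tup: "(st 1 \<omega>, ca 1 \<omega>, cb 1 \<omega>) = \<omega> 1" for \<omega> :: "'s path" by (simp add: st_def ca_def cb_def)
  have [measurable]: "(\<lambda>\<omega>. \<omega> 1) \<in> measurable path_space (count_space UNIV \<Otimes>\<^sub>M borel :: ('s \<times> real \<times> real) measure)"
    unfolding path_space_def by measurable
  note snd_path_measurable[measurable]
  have fm: "(\<lambda>\<omega>. f (\<omega> 1)) \<in> borel_measurable path_space" by measurable
  have "(\<integral>\<^sup>+\<omega>. indicator {\<omega>. st 1 \<omega> = j} \<omega> * f (\<omega> 1) \<partial>Q i) = ennreal (pmf (p i) j) * (\<integral>\<^sup>+z. f (j, z) \<partial>K i j)" for j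
  proof -
    define D where "D = distr (density (Q i) (indicator {\<omega>. st 1 \<omega> = j})) borel (\<lambda>\<omega>. snd (\<omega> 1))"
    have "D = scale_measure (ennreal (pmf (p i) j)) (K i j)"
    proof (rule measure_eqI)
      show "sets D = sets (scale_measure (ennreal (pmf (p i) j)) (K i j))" by (simp add: D_def K_sets)
      fix X assume "X \<in> sets D"
      then have X [measurable]: "X \<in> sets borel" by (simp add: D_def)
      have "emeasure D X = emeasure (Q i) ({\<omega>. st 1 \<omega> = j} \<inter> (\<lambda>\<omega>. snd (\<omega> 1)) -` X)"
      proof -
        have [measurable]: "(\<lambda>\<omega>. snd (\<omega> 1)) -` X \<in> sets (path_space :: 's path measure)"
          using measurable_sets[OF snd_path_measurable X, of 1] by simp
        show ?thesis unfolding D_def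
          by (subst emeasure_distr) (simp_all add: emeasure_density sets_Q indicator_inter_arith[symmetric] del: One_nat_def)
      qed
      also have "\<dots> = emeasure (Q i) (cyl 1 (case_nat i (\<lambda>_. j)) (case_nat UNIV (\<lambda>_. X)))"
      proof (rule emeasure_eq_AE)
        show "AE \<omega> in Q i. (\<omega> \<in> {\<omega>. st 1 \<omega> = j} \<inter> (\<lambda>\<omega>. snd (\<omega> 1)) -` X) = (\<omega> \<in> cyl 1 (case_nat i (\<lambda>_. j)) (case_nat UNIV (\<lambda>_. X)))"
          using st_0[of i] by eventually_elim (auto simp: cyl_def st_def le_Suc_eq)
        show "{\<omega>. st 1 \<omega> = j} \<inter> (\<lambda>\<omega>. snd (\<omega> 1)) -` X \<in> sets (Q i)"
          using measurable_sets[OF snd_path_measurable X, of 1] by (simp add: sets_Q)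
        show "cyl 1 (case_nat i (\<lambda>_. j)) (case_nat UNIV (\<lambda>_. X)) \<in> sets (Q i)"
          unfolding sets_Q by (rule cyl_sets) (simp split: nat.split)
      qed
      also have "\<dots> = ennreal (pmf (p i) j) * emeasure (K i j) X"
        by (subst cyl_Q) (simp_all split: nat.split)
      finally show "emeasure D X = emeasure (scale_measure (ennreal (pmf (p i) j)) (K i j)) X"
        by simp
    qed
    moreover have "(\<integral>\<^sup>+\<omega>. indicator {\<omega>. st 1 \<omega> = j} \<omega> * f (\<omega> 1) \<partial>Q i) = (\<integral>\<^sup>+z. f (j, z) \<partial>D)"
    proof -
      have "(\<integral>\<^sup>+z. f (j, z) \<partial>D) = (\<integral>\<^sup>+\<omega>. indicator {\<omega>. st 1 \<omega> = j} \<omega> * f (j, snd (\<omega> 1)) \<partial>Q i)"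
        unfolding D_def by (subst nn_integral_distr, simp, measurable) (subst nn_integral_density; simp)
      also have "\<dots> = (\<integral>\<^sup>+\<omega>. indicator {\<omega>. st 1 \<omega> = j} \<omega> * f (\<omega> 1) \<partial>Q i)"
        by (intro nn_integral_cong) (auto simp: st_def split: split_indicator)
      finally show ?thesis by simp
    qed
    ultimately show ?thesis by (simp add: nn_integral_scale_measure)
  qed
  then show ?thesis
    unfolding tup by (subst nn_integral_split_state[OF fm, of i 1]) (simp add: nn_integral_measure_pmf)
qed

end


subsection \<open>Harmonic functions and recurrence\<close>

lemma Pi_prod_0 [simp]: "Pi_prod A 0 w = 1" and perp_sum_0 [simp]: "perp_sum A B 0 w = 0"
  by (simp_all add: Pi_prod_def perp_sum_def)

lemma Pi_prod_Suc: "Pi_prod A (Suc n) w = Pi_prod A n w * A (Suc n) w"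
  by (simp add: Pi_prod_def)

lemma perp_sum_Suc: "perp_sum A B (Suc n) w = perp_sum A B n w + Pi_prod A n w * B (Suc n) w"
  by (simp add: perp_sum_def)

lemma Pi_prod_shift: "Pi_prod ca (n + k) \<omega> = Pi_prod ca n \<omega> * Pi_prod ca k (shift n \<omega>)"
  by (induction k) (simp_all add: Pi_prod_Suc ca_shift)

lemma perp_sum_shift:
  "perp_sum ca cb (n + k) \<omega> = perp_sum ca cb n \<omega> + Pi_prod ca n \<omega> * perp_sum ca cb k (shift n \<omega>)"
  by (induction k) (simp_all add: perp_sum_Suc cb_shift Pi_prod_shift distrib_left mult.assoc)

lemma Pi_prod_measurable [measurable]: "Pi_prod ca n \<in> borel_measurable path_space"
  unfolding Pi_prod_def by measurable

lemma perp_sum_measurable [measurable]: "perp_sum ca cb n \<in> borel_measurable path_space"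
  unfolding perp_sum_def by measurable

lemma Pi_prod_hist: "n \<le> m \<Longrightarrow> (Pi_prod ca n :: 's::countable path \<Rightarrow> _) \<in> borel_measurable (hist m)"
  unfolding Pi_prod_def by (intro borel_measurable_prod ca_hist) auto

lemma perp_sum_hist: "n \<le> m \<Longrightarrow> (perp_sum ca cb n :: 's::countable path \<Rightarrow> _) \<in> borel_measurable (hist m)"
  unfolding perp_sum_def by (intro borel_measurable_sum borel_measurable_times Pi_prod_hist cb_hist) auto

lemma path_Collect: "Measurable.pred path_space R \<Longrightarrow> {\<omega>. R \<omega>} \<in> sets path_space"
  by (simp add: pred_def)

lemma st_sets [measurable]: "{\<omega>. st n \<omega> = j} \<in> sets path_space"
  by (rule path_Collect) measurable

lemma shift_sets [measurable]: "B \<in> sets path_space \<Longrightarrow> shift n -` B \<in> sets path_space"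
  using measurable_sets[OF shift_measurable, of B n] by simp

text \<open>The law \<pi> is invariant under every n-step kernel, so its support contains everything
  that can be reached from one of its points.\<close>

lemma stationary_support:
  fixes p :: "'s \<Rightarrow> 's pmf"
  assumes stat: "bind_pmf \<pi> p = \<pi>" and irr: "irreducible_chain p"
  shows "set_pmf \<pi> = UNIV"
proof -
  have b: "bind_pmf \<pi> (nstep p n) = \<pi>" for n
  proof (induction n)
    case 0
    have "nstep p 0 = return_pmf" by (simp add: fun_eq_iff)
    then show ?case by (simp add: bind_return_pmf')
  next
    case (Suc n)
    have "nstep p (Suc n) = (\<lambda>i. bind_pmf (nstep p n i) p)" by (simp add: fun_eq_iff)
    then have "bind_pmf \<pi> (nstep p (Suc n)) = bind_pmf (bind_pmf \<pi> (nstep p n)) p"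
      by (simp add: bind_assoc_pmf)
    then show ?case by (simp add: Suc stat del: nstep.simps)
  qed
  obtain i where i: "i \<in> set_pmf \<pi>" using set_pmf_not_empty[of \<pi>] by auto
  have "j \<in> set_pmf \<pi>" for j
  proof -
    obtain n where "pmf (nstep p n i) j > 0" using irr unfolding irreducible_chain_def by blast
    then have "j \<in> set_pmf (nstep p n i)" by (simp add: set_pmf_iff)
    then have "j \<in> set_pmf (bind_pmf \<pi> (nstep p n))" using i by auto
    then show ?thesis by (simp add: b)
  qed
  then show ?thesis by auto
qed

section \<open>Bounded harmonic functions under a stationary law\<close>

context path_chain begin

lemma pmf_\<pi>_support: "set_pmf \<pi> = UNIV"
  by (rule stationary_support[OF stationary irreducible])

lemma const_of_edges:
  assumes "\<And>i j. j \<in> set_pmf (p i) \<Longrightarrow> h j = h i"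
  shows "h i = h j"
proof -
  have "j \<in> set_pmf (nstep p n i) \<Longrightarrow> h j = h i" for n j
    by (induction n arbitrary: j) (auto simp: assms)
  moreover obtain n where "pmf (nstep p n i) j > 0" using irreducible unfolding irreducible_chain_def by blast
  ultimately have "h j = h i" by (metis set_pmf_iff less_irrefl)
  then show ?thesis by simp
qed

lemma stationary_nn_integral: "(\<integral>\<^sup>+i. (\<integral>\<^sup>+j. f j \<partial>measure_pmf (p i)) \<partial>measure_pmf \<pi>) = (\<integral>\<^sup>+i. f i \<partial>measure_pmf \<pi>)"
  by (subst nn_integral_bind_pmf[symmetric]) (simp add: stationary)

lemma stationary_integral:
  fixes f :: "'s \<Rightarrow> real"
  assumes f: "\<And>i. 0 \<le> f i" "\<And>i. f i \<le> C"
  shows "(\<integral>i. (\<integral>j. f j \<partial>measure_pmf (p i)) \<partial>measure_pmf \<pi>) = (\<integral>i. f i \<partial>measure_pmf \<pi>)"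
proof -
  have int: "integrable (measure_pmf q) f" for q :: "'s pmf"
    using f by (intro measure_pmf.integrable_const_bound[where B = C]) auto
  have inner: "ennreal (\<integral>j. f j \<partial>measure_pmf (p i)) = (\<integral>\<^sup>+j. ennreal (f j) \<partial>measure_pmf (p i))" for i
    using int f by (intro nn_integral_eq_integral[symmetric]) auto
  have "(\<integral>i. (\<integral>j. f j \<partial>measure_pmf (p i)) \<partial>measure_pmf \<pi>)
    = enn2real (\<integral>\<^sup>+i. ennreal (\<integral>j. f j \<partial>measure_pmf (p i)) \<partial>measure_pmf \<pi>)"
    using f by (intro integral_eq_nn_integral) auto
  also have "\<dots> = enn2real (\<integral>\<^sup>+i. ennreal (f i) \<partial>measure_pmf \<pi>)"
    by (simp add: inner stationary_nn_integral)
  also have "\<dots> = (\<integral>i. f i \<partial>measure_pmf \<pi>)"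
    using f by (intro integral_eq_nn_integral[symmetric]) auto
  finally show ?thesis .
qed

text \<open>The conditional variance \<open>E\<^sub>i (h M\<^sub>1 - h i)\<^sup>2 = E\<^sub>i (h M\<^sub>1)\<^sup>2 - (h i)\<^sup>2\<close> has \<open>\<pi>\<close>-mean zero.\<close>

lemma harmonic_const:
  fixes h :: "'s \<Rightarrow> real"
  assumes bound: "\<And>i. \<bar>h i\<bar> \<le> C"
    and harmonic: "\<And>i. (\<integral>j. h j \<partial>measure_pmf (p i)) = h i"
  shows "h i = h j"
proof (rule const_of_edges)
  have C: "0 \<le> C" using bound[of i] by linarith
  have sq: "(h i)\<^sup>2 \<le> C\<^sup>2" for i using bound[of i] C by (metis abs_le_square_iff abs_of_nonneg)
  have bdd: "integrable (measure_pmf q) f" if "\<And>j. \<bar>f j\<bar> \<le> D" for q :: "'s pmf" and f :: "'s \<Rightarrow> real" and D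
    using that by (intro measure_pmf.integrable_const_bound[where B = D]) auto
  have int: "integrable (measure_pmf q) h" "integrable (measure_pmf q) (\<lambda>j. (h j)\<^sup>2)" for q :: "'s pmf"
    using bdd[of h C, OF bound] bdd[of "\<lambda>j. (h j)\<^sup>2" "C\<^sup>2"] sq by simp_all
  define v where "v i = (\<integral>j. (h j - h i)\<^sup>2 \<partial>measure_pmf (p i))" for i
  have v: "v i = (\<integral>j. (h j)\<^sup>2 \<partial>measure_pmf (p i)) - (h i)\<^sup>2" for i
  proof -
    have "v i = (\<integral>j. (h j)\<^sup>2 - 2 * h i * h j + (h i)\<^sup>2 \<partial>measure_pmf (p i))"
      unfolding v_def by (intro Bochner_Integration.integral_cong) (auto simp: power2_eq_square algebra_simps)
    also have "\<dots> = (\<integral>j. (h j)\<^sup>2 \<partial>measure_pmf (p i)) - 2 * h i * (\<integral>j. h j \<partial>measure_pmf (p i)) + (h i)\<^sup>2"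
      using int by simp
    finally show ?thesis by (simp add: harmonic power2_eq_square)
  qed
  have "\<bar>\<integral>j. (h j)\<^sup>2 \<partial>measure_pmf (p i)\<bar> \<le> C\<^sup>2" for i
  proof -
    have "(\<integral>j. (h j)\<^sup>2 \<partial>measure_pmf (p i)) \<le> (\<integral>j. C\<^sup>2 \<partial>measure_pmf (p i))"
      using int sq by (intro integral_mono) auto
    then show ?thesis by simp
  qed
  then have int2: "integrable \<pi> (\<lambda>i. \<integral>j. (h j)\<^sup>2 \<partial>measure_pmf (p i))"
    by (intro measure_pmf.integrable_const_bound[where B = "C\<^sup>2"]) auto
  have intv: "integrable \<pi> v" unfolding v using int int2 by auto
  have "(\<integral>i. v i \<partial>measure_pmf \<pi>) = 0"
    unfolding v using int int2 stationary_integral[of "\<lambda>i. (h i)\<^sup>2" "C\<^sup>2"] sq by simp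
  moreover have "0 \<le> v i" for i unfolding v_def by (intro integral_nonneg_AE) auto
  ultimately have "AE i in \<pi>. v i = 0"
    using integral_nonneg_eq_0_iff_AE[OF intv] by simp
  then have vi: "v i = 0" for i using pmf_\<pi>_support by (simp add: AE_measure_pmf_iff)
  fix i j assume j: "j \<in> set_pmf (p i)"
  have "(h j - h i)\<^sup>2 \<le> (2 * C)\<^sup>2" for i j
  proof -
    have "\<bar>h j - h i\<bar> \<le> \<bar>2 * C\<bar>" using bound[of i] bound[of j] by linarith
    then show ?thesis by (simp only: abs_le_square_iff)
  qed
  then have "integrable (p i) (\<lambda>j. (h j - h i)\<^sup>2)"
    by (intro measure_pmf.integrable_const_bound[where B = "(2 * C)\<^sup>2"]) auto
  then have "AE j in p i. (h j - h i)\<^sup>2 = 0"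
    using integral_nonneg_eq_0_iff_AE[of "p i" "\<lambda>j. (h j - h i)\<^sup>2"] vi[of i] unfolding v_def by simp
  then show "h j = h i" using j by (auto simp: AE_measure_pmf_iff)
qed

section \<open>Zero-one law and recurrence\<close>

lemma markov_event:
  assumes A: "A \<in> sets (hist n)" and B [measurable]: "B \<in> sets path_space"
  shows "emeasure (Q i) (A \<inter> shift n -` B) = (\<integral>\<^sup>+\<omega>. indicator A \<omega> * emeasure (Q (st n \<omega>)) B \<partial>Q i)"
proof -
  note A[measurable]
  have AP [measurable]: "A \<in> sets path_space" using A by (rule hist_le_path_space)
  have "emeasure (Q i) (A \<inter> shift n -` B) = (\<integral>\<^sup>+\<omega>. indicator (A \<inter> shift n -` B) \<omega> \<partial>Q i)"
    by (subst nn_integral_indicator) (auto simp: sets_Q)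
  also have "\<dots> = (\<integral>\<^sup>+\<omega>. indicator A \<omega> * indicator B (shift n \<omega>) \<partial>Q i)"
    by (intro nn_integral_cong) (simp split: split_indicator)
  also have "\<dots> = (\<integral>\<^sup>+\<omega>. (\<integral>\<^sup>+\<omega>'. indicator A \<omega> * indicator B \<omega>' \<partial>Q (st n \<omega>)) \<partial>Q i)"
    by (rule markov[of "\<lambda>\<omega> \<omega>'. indicator A \<omega> * indicator B \<omega>'"]) measurable
  also have "\<dots> = (\<integral>\<^sup>+\<omega>. indicator A \<omega> * emeasure (Q (st n \<omega>)) B \<partial>Q i)"
    by (intro nn_integral_cong) (simp add: nn_integral_cmult sets_Q)
  finally show ?thesis .
qed

text \<open>R has to hold from every starting state, since any state may be occupied at time
  n.\<close>

lemma AE_shift: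
  assumes [measurable]: "Measurable.pred path_space R" and R: "\<And>j. AE \<omega> in Q j. R \<omega>"
  shows "AE \<omega> in Q i. R (shift n \<omega>)"
proof -
  have N [measurable]: "{\<omega>. \<not> R \<omega>} \<in> sets path_space" by (rule path_Collect) measurable
  have "emeasure (Q j) {\<omega>. \<not> R \<omega>} = 0" for j
    using R[of j] by (subst (asm) AE_iff_measurable[OF _ refl]) (auto simp: sets_Q)
  then have "emeasure (Q i) (UNIV \<inter> shift n -` {\<omega>. \<not> R \<omega>}) = 0"
    using sets.top[of "hist n :: 's path measure"] by (subst markov_event) auto
  moreover have "{\<omega> \<in> space (Q i). \<not> R (shift n \<omega>)} \<in> sets (Q i)"
    using shift_sets[OF N, of n] by (simp add: vimage_def sets_Q)
  ultimately show ?thesis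
    by (subst AE_iff_measurable[OF _ refl]) (auto simp: vimage_def)
qed

lemma st_law: "(\<integral>\<^sup>+\<omega>. f (st n \<omega>) \<partial>Q i) = (\<integral>\<^sup>+j. f j \<partial>measure_pmf (nstep p n i))"
proof (induction n arbitrary: f)
  case 0
  have "(\<integral>\<^sup>+\<omega>. f (st 0 \<omega>) \<partial>Q i) = (\<integral>\<^sup>+\<omega>. f i \<partial>Q i)"
    using st_0[of i] by (intro nn_integral_cong_AE) auto
  then show ?case by (simp add: Q.emeasure_space_1[simplified])
next
  case (Suc n)
  have "(\<integral>\<^sup>+\<omega>. f (st (Suc n) \<omega>) \<partial>Q i) = (\<integral>\<^sup>+\<omega>. f (st 1 (shift n \<omega>)) \<partial>Q i)"
    by (simp add: st_shift)
  also have "\<dots> = (\<integral>\<^sup>+\<omega>. (\<integral>\<^sup>+\<omega>'. f (st 1 \<omega>') \<partial>Q (st n \<omega>)) \<partial>Q i)"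
    by (rule markov[of "\<lambda>_ \<omega>'. f (st 1 \<omega>')"]) measurable
  also have "\<dots> = (\<integral>\<^sup>+\<omega>. (\<integral>\<^sup>+k. f k \<partial>measure_pmf (p (st n \<omega>))) \<partial>Q i)"
  proof (rule nn_integral_cong)
    fix \<omega> :: "'s path"
    define j where "j = st n \<omega>"
    have "(\<integral>\<^sup>+\<omega>'. f (st 1 \<omega>') \<partial>Q j) = (\<integral>\<^sup>+k. (\<integral>\<^sup>+z. f k \<partial>K j k) \<partial>measure_pmf (p j))"
      using one_step[of "\<lambda>(k, z). f k" j] by (simp add: split_beta')
    then have "(\<integral>\<^sup>+\<omega>'. f (st 1 \<omega>') \<partial>Q j) = (\<integral>\<^sup>+k. f k \<partial>measure_pmf (p j))"
      using prob_space.emeasure_space_1[OF K_prob] by simp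
    then show "(\<integral>\<^sup>+\<omega>'. f (st 1 \<omega>') \<partial>Q (st n \<omega>)) = (\<integral>\<^sup>+k. f k \<partial>measure_pmf (p (st n \<omega>)))"
      by (simp add: j_def)
  qed
  also have "\<dots> = (\<integral>\<^sup>+j. f j \<partial>measure_pmf (nstep p (Suc n) i))"
    using Suc[of "\<lambda>k. \<integral>\<^sup>+j. f j \<partial>measure_pmf (p k)"] by simp
  finally show ?case .
qed

lemma stationary_st: "(\<integral>\<^sup>+i. (\<integral>\<^sup>+\<omega>. f (st n \<omega>) \<partial>Q i) \<partial>measure_pmf \<pi>) = (\<integral>\<^sup>+j. f j \<partial>measure_pmf \<pi>)"
  unfolding st_law
proof (induction n arbitrary: f)
  case 0
  show ?case by (simp add: return_pmf.rep_eq nn_integral_return)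
next
  case (Suc n)
  have "(\<integral>\<^sup>+i. (\<integral>\<^sup>+j. f j \<partial>measure_pmf (nstep p (Suc n) i)) \<partial>measure_pmf \<pi>)
    = (\<integral>\<^sup>+i. (\<integral>\<^sup>+k. (\<integral>\<^sup>+j. f j \<partial>measure_pmf (p k)) \<partial>measure_pmf (nstep p n i)) \<partial>measure_pmf \<pi>)"
    by simp
  then show ?case by (simp add: Suc stationary_nn_integral del: nstep.simps)
qed

lemma emeasure_st: "emeasure (Q i) {\<omega>. st n \<omega> = j} = pmf (nstep p n i) j"
proof -
  have "emeasure (Q i) {\<omega>. st n \<omega> = j} = (\<integral>\<^sup>+\<omega>. indicator {j} (st n \<omega>) \<partial>Q i)"
    by (subst nn_integral_indicator[symmetric])
      (auto simp: sets_Q simp del: nn_integral_indicator intro!: nn_integral_cong split: split_indicator)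
  then show ?thesis by (simp add: st_law emeasure_pmf_single)
qed

lemma reach: "\<exists>n. emeasure (Q i) {\<omega>. st n \<omega> = j} > 0"
  using irreducible unfolding irreducible_chain_def emeasure_st by simp

text \<open>By invariance and the Markov property the probability of the event is a harmonic
  function of the starting state, hence constant. The event is then independent of every cylinder,
  therefore of itself, and its probability equals its own square. Invariance is required only almost
  surely, since the applications divide by products that vanish on a null set.\<close>

lemma zero_one:
  assumes [measurable]: "Measurable.pred path_space R"
    and inv: "\<And>i. AE \<omega> in Q i. R (shift 1 \<omega>) \<longleftrightarrow> R \<omega>"
  shows "(\<forall>i. AE \<omega> in Q i. R \<omega>) \<or> (\<forall>i. AE \<omega> in Q i. \<not> R \<omega>)"
proof -
  have inv_n: "AE \<omega> in Q i. R (shift n \<omega>) \<longleftrightarrow> R \<omega>" for i n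
  proof (induction n)
    case 0
    have "AE \<omega> in Q i. R (shift 1 (shift 0 \<omega>)) \<longleftrightarrow> R (shift 0 \<omega>)"
      using inv by (rule AE_shift[rotated]) measurable
    with inv[of i] show ?case by eventually_elim (simp add: shift_shift)
  next
    case (Suc n)
    have "AE \<omega> in Q i. R (shift 1 (shift n \<omega>)) \<longleftrightarrow> R (shift n \<omega>)"
      using inv by (rule AE_shift[rotated]) measurable
    with Suc show ?case by eventually_elim (simp add: shift_shift)
  qed
  define S where "S = {\<omega>. R \<omega>}"
  have S [measurable]: "S \<in> sets path_space" unfolding S_def using assms(1) by (simp add: pred_def)
  define h where "h i = measure (Q i) S" for i
  \<comment> \<open>Given the first n steps, the conditional probability of S is \<open>h\<close> at
    the current state.\<close>
  have inter: "emeasure (Q i) (A \<inter> S) = (\<integral>\<^sup>+\<omega>. indicator A \<omega> * ennreal (h (st n \<omega>)) \<partial>Q i)"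
    if A: "A \<in> sets (hist n)" for A n i
  proof -
    have [measurable]: "shift n -` S \<in> sets path_space"
      using measurable_sets[OF shift_measurable S, of n] by simp
    have "emeasure (Q i) (A \<inter> S) = emeasure (Q i) (A \<inter> shift n -` S)"
    proof (rule emeasure_eq_AE)
      have "AE \<omega> in Q i. R (shift n \<omega>) \<longleftrightarrow> R \<omega>" by (rule inv_n)
      then show "AE \<omega> in Q i. (\<omega> \<in> A \<inter> S) = (\<omega> \<in> A \<inter> shift n -` S)"
        by eventually_elim (auto simp: S_def)
    qed (use hist_le_path_space[OF A] in \<open>auto simp: sets_Q\<close>)
    then show ?thesis unfolding markov_event[OF A S] by (simp add: Q.emeasure_eq_measure h_def)
  qed
  have "(\<integral>j. h j \<partial>measure_pmf (p i)) = h i" for i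
  proof -
    have "ennreal (h i) = (\<integral>\<^sup>+\<omega>. ennreal (h (st 1 \<omega>)) \<partial>Q i)"
      using inter[OF sets.top[of "hist 1 :: 's path measure"], of i] by (simp add: h_def Q.emeasure_eq_measure)
    also have "\<dots> = (\<integral>\<^sup>+j. ennreal (h j) \<partial>measure_pmf (p i))"
      using st_law[where f = "\<lambda>j. ennreal (h j)" and n = 1 and i = i] by (simp add: bind_return_pmf)
    also have "\<dots> = ennreal (\<integral>j. h j \<partial>measure_pmf (p i))"
      by (intro nn_integral_eq_integral measure_pmf.integrable_const_bound[where B = 1]) (auto simp: h_def)
    finally have "ennreal (h i) = ennreal (\<integral>j. h j \<partial>measure_pmf (p i))" .
    moreover have "0 \<le> h i" "0 \<le> (\<integral>j. h j \<partial>measure_pmf (p i))" by (simp_all add: h_def)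
    ultimately show ?thesis by simp
  qed
  then have const: "h i = h j" for i j
    by (rule harmonic_const[of h 1, rotated]) (auto simp: h_def)
  \<comment> \<open>As \<open>h\<close> is constant, restriction to S and multiplication by
    \<open>h i\<close> agree on all cylinders, hence also on S itself.\<close>
  have "emeasure (Q i) S = ennreal (h i) * emeasure (Q i) S" for i
  proof -
    define M1 where "M1 = density (Q i) (indicator S)"
    define M2 where "M2 = scale_measure (h i) (Q i)"
    have M1: "emeasure M1 X = emeasure (Q i) (X \<inter> S)" if "X \<in> sets path_space" for X
      using that unfolding M1_def by (simp add: emeasure_density sets_Q indicator_inter_arith[symmetric] Int_commute)
    have "M1 = M2"
    proof (rule measure_eqI_generator_eq_countable)
      show "Int_stable (\<Union>n. cyls n :: 's path set set)" by (rule Int_stable_cyls)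
      show "emeasure M1 X = emeasure M2 X" if X: "X \<in> (\<Union>n. cyls n)" for X
      proof -
        from X obtain n where n: "X \<in> cyls n" by auto
        then have X: "X \<in> sets (hist n)" and [measurable]: "X \<in> sets path_space"
          by (auto simp: sets_hist dest: cyls_sets)
        have "emeasure M1 X = (\<integral>\<^sup>+\<omega>. indicator X \<omega> * ennreal (h i) \<partial>Q i)"
          unfolding M1[OF \<open>X \<in> sets path_space\<close>] inter[OF X]
          by (intro nn_integral_cong arg_cong2[where f = times] arg_cong[where f = ennreal] const refl)
        then show ?thesis
          using nn_integral_cmult_indicator[of X "Q i" "ennreal (h i)"] \<open>X \<in> sets path_space\<close>
          by (simp add: M2_def sets_Q mult.commute[of "indicator _ _"])
      qed
      show "sets M1 = sigma_sets UNIV (\<Union>n. cyls n)" "sets M2 = sigma_sets UNIV (\<Union>n. cyls n)"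
        by (simp_all add: M1_def M2_def sets_Q sets_path_space)
      show "words 0 \<subseteq> (\<Union>n. cyls n :: 's path set set)" using words(1)[of 0] by auto
      show "emeasure M1 a \<noteq> \<infinity>" if "a \<in> words 0" for a
      proof -
        have "a \<in> sets path_space" using that words(1)[of 0] cyls_sets by blast
        then show ?thesis by (simp add: M1)
      qed
    qed (use words(2,3)[of 0] in auto)
    then show ?thesis using M1[OF S] by (simp add: M2_def)
  qed
  moreover have "emeasure (Q i) S = ennreal (h i)" and h0: "0 \<le> h i" for i
    by (simp_all add: Q.emeasure_eq_measure h_def)
  ultimately have "ennreal (h i) = ennreal (h i) * ennreal (h i)" for i by metis
  then have "ennreal (h i) = ennreal (h i * h i)" for i by (simp add: ennreal_mult h0)
  then have "h i = h i * h i" for i using h0 by (metis ennreal_inj mult_nonneg_nonneg)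
  then have "h undefined * (1 - h undefined) = 0" by (simp add: algebra_simps)
  then have "h undefined = 0 \<or> h undefined = 1" by auto
  then have "(\<forall>i. h i = 0) \<or> (\<forall>i. h i = 1)" using const by metis
  then show ?thesis
  proof
    assume "\<forall>i. h i = 0"
    then have "\<forall>i. AE \<omega> in Q i. \<not> R \<omega>"
      by (subst AE_iff_measurable[OF _ refl]) (auto simp: sets_Q S_def[symmetric] Q.emeasure_eq_measure h_def)
    then show ?thesis ..
  next
    assume "\<forall>i. h i = 1"
    then have "\<forall>i. AE \<omega> in Q i. R \<omega>"
      using prob_space.prob_Collect_eq_1[OF prob_Q, where P = R] S by (auto simp: h_def S_def sets_Q)
    then show ?thesis ..
  qed
qed

text \<open>The zero-one law leaves only the alternative that from every state j is visited finitely
  often. Then the probability of a visit at or after time m tends to 0, also under the stationary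
  law; but there it is at least \<open>pmf \<pi> j > 0\<close> for every m.\<close>

lemma recurrent: "AE \<omega> in Q i. \<exists>\<^sub>\<infinity>n. st n \<omega> = j"
proof -
  define R where "R \<omega> \<longleftrightarrow> (\<forall>m. \<exists>n\<ge>m. st n \<omega> = j)" for \<omega> :: "'s path"
  have [measurable]: "Measurable.pred path_space R" unfolding R_def by measurable
  have "R (shift 1 \<omega>) \<longleftrightarrow> R \<omega>" for \<omega>
    unfolding R_def st_shift
    by (metis (no_types, opaque_lifting) Suc_le_D Suc_le_mono le_SucI plus_1_eq_Suc)
  then have "(\<forall>i. AE \<omega> in Q i. R \<omega>) \<or> (\<forall>i. AE \<omega> in Q i. \<not> R \<omega>)"
    by (intro zero_one) auto
  then show ?thesis
  proof
    assume "\<forall>i. AE \<omega> in Q i. R \<omega>"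
    then show ?thesis by (simp add: R_def INFM_nat_le)
  next
    assume no: "\<forall>i. AE \<omega> in Q i. \<not> R \<omega>"
    define V where "V m = {\<omega> :: 's path. \<exists>n\<ge>m. st n \<omega> = j}" for m
    have V [measurable]: "V m \<in> sets path_space" for m
    proof -
      have "{\<omega> \<in> space path_space. \<exists>n\<ge>m. st n \<omega> = j} \<in> sets path_space" by measurable
      then show ?thesis by (simp add: V_def)
    qed
    have dec: "decseq V" unfolding V_def by (rule antimonoI) (use order_trans in blast)
    have "(INF m. emeasure (Q i) (V m)) = 0" for i
    proof -
      have "(INF m. emeasure (Q i) (V m)) = emeasure (Q i) (\<Inter>m. V m)"
        using dec by (intro INF_emeasure_decseq) (auto simp: sets_Q)
      also have "\<dots> = 0"
      proof -
        have "{\<omega>. R \<omega>} \<in> sets path_space" by (rule path_Collect) measurable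
        then have "emeasure (Q i) {\<omega>. R \<omega>} = 0"
          using no[rule_format, of i] by (subst (asm) AE_iff_measurable[OF _ refl]) (auto simp: sets_Q)
        moreover have "(\<Inter>m. V m) = {\<omega>. R \<omega>}" by (auto simp: V_def R_def)
        ultimately show ?thesis by simp
      qed
      finally show ?thesis .
    qed
    moreover have "(\<integral>\<^sup>+i. (INF m. emeasure (Q i) (V m)) \<partial>measure_pmf \<pi>)
        = (INF m. (\<integral>\<^sup>+i. emeasure (Q i) (V m) \<partial>measure_pmf \<pi>))"
    proof (rule nn_integral_monotone_convergence_INF_AE[where i = 0])
      show "AE i in measure_pmf \<pi>. emeasure (Q i) (V (Suc m)) \<le> emeasure (Q i) (V m)" for m
        using dec by (intro always_eventually allI emeasure_mono) (auto simp: decseq_Suc_iff sets_Q)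
      have "(\<integral>\<^sup>+i. emeasure (Q i) (V 0) \<partial>measure_pmf \<pi>) \<le> (\<integral>\<^sup>+i. 1 \<partial>measure_pmf \<pi>)"
        by (intro nn_integral_mono Q.emeasure_le_1)
      then show "(\<integral>\<^sup>+i. emeasure (Q i) (V 0) \<partial>measure_pmf \<pi>) < \<infinity>"
        by (simp add: le_less_trans[OF _ ennreal_one_less_top])
    qed simp
    ultimately have z: "(INF m. (\<integral>\<^sup>+i. emeasure (Q i) (V m) \<partial>measure_pmf \<pi>)) = 0" by simp
    have "ennreal (pmf \<pi> j) \<le> (\<integral>\<^sup>+i. emeasure (Q i) (V m) \<partial>measure_pmf \<pi>)" for m
    proof -
      have "ennreal (pmf \<pi> j) = (\<integral>\<^sup>+i. indicator {j} i \<partial>measure_pmf \<pi>)" by (simp add: emeasure_pmf_single)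
      also have "\<dots> = (\<integral>\<^sup>+i. (\<integral>\<^sup>+\<omega>. indicator {j} (st m \<omega>) \<partial>Q i) \<partial>measure_pmf \<pi>)"
        by (rule stationary_st[symmetric])
      also have "\<dots> \<le> (\<integral>\<^sup>+i. emeasure (Q i) (V m) \<partial>measure_pmf \<pi>)"
      proof (rule nn_integral_mono)
        fix i
        have "(\<integral>\<^sup>+\<omega>. indicator {j} (st m \<omega>) \<partial>Q i) \<le> (\<integral>\<^sup>+\<omega>. indicator (V m) \<omega> \<partial>Q i)"
          by (intro nn_integral_mono) (auto simp: V_def split: split_indicator)
        then show "(\<integral>\<^sup>+\<omega>. indicator {j} (st m \<omega>) \<partial>Q i) \<le> emeasure (Q i) (V m)" by (simp add: sets_Q)
      qed
      finally show ?thesis .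
    qed
    then have "ennreal (pmf \<pi> j) \<le> 0" unfolding z[symmetric] by (intro INF_greatest)
    then have "j \<notin> set_pmf \<pi>" by (simp add: set_pmf_iff)
    then show ?thesis using pmf_\<pi>_support by simp
  qed
qed

lemma Pi_prod_nonzero: "AE \<omega> in Q i. \<forall>n. Pi_prod ca n \<omega> \<noteq> 0"
proof -
  have "AE \<omega> in Q i. ca 1 (shift n \<omega>) \<noteq> 0" for n
    using nonzero by (rule AE_shift[rotated]) measurable
  then have "AE \<omega> in Q i. \<forall>n. ca 1 (shift n \<omega>) \<noteq> 0" by (simp add: AE_all_countable)
  then show ?thesis
  proof eventually_elim
    case (elim \<omega>)
    show ?case
    proof
      fix n show "Pi_prod ca n \<omega> \<noteq> 0"
        using elim by (induction n) (auto simp: Pi_prod_Suc ca_shift)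
    qed
  qed
qed

end


subsection \<open>Affine cocycles\<close>

text \<open>A pair \<open>(a, b)\<close> stands for the map \<open>x \<mapsto> a * x + b\<close>, and \<^const>\<open>Pi_prod\<close>, \<^const>\<open>perp_sum\<close> are the components of
  the composition along a path.\<close>

definition aff :: "real \<times> real \<Rightarrow> real \<times> real \<Rightarrow> real \<times> real" where
  "aff u v = (fst u * fst v, fst u * snd v + snd u)"

lemma aff_inverse_unique: "aff u x = (1, 0) \<Longrightarrow> aff v x = (1, 0) \<Longrightarrow> u = v"
proof -
  assume a: "aff u x = (1, 0)" "aff v x = (1, 0)"
  then have "fst x \<noteq> 0" by (auto simp: aff_def)
  moreover have "fst u * fst x = fst v * fst x" using a by (simp add: aff_def)
  ultimately have "fst u = fst v" by simp
  with a show "u = v" by (auto simp: aff_def prod_eq_iff)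
qed

definition path_aff :: "nat \<Rightarrow> 's path \<Rightarrow> real \<times> real" where
  "path_aff n \<omega> = (Pi_prod ca n \<omega>, perp_sum ca cb n \<omega>)"

lemma path_aff_shift: "path_aff (n + k) \<omega> = aff (path_aff n \<omega>) (path_aff k (shift n \<omega>))"
  by (simp add: path_aff_def aff_def Pi_prod_shift perp_sum_shift)

lemma path_aff_hist: "(path_aff n :: 's::countable path \<Rightarrow> _) \<in> borel_measurable (hist n)"
  unfolding path_aff_def by (intro borel_measurable_Pair Pi_prod_hist perp_sum_hist) auto

lemma path_aff_measurable [measurable]: "path_aff n \<in> borel_measurable path_space"
  unfolding path_aff_def by (intro borel_measurable_Pair) measurable

lemma borel_measurable_aff [measurable]:
  assumes "f \<in> borel_measurable L" "g \<in> borel_measurable L"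
  shows "(\<lambda>x. aff (f x) (g x)) \<in> borel_measurable L"
proof -
  have "(\<lambda>x. fst (h x)) \<in> borel_measurable L" "(\<lambda>x. snd (h x)) \<in> borel_measurable L"
    if "h \<in> borel_measurable L" for h :: "_ \<Rightarrow> real \<times> real"
    using that by (auto intro!: measurable_compose[OF that borel_measurable_continuous_onI] continuous_intros)
  then show ?thesis
    unfolding aff_def using assms by (intro borel_measurable_Pair borel_measurable_add borel_measurable_times) auto
qed

text \<open>The stopping time "first visit to i from time N on" is represented by its level sets:
  they are disjoint in n, and each belongs to \<open>hist n\<close>.\<close>

definition first_visit :: "'s \<Rightarrow> nat \<Rightarrow> nat \<Rightarrow> 's path set" where
  "first_visit i N n = {\<omega>. N \<le> n \<and> st n \<omega> = i \<and> (\<forall>k<n. N \<le> k \<longrightarrow> st k \<omega> \<noteq> i)}"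

lemma st_hist_sets: "k \<le> n \<Longrightarrow> {\<omega> :: 's::countable path. st k \<omega> = i} \<in> sets (hist n)"
  using measurable_sets[OF st_hist[of k n], of "{i}"] by (simp add: vimage_def)

lemma first_visit_hist: "(first_visit i N n :: 's::countable path set) \<in> sets (hist n)"
proof -
  have "first_visit i N n = {\<omega>\<in>space (hist n). N \<le> n \<and> st n \<omega> = i \<and> (\<forall>k\<in>{..<n}. N \<le> k \<longrightarrow> \<not> st k \<omega> = i)}"
    by (auto simp: first_visit_def)
  also have "\<dots> \<in> sets (hist n)"
    by (intro sets.sets_Collect_conj sets.sets_Collect_finite_All sets.sets_Collect_imp sets.sets_Collect_neg
        sets.sets_Collect_const) (auto intro!: st_hist_sets)
  finally show ?thesis .
qed

lemma disjoint_first_visit: "disjoint_family (first_visit i N)"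
  unfolding disjoint_family_on_def first_visit_def
  by (auto, metis linorder_neqE_nat)

lemma UN_first_visit: "\<exists>\<^sub>\<infinity>n. st n \<omega> = i \<Longrightarrow> \<exists>n. \<omega> \<in> first_visit i N n"
proof -
  assume "\<exists>\<^sub>\<infinity>n. st n \<omega> = i"
  then have "\<exists>n. N \<le> n \<and> st n \<omega> = i" by (auto simp: INFM_nat_le)
  from LeastI_ex[OF this] not_less_Least[of _ "\<lambda>n. N \<le> n \<and> st n \<omega> = i"]
  show ?thesis unfolding first_visit_def by blast
qed

context path_chain begin

text \<open>The Markov property for null sets: \<open>markov\<close> is applied to the indicator of
  the exceptional pairs.\<close>

lemma AE_markov:
  assumes [measurable]: "Measurable.pred (hist n \<Otimes>\<^sub>M path_space) (\<lambda>(\<omega>, \<omega>'). R \<omega> \<omega>')"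
  shows "(AE \<omega> in Q i. R \<omega> (shift n \<omega>)) \<longleftrightarrow> (AE \<omega> in Q i. AE \<omega>' in Q (st n \<omega>). R \<omega> \<omega>')"
proof -
  define f where "f \<omega> \<omega>' = (indicator {z. \<not> R (fst z) (snd z)} (\<omega>, \<omega>') :: ennreal)" for \<omega> \<omega>'
  have pm: "Measurable.pred (hist n \<Otimes>\<^sub>M path_space) (\<lambda>z. R (fst z) (snd z))"
    using assms by (simp add: split_beta')
  have set: "{z. \<not> R (fst z) (snd z)} \<in> sets (hist n \<Otimes>\<^sub>M path_space)"
  proof -
    note pm[measurable]
    have "{z \<in> space (hist n \<Otimes>\<^sub>M path_space). \<not> R (fst z) (snd z)} \<in> sets (hist n \<Otimes>\<^sub>M path_space)" by measurable
    then show ?thesis by (simp add: space_pair_measure)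
  qed
  have f: "(\<lambda>(\<omega>, \<omega>'). f \<omega> \<omega>') \<in> borel_measurable (hist n \<Otimes>\<^sub>M path_space)"
    unfolding f_def using set by (simp add: split_beta')
  have fm: "(\<lambda>\<omega>. f \<omega> (shift n \<omega>)) \<in> borel_measurable (Q i)"
  proof -
    have "(\<lambda>\<omega>. (\<omega>, shift n \<omega>)) \<in> measurable (Q i) (hist n \<Otimes>\<^sub>M path_space)" by measurable
    from measurable_compose[OF this f] show ?thesis by simp
  qed
  have inner: "(\<lambda>\<omega>. \<integral>\<^sup>+\<omega>'. f \<omega> \<omega>' \<partial>Q j) \<in> borel_measurable (Q i)" for j
  proof -
    have "(\<lambda>(\<omega>, \<omega>'). f \<omega> \<omega>') \<in> borel_measurable (hist n \<Otimes>\<^sub>M Q j)"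
      using f by (simp cong: measurable_cong_sets add: sets_pair_measure_cong[OF refl sets_Q])
    from sigma_finite_measure.borel_measurable_nn_integral[OF sigma_finite_Q this]
    have "(\<lambda>\<omega>. \<integral>\<^sup>+\<omega>'. f \<omega> \<omega>' \<partial>Q j) \<in> borel_measurable (hist n)" by simp
    from measurable_compose[OF id_hist this] show ?thesis by (simp add: measurable_cong_sets[OF sets_Q refl])
  qed
  have "st n \<in> measurable (Q i) (count_space UNIV)" by measurable
  from measurable_compose_countable[OF inner this]
  have outer: "(\<lambda>\<omega>. \<integral>\<^sup>+\<omega>'. f \<omega> \<omega>' \<partial>Q (st n \<omega>)) \<in> borel_measurable (Q i)" .
  have sec: "f \<omega> \<in> borel_measurable (Q j)" for \<omega> j
  proof -
    have "(\<lambda>\<omega>'. (\<omega>, \<omega>')) \<in> measurable (Q j) (hist n \<Otimes>\<^sub>M path_space)" by measurable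
    from measurable_compose[OF this f] show ?thesis by simp
  qed
  have "(AE \<omega> in Q i. R \<omega> (shift n \<omega>)) \<longleftrightarrow> (AE \<omega> in Q i. f \<omega> (shift n \<omega>) = 0)"
    by (simp add: f_def indicator_eq_0_iff)
  also have "\<dots> \<longleftrightarrow> (\<integral>\<^sup>+\<omega>. f \<omega> (shift n \<omega>) \<partial>Q i) = 0"
    using fm by (subst nn_integral_0_iff_AE) auto
  also have "\<dots> \<longleftrightarrow> (\<integral>\<^sup>+\<omega>. (\<integral>\<^sup>+\<omega>'. f \<omega> \<omega>' \<partial>Q (st n \<omega>)) \<partial>Q i) = 0"
    by (simp add: markov[OF f])
  also have "\<dots> \<longleftrightarrow> (AE \<omega> in Q i. (\<integral>\<^sup>+\<omega>'. f \<omega> \<omega>' \<partial>Q (st n \<omega>)) = 0)"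
    using outer by (subst nn_integral_0_iff_AE) auto
  also have "\<dots> \<longleftrightarrow> (AE \<omega> in Q i. AE \<omega>' in Q (st n \<omega>). f \<omega> \<omega>' = 0)"
    using sec by (subst nn_integral_0_iff_AE) auto
  also have "\<dots> \<longleftrightarrow> (AE \<omega> in Q i. AE \<omega>' in Q (st n \<omega>). R \<omega> \<omega>')"
    by (simp add: f_def indicator_eq_0_iff)
  finally show ?thesis .
qed

text \<open>Turns almost sure information on the event of being in j at time n into a statement
  without randomness.\<close>

lemma AE_hit:
  assumes "AE \<omega> in Q i. st n \<omega> = j \<longrightarrow> C" "emeasure (Q i) {\<omega>. st n \<omega> = j} > 0"
  shows C
proof (rule ccontr)
  assume "\<not> C"
  with assms(1) have "AE \<omega> in Q i. st n \<omega> \<noteq> j" by simp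
  then have "emeasure (Q i) {\<omega>. st n \<omega> = j} = 0"
    by (subst (asm) AE_iff_measurable[OF _ refl]) (auto simp: sets_Q)
  with assms(2) show False by simp
qed

text \<open>A process of affine maps that closes up along every loop at \<open>i\<close> is a coboundary: the map along
  a path from \<open>i\<close> to \<open>j\<close> is independent of a return path from \<open>j\<close> to \<open>i\<close>, which inverts it.\<close>

lemma loops_trivial_coboundary:
  assumes H [measurable]: "H \<in> borel_measurable borel"
    and hom: "\<And>u v. H (aff u v) = aff (H u) (H v)"
    and loop: "\<And>n. AE \<omega> in Q i. st n \<omega> = i \<longrightarrow> H (path_aff n \<omega>) = (1, 0)"
  obtains g where "\<And>j. fst (g j) \<noteq> 0"
    "\<And>j. AE \<omega> in Q j. \<forall>n. g (st n \<omega>) = aff (g j) (H (path_aff n \<omega>))"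
proof -
  note [measurable] = path_aff_hist
  define G where "G n \<omega> = H (path_aff n \<omega>)" for n and \<omega> :: "'s path"
  have G_add: "G (n + k) \<omega> = aff (G n \<omega>) (G k (shift n \<omega>))" for n k \<omega>
    by (simp add: G_def path_aff_shift hom)
  have [measurable]: "G n \<in> borel_measurable path_space" "G n \<in> borel_measurable (hist n)" for n
    unfolding G_def by measurable
  have [measurable]: "Measurable.pred (hist n) (\<lambda>\<omega> :: 's path. st n \<omega> = j)" for n j
    using st_hist_sets[of n n j] by (simp add: pred_def)
  have "\<exists>l. emeasure (Q j) {\<omega>. st l \<omega> = i} > 0" for j by (rule reach)
  then obtain l where l: "\<And>j. emeasure (Q j) {\<omega>. st (l j) \<omega> = i} > 0" by metis
  \<comment> \<open>A path from j is back at i after \<open>l j\<close> steps with positive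
    probability. If u is the map along a path from i to j, the closed loop is trivial, so u inverts
    the map of the return path from the left. This property no longer refers to the path behind u
    and determines u.\<close>
  define inv_at where "inv_at j u \<longleftrightarrow> (AE \<omega> in Q j. st (l j) \<omega> = i \<longrightarrow> aff u (G (l j) \<omega>) = (1, 0))" for j u
  have inv_unique: "u = v" if "inv_at j u" "inv_at j v" for j u v
  proof (rule AE_hit[OF _ l[of j]])
    show "AE \<omega> in Q j. st (l j) \<omega> = i \<longrightarrow> u = v"
      using that unfolding inv_at_def by eventually_elim (auto intro: aff_inverse_unique)
  qed
  have inv_nz: "fst u \<noteq> 0" if "inv_at j u" for j u
  proof (rule AE_hit[OF _ l[of j]])
    show "AE \<omega> in Q j. st (l j) \<omega> = i \<longrightarrow> fst u \<noteq> 0"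
      using that unfolding inv_at_def by eventually_elim (auto simp: aff_def)
  qed
  have inv_G: "AE \<omega> in Q i. st n \<omega> = j \<longrightarrow> inv_at j (G n \<omega>)" for n j
  proof -
    define R where "R \<omega> \<omega>' \<longleftrightarrow> (st n \<omega> = j \<longrightarrow> st (l j) \<omega>' = i \<longrightarrow> aff (G n \<omega>) (G (l j) \<omega>') = (1, 0))" for \<omega> \<omega>' :: "'s path"
    have "Measurable.pred (hist n \<Otimes>\<^sub>M path_space) (\<lambda>(\<omega>, \<omega>'). R \<omega> \<omega>')"
      unfolding R_def by measurable
    moreover have "AE \<omega> in Q i. R \<omega> (shift n \<omega>)"
      using loop[of "n + l j"] by eventually_elim (simp add: R_def G_def[symmetric] G_add st_shift)
    ultimately have "AE \<omega> in Q i. AE \<omega>' in Q (st n \<omega>). R \<omega> \<omega>'" by (simp add: AE_markov)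
    then show ?thesis by eventually_elim (auto simp: inv_at_def R_def)
  qed
  define g where "g j = (SOME u. inv_at j u)" for j
  have ex: "\<exists>u. inv_at j u" for j
  proof -
    obtain n where n: "emeasure (Q i) {\<omega>. st n \<omega> = j} > 0" using reach by blast
    show ?thesis
    proof (rule AE_hit[OF _ n])
      show "AE \<omega> in Q i. st n \<omega> = j \<longrightarrow> (\<exists>u. inv_at j u)"
        using inv_G[of n j] by eventually_elim blast
    qed
  qed
  then have g: "inv_at j (g j)" for j unfolding g_def by (rule someI_ex)
  have Gg: "AE \<omega> in Q i. \<forall>n. G n \<omega> = g (st n \<omega>)"
  proof -
    have "AE \<omega> in Q i. \<forall>n j. st n \<omega> = j \<longrightarrow> inv_at j (G n \<omega>)"
      unfolding AE_all_countable using inv_G by blast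
    then show ?thesis by eventually_elim (blast intro: inv_unique g)
  qed
  show ?thesis
  proof
    show "fst (g j) \<noteq> 0" for j using g by (rule inv_nz)
    \<comment> \<open>For paths from j, prefix a path from i to j of positive probability and cancel
      the map \<open>g j\<close> along the prefix.\<close>
    show "AE \<omega> in Q j. \<forall>n. g (st n \<omega>) = aff (g j) (H (path_aff n \<omega>))" for j
    proof -
      obtain n where n: "emeasure (Q i) {\<omega>. st n \<omega> = j} > 0" using reach by blast
      define R where "R \<omega>' \<longleftrightarrow> (\<forall>k. g (st k \<omega>') = aff (g j) (G k \<omega>'))" for \<omega>' :: "'s path"
      have [measurable]: "Measurable.pred path_space R" unfolding R_def by measurable
      have "Measurable.pred (hist n \<Otimes>\<^sub>M path_space) (\<lambda>(\<omega>, \<omega>'). st n \<omega> = j \<longrightarrow> R \<omega>')" by measurable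
      moreover have "AE \<omega> in Q i. st n \<omega> = j \<longrightarrow> R (shift n \<omega>)"
        using Gg by eventually_elim (auto simp: R_def st_shift, metis G_add)
      ultimately have "AE \<omega> in Q i. AE \<omega>' in Q (st n \<omega>). st n \<omega> = j \<longrightarrow> R \<omega>'"
        by (subst (asm) AE_markov[where n = n and R = "\<lambda>\<omega> \<omega>'. st n \<omega> = j \<longrightarrow> R \<omega>'"]) simp_all
      then have "AE \<omega> in Q i. st n \<omega> = j \<longrightarrow> (AE \<omega>' in Q j. R \<omega>')"
        by eventually_elim auto
      from AE_hit[OF this n] show ?thesis by (simp add: R_def G_def)
    qed
  qed
qed

end


subsection \<open>The conditional mass martingale\<close>

context path_chain begin

section \<open>Kernels and the fixed point equation on path space\<close>

lemma prob_kernelsD: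
  fixes \<nu> :: "'s \<Rightarrow> real measure"
  assumes "\<nu> \<in> prob_kernels"
  shows "prob_space (\<nu> i)" "sets (\<nu> i) = sets borel" "space (\<nu> i) = UNIV"
    "\<nu> \<in> measurable (count_space UNIV) (subprob_algebra borel)"
proof -
  show "prob_space (\<nu> i)" and s: "sets (\<nu> i) = sets borel" for i
    using assms by (auto simp: prob_kernels_def space_prob_algebra)
  then show "\<nu> \<in> measurable (count_space UNIV) (subprob_algebra borel)"
    by (auto simp: space_subprob_algebra intro!: prob_space_imp_subprob_space)
  show "space (\<nu> i) = UNIV" using sets_eq_imp_space_eq[OF s[of i]] by simp
qed

lemma kernel_section_measurable:
  fixes \<nu> :: "'s \<Rightarrow> real measure"
  assumes \<nu>: "\<nu> \<in> prob_kernels" and E [measurable]: "E \<in> sets borel"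
    and [measurable]: "s \<in> measurable L (count_space UNIV)" "f \<in> borel_measurable L" "g \<in> borel_measurable L"
  shows "(\<lambda>w. emeasure (\<nu> (s w)) {x. f w * x + g w \<in> E}) \<in> borel_measurable L"
proof (rule emeasure_measurable_subprob_algebra2[where N = borel])
  show "(SIGMA w:space L. {x. f w * x + g w \<in> E}) \<in> sets (L \<Otimes>\<^sub>M borel)"
  proof -
    have "{z \<in> space (L \<Otimes>\<^sub>M borel). f (fst z) * snd z + g (fst z) \<in> E} \<in> sets (L \<Otimes>\<^sub>M borel)"
      by measurable
    also have "{z \<in> space (L \<Otimes>\<^sub>M borel). f (fst z) * snd z + g (fst z) \<in> E} = (SIGMA w:space L. {x. f w * x + g w \<in> E})"
      by (auto simp: space_pair_measure)
    finally show ?thesis .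
  qed
  show "(\<lambda>w. \<nu> (s w)) \<in> measurable L (subprob_algebra borel)"
    using prob_kernelsD(4)[OF \<nu>] by (rule measurable_compose[rotated]) simp
qed

lemma affine_preimage_borel: "E \<in> sets borel \<Longrightarrow> {x :: real. a * x + b \<in> E} \<in> sets borel"
proof -
  assume [measurable]: "E \<in> sets borel"
  have "{x \<in> space borel. a * x + b \<in> E} \<in> sets borel" by measurable
  then show ?thesis by simp
qed

text \<open>Fubini, with the roles of the kernel argument and the mark exchanged. From here on a
  fixed point is handled as an expectation over the first step of a path.\<close>

lemma emeasure_Psi1_path:
  assumes \<nu>: "\<nu> \<in> prob_kernels" and E [measurable]: "E \<in> sets borel"
  shows "emeasure (Psi1 p K \<nu> i) E = (\<integral>\<^sup>+\<omega>. emeasure (\<nu> (st 1 \<omega>)) {x. ca 1 \<omega> * x + cb 1 \<omega> \<in> E} \<partial>Q i)"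
proof -
  note D = prob_kernelsD[OF \<nu>]
  have fs [measurable]: "(fst :: real \<times> real \<Rightarrow> real) \<in> borel_measurable borel" "(snd :: real \<times> real \<Rightarrow> real) \<in> borel_measurable borel"
    by (auto intro!: borel_measurable_continuous_onI continuous_intros)
  have "(\<integral>\<^sup>+\<omega>. emeasure (\<nu> (st 1 \<omega>)) {x. ca 1 \<omega> * x + cb 1 \<omega> \<in> E} \<partial>Q i)
    = (\<integral>\<^sup>+j. (\<integral>\<^sup>+z. emeasure (\<nu> j) {x. fst z * x + snd z \<in> E} \<partial>K i j) \<partial>measure_pmf (p i))"
  proof -
    have "(\<lambda>u :: 's \<times> real \<times> real. emeasure (\<nu> (fst u)) {x. fst (snd u) * x + snd (snd u) \<in> E}) \<in> borel_measurable (count_space UNIV \<Otimes>\<^sub>M borel)"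
      by (rule kernel_section_measurable[OF \<nu> E]) measurable
    from one_step[OF this, of i] show ?thesis by simp
  qed
  also have "\<dots> = (\<integral>\<^sup>+j. (\<integral>\<^sup>+r. emeasure (K i j) {(a, b). a * r + b \<in> E} \<partial>\<nu> j) \<partial>measure_pmf (p i))"
  proof (rule nn_integral_cong)
    fix j
    interpret pair_sigma_finite "K i j" "\<nu> j"
      using K_prob[of i j] D(1)[of j] by (simp add: pair_sigma_finite_def prob_space_imp_sigma_finite)
    note [measurable_cong] = D(2) K_sets
    have "(\<integral>\<^sup>+z. emeasure (\<nu> j) {x. fst z * x + snd z \<in> E} \<partial>K i j)
      = (\<integral>\<^sup>+z. (\<integral>\<^sup>+r. indicator E (fst z * r + snd z) \<partial>\<nu> j) \<partial>K i j)"
    proof (rule nn_integral_cong)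
      fix z :: "real \<times> real"
      have "{x. fst z * x + snd z \<in> E} \<in> sets (\<nu> j)" using affine_preimage_borel[OF E] by (simp add: D(2))
      then show "emeasure (\<nu> j) {x. fst z * x + snd z \<in> E} = (\<integral>\<^sup>+r. indicator E (fst z * r + snd z) \<partial>\<nu> j)"
        using nn_integral_indicator[of "{x. fst z * x + snd z \<in> E}" "\<nu> j"] by (simp add: indicator_def)
    qed
    also have "\<dots> = (\<integral>\<^sup>+r. (\<integral>\<^sup>+z. indicator E (fst z * r + snd z) \<partial>K i j) \<partial>\<nu> j)"
      by (rule Fubini'[symmetric]) measurable
    also have "\<dots> = (\<integral>\<^sup>+r. emeasure (K i j) {(a, b). a * r + b \<in> E} \<partial>\<nu> j)"
    proof (rule nn_integral_cong)
      fix r :: real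
      have "{z \<in> space (borel :: (real \<times> real) measure). fst z * r + snd z \<in> E} \<in> sets borel" by measurable
      then have "{(a, b). a * r + b \<in> E} \<in> sets (K i j)" by (simp add: K_sets split_beta')
      then show "(\<integral>\<^sup>+z. indicator E (fst z * r + snd z) \<partial>K i j) = emeasure (K i j) {(a, b). a * r + b \<in> E}"
        using nn_integral_indicator[of "{(a, b). a * r + b \<in> E}" "K i j"] by (simp add: indicator_def split_beta')
    qed
    finally show "(\<integral>\<^sup>+z. emeasure (\<nu> j) {x. fst z * x + snd z \<in> E} \<partial>K i j) = (\<integral>\<^sup>+r. emeasure (K i j) {(a, b). a * r + b \<in> E} \<partial>\<nu> j)" .
  qed
  also have "\<dots> = emeasure (Psi1 p K \<nu> i) E"
    by (rule emeasure_Psi1[symmetric]) (use K_kernel \<nu> E in auto)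
  finally show ?thesis ..
qed

lemma fixed_point_step:
  assumes fp: "fixed_point p K \<nu>" and E: "E \<in> sets borel"
  shows "(\<integral>\<^sup>+\<omega>. emeasure (\<nu> (st 1 \<omega>)) {x. ca 1 \<omega> * x + cb 1 \<omega> \<in> E} \<partial>Q i) = emeasure (\<nu> i) E"
  using emeasure_Psi1_path[OF _ E, of \<nu> i] fp by (simp add: fixed_point_def)

text \<open>The conditional probability of \<open>R \<in> E\<close> given the path up to time \<open>n\<close>, if \<open>R\<close> has law \<open>\<nu> M\<^sub>0\<close>.\<close>

definition cond_mass :: "('s \<Rightarrow> real measure) \<Rightarrow> real set \<Rightarrow> nat \<Rightarrow> 's path \<Rightarrow> ennreal" where
  "cond_mass \<nu> E n \<omega> = emeasure (\<nu> (st n \<omega>)) {x. Pi_prod ca n \<omega> * x + perp_sum ca cb n \<omega> \<in> E}"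

lemma cond_mass_hist:
  assumes "\<nu> \<in> prob_kernels" "E \<in> sets borel"
  shows "cond_mass \<nu> E n \<in> borel_measurable (hist n)" "cond_mass \<nu> E n \<in> borel_measurable path_space"
  unfolding cond_mass_def
  by (intro kernel_section_measurable assms st_hist Pi_prod_hist perp_sum_hist order_refl
      st_measurable Pi_prod_measurable perp_sum_measurable)+

lemma cond_mass_le_1: "\<nu> \<in> prob_kernels \<Longrightarrow> cond_mass \<nu> E n \<omega> \<le> 1"
  unfolding cond_mass_def using prob_kernelsD(1) by (intro subprob_space.subprob_emeasure_le_1 prob_space_imp_subprob_space)

text \<open>Given the first n steps, the map along them is known, so the one-step fixed point
  equation is applied to the preimage of E under this map.\<close>

lemma cond_mass_step:
  assumes fp: "fixed_point p K \<nu>" and E [measurable]: "E \<in> sets borel" and A: "A \<in> sets (hist n)"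
  shows "(\<integral>\<^sup>+\<omega>. indicator A \<omega> * cond_mass \<nu> E (Suc n) \<omega> \<partial>Q i) = (\<integral>\<^sup>+\<omega>. indicator A \<omega> * cond_mass \<nu> E n \<omega> \<partial>Q i)"
proof -
  have \<nu>: "\<nu> \<in> prob_kernels" using fp by (simp add: fixed_point_def)
  define f where "f \<omega> \<omega>' = indicator A \<omega> * emeasure (\<nu> (st 1 \<omega>'))
    {x. (Pi_prod ca n \<omega> * ca 1 \<omega>') * x + (Pi_prod ca n \<omega> * cb 1 \<omega>' + perp_sum ca cb n \<omega>) \<in> E}" for \<omega> \<omega>' :: "'s path"
  have f: "(\<lambda>(\<omega>, \<omega>'). f \<omega> \<omega>') \<in> borel_measurable (hist n \<Otimes>\<^sub>M path_space)"
    unfolding f_def split_beta'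
  proof (intro borel_measurable_times_ennreal kernel_section_measurable[OF \<nu> E])
    note [measurable] = A Pi_prod_hist[OF order_refl, of n] perp_sum_hist[OF order_refl, of n]
    show "(\<lambda>x. indicator A (fst x) :: ennreal) \<in> borel_measurable (hist n \<Otimes>\<^sub>M path_space)" by measurable
    show "(\<lambda>x. st 1 (snd x)) \<in> measurable (hist n \<Otimes>\<^sub>M path_space) (count_space UNIV)" by measurable
    show "(\<lambda>x :: 's path \<times> 's path. Pi_prod ca n (fst x) * ca 1 (snd x)) \<in> borel_measurable (hist n \<Otimes>\<^sub>M path_space)" by measurable
    show "(\<lambda>x :: 's path \<times> 's path. Pi_prod ca n (fst x) * cb 1 (snd x) + perp_sum ca cb n (fst x)) \<in> borel_measurable (hist n \<Otimes>\<^sub>M path_space)" by measurable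
  qed
  have "(\<integral>\<^sup>+\<omega>. indicator A \<omega> * cond_mass \<nu> E (Suc n) \<omega> \<partial>Q i) = (\<integral>\<^sup>+\<omega>. f \<omega> (shift n \<omega>) \<partial>Q i)"
    by (intro nn_integral_cong)
      (simp add: f_def cond_mass_def st_shift ca_shift cb_shift Pi_prod_Suc perp_sum_Suc algebra_simps)
  also have "\<dots> = (\<integral>\<^sup>+\<omega>. (\<integral>\<^sup>+\<omega>'. f \<omega> \<omega>' \<partial>Q (st n \<omega>)) \<partial>Q i)" by (rule markov[OF f])
  also have "\<dots> = (\<integral>\<^sup>+\<omega>. indicator A \<omega> * cond_mass \<nu> E n \<omega> \<partial>Q i)"
  proof (rule nn_integral_cong)
    fix \<omega> :: "'s path"
    define E' where "E' = {y. Pi_prod ca n \<omega> * y + perp_sum ca cb n \<omega> \<in> E}"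
    have E': "E' \<in> sets borel" unfolding E'_def by (rule affine_preimage_borel) simp
    have "(\<integral>\<^sup>+\<omega>'. f \<omega> \<omega>' \<partial>Q (st n \<omega>)) = (\<integral>\<^sup>+\<omega>'. indicator A \<omega> * emeasure (\<nu> (st 1 \<omega>')) {x. ca 1 \<omega>' * x + cb 1 \<omega>' \<in> E'} \<partial>Q (st n \<omega>))"
      by (simp add: f_def E'_def algebra_simps)
    also have "\<dots> = indicator A \<omega> * (\<integral>\<^sup>+\<omega>'. emeasure (\<nu> (st 1 \<omega>')) {x. ca 1 \<omega>' * x + cb 1 \<omega>' \<in> E'} \<partial>Q (st n \<omega>))"
      by (intro nn_integral_cmult kernel_section_measurable[OF \<nu> E']) measurable
    also have "\<dots> = indicator A \<omega> * cond_mass \<nu> E n \<omega>"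
      unfolding fixed_point_step[OF fp E'] by (simp add: cond_mass_def E'_def)
    finally show "(\<integral>\<^sup>+\<omega>'. f \<omega> \<omega>' \<partial>Q (st n \<omega>)) = indicator A \<omega> * cond_mass \<nu> E n \<omega>" .
  qed
  finally show ?thesis .
qed

lemma cond_mass_martingale:
  assumes fp: "fixed_point p K \<nu>" and E: "E \<in> sets borel" and A: "A \<in> sets (hist n)" and nm: "n \<le> m"
  shows "(\<integral>\<^sup>+\<omega>. indicator A \<omega> * cond_mass \<nu> E m \<omega> \<partial>Q i) = (\<integral>\<^sup>+\<omega>. indicator A \<omega> * cond_mass \<nu> E n \<omega> \<partial>Q i)"
  using nm
proof (induction m rule: dec_induct)
  case (step m)
  then show ?case using cond_mass_step[OF fp E hist_mono[OF step(1) A], of i] by simp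
qed simp

lemma cond_mass_mean:
  assumes fp: "fixed_point p K \<nu>" and E: "E \<in> sets borel"
  shows "(\<integral>\<^sup>+\<omega>. cond_mass \<nu> E m \<omega> \<partial>Q i) = emeasure (\<nu> i) E"
proof -
  have "(\<integral>\<^sup>+\<omega>. cond_mass \<nu> E m \<omega> \<partial>Q i) = (\<integral>\<^sup>+\<omega>. cond_mass \<nu> E 0 \<omega> \<partial>Q i)"
    using cond_mass_martingale[OF fp E sets.top, of 0 m i] by simp
  also have "\<dots> = (\<integral>\<^sup>+\<omega>. emeasure (\<nu> i) E \<partial>Q i)"
    using st_0[of i] by (intro nn_integral_cong_AE) (auto simp: cond_mass_def)
  finally show ?thesis using Q.emeasure_space_1[of i] by simp
qed

text \<open>Doob's maximal inequality. The paths are split by the first time at which the level c is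
  reached; the martingale property moves the mass from each such time to a common later time, where
  the total is at most the mean.\<close>

lemma cond_mass_maximal:
  assumes fp: "fixed_point p K \<nu>" and E: "E \<in> sets borel"
  shows "c * emeasure (Q i) {\<omega>. \<exists>n. c \<le> cond_mass \<nu> E n \<omega>} \<le> emeasure (\<nu> i) E"
proof -
  have \<nu>: "\<nu> \<in> prob_kernels" using fp by (simp add: fixed_point_def)
  note [measurable] = cond_mass_hist[OF \<nu> E]
  define D where "D n = {\<omega>. c \<le> cond_mass \<nu> E n \<omega> \<and> (\<forall>k<n. \<not> c \<le> cond_mass \<nu> E k \<omega>)}" for n
  have D: "D n \<in> sets (hist n)" for n
  proof -
    have [measurable]: "cond_mass \<nu> E k \<in> borel_measurable (hist n)" if "k \<le> n" for k
      using cond_mass_hist(1)[OF \<nu> E, of k] hist_mono[OF that] by (auto simp: measurable_def)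
    have S: "{\<omega>\<in>space (hist n). c \<le> cond_mass \<nu> E k \<omega>} \<in> sets (hist n)" if "k \<le> n" for k
      using that by measurable
    have "D n = {\<omega>\<in>space (hist n). c \<le> cond_mass \<nu> E n \<omega> \<and> (\<forall>k\<in>{..<n}. \<not> c \<le> cond_mass \<nu> E k \<omega>)}"
      by (auto simp: D_def)
    also have "\<dots> \<in> sets (hist n)"
      by (intro sets.sets_Collect_conj sets.sets_Collect_finite_All sets.sets_Collect_neg S) auto
    finally show ?thesis .
  qed
  have D' [measurable]: "D n \<in> sets path_space" for n using D by (rule hist_le_path_space)
  have disj: "disjoint_family D"
    unfolding disjoint_family_on_def D_def by (auto, metis linorder_neqE_nat)
  have U: "{\<omega>. \<exists>n. c \<le> cond_mass \<nu> E n \<omega>} = (\<Union>n. D n)"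
  proof (intro equalityI subsetI)
    fix \<omega> assume "\<omega> \<in> {\<omega>. \<exists>n. c \<le> cond_mass \<nu> E n \<omega>}"
    then have ex: "\<exists>n. c \<le> cond_mass \<nu> E n \<omega>" by simp
    from LeastI_ex[OF ex] not_less_Least[of _ "\<lambda>n. c \<le> cond_mass \<nu> E n \<omega>"]
    show "\<omega> \<in> (\<Union>n. D n)" unfolding D_def by blast
  qed (auto simp: D_def)
  have part: "(\<Sum>n<m. c * emeasure (Q i) (D n)) \<le> emeasure (\<nu> i) E" for m
  proof -
    have "(\<Sum>n<m. c * emeasure (Q i) (D n)) \<le> (\<Sum>n<m. \<integral>\<^sup>+\<omega>. indicator (D n) \<omega> * cond_mass \<nu> E m \<omega> \<partial>Q i)"
    proof (rule sum_mono)
      fix n assume "n \<in> {..<m}"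
      then have "n \<le> m" by simp
      have "c * emeasure (Q i) (D n) = (\<integral>\<^sup>+\<omega>. c * indicator (D n) \<omega> \<partial>Q i)"
        by (subst nn_integral_cmult_indicator) (auto simp: sets_Q)
      also have "\<dots> \<le> (\<integral>\<^sup>+\<omega>. indicator (D n) \<omega> * cond_mass \<nu> E n \<omega> \<partial>Q i)"
        by (intro nn_integral_mono) (auto simp: D_def split: split_indicator)
      also have "\<dots> = (\<integral>\<^sup>+\<omega>. indicator (D n) \<omega> * cond_mass \<nu> E m \<omega> \<partial>Q i)"
        by (rule cond_mass_martingale[OF fp E D \<open>n \<le> m\<close>, symmetric])
      finally show "c * emeasure (Q i) (D n) \<le> (\<integral>\<^sup>+\<omega>. indicator (D n) \<omega> * cond_mass \<nu> E m \<omega> \<partial>Q i)" .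
    qed
    also have "\<dots> = (\<integral>\<^sup>+\<omega>. (\<Sum>n<m. indicator (D n) \<omega> * cond_mass \<nu> E m \<omega>) \<partial>Q i)"
      by (intro nn_integral_sum[symmetric]) measurable
    also have "\<dots> \<le> (\<integral>\<^sup>+\<omega>. cond_mass \<nu> E m \<omega> \<partial>Q i)"
    proof (rule nn_integral_mono)
      fix \<omega>
      have "(\<Sum>n<m. indicator (D n) \<omega> :: ennreal) = indicator (\<Union>n<m. D n) \<omega>"
        using disj by (intro indicator_UN_disjoint[symmetric]) (auto simp: disjoint_family_on_def)
      then show "(\<Sum>n<m. indicator (D n) \<omega> * cond_mass \<nu> E m \<omega>) \<le> cond_mass \<nu> E m \<omega>"
        by (simp add: sum_distrib_right[symmetric] split: split_indicator)
    qed
    also have "\<dots> = emeasure (\<nu> i) E" by (rule cond_mass_mean[OF fp E])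
    finally show ?thesis .
  qed
  have "c * emeasure (Q i) (\<Union>n. D n) = c * (\<Sum>n. emeasure (Q i) (D n))"
    using disj by (subst suminf_emeasure) (auto simp: sets_Q)
  also have "\<dots> = (\<Sum>n. c * emeasure (Q i) (D n))" by simp
  also have "\<dots> \<le> emeasure (\<nu> i) E"
    using part by (intro suminf_le_const) auto
  finally show ?thesis by (simp add: U)
qed

lemma AE_first_visit: "AE \<omega> in Q i. \<exists>n. \<omega> \<in> first_visit j N n"
  using recurrent[of j i] by eventually_elim (rule UN_first_visit)

text \<open>Optional stopping at the first visit to j from time N on. The paths without such a visit
  before time m contribute at most their probability, which tends to 0 by recurrence.\<close>

lemma cond_mass_first_visit:
  assumes fp: "fixed_point p K \<nu>" and E: "E \<in> sets borel"
  shows "(\<Sum>n. \<integral>\<^sup>+\<omega>. indicator (first_visit j N n) \<omega> * cond_mass \<nu> E n \<omega> \<partial>Q i) = emeasure (\<nu> i) E"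
proof -
  have \<nu>: "\<nu> \<in> prob_kernels" using fp by (simp add: fixed_point_def)
  note [measurable] = cond_mass_hist[OF \<nu> E]
  let ?D = "first_visit j N"
  have D' [measurable]: "?D n \<in> sets path_space" for n using first_visit_hist by (rule hist_le_path_space)
  define t where "t n = (\<integral>\<^sup>+\<omega>. indicator (?D n) \<omega> * cond_mass \<nu> E n \<omega> \<partial>Q i)" for n
  define W where "W m = UNIV - (\<Union>n<m. ?D n)" for m
  have W [measurable]: "W m \<in> sets path_space" for m
    unfolding W_def using sets.top[of path_space] by (intro sets.Diff sets.finite_UN) auto
  have split: "(\<Sum>n<m. t n) + (\<integral>\<^sup>+\<omega>. indicator (W m) \<omega> * cond_mass \<nu> E m \<omega> \<partial>Q i) = emeasure (\<nu> i) E" for m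
  proof -
    have "(\<Sum>n<m. t n) = (\<Sum>n<m. \<integral>\<^sup>+\<omega>. indicator (?D n) \<omega> * cond_mass \<nu> E m \<omega> \<partial>Q i)"
      unfolding t_def by (intro sum.cong refl cond_mass_martingale[OF fp E first_visit_hist, symmetric]) auto
    also have "\<dots> = (\<integral>\<^sup>+\<omega>. (\<Sum>n<m. indicator (?D n) \<omega> * cond_mass \<nu> E m \<omega>) \<partial>Q i)"
      by (intro nn_integral_sum[symmetric]) measurable
    finally have "(\<Sum>n<m. t n) + (\<integral>\<^sup>+\<omega>. indicator (W m) \<omega> * cond_mass \<nu> E m \<omega> \<partial>Q i)
      = (\<integral>\<^sup>+\<omega>. (\<Sum>n<m. indicator (?D n) \<omega> * cond_mass \<nu> E m \<omega>) + indicator (W m) \<omega> * cond_mass \<nu> E m \<omega> \<partial>Q i)"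
      by (simp add: nn_integral_add)
    also have "\<dots> = (\<integral>\<^sup>+\<omega>. cond_mass \<nu> E m \<omega> \<partial>Q i)"
    proof (rule nn_integral_cong)
      fix \<omega>
      have "(\<Sum>n<m. indicator (?D n) \<omega> :: ennreal) = indicator (\<Union>n<m. ?D n) \<omega>"
        using disjoint_first_visit[of j N] by (intro indicator_UN_disjoint[symmetric]) (auto simp: disjoint_family_on_def)
      then show "(\<Sum>n<m. indicator (?D n) \<omega> * cond_mass \<nu> E m \<omega>) + indicator (W m) \<omega> * cond_mass \<nu> E m \<omega> = cond_mass \<nu> E m \<omega>"
        by (simp add: sum_distrib_right[symmetric] W_def split: split_indicator)
    qed
    finally show ?thesis by (simp add: cond_mass_mean[OF fp E])
  qed
  have Wlim: "(\<lambda>m. emeasure (Q i) (W m)) \<longlonglongrightarrow> 0"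
  proof -
    have "(\<lambda>m. emeasure (Q i) (W m)) \<longlonglongrightarrow> emeasure (Q i) (\<Inter>m. W m)"
    proof (rule Lim_emeasure_decseq)
      show "decseq W" by (auto simp: W_def decseq_def)
    qed (auto simp: sets_Q)
    moreover have "emeasure (Q i) (\<Inter>m. W m) = 0"
    proof -
      have eq: "{\<omega> \<in> space (Q i). \<not> (\<exists>n. \<omega> \<in> ?D n)} = (\<Inter>m. W m)"
        using lessI by (fastforce simp: W_def)
      have "(\<Inter>m. W m) \<in> sets (Q i)" by (auto simp: sets_Q)
      from AE_iff_measurable[OF this eq] show ?thesis
        using AE_first_visit[where i = i and j = j and N = N] by simp
    qed
    ultimately show ?thesis by simp
  qed
  have "suminf t \<le> emeasure (\<nu> i) E"
  proof (rule suminf_le_const)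
    show "(\<Sum>n<m. t n) \<le> emeasure (\<nu> i) E" for m unfolding split[of m, symmetric] by simp
  qed auto
  moreover have "emeasure (\<nu> i) E \<le> suminf t + emeasure (Q i) (W m)" for m
  proof -
    have "(\<integral>\<^sup>+\<omega>. indicator (W m) \<omega> * cond_mass \<nu> E m \<omega> \<partial>Q i) \<le> (\<integral>\<^sup>+\<omega>. indicator (W m) \<omega> \<partial>Q i)"
      using cond_mass_le_1[OF \<nu>] by (intro nn_integral_mono) (auto split: split_indicator)
    also have "\<dots> = emeasure (Q i) (W m)" by (simp add: sets_Q)
    finally show ?thesis
      unfolding split[of m, symmetric] by (intro add_mono sum_le_suminf) auto
  qed
  then have "emeasure (\<nu> i) E \<le> suminf t + 0"
    by (intro LIMSEQ_le_const[OF tendsto_add[OF tendsto_const Wlim]]) auto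
  ultimately show ?thesis unfolding t_def by (simp add: antisym)
qed

end


subsection \<open>A truncated renewal estimate\<close>

context sequence_space begin

lemma nn_integral_comb_seq:
  assumes [measurable]: "g \<in> borel_measurable S"
  shows "(\<integral>\<^sup>+s. g s \<partial>S) = (\<integral>\<^sup>+s. (\<integral>\<^sup>+s'. g (comb_seq n s s') \<partial>S) \<partial>S)"
proof -
  have "(\<integral>\<^sup>+s. g s \<partial>S) = (\<integral>\<^sup>+s. g s \<partial>distr (S \<Otimes>\<^sub>M S) S (\<lambda>(s, s'). comb_seq n s s'))"
    by (simp add: PiM_comb_seq)
  also have "\<dots> = (\<integral>\<^sup>+z. g (case z of (s, s') \<Rightarrow> comb_seq n s s') \<partial>(S \<Otimes>\<^sub>M S))"
    by (rule nn_integral_distr) measurable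
  also have "\<dots> = (\<integral>\<^sup>+s. (\<integral>\<^sup>+s'. g (comb_seq n s s') \<partial>S) \<partial>S)"
  proof -
    have m: "(\<lambda>z. g (case z of (s, s') \<Rightarrow> comb_seq n s s')) \<in> borel_measurable (S \<Otimes>\<^sub>M S)" by measurable
    show ?thesis using P.nn_integral_fst[OF m] by simp
  qed
  finally show ?thesis .
qed

lemma nn_integral_component: "f \<in> borel_measurable M \<Longrightarrow> (\<integral>\<^sup>+s. f (s n) \<partial>S) = (\<integral>\<^sup>+z. f z \<partial>M)"
  by (subst PiM_component[of n, symmetric]) (simp_all add: nn_integral_distr)

section \<open>Random walks with nonnegative steps\<close>

context
  fixes x :: "'a \<Rightarrow> real"
  assumes x [measurable]: "x \<in> borel_measurable M" and x_nonneg: "\<And>z. 0 \<le> x z"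
begin

definition walk :: "nat \<Rightarrow> (nat \<Rightarrow> 'a) \<Rightarrow> real" where "walk n s = (\<Sum>k<n. x (s k))"

lemma walk_measurable [measurable]: "walk n \<in> borel_measurable S"
  unfolding walk_def by measurable

lemma walk_comb_seq: "walk (n + m) (comb_seq n s s') = walk n s + walk m s'"
proof (induction m)
  case 0
  show ?case by (simp add: walk_def comb_seq_less)
next
  case (Suc m)
  then show ?case using comb_seq_add[of n s s' m] by (simp add: walk_def add.commute)
qed

lemma walk_nonneg: "0 \<le> walk n s"
  unfolding walk_def by (simp add: sum_nonneg x_nonneg)

text \<open>If no step before the passage exceeds v, truncation changes nothing and the truncated
  steps add up to the walk. If one does, its truncation alone equals v.\<close>

lemma first_passage_sum:
  assumes v: "0 < v" and N: "v \<le> walk N s"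
  shows "ennreal v \<le> (\<Sum>n. indicator {s. walk n s < v} s * ennreal (min (x (s n)) v))"
proof -
  define L where "L = (LEAST N. v \<le> walk N s)"
  have L: "v \<le> walk L s" unfolding L_def using N by (rule LeastI)
  have less: "walk n s < v" if "n < L" for n using not_less_Least[OF that[unfolded L_def]] by simp
  have "v \<le> (\<Sum>n<L. min (x (s n)) v)"
  proof (cases "\<forall>n<L. x (s n) \<le> v")
    case True
    then have "(\<Sum>n<L. min (x (s n)) v) = walk L s" unfolding walk_def by (intro sum.cong) auto
    then show ?thesis using L by simp
  next
    case False
    then obtain m where m: "m < L" "v < x (s m)" by force
    have "v = min (x (s m)) v" using m by simp
    also have "\<dots> \<le> (\<Sum>n<L. min (x (s n)) v)"
      using m v x_nonneg by (intro member_le_sum) auto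
    finally show ?thesis .
  qed
  then have "ennreal v \<le> ennreal (\<Sum>n<L. min (x (s n)) v)" by (rule ennreal_leI)
  also have "\<dots> = (\<Sum>n<L. ennreal (min (x (s n)) v))"
    using v x_nonneg by (subst sum_ennreal) auto
  also have "\<dots> = (\<Sum>n<L. indicator {s. walk n s < v} s * ennreal (min (x (s n)) v))"
    using less by (intro sum.cong) auto
  also have "\<dots> \<le> (\<Sum>n. indicator {s. walk n s < v} s * ennreal (min (x (s n)) v))"
    by (intro sum_le_suminf) auto
  finally show ?thesis .
qed

lemma integrable_trunc: "0 < v \<Longrightarrow> integrable M (\<lambda>z. min (x z) v)"
proof (rule M.integrable_const_bound[where B = v])
  assume "0 < v"
  then have "norm (min (x z) v) \<le> v" for z using x_nonneg[of z] by (auto simp: min_def)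
  then show "AE z in M. norm (min (x z) v) \<le> v" by simp
qed measurable

lemma trunc_mean_pos:
  assumes pos: "emeasure M {z\<in>space M. 0 < x z} > 0" and v: "0 < v"
  shows "0 < (\<integral>z. min (x z) v \<partial>M)" "ennreal (\<integral>z. min (x z) v \<partial>M) = (\<integral>\<^sup>+z. ennreal (min (x z) v) \<partial>M)"
proof -
  note int = integrable_trunc[OF v]
  show eq: "ennreal (\<integral>z. min (x z) v \<partial>M) = (\<integral>\<^sup>+z. ennreal (min (x z) v) \<partial>M)"
    using int v x_nonneg by (intro nn_integral_eq_integral[symmetric]) (auto intro: less_imp_le)
  have "(\<integral>\<^sup>+z. ennreal (min (x z) v) \<partial>M) \<noteq> 0"
  proof
    assume "(\<integral>\<^sup>+z. ennreal (min (x z) v) \<partial>M) = 0"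
    then have "AE z in M. ennreal (min (x z) v) = 0" by (subst (asm) nn_integral_0_iff_AE) auto
    then have "AE z in M. \<not> 0 < x z"
    proof eventually_elim
      case (elim z)
      then show ?case using v by (auto simp: ennreal_eq_0_iff min_def split: if_splits)
    qed
    then have "emeasure M {z\<in>space M. 0 < x z} = 0"
      by (subst (asm) AE_iff_measurable[OF _ refl]) auto
    with pos show False by simp
  qed
  then have "ennreal (\<integral>z. min (x z) v \<partial>M) > 0" by (simp add: eq zero_less_iff_neq_zero)
  then show "0 < (\<integral>z. min (x z) v \<partial>M)" by simp
qed

text \<open>Wald's identity for the walk whose steps are truncated at \<open>v\<close>, stopped when it reaches \<open>v\<close>.\<close>

lemma renewal_lower_bound:
  assumes pos: "emeasure M {z\<in>space M. 0 < x z} > 0" and v: "0 < v"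
  shows "ennreal (v / (\<integral>z. min (x z) v \<partial>M)) \<le> (\<Sum>n. emeasure S {s\<in>space S. walk n s < v})"
proof -
  define U where "U = (\<Sum>n. emeasure S {s\<in>space S. walk n s < v})"
  define m where "m = (\<integral>z. min (x z) v \<partial>M)"
  note m = trunc_mean_pos[OF pos v, folded m_def]
  show ?thesis
  proof (cases "U = \<infinity>")
    case True then show ?thesis by (simp add: U_def)
  next
    case False
    then obtain u where u: "0 \<le> u" "U = ennreal u" by (cases U) auto
    \<comment> \<open>If the walk stayed below v forever with positive probability e, every term of
      the finite sum U would be at least e. Hence the first passage happens almost surely.\<close>
    define I where "I = {s\<in>space S. \<forall>n. walk n s < v}"
    have I [measurable]: "I \<in> sets S" unfolding I_def by measurable
    obtain e where e: "0 \<le> e" "emeasure S I = ennreal e" by (cases "emeasure S I") auto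
    have "real n * e \<le> u" for n
    proof -
      have "ennreal (real n * e) = (\<Sum>k<n. emeasure S I)"
        using e by (simp add: ennreal_of_nat_eq_real_of_nat ennreal_mult)
      also have "\<dots> \<le> (\<Sum>k<n. emeasure S {s\<in>space S. walk k s < v})"
        by (intro sum_mono emeasure_mono) (auto simp: I_def)
      also have "\<dots> \<le> U" unfolding U_def by (intro sum_le_suminf) auto
      finally show ?thesis using u by simp
    qed
    then have "e \<le> 0" by (meson ex_less_of_nat_mult not_le)
    then have I0: "emeasure S I = 0" using e by simp
    have "AE s in S. \<exists>n. v \<le> walk n s"
      using I0 by (subst AE_iff_measurable[OF I]) (auto simp: I_def not_le)
    then have "AE s in S. ennreal v \<le> (\<Sum>n. indicator {s. walk n s < v} s * ennreal (min (x (s n)) v))"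
      by eventually_elim (use first_passage_sum[OF v] in blast)
    then have "(\<integral>\<^sup>+s. ennreal v \<partial>S) \<le> (\<integral>\<^sup>+s. (\<Sum>n. indicator {s. walk n s < v} s * ennreal (min (x (s n)) v)) \<partial>S)"
      by (rule nn_integral_mono_AE)
    also have "\<dots> = (\<Sum>n. \<integral>\<^sup>+s. indicator {s. walk n s < v} s * ennreal (min (x (s n)) v) \<partial>S)"
      by (intro nn_integral_suminf) (simp add: indicator_def)
    also have "\<dots> = (\<Sum>n. emeasure S {s\<in>space S. walk n s < v} * ennreal m)"
    proof (intro suminf_cong)
      fix n
      have "(\<integral>\<^sup>+s. indicator {s. walk n s < v} s * ennreal (min (x (s n)) v) \<partial>S)
        = (\<integral>\<^sup>+s. (\<integral>\<^sup>+s'. indicator {s. walk n s < v} s * ennreal (min (x (s' 0)) v) \<partial>S) \<partial>S)"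
      proof (subst nn_integral_comb_seq[of _ n])
        show "(\<lambda>s. indicator {s. walk n s < v} s * ennreal (min (x (s n)) v)) \<in> borel_measurable S"
          unfolding indicator_def by measurable
        have "walk n (comb_seq n s s') = walk n s" "comb_seq n s s' n = s' 0" for s s' :: "nat \<Rightarrow> 'a"
          using walk_comb_seq[of n 0 s s'] comb_seq_add[of n s s' 0] by (simp_all add: walk_def[of 0])
        then show "(\<integral>\<^sup>+s. (\<integral>\<^sup>+s'. indicator {s. walk n s < v} (comb_seq n s s') * ennreal (min (x (comb_seq n s s' n)) v) \<partial>S) \<partial>S)
          = (\<integral>\<^sup>+s. (\<integral>\<^sup>+s'. indicator {s. walk n s < v} s * ennreal (min (x (s' 0)) v) \<partial>S) \<partial>S)"
          by (simp add: indicator_def)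
      qed
      also have "\<dots> = (\<integral>\<^sup>+s. ennreal m * indicator {s\<in>space S. walk n s < v} s \<partial>S)"
      proof (rule nn_integral_cong)
        fix s assume s: "s \<in> space S"
        have "(\<integral>\<^sup>+s'. indicator {s. walk n s < v} s * ennreal (min (x (s' 0)) v) \<partial>S)
          = indicator {s. walk n s < v} s * (\<integral>\<^sup>+s'. ennreal (min (x (s' 0)) v) \<partial>S)"
          by (rule nn_integral_cmult) measurable
        also have "(\<integral>\<^sup>+s'. ennreal (min (x (s' 0)) v) \<partial>S) = (\<integral>\<^sup>+z. ennreal (min (x z) v) \<partial>M)"
          by (rule nn_integral_component[of "\<lambda>z. ennreal (min (x z) v)"]) measurable
        finally show "(\<integral>\<^sup>+s'. indicator {s. walk n s < v} s * ennreal (min (x (s' 0)) v) \<partial>S)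
            = ennreal m * indicator {s\<in>space S. walk n s < v} s"
          using s m(2) by (simp add: mult.commute split: split_indicator)
      qed
      also have "\<dots> = emeasure S {s\<in>space S. walk n s < v} * ennreal m"
        by (subst nn_integral_cmult_indicator) (auto simp: mult.commute)
      finally show "(\<integral>\<^sup>+s. indicator {s. walk n s < v} s * ennreal (min (x (s n)) v) \<partial>S)
          = emeasure S {s\<in>space S. walk n s < v} * ennreal m" .
    qed
    also have "\<dots> = U * ennreal m" by (simp add: U_def)
    finally have "ennreal v \<le> ennreal (u * m)" using u m by (simp add: ennreal_mult P.emeasure_space_1)
    then have "v \<le> u * m" using u m by (simp add: ennreal_le_iff)
    then show ?thesis using u m by (simp add: U_def[symmetric] m_def[symmetric] divide_le_eq ennreal_leI)
  qed
qed

text \<open>Choose C so that the bound holds for all n with this C with positive probability q.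
  After an exceedance of the walk plus C at time n, the remaining sequence obeys the bound with
  probability q, independently, and then this exceedance is the last one. Last exceedances at
  different times exclude each other, so the expected number of exceedances is at most 1/q. By
  independence of \<open>y (s n)\<close> and \<open>walk n\<close>, this number is the integral of
  \<open>U (y - C)\<close>, where \<open>U v\<close> is the expected number of visits of the walk
  below v, and \<open>renewal_lower_bound\<close> compares U with the integrand.\<close>

lemma J_integral_finite:
  assumes y [measurable]: "y \<in> borel_measurable M" and y_nonneg: "\<And>z. 0 \<le> y z"
    and pos: "emeasure M {z\<in>space M. 0 < x z} > 0"
    and bdd: "AE s in S. \<exists>C. \<forall>n. y (s n) \<le> walk n s + C"
  shows "(\<integral>\<^sup>+z. ennreal (if y z = 0 then 1 else y z / (\<integral>w. min (x w) (y z) \<partial>M)) \<partial>M) < \<infinity>"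
proof -
  define D where "D C = {s\<in>space S. \<forall>n. y (s n) \<le> walk n s + C}" for C
  have D [measurable]: "D C \<in> sets S" for C unfolding D_def not_less[symmetric] by measurable
  have "\<exists>k::nat. emeasure S (D (real (Suc k))) > 0"
  proof (rule ccontr)
    assume "\<not> ?thesis"
    then have "AE s in S. s \<notin> D (real (Suc k))" for k
      by (intro AE_not_in) (auto simp: null_sets_def zero_less_iff_neq_zero)
    then have "AE s in S. \<forall>k. s \<notin> D (real (Suc k))" by (simp add: AE_all_countable)
    with bdd AE_space have "AE s in S. False"
    proof eventually_elim
      case (elim s)
      then obtain C where C: "\<And>n. y (s n) \<le> walk n s + C" by auto
      obtain k where "C \<le> real k" using real_arch_simple by blast
      with C elim(2) have "s \<in> D (real (Suc k))" by (force simp: D_def intro: order_trans)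
      with elim show False by blast
    qed
    then show False using P.emeasure_space_1 by (simp add: AE_iff_null null_sets_def)
  qed
  then obtain k where k: "emeasure S (D (real (Suc k))) > 0" by blast
  \<comment> \<open>The successor makes C at least 1, so that \<open>2 * C\<close> is a positive
    level in the final comparison.\<close>
  define C where "C = real (Suc k)"
  have C: "1 \<le> C" by (simp add: C_def)
  define q where "q = emeasure S (D C)"
  have q: "0 < q" "q \<le> 1" using k by (auto simp: q_def C_def P.emeasure_le_1)
  define E where "E n = {s\<in>space S. walk n s + C < y (s n)}" for n
  have E [measurable]: "E n \<in> sets S" for n unfolding E_def by measurable
  define F where "F n = {s\<in>E n. \<forall>k>n. s \<notin> E k}" for n
  have F [measurable]: "F n \<in> sets S" for n
  proof -
    have "F n = {s\<in>space S. s \<in> E n \<and> (\<forall>k>n. s \<notin> E k)}" using sets.sets_into_space[OF E] by (auto simp: F_def)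
    also have "\<dots> \<in> sets S" by measurable
    finally show ?thesis .
  qed
  have FE: "emeasure S (E n) * q \<le> emeasure S (F n)" for n
  proof -
    have "emeasure S (E n) * q = (\<integral>\<^sup>+s. q * indicator (E n) s \<partial>S)"
      by (subst nn_integral_cmult_indicator) (auto simp: mult.commute)
    also have "\<dots> = (\<integral>\<^sup>+s. (\<integral>\<^sup>+s'. indicator (E n) s * indicator (D C) s' \<partial>S) \<partial>S)"
    proof (intro nn_integral_cong)
      fix s
      have "(\<integral>\<^sup>+s'. indicator (E n) s * indicator (D C) s' \<partial>S) = indicator (E n) s * q"
        by (simp add: nn_integral_cmult q_def)
      then show "q * indicator (E n) s = (\<integral>\<^sup>+s'. indicator (E n) s * indicator (D C) s' \<partial>S)"
        by (simp add: mult.commute)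
    qed
    also have "\<dots> \<le> (\<integral>\<^sup>+s. (\<integral>\<^sup>+s'. indicator (F n) (comb_seq (Suc n) s s') \<partial>S) \<partial>S)"
    proof (intro nn_integral_mono)
      fix s s' assume s: "s \<in> space S" "s' \<in> space S"
      \<comment> \<open>The new prefix of length n + 1 only raises the walk, since steps are
        nonnegative; so the bound that s' satisfies on its own excludes every exceedance after time
        n.\<close>
      have sp: "comb_seq (Suc n) s s' \<in> space S"
        using s by (auto simp: space_PiM comb_seq_def PiE_iff)
      have "comb_seq (Suc n) s s' \<in> F n" if a: "s \<in> E n" "s' \<in> D C"
      proof -
        have w: "walk n (comb_seq (Suc n) s s') = walk n s" by (simp add: walk_def comb_seq_less)
        have "comb_seq (Suc n) s s' \<in> E n" using a sp w by (simp add: E_def comb_seq_less)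
        moreover have "comb_seq (Suc n) s s' \<notin> E l" if "n < l" for l
        proof -
          define m where "m = l - Suc n"
          have l: "l = m + Suc n" using that by (simp add: m_def)
          have "y (s' m) \<le> walk m s' + C" using a by (simp add: D_def)
          also have "\<dots> \<le> walk l (comb_seq (Suc n) s s') + C"
            using walk_comb_seq[of "Suc n" m s s'] walk_nonneg[of "Suc n" s] by (simp add: l add.commute)
          finally have "\<not> walk l (comb_seq (Suc n) s s') + C < y (s' m)" by simp
          moreover have "comb_seq (Suc n) s s' l = s' m" unfolding l by (rule comb_seq_add)
          ultimately show ?thesis by (simp add: E_def)
        qed
        ultimately show ?thesis by (simp add: F_def)
      qed
      then show "indicator (E n) s * indicator (D C) s' \<le> (indicator (F n) (comb_seq (Suc n) s s') :: ennreal)"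
        by (simp split: split_indicator)
    qed
    also have "\<dots> = emeasure S (F n)"
      by (subst nn_integral_comb_seq[symmetric]) auto
    finally show ?thesis .
  qed
  have disj: "disjoint_family F"
    unfolding disjoint_family_on_def F_def by (auto, metis linorder_neqE_nat)
  have "(\<Sum>n. emeasure S (E n)) * q = (\<Sum>n. emeasure S (E n) * q)" by simp
  also have "\<dots> \<le> (\<Sum>n. emeasure S (F n))" using FE by (intro suminf_le) auto
  also have "\<dots> = emeasure S (\<Union>n. F n)" using disj by (intro suminf_emeasure) auto
  also have "\<dots> \<le> 1" by (rule P.emeasure_le_1)
  finally have "(\<Sum>n. emeasure S (E n)) * q \<le> 1" .
  then have fin: "(\<Sum>n. emeasure S (E n)) < \<infinity>"
    using q by (cases "(\<Sum>n. emeasure S (E n)) = \<infinity>") (auto simp: ennreal_top_mult less_top top_unique split: if_splits)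
  define U where "U v = (\<Sum>n. emeasure S {s\<in>space S. walk n s < v})" for v
  have Un: "(\<lambda>z. emeasure S {s\<in>space S. walk n s < y z - C}) \<in> borel_measurable M" for n
  proof -
    have "(\<lambda>(z, s). indicator {s\<in>space S. walk n s < y z - C} s :: ennreal) \<in> borel_measurable (M \<Otimes>\<^sub>M S)"
      unfolding indicator_def by measurable
    from P.borel_measurable_nn_integral[OF this]
    have "(\<lambda>z. \<integral>\<^sup>+s. indicator {s\<in>space S. walk n s < y z - C} s \<partial>S) \<in> borel_measurable M" .
    moreover have "(\<integral>\<^sup>+s. indicator {s\<in>space S. walk n s < y z - C} s \<partial>S) = emeasure S {s\<in>space S. walk n s < y z - C}" for z
      by (rule nn_integral_indicator) measurable
    ultimately show ?thesis by simp
  qed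
  \<comment> \<open>\<open>walk n\<close> depends on the coordinates below n only, so
    \<open>y (s n)\<close> can be integrated last.\<close>
  have SE: "emeasure S (E n) = (\<integral>\<^sup>+z. emeasure S {s\<in>space S. walk n s < y z - C} \<partial>M)" for n
  proof -
    have "emeasure S (E n) = (\<integral>\<^sup>+s. indicator (E n) s \<partial>S)" by simp
    also have "\<dots> = (\<integral>\<^sup>+s. (\<integral>\<^sup>+s'. indicator (E n) (comb_seq n s s') \<partial>S) \<partial>S)"
      by (rule nn_integral_comb_seq) measurable
    also have "\<dots> = (\<integral>\<^sup>+s. (\<integral>\<^sup>+s'. indicator {s\<in>space S. walk n s < y (s' 0) - C} s \<partial>S) \<partial>S)"
    proof (intro nn_integral_cong)
      fix s s' assume s: "s \<in> space S" "s' \<in> space S"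
      have sp: "comb_seq n s s' \<in> space S"
        using s by (auto simp: space_PiM comb_seq_def PiE_iff)
      show "indicator (E n) (comb_seq n s s') = (indicator {s\<in>space S. walk n s < y (s' 0) - C} s :: ennreal)"
        using s sp walk_comb_seq[of n 0 s s'] comb_seq_add[of n s s' 0]
        by (auto simp: E_def walk_def[of 0] split: split_indicator)
    qed
    also have "\<dots> = (\<integral>\<^sup>+s'. (\<integral>\<^sup>+s. indicator {s\<in>space S. walk n s < y (s' 0) - C} s \<partial>S) \<partial>S)"
    proof -
      interpret pair_sigma_finite S S by unfold_locales
      show ?thesis
        by (rule Fubini'[symmetric]) (unfold indicator_def, measurable)
    qed
    also have "\<dots> = (\<integral>\<^sup>+s'. emeasure S {s\<in>space S. walk n s < y (s' 0) - C} \<partial>S)"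
      by (intro nn_integral_cong nn_integral_indicator) measurable
    also have "\<dots> = (\<integral>\<^sup>+z. emeasure S {s\<in>space S. walk n s < y z - C} \<partial>M)"
      by (rule nn_integral_component[OF Un])
    finally show ?thesis .
  qed
  have UC: "(\<integral>\<^sup>+z. U (y z - C) \<partial>M) < \<infinity>"
    unfolding U_def using fin by (subst nn_integral_suminf) (simp_all add: Un SE)
  have U_meas: "(\<lambda>z. U (y z - C)) \<in> borel_measurable M"
    unfolding U_def using Un by measurable
  define mr where "mr v = (\<integral>w. min (x w) v \<partial>M)" for v
  have mr_pos: "0 < mr v" if "0 < v" for v using trunc_mean_pos(1)[OF pos that] by (simp add: mr_def)
  note int = integrable_trunc
  have mr_mono: "mr v \<le> mr w" if "0 < v" "v \<le> w" for v w
    unfolding mr_def using that int by (intro integral_mono) auto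
  have mr_le: "mr v \<le> v" if "0 < v" for v
  proof -
    have "mr v \<le> (\<integral>z. v \<partial>M)" unfolding mr_def using that int by (intro integral_mono) auto
    then show ?thesis by (simp add: M.prob_space)
  qed
  \<comment> \<open>The truncated mean grows at most linearly in the level, so that
    \<open>v / mr v\<close> is nondecreasing.\<close>
  have mr_scale: "mr w \<le> w / v * mr v" if "0 < v" "v \<le> w" for v w
  proof -
    have "mr w \<le> (\<integral>z. w / v * min (x z) v \<partial>M)"
      unfolding mr_def
    proof (rule integral_mono)
      fix z
      show "min (x z) w \<le> w / v * min (x z) v"
      proof (cases "x z \<le> v")
        case True
        have "1 * x z \<le> w / v * x z" using that x_nonneg[of z] by (intro mult_right_mono) (simp_all add: field_simps)
        then show ?thesis using True that by (simp add: min_def)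
      next
        case False then show ?thesis using that by (simp add: min_def)
      qed
    qed (use that int in auto)
    also have "\<dots> = w / v * mr v" by (simp add: mr_def)
    finally show ?thesis .
  qed
  \<comment> \<open>Up to \<open>2 * C\<close> the quotient is dominated by its value at
    \<open>2 * C\<close>, which is at least 1 because \<open>mr v \<le> v\<close>. Above it, y is at
    most \<open>2 * (y - C)\<close> and \<open>mr\<close> is monotone, whence the factor 2 in front
    of U.\<close>
  have bound: "ennreal (if y z = 0 then 1 else y z / mr (y z)) \<le> ennreal (2 * C / mr (2 * C)) + 2 * U (y z - C)" for z
  proof -
    consider "y z = 0" | "0 < y z" "y z \<le> 2 * C" | "2 * C < y z" using y_nonneg[of z] by linarith
    then show ?thesis
    proof cases
      case 1
      have "1 \<le> 2 * C / mr (2 * C)" using mr_le[of "2 * C"] mr_pos[of "2 * C"] C by simp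
      then have "ennreal 1 \<le> ennreal (2 * C / mr (2 * C))" by (rule ennreal_leI)
      then show ?thesis using 1 by (simp add: add_increasing2)
    next
      case 2
      then have "y z / mr (y z) \<le> 2 * C / mr (2 * C)"
        using mr_scale[of "y z" "2 * C"] mr_pos[of "2 * C"] mr_pos[of "y z"] C by (simp add: field_simps)
      then have "ennreal (y z / mr (y z)) \<le> ennreal (2 * C / mr (2 * C))" by (rule ennreal_leI)
      then show ?thesis using 2 by (simp add: add_increasing2)
    next
      case 3
      then have v: "0 < y z - C" using C by simp
      have "y z / mr (y z) \<le> 2 * (y z - C) / mr (y z - C)"
        using 3 C v mr_mono[of "y z - C" "y z"] mr_pos[OF v] by (intro frac_le) auto
      then have "ennreal (y z / mr (y z)) \<le> ennreal (2 * ((y z - C) / mr (y z - C)))" by (intro ennreal_leI) simp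
      also have "\<dots> = 2 * ennreal ((y z - C) / mr (y z - C))"
        using v mr_pos[OF v] by (subst ennreal_mult) auto
      also have "\<dots> \<le> 2 * U (y z - C)"
        unfolding U_def mr_def by (intro mult_left_mono renewal_lower_bound[OF pos v]) simp
      finally show ?thesis using 3 C by (simp add: add_increasing)
    qed
  qed
  have "(\<integral>\<^sup>+z. ennreal (if y z = 0 then 1 else y z / mr (y z)) \<partial>M)
      \<le> (\<integral>\<^sup>+z. ennreal (2 * C / mr (2 * C)) + 2 * U (y z - C) \<partial>M)"
    by (intro nn_integral_mono bound)
  also have "\<dots> = ennreal (2 * C / mr (2 * C)) + 2 * (\<integral>\<^sup>+z. U (y z - C) \<partial>M)"
    using U_meas by (simp add: nn_integral_add nn_integral_cmult M.emeasure_space_1)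
  also have "\<dots> < \<infinity>" using UC by (simp add: ennreal_mult_less_top ennreal_add_less_top)
  finally show ?thesis unfolding mr_def .
qed

end

end


subsection \<open>Isometric fixed points\<close>

lemma real_distribution_borel: "prob_space L \<Longrightarrow> sets L = sets borel \<Longrightarrow> real_distribution L"
  using sets_eq_imp_space_eq[of L borel]
  by (simp add: real_distribution_def real_distribution_axioms_def)

lemma char_affine:
  assumes "prob_space L" "sets L = sets borel"
  shows "char (distr L borel (\<lambda>x. a * x + b)) t = iexp (t * b) * char L (t * a)"
proof -
  have [measurable_cong]: "sets L = sets borel" by fact
  have "char (distr L borel (\<lambda>x. a * x + b)) t = (CLINT x|L. iexp (t * b) * iexp (t * a * x))"
    unfolding char_def by (subst integral_distr) (auto simp: distrib_left exp_add[symmetric] ac_simps intro!: Bochner_Integration.integral_cong)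
  then show ?thesis by (simp add: char_def)
qed

lemma char_re_im:
  assumes "real_distribution L"
  shows "Re (char L t) = (\<integral>x. cos (t * x) \<partial>L)" "Im (char L t) = (\<integral>x. sin (t * x) \<partial>L)"
proof -
  interpret real_distribution L by fact
  have int: "integrable L (\<lambda>x. iexp (t * x))" by (rule integrable_iexp) auto
  show "Re (char L t) = (\<integral>x. cos (t * x) \<partial>L)" "Im (char L t) = (\<integral>x. sin (t * x) \<partial>L)"
    unfolding char_def using integral_Re[OF int] integral_Im[OF int] by (simp_all add: Re_exp Im_exp)
qed

lemma char_minus: "char L (- t) = cnj (char L t)"
proof -
  have "cnj (char L t) = (CLINT x|L. cnj (iexp (t * x)))" unfolding char_def by simp
  also have "\<dots> = char L (- t)" unfolding char_def by (simp add: exp_cnj)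
  finally show ?thesis by simp
qed

text \<open>By continuity rational arguments suffice. Thus an equality that holds almost surely for
  each fixed t can be collected over countably many t into an equality of laws.\<close>

lemma char_eq_at_rationals:
  assumes "real_distribution L" "real_distribution L'" and "\<And>q. char L (of_rat q) = char L' (of_rat q)"
  shows "L = L'"
proof (rule Levy_uniqueness[OF assms(1,2)])
  show "char L = char L'"
  proof
    fix t
    obtain f :: "nat \<Rightarrow> real" where f: "\<And>n. f n \<in> \<rat>" "f \<longlonglongrightarrow> t"
    proof -
      have "t \<in> closure \<rat>" using Rats_closure_real by simp
      then show ?thesis using that unfolding closure_sequential by blast
    qed
    have "char L (f n) = char L' (f n)" for n using f(1)[of n] assms(3) by (auto elim: Rats_cases)
    moreover have "(\<lambda>n. char L (f n)) \<longlonglongrightarrow> char L t" "(\<lambda>n. char L' (f n)) \<longlonglongrightarrow> char L' t"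
      using assms(1,2) f(2) by (auto intro: isCont_tendsto_compose[OF real_distribution.isCont_char])
    ultimately show "char L t = char L' t" using LIMSEQ_unique by auto
  qed
qed

lemma integral_bind_real:
  fixes f :: "real \<Rightarrow> real"
  assumes M: "prob_space M" and \<kappa>: "\<kappa> \<in> measurable M (subprob_algebra borel)"
    and f [measurable]: "f \<in> borel_measurable borel" and b: "\<And>x. \<bar>f x\<bar> \<le> B"
  shows "(\<integral>x. f x \<partial>(M \<bind> \<kappa>)) = (\<integral>w. (\<integral>x. f x \<partial>\<kappa> w) \<partial>M)"
proof -
  interpret prob_space M by fact
  have "(\<integral>x. f x \<partial>(M \<bind> \<kappa>)) = (\<integral>x. f x \<partial>join (distr M (subprob_algebra borel) \<kappa>))"
    using bind_nonempty''[OF \<kappa> not_empty] by simp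
  also have "\<dots> = (\<integral>L. (\<integral>x. f x \<partial>L) \<partial>distr M (subprob_algebra borel) \<kappa>)"
  proof (rule integral_join[where N = borel and B = B and B' = 1])
    show "finite_measure (distr M (subprob_algebra borel) \<kappa>)"
      using prob_space_distr[OF \<kappa>] by (simp add: prob_space_def)
    show "AE M' in distr M (subprob_algebra borel) \<kappa>. emeasure M' (space M') \<le> ennreal 1"
      by (rule AE_I2) (auto simp: space_subprob_algebra intro: subprob_space.subprob_emeasure_le_1)
  qed (use b in auto)
  also have "\<dots> = (\<integral>w. (\<integral>x. f x \<partial>\<kappa> w) \<partial>M)"
    by (rule integral_distr[OF \<kappa>]) measurable
  finally show ?thesis .
qed

context path_chain begin

lemma expectation_st_1:
  fixes f :: "'s \<Rightarrow> real"
  assumes "\<And>i. 0 \<le> f i"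
  shows "(\<integral>\<omega>. f (st 1 \<omega>) \<partial>Q i) = (\<integral>j. f j \<partial>measure_pmf (p i))"
proof -
  have "(\<integral>\<omega>. f (st 1 \<omega>) \<partial>Q i) = enn2real (\<integral>\<^sup>+\<omega>. ennreal (f (st 1 \<omega>)) \<partial>Q i)"
    by (rule integral_eq_nn_integral) (use assms in auto)
  also have "\<dots> = enn2real (\<integral>\<^sup>+j. ennreal (f j) \<partial>measure_pmf (p i))"
    using st_law[where f = "\<lambda>j. ennreal (f j)" and n = 1 and i = i] by (simp add: bind_return_pmf)
  also have "\<dots> = (\<integral>j. f j \<partial>measure_pmf (p i))"
    by (rule integral_eq_nn_integral[symmetric]) (use assms in auto)
  finally show ?thesis .
qed

text \<open>Let \<open>U = E[exp (\<i>t(e X + b)) | M\<^sub>0, M\<^sub>1, e, b]\<close>, so that \<open>|U| = |\<phi>\<^sub>M\<^sub>1(t)|\<close> as \<open>|e| = 1\<close>. Under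
  the stationary law, \<open>E|U - \<phi>\<^sub>M\<^sub>0(t)|\<^sup>2 = E|\<phi>\<^sub>M\<^sub>1(t)|\<^sup>2 - E|\<phi>\<^sub>M\<^sub>0(t)|\<^sup>2 = 0\<close>.\<close>

lemma isometric_fixed_point:
  fixes e b :: "'s path \<Rightarrow> real"
  assumes \<nu>: "\<nu> \<in> prob_kernels"
    and e [measurable]: "e \<in> borel_measurable path_space" and b [measurable]: "b \<in> borel_measurable path_space"
    and iso: "\<And>i. AE \<omega> in Q i. \<bar>e \<omega>\<bar> = 1"
    and fix_eq: "\<And>i E. E \<in> sets borel \<Longrightarrow>
      (\<integral>\<^sup>+\<omega>. emeasure (\<nu> (st 1 \<omega>)) {x. e \<omega> * x + b \<omega> \<in> E} \<partial>Q i) = emeasure (\<nu> i) E"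
  shows "AE \<omega> in Q i. distr (\<nu> (st 1 \<omega>)) borel (\<lambda>x. e \<omega> * x + b \<omega>) = \<nu> i"
proof -
  note D = prob_kernelsD[OF \<nu>]
  define \<kappa> where "\<kappa> \<omega> = distr (\<nu> (st 1 \<omega>)) borel (\<lambda>x. e \<omega> * x + b \<omega>)" for \<omega>
  have mm: "(\<lambda>x. a * x + c) \<in> measurable (\<nu> j) borel" for a c j
    unfolding measurable_cong_sets[OF D(2) refl] by measurable
  have \<kappa>D: "real_distribution (\<kappa> \<omega>)" "real_distribution (\<nu> j)" for \<omega> j
    unfolding \<kappa>_def using D mm by (auto intro!: real_distribution_borel prob_space.prob_space_distr)
  have \<kappa> [measurable]: "\<kappa> \<in> measurable (Q i) (subprob_algebra borel)" for i
    unfolding \<kappa>_def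
  proof (rule measurable_distr2)
    show "(\<lambda>(\<omega>, x). e \<omega> * x + b \<omega>) \<in> borel_measurable (Q i \<Otimes>\<^sub>M borel)" by measurable
    show "(\<lambda>\<omega>. \<nu> (st 1 \<omega>)) \<in> measurable (Q i) (subprob_algebra borel)"
      by (rule measurable_compose[OF _ D(4)]) measurable
  qed
  have bind: "Q i \<bind> \<kappa> = \<nu> i" for i
  proof (rule measure_eqI)
    have "sets (Q i \<bind> \<kappa>) = sets borel" by (rule sets_bind) (auto simp: \<kappa>_def)
    then show s: "sets (Q i \<bind> \<kappa>) = sets (\<nu> i)" by (simp add: D(2))
    fix E assume "E \<in> sets (Q i \<bind> \<kappa>)"
    then have E: "E \<in> sets borel" by (simp add: s D(2))
    have "emeasure (Q i \<bind> \<kappa>) E = (\<integral>\<^sup>+\<omega>. emeasure (\<kappa> \<omega>) E \<partial>Q i)"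
      by (rule emeasure_bind[OF _ \<kappa> E]) simp
    also have "\<dots> = (\<integral>\<^sup>+\<omega>. emeasure (\<nu> (st 1 \<omega>)) {x. e \<omega> * x + b \<omega> \<in> E} \<partial>Q i)"
      unfolding \<kappa>_def by (intro nn_integral_cong, subst emeasure_distr) (auto simp: mm E D(3) vimage_def)
    finally show "emeasure (Q i \<bind> \<kappa>) E = emeasure (\<nu> i) E" unfolding fix_eq[OF E] .
  qed
  have mean: "(\<integral>x. f x \<partial>\<nu> i) = (\<integral>\<omega>. (\<integral>x. f x \<partial>\<kappa> \<omega>) \<partial>Q i)"
    if "f \<in> borel_measurable borel" "\<And>x. \<bar>f x\<bar> \<le> 1" for f :: "real \<Rightarrow> real" and i
    unfolding bind[symmetric] by (rule integral_bind_real[OF prob_Q \<kappa> that])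
  have fixed_t: "AE \<omega> in Q i. char (\<kappa> \<omega>) t = char (\<nu> i) t" for t i
  proof -
    \<comment> \<open>Real and imaginary parts are kept apart so that only real integrals occur:
      \<open>C\<close> and \<open>S\<close> belong to the random image law, \<open>c\<close> and
      \<open>s\<close> to the law \<open>\<nu> j\<close>.\<close>
    define C where "C \<omega> = (\<integral>x. cos (t * x) \<partial>\<kappa> \<omega>)" for \<omega>
    define S where "S \<omega> = (\<integral>x. sin (t * x) \<partial>\<kappa> \<omega>)" for \<omega>
    define c where "c j = (\<integral>x. cos (t * x) \<partial>\<nu> j)" for j
    define s where "s j = (\<integral>x. sin (t * x) \<partial>\<nu> j)" for j
    define g where "g j = (cmod (char (\<nu> j) t))\<^sup>2" for j
    have g_cs: "g j = (c j)\<^sup>2 + (s j)\<^sup>2" for j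
      unfolding g_def c_def s_def cmod_power2 char_re_im[OF \<kappa>D(2)] ..
    note ri = char_re_im[OF \<kappa>D(1)] char_re_im[OF \<kappa>D(2)]
    have cs: "c j = Re (char (\<nu> j) t)" "s j = Im (char (\<nu> j) t)" for j
      using ri by (simp_all add: c_def s_def)
    have CS: "C \<omega> = Re (char (\<kappa> \<omega>) t)" "S \<omega> = Im (char (\<kappa> \<omega>) t)" for \<omega>
      using ri by (simp_all add: C_def S_def)
    have CS_meas [measurable]: "C \<in> borel_measurable (Q i)" "S \<in> borel_measurable (Q i)" for i
      unfolding C_def S_def by measurable
    have le1: "\<bar>Re (char L t)\<bar> \<le> 1" "\<bar>Im (char L t)\<bar> \<le> 1" "cmod (char L t) \<le> 1" if "real_distribution L" for L
      using real_distribution.cmod_char_le_1[OF that, of t] abs_Re_le_cmod[of "char L t"] abs_Im_le_cmod[of "char L t"] by linarith+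
    have bounds: "\<bar>C \<omega>\<bar> \<le> 1" "\<bar>S \<omega>\<bar> \<le> 1" "\<bar>c j\<bar> \<le> 1" "\<bar>s j\<bar> \<le> 1" "0 \<le> g j" "g j \<le> 1" for \<omega> j
      using le1[OF \<kappa>D(1)] le1[OF \<kappa>D(2)] by (simp_all add: CS cs g_def power_le_one)
    have EC: "(\<integral>\<omega>. C \<omega> \<partial>Q i) = c i" and ES: "(\<integral>\<omega>. S \<omega> \<partial>Q i) = s i" for i
      unfolding C_def S_def c_def s_def by (rule mean[symmetric]; simp)+
    have intC: "integrable (Q i) C" "integrable (Q i) S" for i
      using bounds by (auto intro!: Q.integrable_const_bound[where B = 1])
    have intC2: "integrable (Q i) (\<lambda>\<omega>. (C \<omega>)\<^sup>2)" "integrable (Q i) (\<lambda>\<omega>. (S \<omega>)\<^sup>2)" for i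
      using bounds by (auto intro!: Q.integrable_const_bound[where B = 1] simp: abs_square_le_1)
    have norm_eq: "AE \<omega> in Q i. (C \<omega>)\<^sup>2 + (S \<omega>)\<^sup>2 = g (st 1 \<omega>)" for i
      using iso[of i]
    proof eventually_elim
      case (elim \<omega>)
      have "char (\<kappa> \<omega>) t = iexp (t * b \<omega>) * char (\<nu> (st 1 \<omega>)) (t * e \<omega>)"
        unfolding \<kappa>_def by (rule char_affine[OF D(1,2)])
      then have "cmod (char (\<kappa> \<omega>) t) = cmod (char (\<nu> (st 1 \<omega>)) (t * e \<omega>))" by (simp add: norm_mult)
      also have "\<dots> = cmod (char (\<nu> (st 1 \<omega>)) t)"
        \<comment> \<open>The slope -1 replaces t by -t, which conjugates the characteristic
          function and keeps its modulus.\<close>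
        using elim by (cases "e \<omega> = 1") (auto simp: abs_if char_minus split: if_splits)
      finally have "cmod (char (\<kappa> \<omega>) t) = cmod (char (\<nu> (st 1 \<omega>)) t)" .
      then show ?case unfolding g_def by (simp only: CS cmod_power2[symmetric])
    qed
    define v where "v i = (\<integral>\<omega>. (C \<omega> - c i)\<^sup>2 + (S \<omega> - s i)\<^sup>2 \<partial>Q i)" for i
    have intv: "integrable (Q i) (\<lambda>\<omega>. (C \<omega> - c i)\<^sup>2 + (S \<omega> - s i)\<^sup>2)" for i
      using intC[of i] intC2[of i] by (simp add: power2_diff)
    \<comment> \<open>The variance is the increase of the mean of g over one step, and such an
      increase has \<pi>-mean zero by stationarity.\<close>
    have v: "v i = (\<integral>j. g j \<partial>measure_pmf (p i)) - g i" for i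
    proof -
      have "v i = (\<integral>\<omega>. ((C \<omega>)\<^sup>2 + (S \<omega>)\<^sup>2) - 2 * c i * C \<omega> - 2 * s i * S \<omega> + ((c i)\<^sup>2 + (s i)\<^sup>2) \<partial>Q i)"
        unfolding v_def by (intro Bochner_Integration.integral_cong) (auto simp: power2_diff)
      also have "\<dots> = (\<integral>\<omega>. (C \<omega>)\<^sup>2 + (S \<omega>)\<^sup>2 \<partial>Q i) - 2 * c i * c i - 2 * s i * s i + ((c i)\<^sup>2 + (s i)\<^sup>2)"
        using intC[of i] intC2[of i] by (simp add: EC ES Q.prob_space[simplified])
      also have "(\<integral>\<omega>. (C \<omega>)\<^sup>2 + (S \<omega>)\<^sup>2 \<partial>Q i) = (\<integral>\<omega>. g (st 1 \<omega>) \<partial>Q i)"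
        using norm_eq[of i] by (intro integral_cong_AE) auto
      also have "\<dots> = (\<integral>j. g j \<partial>measure_pmf (p i))"
        using bounds by (intro expectation_st_1) auto
      finally show ?thesis using g_cs[of i] by (simp add: power2_eq_square)
    qed
    have intg: "integrable q g" for q :: "'s pmf"
      using bounds by (intro measure_pmf.integrable_const_bound[where B = 1]) auto
    have intg2: "integrable \<pi> (\<lambda>i. \<integral>j. g j \<partial>measure_pmf (p i))"
    proof (rule measure_pmf.integrable_const_bound[where B = 1])
      have "(\<integral>j. g j \<partial>measure_pmf (p i)) \<le> (\<integral>j. 1 \<partial>measure_pmf (p i))" for i
        using bounds intg by (intro integral_mono) auto
      moreover have "0 \<le> (\<integral>j. g j \<partial>measure_pmf (p i))" for i
        using bounds by (intro Bochner_Integration.integral_nonneg) auto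
      ultimately show "AE i in \<pi>. norm (\<integral>j. g j \<partial>measure_pmf (p i)) \<le> 1" by simp
    qed simp
    have "(\<integral>i. v i \<partial>measure_pmf \<pi>) = 0"
      unfolding v using intg intg2 stationary_integral[of g 1] bounds by simp
    moreover have "integrable \<pi> v" unfolding v using intg intg2 by simp
    moreover have "0 \<le> v i" for i unfolding v_def by (intro Bochner_Integration.integral_nonneg) simp
    ultimately have "AE i in \<pi>. v i = 0"
      using integral_nonneg_eq_0_iff_AE[of \<pi> v] by simp
    then have "v i = 0" using pmf_\<pi>_support by (simp add: AE_measure_pmf_iff)
    then have "AE \<omega> in Q i. (C \<omega> - c i)\<^sup>2 + (S \<omega> - s i)\<^sup>2 = 0"
      unfolding v_def using integral_nonneg_eq_0_iff_AE[OF intv] by simp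
    then show ?thesis
      by eventually_elim (auto simp: sum_power2_eq_zero_iff CS cs complex_eq_iff)
  qed
  have "AE \<omega> in Q i. \<forall>q :: rat. char (\<kappa> \<omega>) (of_rat q) = char (\<nu> i) (of_rat q)"
    unfolding AE_all_countable using fixed_t by blast
  then show ?thesis
    by eventually_elim (use char_eq_at_rationals[OF \<kappa>D] in \<open>auto simp: \<kappa>_def\<close>)
qed

end


subsection \<open>Growth along the visits to a state\<close>

lemma borel_prob_tail:
  assumes L: "prob_space L" "sets L = sets borel" and d: "0 < \<delta>"
  obtains K :: nat where "1 - \<delta> < measure L {x :: real. \<bar>x\<bar> \<le> real K}" "emeasure L {x. real K < \<bar>x\<bar>} < ennreal \<delta>"
proof -
  interpret prob_space L by fact
  have sp: "space L = UNIV" using sets_eq_imp_space_eq[OF L(2)] by simp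
  have S: "{x :: real. \<bar>x\<bar> \<le> real n} \<in> events" for n
  proof -
    have "{x \<in> space borel. \<bar>x :: real\<bar> \<le> real n} \<in> sets borel" by measurable
    then show ?thesis by (simp add: L(2))
  qed
  have "(\<lambda>n. prob {x. \<bar>x\<bar> \<le> real n}) \<longlonglongrightarrow> prob (\<Union>n. {x. \<bar>x\<bar> \<le> real n})"
    using S by (intro finite_Lim_measure_incseq) (auto simp: incseq_def)
  also have "(\<Union>n. {x :: real. \<bar>x\<bar> \<le> real n}) = space L" using real_arch_simple by (auto simp: sp)
  finally have "(\<lambda>n. prob {x. \<bar>x\<bar> \<le> real n}) \<longlonglongrightarrow> 1" by (simp add: prob_space)
  then have "eventually (\<lambda>n. 1 - \<delta> < prob {x. \<bar>x\<bar> \<le> real n}) sequentially"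
    using d by (intro order_tendstoD) auto
  then obtain K where K: "1 - \<delta> < prob {x. \<bar>x\<bar> \<le> real K}" by (auto simp: eventually_sequentially)
  have "prob {x. real K < \<bar>x\<bar>} = 1 - prob {x. \<bar>x\<bar> \<le> real K}"
    using prob_compl[OF S[of K]] by (simp add: sp Compl_eq_Diff_UNIV[symmetric] Collect_neg_eq[symmetric] not_le)
  with K d have "emeasure L {x. real K < \<bar>x\<bar>} < ennreal \<delta>"
    by (simp add: emeasure_eq_measure ennreal_less_iff)
  with K that show ?thesis by blast
qed

text \<open>Iteration makes a nonzero translation so long that an interval with more than half of
  the mass becomes disjoint from its translate, which has the same mass.\<close>

lemma translation_invariant_prob:
  assumes L: "prob_space L" "sets L = sets borel" and inv: "distr L borel (\<lambda>x. x + c) = L"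
  shows "c = (0 :: real)"
proof (rule ccontr)
  assume c: "c \<noteq> 0"
  interpret prob_space L by fact
  have sp: "space L = UNIV" using sets_eq_imp_space_eq[OF L(2)] by simp
  note [measurable_cong] = L(2)
  have inv_n: "distr L borel (\<lambda>x. x + real n * c) = L" for n
  proof (induction n)
    case 0 then show ?case using distr_id2[OF L(2)[symmetric]] by simp
  next
    case (Suc n)
    have "distr L borel (\<lambda>x. x + real (Suc n) * c) = distr (distr L borel (\<lambda>x. x + real n * c)) borel (\<lambda>x. x + c)"
      by (subst distr_distr) (auto simp: comp_def algebra_simps)
    then show ?case by (simp add: Suc inv)
  qed
  obtain K :: nat where K: "1 - 1 / 2 < measure L {x :: real. \<bar>x\<bar> \<le> real K}"
    using borel_prob_tail[OF L, of "1 / 2"] by auto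
  obtain n where n: "2 * real K < real n * \<bar>c\<bar>" using c ex_less_of_nat_mult[of "\<bar>c\<bar>" "2 * real K"] by auto
  define A where "A = {x :: real. \<bar>x\<bar> \<le> real K}"
  define B where "B = {x :: real. \<bar>x + real n * c\<bar> \<le> real K}"
  have A: "A \<in> sets borel" and B: "B \<in> sets borel"
  proof -
    have "{x \<in> space borel. \<bar>x :: real\<bar> \<le> real K} \<in> sets borel" "{x \<in> space borel. \<bar>x + real n * c\<bar> \<le> real K} \<in> sets borel"
      by measurable
    then show "A \<in> sets borel" "B \<in> sets borel" by (simp_all add: A_def B_def)
  qed
  have "measure L A = measure (distr L borel (\<lambda>x. x + real n * c)) A" by (simp add: inv_n)
  also have "\<dots> = measure L B"
    by (subst measure_distr) (use A in \<open>auto simp: sp A_def B_def vimage_def\<close>)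
  finally have AB: "measure L A = measure L B" .
  have "A \<inter> B = {}"
  proof -
    have False if "\<bar>x\<bar> \<le> real K" "\<bar>x + real n * c\<bar> \<le> real K" for x
    proof -
      have "\<bar>real n * c\<bar> \<le> 2 * real K" using that by linarith
      then show False using n by (simp add: abs_mult)
    qed
    then show ?thesis by (auto simp: A_def B_def)
  qed
  then have "measure L A + measure L B = measure L (A \<union> B)"
    using A B by (subst finite_measure_Union) (auto simp: L(2))
  also have "\<dots> \<le> 1" by (rule prob_le_1)
  finally show False using K AB by (simp add: A_def)
qed

text \<open>Balls with more than half of the mass each must intersect, so the centres of shrinking
  balls form a Cauchy sequence. The balls of doubled radius around its limit still carry almost all
  mass and shrink to one point.\<close>

lemma concentrated_imp_dirac:
  assumes L: "prob_space L" "sets L = sets borel"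
    and conc: "\<And>\<epsilon>. 0 < \<epsilon> \<Longrightarrow> \<exists>y :: real. 1 - \<epsilon> \<le> measure L (cball y \<epsilon>)"
  obtains c where "L = return borel c"
proof -
  interpret prob_space L by fact
  have ev: "cball y r \<in> events" for y :: real and r by (simp add: L(2))
  \<comment> \<open>The offset 3 keeps every radius below 1/2, so any two of the balls have more
    than total mass 1 between them.\<close>
  define \<epsilon> where "\<epsilon> k = 1 / real (k + 3)" for k
  have \<epsilon>: "0 < \<epsilon> k" "\<epsilon> k < 1 / 2" for k by (auto simp: \<epsilon>_def field_simps)
  have \<epsilon>_lim: "\<epsilon> \<longlonglongrightarrow> 0" unfolding \<epsilon>_def by real_asymp
  have "\<forall>k. \<exists>y. 1 - \<epsilon> k \<le> prob (cball y (\<epsilon> k))" using conc \<epsilon> by blast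
  then obtain y where y: "\<And>k. 1 - \<epsilon> k \<le> prob (cball (y k) (\<epsilon> k))" by metis
  have close: "dist (y k) (y l) \<le> \<epsilon> k + \<epsilon> l" for k l
  proof -
    have "cball (y k) (\<epsilon> k) \<inter> cball (y l) (\<epsilon> l) \<noteq> {}"
    proof
      assume "cball (y k) (\<epsilon> k) \<inter> cball (y l) (\<epsilon> l) = {}"
      then have "prob (cball (y k) (\<epsilon> k)) + prob (cball (y l) (\<epsilon> l)) = prob (cball (y k) (\<epsilon> k) \<union> cball (y l) (\<epsilon> l))"
        using ev by (intro finite_measure_Union[symmetric]) auto
      then show False using prob_le_1[of "cball (y k) (\<epsilon> k) \<union> cball (y l) (\<epsilon> l)"] y[of k] y[of l] \<epsilon>(2)[of k] \<epsilon>(2)[of l] by linarith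
    qed
    then obtain z where "dist (y k) z \<le> \<epsilon> k" "dist (y l) z \<le> \<epsilon> l" by auto
    then show ?thesis by metric
  qed
  have "Cauchy y"
    unfolding Cauchy_def
  proof (intro allI impI)
    fix r :: real assume "0 < r"
    then have "eventually (\<lambda>k. \<epsilon> k < r / 2) sequentially" using \<epsilon>_lim by (intro order_tendstoD) auto
    then obtain N where "\<And>k. N \<le> k \<Longrightarrow> \<epsilon> k < r / 2" by (auto simp: eventually_sequentially)
    then show "\<exists>M. \<forall>m\<ge>M. \<forall>n\<ge>M. dist (y m) (y n) < r"
      using close by (intro exI[of _ N]) (smt (verit) field_sum_of_halves)
  qed
  then obtain c where c: "y \<longlonglongrightarrow> c" using Cauchy_convergent convergent_def by blast
  have yc: "dist (y k) c \<le> \<epsilon> k" for k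
  proof -
    have "(\<lambda>l. dist (y k) (y l)) \<longlonglongrightarrow> dist (y k) c" using c by (intro tendsto_intros)
    moreover have "(\<lambda>l. \<epsilon> k + \<epsilon> l) \<longlonglongrightarrow> \<epsilon> k + 0" using \<epsilon>_lim by (intro tendsto_intros)
    ultimately show ?thesis using close by (auto intro: LIMSEQ_le)
  qed
  have ge: "1 - \<epsilon> k \<le> prob (cball c (2 * \<epsilon> k))" for k
  proof -
    have "cball (y k) (\<epsilon> k) \<subseteq> cball c (2 * \<epsilon> k)"
    proof
      fix x assume "x \<in> cball (y k) (\<epsilon> k)"
      then have "dist (y k) x \<le> \<epsilon> k" by simp
      with yc[of k] show "x \<in> cball c (2 * \<epsilon> k)" unfolding mem_cball by metric
    qed
    then show ?thesis using y[of k] finite_measure_mono[OF _ ev] by (meson order_trans)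
  qed
  have "(\<lambda>k. prob (cball c (2 * \<epsilon> k))) \<longlonglongrightarrow> prob (\<Inter>k. cball c (2 * \<epsilon> k))"
  proof (rule finite_Lim_measure_decseq)
    show "decseq (\<lambda>k. cball c (2 * \<epsilon> k))"
      unfolding decseq_def by (intro allI impI subset_cball) (simp add: \<epsilon>_def frac_le)
  qed (use ev in auto)
  also have "(\<Inter>k. cball c (2 * \<epsilon> k)) = {c}"
  proof -
    have "x = c" if "\<forall>k. dist c x \<le> 2 * \<epsilon> k" for x
    proof -
      have "(\<lambda>k. 2 * \<epsilon> k) \<longlonglongrightarrow> 2 * 0" using \<epsilon>_lim by (intro tendsto_intros)
      then have "dist c x \<le> 0" using that by (intro LIMSEQ_le_const[of "\<lambda>k. 2 * \<epsilon> k"]) auto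
      then show ?thesis by simp
    qed
    moreover have "0 \<le> \<epsilon> k" for k using \<epsilon>(1)[of k] by simp
    ultimately show ?thesis by auto
  qed
  finally have "(\<lambda>k. prob (cball c (2 * \<epsilon> k))) \<longlonglongrightarrow> prob {c}" .
  moreover have "(\<lambda>k. 1 - \<epsilon> k) \<longlonglongrightarrow> 1 - 0" using \<epsilon>_lim by (intro tendsto_intros)
  ultimately have "1 \<le> prob {c}" using ge by (auto intro: LIMSEQ_le)
  then have "prob {c} = 1" using prob_le_1[of "{c}"] by simp
  then have "AE x in L. x = c"
    using prob_eq_1[of "{c}"] by (simp add: L(2))
  then have "L = return L c" by (rule AE_eq_constD)
  also have "\<dots> = return borel c" using L(2) by (rule return_cong)
  finally show ?thesis by (rule that)
qed

text \<open>The times off \<open>i\<close> contribute \<open>0\<close>, which is harmless for a nonnegative upper limit over infinitely many visits.\<close>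

definition lev :: "'s \<Rightarrow> 's path \<Rightarrow> ereal" where
  "lev i \<omega> = limsup (\<lambda>n. ereal (if st n \<omega> = i then \<bar>Pi_prod ca n \<omega>\<bar> else 0))"

lemma lev_nonneg: "0 \<le> lev i \<omega>"
  unfolding lev_def by (intro le_Limsup) auto

lemma lev_measurable [measurable]: "lev i \<in> borel_measurable path_space"
  unfolding lev_def by measurable

text \<open>Dropping a prefix divides by \<open>|\<Pi>|\<close> of that prefix. Where this is
  nonzero, the values 0 and infinity are therefore shift invariant, as the zero-one law
  requires.\<close>

lemma lev_shift: "lev i \<omega> = ereal \<bar>Pi_prod ca n \<omega>\<bar> * lev i (shift n \<omega>)"
proof -
  define u where "u k = ereal (if st k \<omega> = i then \<bar>Pi_prod ca k \<omega>\<bar> else 0)" for k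
  have "lev i \<omega> = limsup u" by (simp add: lev_def u_def[abs_def])
  also have "\<dots> = limsup (\<lambda>k. u (k + n))" by (rule limsup_shift_k[symmetric])
  also have "(\<lambda>k. u (k + n)) = (\<lambda>k. ereal \<bar>Pi_prod ca n \<omega>\<bar> *
      ereal (if st k (shift n \<omega>) = i then \<bar>Pi_prod ca k (shift n \<omega>)\<bar> else 0))"
    using Pi_prod_shift[of n _ \<omega>] by (auto simp: u_def st_shift add.commute abs_mult)
  finally show ?thesis unfolding lev_def by (simp only: Limsup_ereal_mult_left trivial_limit_sequentially abs_ge_zero simp_thms)
qed

lemma lev_0D:
  assumes "lev i \<omega> = 0" "0 < \<epsilon>"
  shows "\<exists>N. \<forall>n\<ge>N. st n \<omega> = i \<longrightarrow> \<bar>Pi_prod ca n \<omega>\<bar> < \<epsilon>"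
proof -
  have "eventually (\<lambda>n. ereal (if st n \<omega> = i then \<bar>Pi_prod ca n \<omega>\<bar> else 0) < ereal \<epsilon>) sequentially"
    using assms unfolding lev_def by (intro Limsup_lessD) simp
  then show ?thesis by (auto simp: eventually_sequentially split: if_splits)
qed

lemma lev_topD:
  assumes "lev i \<omega> = \<infinity>"
  shows "\<exists>n. st n \<omega> = i \<and> K < \<bar>Pi_prod ca n \<omega>\<bar>"
proof (rule ccontr)
  assume "\<not> ?thesis"
  then have "lev i \<omega> \<le> ereal \<bar>K\<bar>"
    unfolding lev_def by (intro Limsup_bounded always_eventually) (auto simp: not_less intro: order_trans)
  with assms show False by simp
qed

section \<open>The trichotomy at a single state\<close>

context path_chain begin

text \<open>R may be nonmeasurable: the null sets for the countably many starting states are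
  intersected, which leaves one measurable set that contains all failures and is null from every
  state.\<close>

lemma AE_shift_any:
  assumes R: "\<And>j. AE \<omega> in Q j. R \<omega>"
  shows "AE \<omega> in Q i. R (shift n \<omega>)"
proof -
  have "\<exists>N. N \<in> sets path_space \<and> emeasure (Q j) N = 0 \<and> {\<omega>. \<not> R \<omega>} \<subseteq> N" for j
    using R[of j] by (auto elim!: AE_E simp: sets_Q)
  then obtain N where N: "\<And>j. N j \<in> sets path_space" "\<And>j. emeasure (Q j) (N j) = 0" "\<And>j. {\<omega>. \<not> R \<omega>} \<subseteq> N j"
    by metis
  define X where "X = (\<Inter>j. N j)"
  have X: "X \<in> sets path_space" unfolding X_def using N(1) by (intro sets.countable_INT') auto
  have "AE \<omega> in Q j. \<omega> \<notin> X" for j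
  proof (rule AE_not_in)
    have "emeasure (Q j) X \<le> emeasure (Q j) (N j)"
      using N(1) by (intro emeasure_mono) (auto simp: X_def sets_Q)
    then show "X \<in> null_sets (Q j)" using X N(2)[of j] by (simp add: null_sets_def sets_Q)
  qed
  then have "AE \<omega> in Q i. shift n \<omega> \<notin> X"
  proof (rule AE_shift[rotated])
    show "Measurable.pred path_space (\<lambda>\<omega>. \<omega> \<notin> X)" using X by measurable
  qed
  then show ?thesis by eventually_elim (use N(3) in \<open>auto simp: X_def\<close>)
qed

text \<open>The sets \<open>D n\<close> are the level sets of a stopping time at which the chain is
  in i; the stopping time may be infinite with positive probability.\<close>

lemma strong_markov:
  assumes D: "\<And>n. D n \<in> sets (hist n)" "\<And>n. D n \<subseteq> {\<omega>. st n \<omega> = i}" "disjoint_family D"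
    and B [measurable]: "B \<in> sets path_space"
  shows "emeasure (Q j) (\<Union>n. D n \<inter> shift n -` B) = emeasure (Q j) (\<Union>n. D n) * emeasure (Q i) B"
proof -
  have [measurable]: "D n \<in> sets path_space" for n using D(1) by (rule hist_le_path_space)
  have "emeasure (Q j) (\<Union>n. D n \<inter> shift n -` B) = (\<Sum>n. emeasure (Q j) (D n \<inter> shift n -` B))"
    using D(3) by (intro suminf_emeasure[symmetric]) (auto simp: sets_Q disjoint_family_on_def)
  also have "\<dots> = (\<Sum>n. emeasure (Q j) (D n) * emeasure (Q i) B)"
  proof (rule suminf_cong)
    fix n
    have "D n \<inter> {\<omega>. st n \<omega> = i} = D n" using D(2) by auto
    then show "emeasure (Q j) (D n \<inter> shift n -` B) = emeasure (Q j) (D n) * emeasure (Q i) B"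
    proof -
      have "emeasure (Q j) (D n \<inter> {\<omega>. st n \<omega> = i} \<inter> shift n -` B) = emeasure (Q j) (D n \<inter> {\<omega>. st n \<omega> = i}) * emeasure (Q i) B"
        by (rule markov_hist[OF D(1) B])
      then show ?thesis using \<open>D n \<inter> {\<omega>. st n \<omega> = i} = D n\<close> by simp
    qed
  qed
  also have "\<dots> = (\<Sum>n. emeasure (Q j) (D n)) * emeasure (Q i) B" by simp
  also have "(\<Sum>n. emeasure (Q j) (D n)) = emeasure (Q j) (\<Union>n. D n)"
    using D(3) by (intro suminf_emeasure) (auto simp: sets_Q)
  finally show ?thesis .
qed

text \<open>By the zero-one law it remains to treat an upper limit that is almost surely positive
  and finite. Its logarithm l satisfies \<open>l = ln |A_1| + l o shift\<close>, so the laws of l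
  form a kernel that is invariant under the random translations by \<open>ln |A_1|\<close>.
  Translations are isometries, hence these laws are carried into each other exactly and not only on
  average. Along a loop at i the translation preserves the law of l, so it is zero, that is,
  \<open>|\<Pi>| = 1\<close>.\<close>

lemma trichotomy:
  "(\<forall>j. AE \<omega> in Q j. lev i \<omega> = 0) \<or> (\<forall>j. AE \<omega> in Q j. lev i \<omega> = \<infinity>) \<or>
   (\<forall>n. AE \<omega> in Q i. st n \<omega> = i \<longrightarrow> \<bar>Pi_prod ca n \<omega>\<bar> = 1)"
proof -
  have lev1: "AE \<omega> in Q j. (lev i (shift 1 \<omega>) = 0 \<longleftrightarrow> lev i \<omega> = 0) \<and> (lev i (shift 1 \<omega>) = \<infinity> \<longleftrightarrow> lev i \<omega> = \<infinity>)" for j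
    using Pi_prod_nonzero[of j]
  proof eventually_elim
    case (elim \<omega>)
    then have "0 < \<bar>Pi_prod ca 1 \<omega>\<bar>" by simp
    then show ?case
      using lev_nonneg[of i "shift 1 \<omega>"] lev_shift[of i \<omega> 1] by (cases "lev i (shift 1 \<omega>)") auto
  qed
  have z: "(\<forall>j. AE \<omega> in Q j. lev i \<omega> = 0) \<or> (\<forall>j. AE \<omega> in Q j. lev i \<omega> \<noteq> 0)"
    by (rule zero_one) (use lev1 in auto)
  have t: "(\<forall>j. AE \<omega> in Q j. lev i \<omega> = \<infinity>) \<or> (\<forall>j. AE \<omega> in Q j. lev i \<omega> \<noteq> \<infinity>)"
    by (rule zero_one) (use lev1 in auto)
  show ?thesis
  proof (rule ccontr)
    assume neg: "\<not> ?thesis"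
    then have lev_fin: "AE \<omega> in Q j. lev i \<omega> \<noteq> 0 \<and> lev i \<omega> \<noteq> \<infinity>" for j using z t by auto
    define l where "l \<omega> = ln (real_of_ereal (lev i \<omega>))" for \<omega>
    have l_meas [measurable]: "l \<in> borel_measurable path_space" unfolding l_def by measurable
    define \<nu> where "\<nu> j = distr (Q j) borel l" for j
    have \<nu>: "\<nu> \<in> prob_kernels"
      unfolding prob_kernels_def \<nu>_def by (auto simp: space_prob_algebra intro!: Q.prob_space_distr)
    note D = prob_kernelsD[OF \<nu>]
    have l1: "AE \<omega> in Q j. l \<omega> = ln \<bar>ca 1 \<omega>\<bar> + l (shift 1 \<omega>)" for j
    proof -
      have "AE \<omega> in Q j. lev i (shift 1 \<omega>) \<noteq> 0 \<and> lev i (shift 1 \<omega>) \<noteq> \<infinity>"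
        by (rule AE_shift[OF _ lev_fin]) measurable
      with nonzero[of j] show ?thesis
      proof eventually_elim
        case (elim \<omega>)
        then obtain r where r: "lev i (shift 1 \<omega>) = ereal r" using lev_nonneg[of i "shift 1 \<omega>"] by (cases "lev i (shift 1 \<omega>)") auto
        then have "0 < r" using elim lev_nonneg[of i "shift 1 \<omega>"] by auto
        moreover have "lev i \<omega> = ereal (\<bar>ca 1 \<omega>\<bar> * r)"
          using lev_shift[of i \<omega> 1] r by (simp add: Pi_prod_Suc)
        ultimately show ?case using elim r by (simp add: l_def ln_mult)
      qed
    qed
    have fix_eq: "(\<integral>\<^sup>+\<omega>. emeasure (\<nu> (st 1 \<omega>)) {x. 1 * x + ln \<bar>ca 1 \<omega>\<bar> \<in> E} \<partial>Q j) = emeasure (\<nu> j) E"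
      if E [measurable]: "E \<in> sets borel" for j E
    proof -
      have Epre: "{x. x + c \<in> E} \<in> sets borel" for c using affine_preimage_borel[OF E, of 1 c] by simp
      have l_distr: "(\<integral>\<^sup>+x. indicator F x \<partial>\<nu> k) = (\<integral>\<^sup>+\<omega>. indicator F (l \<omega>) \<partial>Q k)"
        if [measurable]: "F \<in> sets borel" for F k
        unfolding \<nu>_def by (rule nn_integral_distr) measurable
      have "emeasure (\<nu> j) E = (\<integral>\<^sup>+\<omega>. indicator E (l \<omega>) \<partial>Q j)"
        using E by (simp add: l_distr[symmetric] D(2))
      also have "\<dots> = (\<integral>\<^sup>+\<omega>. indicator E (ln \<bar>ca 1 \<omega>\<bar> + l (shift 1 \<omega>)) \<partial>Q j)"
        using l1[of j] by (intro nn_integral_cong_AE) auto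
      also have "\<dots> = (\<integral>\<^sup>+\<omega>. (\<integral>\<^sup>+\<omega>'. indicator E (ln \<bar>ca 1 \<omega>\<bar> + l \<omega>') \<partial>Q (st 1 \<omega>)) \<partial>Q j)"
      proof (rule markov[of "\<lambda>\<omega> \<omega>'. indicator E (ln \<bar>ca 1 \<omega>\<bar> + l \<omega>')"])
        note [measurable] = ca_hist[OF order_refl, of 1]
        show "(\<lambda>(\<omega> :: 's path, \<omega>'). indicator E (ln \<bar>ca 1 \<omega>\<bar> + l \<omega>') :: ennreal) \<in> borel_measurable (hist 1 \<Otimes>\<^sub>M path_space)"
          by measurable
      qed
      also have "\<dots> = (\<integral>\<^sup>+\<omega>. emeasure (\<nu> (st 1 \<omega>)) {x. 1 * x + ln \<bar>ca 1 \<omega>\<bar> \<in> E} \<partial>Q j)"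
      proof (rule nn_integral_cong)
        fix \<omega> :: "'s path"
        define c where "c = ln \<bar>ca 1 \<omega>\<bar>"
        have "emeasure (\<nu> (st 1 \<omega>)) {x. x + c \<in> E} = (\<integral>\<^sup>+\<omega>'. indicator {x. x + c \<in> E} (l \<omega>') \<partial>Q (st 1 \<omega>))"
          using Epre[of c] by (simp only: l_distr[symmetric] nn_integral_indicator D(2))
        also have "\<dots> = (\<integral>\<^sup>+\<omega>'. indicator E (c + l \<omega>') \<partial>Q (st 1 \<omega>))"
          by (intro nn_integral_cong) (auto simp: add.commute split: split_indicator)
        finally show "(\<integral>\<^sup>+\<omega>'. indicator E (ln \<bar>ca 1 \<omega>\<bar> + l \<omega>') \<partial>Q (st 1 \<omega>)) = emeasure (\<nu> (st 1 \<omega>)) {x. 1 * x + ln \<bar>ca 1 \<omega>\<bar> \<in> E}"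
          by (simp add: c_def)
      qed
      finally show ?thesis by simp
    qed
    have step: "AE \<omega> in Q j. distr (\<nu> (st 1 \<omega>)) borel (\<lambda>x. 1 * x + ln \<bar>ca 1 \<omega>\<bar>) = \<nu> j" for j
      by (rule isometric_fixed_point[OF \<nu> _ _ _ fix_eq]) auto
    have step': "AE \<omega> in Q j. \<forall>n. distr (\<nu> (st (Suc n) \<omega>)) borel (\<lambda>x. x + ln \<bar>ca (Suc n) \<omega>\<bar>) = \<nu> (st n \<omega>)" for j
      unfolding AE_all_countable
    proof
      fix n
      have "AE \<omega> in Q j. distr (\<nu> (st 1 \<omega>)) borel (\<lambda>x. 1 * x + ln \<bar>ca 1 \<omega>\<bar>) = \<nu> (st 0 \<omega>)" for j
        using step[of j] st_0[of j] by eventually_elim simp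
      from AE_shift_any[OF this, of n j]
      show "AE \<omega> in Q j. distr (\<nu> (st (Suc n) \<omega>)) borel (\<lambda>x. x + ln \<bar>ca (Suc n) \<omega>\<bar>) = \<nu> (st n \<omega>)"
        by (simp add: st_shift ca_shift)
    qed
    have "AE \<omega> in Q i. st n \<omega> = i \<longrightarrow> \<bar>Pi_prod ca n \<omega>\<bar> = 1" for n
      using step'[of i] Pi_prod_nonzero[of i] st_0[of i]
    proof eventually_elim
      case (elim \<omega>)
      have [measurable_cong]: "sets (\<nu> j) = sets borel" for j by (rule D(2))
      have "distr (\<nu> (st n \<omega>)) borel (\<lambda>x. x + ln \<bar>Pi_prod ca n \<omega>\<bar>) = \<nu> (st 0 \<omega>)" for n
      proof (induction n)
        case 0 then show ?case using distr_id2[OF D(2)[symmetric]] by simp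
      next
        case (Suc n)
        have nz: "Pi_prod ca n \<omega> \<noteq> 0" "Pi_prod ca (Suc n) \<omega> \<noteq> 0" using elim(2) by auto
        then have "ca (Suc n) \<omega> \<noteq> 0" by (simp add: Pi_prod_Suc)
        with nz have "distr (\<nu> (st (Suc n) \<omega>)) borel (\<lambda>x. x + ln \<bar>Pi_prod ca (Suc n) \<omega>\<bar>)
          = distr (distr (\<nu> (st (Suc n) \<omega>)) borel (\<lambda>x. x + ln \<bar>ca (Suc n) \<omega>\<bar>)) borel (\<lambda>x. x + ln \<bar>Pi_prod ca n \<omega>\<bar>)"
          by (subst distr_distr) (auto simp: comp_def Pi_prod_Suc abs_mult ln_mult algebra_simps)
        also have "\<dots> = \<nu> (st 0 \<omega>)" using elim(1) Suc by simp
        finally show ?case .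
      qed
      from this[of n] have "st n \<omega> = i \<longrightarrow> distr (\<nu> i) borel (\<lambda>x. x + ln \<bar>Pi_prod ca n \<omega>\<bar>) = \<nu> i"
        using elim(3) by auto
      then have "st n \<omega> = i \<longrightarrow> ln \<bar>Pi_prod ca n \<omega>\<bar> = 0"
        using translation_invariant_prob[OF D(1,2)] by blast
      then show ?case using elim(2) by (simp add: ln_eq_zero_iff)
    qed
    with neg show False by blast
  qed
qed

text \<open>By the maximal inequality there are paths along which the image of the law never puts
  mass \<epsilon> outside [-L, L], while the slopes at the visits are unbounded. The preimage of
  [-L, L] under a map with slope a is a ball of radius \<open>L / |a|\<close>; it carries all but
  \<epsilon> of \<open>\<nu> i\<close>.\<close>

lemma unbounded_imp_dirac:
  assumes fp: "fixed_point p K \<nu>" and top: "AE \<omega> in Q i. lev i \<omega> = \<infinity>"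
  obtains c where "\<nu> i = return borel c"
proof -
  have \<nu>: "\<nu> \<in> prob_kernels" using fp by (simp add: fixed_point_def)
  note D = prob_kernelsD[OF \<nu>]
  interpret \<nu>i: prob_space "\<nu> i" by (rule D)
  have "\<exists>y. 1 - \<epsilon> \<le> measure (\<nu> i) (cball y \<epsilon>)" if \<epsilon>: "0 < \<epsilon>" for \<epsilon>
  proof -
    \<comment> \<open>With tail mass below \<open>\<epsilon> / 2\<close>, the level \<epsilon> is
      reached with probability below 1, which leaves a path to choose.\<close>
    obtain L :: nat where L: "emeasure (\<nu> i) {x. real L < \<bar>x\<bar>} < ennreal (\<epsilon> / 2)"
      using borel_prob_tail[OF D(1,2), of "\<epsilon> / 2" i] \<epsilon> by auto
    define E where "E = {x. real L < \<bar>x\<bar>}"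
    have E: "E \<in> sets borel"
    proof -
      have "{x \<in> space borel. real L < \<bar>x\<bar>} \<in> sets borel" by measurable
      then show ?thesis by (simp add: E_def)
    qed
    define X where "X = {\<omega>. \<exists>n. ennreal \<epsilon> \<le> cond_mass \<nu> E n \<omega>}"
    have "ennreal \<epsilon> * emeasure (Q i) X \<le> emeasure (\<nu> i) E" unfolding X_def by (rule cond_mass_maximal[OF fp E])
    also have "\<dots> < ennreal (\<epsilon> / 2)" using L by (simp add: E_def)
    finally have "ennreal (\<epsilon> * Q.prob i X) < ennreal (\<epsilon> / 2)"
      using \<epsilon> by (simp add: Q.emeasure_eq_measure ennreal_mult)
    then have X: "Q.prob i X < 1" using \<epsilon> by (simp add: ennreal_less_iff)
    have "\<exists>\<omega>. lev i \<omega> = \<infinity> \<and> \<omega> \<notin> X"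
    proof (rule ccontr)
      assume "\<not> ?thesis"
      then have "AE \<omega> in Q i. \<omega> \<in> X" using top by auto
      then have "Q.prob i X = 1"
      proof -
        note [measurable] = cond_mass_hist(2)[OF \<nu> E]
        have "X \<in> sets path_space" unfolding X_def by (rule path_Collect) measurable
        then show ?thesis using \<open>AE \<omega> in Q i. \<omega> \<in> X\<close> by (simp add: Q.prob_eq_1 sets_Q)
      qed
      with X show False by simp
    qed
    then obtain \<omega> where \<omega>: "lev i \<omega> = \<infinity>" "\<omega> \<notin> X" by blast
    obtain n where n: "st n \<omega> = i" "max 1 (real L / \<epsilon>) < \<bar>Pi_prod ca n \<omega>\<bar>" using lev_topD[OF \<omega>(1)] by blast
    define a b where "a = Pi_prod ca n \<omega>" "b = perp_sum ca cb n \<omega>"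
    have a: "a \<noteq> 0" "real L / \<epsilon> < \<bar>a\<bar>" using n by (auto simp: a_b_def)
    have "cond_mass \<nu> E n \<omega> < ennreal \<epsilon>" using \<omega>(2) by (auto simp: X_def not_le)
    then have m: "measure (\<nu> i) {x. a * x + b \<in> E} < \<epsilon>"
      using \<epsilon> by (simp add: cond_mass_def n a_b_def \<nu>i.emeasure_eq_measure ennreal_less_iff)
    have S: "{x. a * x + b \<in> E} \<in> sets (\<nu> i)" using affine_preimage_borel[OF E] by (simp add: D(2))
    have "UNIV - {x. a * x + b \<in> E} \<subseteq> cball (- b / a) \<epsilon>"
    proof
      fix x assume "x \<in> UNIV - {x. a * x + b \<in> E}"
      then have "\<bar>a * x + b\<bar> \<le> real L" by (simp add: E_def)
      also have "\<dots> \<le> \<epsilon> * \<bar>a\<bar>" using a \<epsilon> by (simp add: field_simps)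
      finally have "\<bar>a\<bar> * \<bar>x + b / a\<bar> \<le> \<bar>a\<bar> * \<epsilon>" using a by (simp add: abs_mult[symmetric] distrib_left mult.commute)
      then have "\<bar>x + b / a\<bar> \<le> \<epsilon>" using a by (subst (asm) mult_le_cancel_left_pos) auto
      then show "x \<in> cball (- b / a) \<epsilon>" by (simp add: dist_real_def)
    qed
    then have "measure (\<nu> i) (UNIV - {x. a * x + b \<in> E}) \<le> measure (\<nu> i) (cball (- b / a) \<epsilon>)"
      by (intro \<nu>i.finite_measure_mono) (auto simp: D(2))
    moreover have "measure (\<nu> i) (UNIV - {x. a * x + b \<in> E}) = 1 - measure (\<nu> i) {x. a * x + b \<in> E}"
      using \<nu>i.prob_compl[OF S] by (simp add: D(3))
    ultimately show ?thesis using m by (intro exI[of _ "- b / a"]) linarith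
  qed
  then show ?thesis using concentrated_imp_dirac[OF D(1,2)] that by blast
qed

end


subsection \<open>Convergence of the perpetuity\<close>

text \<open>Convergence along the times spent at i, phrased without an enumeration of the return
  times.\<close>

definition visit_limit :: "'s \<Rightarrow> 's path \<Rightarrow> real \<Rightarrow> bool" where
  "visit_limit i \<omega> z \<longleftrightarrow>
     (\<forall>\<epsilon>>0. \<exists>N. \<forall>n\<ge>N. st n \<omega> = i \<longrightarrow> \<bar>perp_sum ca cb n \<omega> - z\<bar> \<le> \<epsilon>)"

definition visit_time :: "'s \<Rightarrow> nat \<Rightarrow> 's path \<Rightarrow> nat" where
  "visit_time i N \<omega> = (LEAST n. N \<le> n \<and> st n \<omega> = i)"

lemma visit_time_measurable [measurable]: "visit_time i N \<in> measurable path_space (count_space UNIV)"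
  unfolding visit_time_def by measurable

lemma visit_time:
  assumes "\<exists>\<^sub>\<infinity>n. st n \<omega> = i"
  shows "N \<le> visit_time i N \<omega>" "st (visit_time i N \<omega>) \<omega> = i" "\<omega> \<in> first_visit i N (visit_time i N \<omega>)"
proof -
  have "\<exists>n. N \<le> n \<and> st n \<omega> = i" using assms by (auto simp: INFM_nat_le)
  note * = LeastI_ex[OF this, folded visit_time_def] not_less_Least[of _ "\<lambda>n. N \<le> n \<and> st n \<omega> = i", folded visit_time_def]
  show "N \<le> visit_time i N \<omega>" "st (visit_time i N \<omega>) \<omega> = i" "\<omega> \<in> first_visit i N (visit_time i N \<omega>)"
    using * by (auto simp: first_visit_def)
qed

lemma first_visit_unique: "\<omega> \<in> first_visit i N n \<Longrightarrow> \<omega> \<in> first_visit i N m \<Longrightarrow> n = m"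
  using disjoint_first_visit[of i N] by (auto simp: disjoint_family_on_def)

context path_chain begin

text \<open>If less than 1/4 of the image of \<open>\<nu> i\<close> lies outside [-L, L], while more
  than 3/4 of \<open>\<nu> i\<close> lies in [-c, c], then some point of [-c, c] is mapped into
  [-L, L]. Once the slope is below 1, the translation part is thus at most L + c; the finitely many
  earlier times are bounded trivially.\<close>

lemma visits_bounded:
  assumes fp: "fixed_point p K \<nu>" and lev0: "AE \<omega> in Q i. lev i \<omega> = 0"
  shows "AE \<omega> in Q i. \<exists>C::nat. \<forall>n. st n \<omega> = i \<longrightarrow> \<bar>perp_sum ca cb n \<omega>\<bar> \<le> real C"
proof -
  have \<nu>: "\<nu> \<in> prob_kernels" using fp by (simp add: fixed_point_def)
  note D = prob_kernelsD[OF \<nu>]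
  interpret \<nu>i: prob_space "\<nu> i" by (rule D)
  define Bd where "Bd \<omega> \<longleftrightarrow> (\<exists>C::nat. \<forall>n. st n \<omega> = i \<longrightarrow> \<bar>perp_sum ca cb n \<omega>\<bar> \<le> real C)" for \<omega> :: "'s path"
  have [measurable]: "Measurable.pred path_space Bd" unfolding Bd_def by measurable
  obtain c :: nat where c: "1 - 1 / 4 < measure (\<nu> i) {x. \<bar>x\<bar> \<le> real c}"
    using borel_prob_tail[OF D(1,2), of "1 / 4" i] by auto
  have bound: "emeasure (Q i) {\<omega>. \<not> Bd \<omega>} \<le> ennreal \<epsilon>" if \<epsilon>: "0 < \<epsilon>" for \<epsilon> :: real
  proof -
    \<comment> \<open>Tail mass below \<open>\<epsilon> / 4\<close> and the level 1/4 give an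
      exceptional probability of at most \<epsilon>.\<close>
    obtain L :: nat where L: "emeasure (\<nu> i) {x. real L < \<bar>x\<bar>} < ennreal (\<epsilon> / 4)"
      using borel_prob_tail[OF D(1,2), of "\<epsilon> / 4" i] \<epsilon> by auto
    define E where "E = {x. real L < \<bar>x\<bar>}"
    have E: "E \<in> sets borel"
    proof -
      have "{x \<in> space borel. real L < \<bar>x\<bar>} \<in> sets borel" by measurable
      then show ?thesis by (simp add: E_def)
    qed
    note [measurable] = cond_mass_hist(2)[OF \<nu> E]
    define X where "X = {\<omega>. \<exists>n. ennreal (1 / 4) \<le> cond_mass \<nu> E n \<omega>}"
    have X: "X \<in> sets path_space" unfolding X_def by (rule path_Collect) measurable
    have "ennreal (1 / 4) * emeasure (Q i) X \<le> emeasure (\<nu> i) E" unfolding X_def by (rule cond_mass_maximal[OF fp E])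
    also have "\<dots> \<le> ennreal (\<epsilon> / 4)" using L by (simp add: E_def)
    finally have "ennreal (1 / 4) * ennreal (Q.prob i X) \<le> ennreal (\<epsilon> / 4)" by (simp only: Q.emeasure_eq_measure)
    then have "ennreal (1 / 4 * Q.prob i X) \<le> ennreal (\<epsilon> / 4)" by (subst ennreal_mult) auto
    then have "Q.prob i X \<le> \<epsilon>" using \<epsilon> by (subst (asm) ennreal_le_iff) auto
    then have "emeasure (Q i) X \<le> ennreal \<epsilon>" by (simp add: Q.emeasure_eq_measure ennreal_leI)
    moreover have "AE \<omega> in Q i. \<omega> \<in> {\<omega>. \<not> Bd \<omega>} \<longrightarrow> \<omega> \<in> X"
      using lev0
    proof eventually_elim
      case (elim \<omega>)
      have "Bd \<omega>" if nX: "\<omega> \<notin> X"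
      proof -
        obtain N where N: "\<And>n. N \<le> n \<Longrightarrow> st n \<omega> = i \<Longrightarrow> \<bar>Pi_prod ca n \<omega>\<bar> < 1" using lev_0D[OF elim, of 1] by auto
        have late: "\<bar>perp_sum ca cb n \<omega>\<bar> \<le> real (L + c)" if n: "N \<le> n" "st n \<omega> = i" for n
        proof -
          define a b where "a = Pi_prod ca n \<omega>" "b = perp_sum ca cb n \<omega>"
          have "cond_mass \<nu> E n \<omega> < ennreal (1 / 4)" using nX by (auto simp: X_def not_le)
          then have m: "measure (\<nu> i) {x. a * x + b \<in> E} < 1 / 4"
            using n by (simp add: cond_mass_def a_b_def \<nu>i.emeasure_eq_measure ennreal_less_iff)
          have S: "{x. a * x + b \<in> E} \<in> sets (\<nu> i)" using affine_preimage_borel[OF E] by (simp add: D(2))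
          have "\<not> {x. \<bar>x\<bar> \<le> real c} \<subseteq> {x. a * x + b \<in> E}"
          proof
            assume "{x. \<bar>x\<bar> \<le> real c} \<subseteq> {x. a * x + b \<in> E}"
            then have "measure (\<nu> i) {x. \<bar>x\<bar> \<le> real c} \<le> measure (\<nu> i) {x. a * x + b \<in> E}"
              using S by (rule \<nu>i.finite_measure_mono)
            with c m show False by simp
          qed
          then have "\<exists>x. \<bar>x\<bar> \<le> real c \<and> \<not> real L < \<bar>a * x + b\<bar>" unfolding E_def by blast
          then obtain x where x: "\<bar>x\<bar> \<le> real c" "\<bar>a * x + b\<bar> \<le> real L" by (auto simp: not_less)
          have "\<bar>a * x\<bar> \<le> 1 * \<bar>x\<bar>" unfolding abs_mult using N[OF n] by (intro mult_right_mono) (auto simp: a_b_def)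
          then show ?thesis using x unfolding a_b_def[symmetric] by simp
        qed
        define m where "m = Max ((\<lambda>n. \<bar>perp_sum ca cb n \<omega>\<bar>) ` {..N})"
        have early: "\<bar>perp_sum ca cb n \<omega>\<bar> \<le> m" if "n \<le> N" for n
          unfolding m_def using that by (intro Max_ge) auto
        obtain C :: nat where "max m (real (L + c)) \<le> real C" using real_arch_simple by blast
        then have "\<forall>n. st n \<omega> = i \<longrightarrow> \<bar>perp_sum ca cb n \<omega>\<bar> \<le> real C"
          using early late by (metis max.bounded_iff nat_le_linear order_trans)
        then show ?thesis by (auto simp: Bd_def)
      qed
      then show ?case by auto
    qed
    then have "emeasure (Q i) {\<omega>. \<not> Bd \<omega>} \<le> emeasure (Q i) X"
      using X by (intro emeasure_mono_AE) (auto simp: sets_Q)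
    ultimately show ?thesis by (rule order_trans[rotated])
  qed
  have "emeasure (Q i) {\<omega>. \<not> Bd \<omega>} \<le> 0"
    by (rule ennreal_le_epsilon) (use bound in simp)
  moreover have "{\<omega>. \<not> Bd \<omega>} \<in> sets (Q i)" unfolding sets_Q by (rule path_Collect) measurable
  ultimately have "AE \<omega> in Q i. Bd \<omega>"
    by (subst AE_iff_measurable[OF _ refl]) auto
  then show ?thesis by (simp add: Bd_def)
qed

text \<open>After the first visit \<open>T\<close> to \<open>i\<close>, later visits satisfy \<open>Z\<^sub>n - Z\<^sub>T = \<Pi>\<^sub>T Z'\<^sub>n\<^sub>-\<^sub>T\<close>, where
  \<open>\<Pi>\<^sub>T\<close> is small and \<open>Z'\<close> is bounded along its visits.\<close>

lemma visits_Cauchy: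
  assumes fp: "fixed_point p K \<nu>" and lev0: "AE \<omega> in Q i. lev i \<omega> = 0" and \<epsilon>: "0 < \<epsilon>"
  shows "AE \<omega> in Q i. \<exists>N. \<forall>n\<ge>N. \<forall>m\<ge>N. st n \<omega> = i \<longrightarrow> st m \<omega> = i \<longrightarrow>
    \<bar>perp_sum ca cb n \<omega> - perp_sum ca cb m \<omega>\<bar> \<le> \<epsilon>"
proof -
  define Bd where "Bd C = {\<omega>. \<forall>n. st n \<omega> = i \<longrightarrow> \<bar>perp_sum ca cb n \<omega>\<bar> \<le> real C}" for C
  have Bd [measurable]: "Bd C \<in> sets path_space" for C unfolding Bd_def by (rule path_Collect) measurable
  \<comment> \<open>The factor 2 arises because two later visits are each compared with the value at
    the first visit T.\<close>
  define Sm where "Sm C N = {\<omega>. \<forall>n\<ge>N. st n \<omega> = i \<longrightarrow> 2 * real C * \<bar>Pi_prod ca n \<omega>\<bar> \<le> \<epsilon>}" for C N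
  have Sm [measurable]: "Sm C N \<in> sets path_space" for C N unfolding Sm_def by (rule path_Collect) measurable
  define G where "G N = {\<omega>. \<forall>n\<ge>N. \<forall>m\<ge>N. st n \<omega> = i \<longrightarrow> st m \<omega> = i \<longrightarrow>
    \<bar>perp_sum ca cb n \<omega> - perp_sum ca cb m \<omega>\<bar> \<le> \<epsilon>}" for N
  have G [measurable]: "G N \<in> sets path_space" for N unfolding G_def by (rule path_Collect) measurable
  have Bd_lim: "(\<lambda>C. Q.prob i (Bd C)) \<longlonglongrightarrow> 1"
  proof -
    have "(\<lambda>C. Q.prob i (Bd C)) \<longlonglongrightarrow> Q.prob i (\<Union>C. Bd C)"
    proof (rule Q.finite_Lim_measure_incseq)
      show "incseq Bd"
      proof (intro monoI subsetI)
        fix m n \<omega> assume "m \<le> n" "\<omega> \<in> Bd m"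
        moreover from \<open>m \<le> n\<close> have "real m \<le> real n" by simp
        ultimately show "\<omega> \<in> Bd n" by (force simp: Bd_def)
      qed
    qed (auto simp: sets_Q)
    moreover have "Q.prob i (\<Union>C. Bd C) = 1"
    proof -
      have U: "(\<Union>C. Bd C) \<in> sets (Q i)" by (auto simp: sets_Q)
      show ?thesis using visits_bounded[OF fp lev0] by (subst Q.prob_eq_1[OF U]) (simp add: Bd_def)
    qed
    ultimately show ?thesis by simp
  qed
  have Sm_lim: "(\<lambda>N. Q.prob i (Sm C N)) \<longlonglongrightarrow> 1" for C
  proof -
    have "(\<lambda>N. Q.prob i (Sm C N)) \<longlonglongrightarrow> Q.prob i (\<Union>N. Sm C N)"
    proof (rule Q.finite_Lim_measure_incseq)
      show "incseq (Sm C)" by (auto simp: Sm_def incseq_def)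
    qed (auto simp: sets_Q)
    moreover have "AE \<omega> in Q i. \<omega> \<in> (\<Union>N. Sm C N)"
      using lev0
    proof eventually_elim
      case (elim \<omega>)
      \<comment> \<open>The summand 1 keeps the denominator positive for C = 0.\<close>
      have pos: "0 < \<epsilon> / (2 * real C + 1)" using \<epsilon> by simp
      obtain N where N: "\<And>n. N \<le> n \<Longrightarrow> st n \<omega> = i \<Longrightarrow> \<bar>Pi_prod ca n \<omega>\<bar> < \<epsilon> / (2 * real C + 1)"
        using lev_0D[OF elim pos] by auto
      have "2 * real C * \<bar>Pi_prod ca n \<omega>\<bar> \<le> \<epsilon>" if "N \<le> n" "st n \<omega> = i" for n
      proof -
        have "(2 * real C + 1) * \<bar>Pi_prod ca n \<omega>\<bar> \<le> \<epsilon>" using N[OF that] by (simp add: field_simps)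
        then show ?thesis by (simp add: algebra_simps)
      qed
      then show ?case by (auto simp: Sm_def)
    qed
    then have "Q.prob i (\<Union>N. Sm C N) = 1" by (subst Q.prob_eq_1) (auto simp: sets_Q)
    ultimately show ?thesis by simp
  qed
  \<comment> \<open>H says that the path after the first visit from time N on is bounded by C; by
    the strong Markov property it has the probability of \<open>Bd C\<close>. The rest is inclusion
    and exclusion for two events.\<close>
  have G_ge: "Q.prob i (Sm C N) + Q.prob i (Bd C) - 1 \<le> Q.prob i (G N)" for C N
  proof -
    define H where "H = (\<Union>n. first_visit i N n \<inter> shift n -` Bd C)"
    have [measurable]: "first_visit i N n \<in> sets path_space" for n using first_visit_hist by (rule hist_le_path_space)
    have H [measurable]: "H \<in> sets path_space" unfolding H_def by measurable
    have "emeasure (Q i) H = emeasure (Q i) (\<Union>n. first_visit i N n) * emeasure (Q i) (Bd C)"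
      unfolding H_def
      by (rule strong_markov[OF first_visit_hist _ disjoint_first_visit Bd]) (auto simp: first_visit_def)
    also have "emeasure (Q i) (\<Union>n. first_visit i N n) = 1"
      using AE_first_visit[where i = i and j = i and N = N]
      by (subst Q.emeasure_eq_1_AE) (auto simp: sets_Q)
    finally have PH: "Q.prob i H = Q.prob i (Bd C)" by (simp add: Q.emeasure_eq_measure)
    have "Sm C N \<inter> H \<subseteq> G N"
    proof
      fix \<omega> assume "\<omega> \<in> Sm C N \<inter> H"
      then obtain T where T: "\<omega> \<in> first_visit i N T" "shift T \<omega> \<in> Bd C" and S: "\<omega> \<in> Sm C N" by (auto simp: H_def)
      have TS: "2 * real C * \<bar>Pi_prod ca T \<omega>\<bar> \<le> \<epsilon>" using T(1) S by (auto simp: Sm_def first_visit_def)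
      have dist: "\<bar>perp_sum ca cb n \<omega> - perp_sum ca cb T \<omega>\<bar> \<le> real C * \<bar>Pi_prod ca T \<omega>\<bar>" if "N \<le> n" "st n \<omega> = i" for n
      proof -
        have "T \<le> n" using T(1) that by (auto simp: first_visit_def not_less[symmetric])
        define k where "k = n - T"
        have n: "n = T + k" using \<open>T \<le> n\<close> by (simp add: k_def)
        have "\<bar>perp_sum ca cb k (shift T \<omega>)\<bar> \<le> real C" using T(2) that by (simp add: Bd_def st_shift n)
        then have "\<bar>perp_sum ca cb k (shift T \<omega>)\<bar> * \<bar>Pi_prod ca T \<omega>\<bar> \<le> real C * \<bar>Pi_prod ca T \<omega>\<bar>"
          by (rule mult_right_mono) simp
        then show ?thesis unfolding n perp_sum_shift by (simp add: abs_mult mult.commute)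
      qed
      show "\<omega> \<in> G N"
        unfolding G_def
      proof (intro CollectI allI impI)
        fix n m assume a: "N \<le> n" "N \<le> m" "st n \<omega> = i" "st m \<omega> = i"
        show "\<bar>perp_sum ca cb n \<omega> - perp_sum ca cb m \<omega>\<bar> \<le> \<epsilon>"
          using dist[OF a(1,3)] dist[OF a(2,4)] TS by linarith
      qed
    qed
    then have "Q.prob i (Sm C N \<inter> H) \<le> Q.prob i (G N)" by (intro Q.finite_measure_mono) (auto simp: sets_Q)
    moreover have "Q.prob i (Sm C N) + Q.prob i H - 1 \<le> Q.prob i (Sm C N \<inter> H)"
    proof -
      have "Q.prob i (Sm C N \<union> H) = Q.prob i (Sm C N) + Q.prob i H - Q.prob i (Sm C N \<inter> H)"
        by (rule measure_Un3) (auto simp: sets_Q Q.fmeasurable_eq_sets)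
      then show ?thesis using Q.prob_le_1[of i "Sm C N \<union> H"] by linarith
    qed
    ultimately show ?thesis by (simp add: PH)
  qed
  have "Q.prob i (\<Union>N. G N) \<ge> 1"
  proof -
    have "Q.prob i (Sm C N) + Q.prob i (Bd C) - 1 \<le> Q.prob i (\<Union>N. G N)" for C N
    proof -
      have "Q.prob i (G N) \<le> Q.prob i (\<Union>N. G N)"
        by (intro Q.finite_measure_mono) (auto simp: sets_Q)
      then show ?thesis using G_ge[of C N] by linarith
    qed
    \<comment> \<open>The limits are taken in this order: N to infinity for fixed C, then C to
      infinity.\<close>
    then have "1 + Q.prob i (Bd C) - 1 \<le> Q.prob i (\<Union>N. G N)" for C
      by (intro LIMSEQ_le_const2[OF tendsto_diff[OF tendsto_add[OF Sm_lim tendsto_const] tendsto_const]]) auto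
    then have "Q.prob i (Bd C) \<le> Q.prob i (\<Union>N. G N)" for C by simp
    then show ?thesis by (intro LIMSEQ_le_const2[OF Bd_lim]) auto
  qed
  then have "Q.prob i (\<Union>N. G N) = 1" using Q.prob_le_1[of i "\<Union>N. G N"] by linarith
  then have "AE \<omega> in Q i. \<omega> \<in> (\<Union>N. G N)" by (subst (asm) Q.prob_eq_1) (auto simp: sets_Q)
  then show ?thesis by eventually_elim (auto simp: G_def)
qed

lemma visit_limit_exists:
  assumes fp: "fixed_point p K \<nu>" and lev0: "AE \<omega> in Q i. lev i \<omega> = 0"
  shows "AE \<omega> in Q i. \<exists>z. visit_limit i \<omega> z"
proof -
  have "AE \<omega> in Q i. \<forall>r::nat. \<exists>N. \<forall>n\<ge>N. \<forall>m\<ge>N. st n \<omega> = i \<longrightarrow> st m \<omega> = i \<longrightarrow>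
    \<bar>perp_sum ca cb n \<omega> - perp_sum ca cb m \<omega>\<bar> \<le> 1 / real (Suc r)"
    unfolding AE_all_countable using visits_Cauchy[OF fp lev0] by simp
  with recurrent[where i = i and j = i] show ?thesis
  proof eventually_elim
    case (elim \<omega>)
    define y where "y N = perp_sum ca cb (visit_time i N \<omega>) \<omega>" for N
    note vt = visit_time[OF elim(1)]
    have small: "\<exists>N. \<forall>n\<ge>N. \<forall>m\<ge>N. st n \<omega> = i \<longrightarrow> st m \<omega> = i \<longrightarrow>
        \<bar>perp_sum ca cb n \<omega> - perp_sum ca cb m \<omega>\<bar> \<le> \<epsilon>" if pos: "0 < \<epsilon>" for \<epsilon> :: real
    proof -
      obtain r where r: "1 / real (Suc r) < \<epsilon>" using reals_Archimedean[OF pos] by (auto simp: inverse_eq_divide)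
      obtain N where "\<forall>n\<ge>N. \<forall>m\<ge>N. st n \<omega> = i \<longrightarrow> st m \<omega> = i \<longrightarrow>
        \<bar>perp_sum ca cb n \<omega> - perp_sum ca cb m \<omega>\<bar> \<le> 1 / real (Suc r)" using elim(2) by blast
      with r show ?thesis by (intro exI[of _ N]) force
    qed
    have "Cauchy y"
      unfolding Cauchy_def
    proof (intro allI impI)
      fix e :: real assume "0 < e"
      then obtain N where N: "\<forall>n\<ge>N. \<forall>m\<ge>N. st n \<omega> = i \<longrightarrow> st m \<omega> = i \<longrightarrow>
        \<bar>perp_sum ca cb n \<omega> - perp_sum ca cb m \<omega>\<bar> \<le> e / 2" using small[of "e / 2"] by auto
      have "dist (y m) (y n) < e" if "N \<le> m" "N \<le> n" for m n
      proof -
        have "\<bar>y m - y n\<bar> \<le> e / 2"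
          unfolding y_def
          by (rule N[rule_format, OF order_trans[OF that(1) vt(1)] order_trans[OF that(2) vt(1)] vt(2) vt(2)])
        then show ?thesis using \<open>0 < e\<close> by (simp add: dist_real_def)
      qed
      then show "\<exists>M. \<forall>m\<ge>M. \<forall>n\<ge>M. dist (y m) (y n) < e" by blast
    qed
    then obtain z where z: "y \<longlonglongrightarrow> z" using Cauchy_convergent convergent_def by blast
    have "visit_limit i \<omega> z"
      unfolding visit_limit_def
    proof (intro allI impI)
      fix \<epsilon> :: real assume "0 < \<epsilon>"
      then obtain N where N: "\<forall>n\<ge>N. \<forall>m\<ge>N. st n \<omega> = i \<longrightarrow> st m \<omega> = i \<longrightarrow>
        \<bar>perp_sum ca cb n \<omega> - perp_sum ca cb m \<omega>\<bar> \<le> \<epsilon>" using small by blast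
      have "\<bar>perp_sum ca cb n \<omega> - z\<bar> \<le> \<epsilon>" if "N \<le> n" "st n \<omega> = i" for n
      proof (rule LIMSEQ_le_const2)
        show "(\<lambda>k. \<bar>perp_sum ca cb n \<omega> - y k\<bar>) \<longlonglongrightarrow> \<bar>perp_sum ca cb n \<omega> - z\<bar>"
          using z by (intro tendsto_intros)
        have "\<bar>perp_sum ca cb n \<omega> - y k\<bar> \<le> \<epsilon>" if "N \<le> k" for k
          unfolding y_def
          by (rule N[rule_format, OF \<open>N \<le> n\<close> order_trans[OF that vt(1)] \<open>st n \<omega> = i\<close> vt(2)])
        then show "\<exists>N. \<forall>k\<ge>N. \<bar>perp_sum ca cb n \<omega> - y k\<bar> \<le> \<epsilon>" by blast
      qed
      then show "\<exists>N. \<forall>n\<ge>N. st n \<omega> = i \<longrightarrow> \<bar>perp_sum ca cb n \<omega> - z\<bar> \<le> \<epsilon>" by blast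
    qed
    then show ?case ..
  qed
qed

text \<open>The fixed point equation at a random time: at the visit the state is i again, so the
  optional stopping identity involves only the single law \<open>\<nu> i\<close>.\<close>

lemma fixed_point_at_visit:
  fixes i :: 's
  assumes fp: "fixed_point p K \<nu>"
  defines "\<kappa> N \<omega> \<equiv> distr (\<nu> i) borel (\<lambda>x. Pi_prod ca (visit_time i N \<omega>) \<omega> * x + perp_sum ca cb (visit_time i N \<omega>) \<omega>)"
  shows "\<kappa> N \<in> measurable (Q i) (subprob_algebra borel)" "Q i \<bind> \<kappa> N = \<nu> i"
proof -
  have \<nu>: "\<nu> \<in> prob_kernels" using fp by (simp add: fixed_point_def)
  note D = prob_kernelsD[OF \<nu>]
  have PZ [measurable]: "(\<lambda>\<omega>. Pi_prod ca (visit_time i N \<omega>) \<omega>) \<in> borel_measurable path_space"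
    "(\<lambda>\<omega>. perp_sum ca cb (visit_time i N \<omega>) \<omega>) \<in> borel_measurable path_space"
    by (rule measurable_compose_countable[OF _ visit_time_measurable]; measurable)+
  show \<kappa>: "\<kappa> N \<in> measurable (Q i) (subprob_algebra borel)"
    unfolding \<kappa>_def
  proof (rule measurable_distr2)
    show "(\<lambda>(\<omega>, x). Pi_prod ca (visit_time i N \<omega>) \<omega> * x + perp_sum ca cb (visit_time i N \<omega>) \<omega>) \<in> borel_measurable (Q i \<Otimes>\<^sub>M borel)"
      by measurable
    show "(\<lambda>\<omega>. \<nu> i) \<in> measurable (Q i) (subprob_algebra borel)"
      using measurable_space[OF D(4), of i] by simp
  qed
  show "Q i \<bind> \<kappa> N = \<nu> i"
  proof (rule measure_eqI)
    have "sets (Q i \<bind> \<kappa> N) = sets borel" by (rule sets_bind) (auto simp: \<kappa>_def)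
    then show s: "sets (Q i \<bind> \<kappa> N) = sets (\<nu> i)" by (simp add: D(2))
    fix E assume "E \<in> sets (Q i \<bind> \<kappa> N)"
    then have E: "E \<in> sets borel" by (simp add: s D(2))
    have mm: "(\<lambda>x. a * x + c) \<in> measurable (\<nu> j) borel" for a c j
      unfolding measurable_cong_sets[OF D(2) refl] by measurable
    note [measurable] = cond_mass_hist(2)[OF \<nu> E]
    have [measurable]: "first_visit i N n \<in> sets path_space" for n using first_visit_hist by (rule hist_le_path_space)
    have "emeasure (Q i \<bind> \<kappa> N) E = (\<integral>\<^sup>+\<omega>. emeasure (\<kappa> N \<omega>) E \<partial>Q i)"
      by (rule emeasure_bind[OF _ \<kappa> E]) simp
    also have "\<dots> = (\<integral>\<^sup>+\<omega>. (\<Sum>n. indicator (first_visit i N n) \<omega> * cond_mass \<nu> E n \<omega>) \<partial>Q i)"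
    proof (rule nn_integral_cong_AE)
      show "AE \<omega> in Q i. emeasure (\<kappa> N \<omega>) E = (\<Sum>n. indicator (first_visit i N n) \<omega> * cond_mass \<nu> E n \<omega>)"
        using recurrent[where i = i and j = i]
      proof eventually_elim
        case (elim \<omega>)
        note vt = visit_time[OF elim, of N]
        have "(\<Sum>n. indicator (first_visit i N n) \<omega> * cond_mass \<nu> E n \<omega>)
          = (\<Sum>n\<in>{visit_time i N \<omega>}. indicator (first_visit i N n) \<omega> * cond_mass \<nu> E n \<omega>)"
          using first_visit_unique[OF vt(3)] by (intro suminf_finite) (auto split: split_indicator)
        also have "\<dots> = cond_mass \<nu> E (visit_time i N \<omega>) \<omega>" using vt(3) by simp
        also have "\<dots> = emeasure (\<kappa> N \<omega>) E"
          unfolding \<kappa>_def using vt(2) by (subst emeasure_distr) (auto simp: mm E D(3) cond_mass_def vimage_def)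
        finally show ?case by simp
      qed
    qed
    also have "\<dots> = (\<Sum>n. \<integral>\<^sup>+\<omega>. indicator (first_visit i N n) \<omega> * cond_mass \<nu> E n \<omega> \<partial>Q i)"
      by (intro nn_integral_suminf) measurable
    also have "\<dots> = emeasure (\<nu> i) E" by (rule cond_mass_first_visit[OF fp E])
    finally show "emeasure (Q i \<bind> \<kappa> N) E = emeasure (\<nu> i) E" .
  qed
qed

text \<open>Along the visits the slopes tend to 0 and the translation parts to z, so the image of
  any fixed law under these maps concentrates at z. The mean of the images is \<open>\<nu> i\<close>
  at all stages, hence \<open>\<nu> i\<close> is the law of z. Bounded continuous test functions and
  dominated convergence make this precise.\<close>

lemma fixed_point_perpetuity:
  assumes fp: "fixed_point p K \<nu>" and lev0: "AE \<omega> in Q i. lev i \<omega> = 0"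
    and z [measurable]: "z \<in> borel_measurable path_space" and lim: "AE \<omega> in Q i. visit_limit i \<omega> (z \<omega>)"
  shows "\<nu> i = distr (Q i) borel z"
proof -
  have \<nu>: "\<nu> \<in> prob_kernels" using fp by (simp add: fixed_point_def)
  note D = prob_kernelsD[OF \<nu>]
  interpret \<nu>i: prob_space "\<nu> i" by (rule D)
  have [measurable_cong]: "sets (\<nu> i) = sets borel" by (rule D)
  define Pt where "Pt N \<omega> = Pi_prod ca (visit_time i N \<omega>) \<omega>" for N \<omega>
  define Zt where "Zt N \<omega> = perp_sum ca cb (visit_time i N \<omega>) \<omega>" for N \<omega>
  have PZ [measurable]: "Pt N \<in> borel_measurable path_space" "Zt N \<in> borel_measurable path_space" for N
    unfolding Pt_def Zt_def by (rule measurable_compose_countable[OF _ visit_time_measurable]; measurable)+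
  have lims: "AE \<omega> in Q i. ((\<lambda>N. Pt N \<omega>) \<longlonglongrightarrow> 0) \<and> ((\<lambda>N. Zt N \<omega>) \<longlonglongrightarrow> z \<omega>)"
    using recurrent[where i = i and j = i] lev0 lim
  proof eventually_elim
    case (elim \<omega>)
    note vt = visit_time[OF elim(1)]
    have "(\<lambda>N. Pt N \<omega>) \<longlonglongrightarrow> 0"
    proof (rule LIMSEQ_I)
      fix r :: real assume "0 < r"
      then obtain N where "\<And>n. N \<le> n \<Longrightarrow> st n \<omega> = i \<Longrightarrow> \<bar>Pi_prod ca n \<omega>\<bar> < r" using lev_0D[OF elim(2)] by blast
      then show "\<exists>no. \<forall>n\<ge>no. norm (Pt n \<omega> - 0) < r"
        using vt by (intro exI[of _ N]) (auto simp: Pt_def intro: order_trans)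
    qed
    moreover have "(\<lambda>N. Zt N \<omega>) \<longlonglongrightarrow> z \<omega>"
    proof (rule LIMSEQ_I)
      fix r :: real assume "0 < r"
      then have "0 < r / 2" by simp
      then obtain N where N: "\<And>n. N \<le> n \<Longrightarrow> st n \<omega> = i \<Longrightarrow> \<bar>perp_sum ca cb n \<omega> - z \<omega>\<bar> \<le> r / 2"
        using elim(3) unfolding visit_limit_def by blast
      have "norm (Zt n \<omega> - z \<omega>) < r" if "N \<le> n" for n
      proof -
        have "\<bar>Zt n \<omega> - z \<omega>\<bar> \<le> r / 2" unfolding Zt_def using vt that by (intro N) (auto intro: order_trans)
        then show ?thesis using \<open>0 < r\<close> by simp
      qed
      then show "\<exists>no. \<forall>n\<ge>no. norm (Zt n \<omega> - z \<omega>) < r" by blast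
    qed
    ultimately show ?case ..
  qed
  have int_eq: "(\<integral>x. f x \<partial>\<nu> i) = (\<integral>\<omega>. f (z \<omega>) \<partial>Q i)"
    if f: "continuous_on UNIV f" "\<And>x. \<bar>f x\<bar> \<le> 1" for f :: "real \<Rightarrow> real"
  proof -
    have fm [measurable]: "f \<in> borel_measurable borel" using f(1) by (rule borel_measurable_continuous_onI)
    define F where "F N \<omega> = (\<integral>x. f (Pt N \<omega> * x + Zt N \<omega>) \<partial>\<nu> i)" for N \<omega>
    have F: "(\<integral>\<omega>. F N \<omega> \<partial>Q i) = (\<integral>x. f x \<partial>\<nu> i)" for N
    proof -
      have "(\<integral>x. f x \<partial>\<nu> i) = (\<integral>\<omega>. (\<integral>x. f x \<partial>distr (\<nu> i) borel (\<lambda>x. Pt N \<omega> * x + Zt N \<omega>)) \<partial>Q i)"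
        using integral_bind_real[OF prob_Q fixed_point_at_visit(1)[OF fp] fm f(2), of i N]
        unfolding fixed_point_at_visit(2)[OF fp] Pt_def Zt_def .
      also have "\<dots> = (\<integral>\<omega>. F N \<omega> \<partial>Q i)"
        unfolding F_def by (intro Bochner_Integration.integral_cong refl integral_distr) measurable
      finally show ?thesis ..
    qed
    have F_meas: "F N \<in> borel_measurable (Q i)" for N
      unfolding F_def by measurable
    have F_lim: "AE \<omega> in Q i. (\<lambda>N. F N \<omega>) \<longlonglongrightarrow> f (z \<omega>)"
      using lims
    proof eventually_elim
      case (elim \<omega>)
      have "(\<lambda>N. F N \<omega>) \<longlonglongrightarrow> (\<integral>x. f (0 * x + z \<omega>) \<partial>\<nu> i)"
        unfolding F_def
      proof (rule integral_dominated_convergence[where w = "\<lambda>_. 1"])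
        show "AE x in \<nu> i. (\<lambda>N. f (Pt N \<omega> * x + Zt N \<omega>)) \<longlonglongrightarrow> f (0 * x + z \<omega>)"
        proof (rule AE_I2)
          fix x
          have "(\<lambda>N. Pt N \<omega> * x + Zt N \<omega>) \<longlonglongrightarrow> 0 * x + z \<omega>" using elim by (intro tendsto_intros) auto
          then show "(\<lambda>N. f (Pt N \<omega> * x + Zt N \<omega>)) \<longlonglongrightarrow> f (0 * x + z \<omega>)"
            by (rule continuous_on_tendsto_compose[OF f(1)]) auto
        qed
      qed (use f(2) in auto)
      then show ?case by (simp add: \<nu>i.prob_space)
    qed
    have "(\<lambda>N. \<integral>\<omega>. F N \<omega> \<partial>Q i) \<longlonglongrightarrow> (\<integral>\<omega>. f (z \<omega>) \<partial>Q i)"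
    proof (rule integral_dominated_convergence[where w = "\<lambda>_. 1"])
      show "AE \<omega> in Q i. norm (F N \<omega>) \<le> 1" for N
      proof (rule AE_I2)
        fix \<omega>
        have int: "integrable (\<nu> i) (\<lambda>x. f (Pt N \<omega> * x + Zt N \<omega>))"
          using f(2) by (intro \<nu>i.integrable_const_bound[where B = 1]) auto
        have le: "f x \<le> 1" "- 1 \<le> f x" for x using f(2)[of x] by (auto simp: abs_le_iff)
        have "F N \<omega> \<le> 1" "- 1 \<le> F N \<omega>"
          unfolding F_def using int le by (auto intro: \<nu>i.integral_le_const \<nu>i.integral_ge_const)
        then show "norm (F N \<omega>) \<le> 1" by simp
      qed
    qed (use F_meas F_lim in auto)
    then have "(\<lambda>N::nat. \<integral>x. f x \<partial>\<nu> i) \<longlonglongrightarrow> (\<integral>\<omega>. f (z \<omega>) \<partial>Q i)" by (simp only: F)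
    then show ?thesis by (simp only: LIMSEQ_const_iff)
  qed
  have rd: "real_distribution (\<nu> i)" "real_distribution (distr (Q i) borel z)"
    using D by (auto intro!: real_distribution_borel Q.prob_space_distr)
  show ?thesis
  proof (rule Levy_uniqueness[OF rd])
    show "char (\<nu> i) = char (distr (Q i) borel z)"
    proof
      fix t
      have "(\<integral>x. cos (t * x) \<partial>\<nu> i) = (\<integral>x. cos (t * x) \<partial>distr (Q i) borel z)"
        "(\<integral>x. sin (t * x) \<partial>\<nu> i) = (\<integral>x. sin (t * x) \<partial>distr (Q i) borel z)"
      proof -
        have "continuous_on UNIV (\<lambda>x. cos (t * x))" "continuous_on UNIV (\<lambda>x. sin (t * x))"
          by (intro continuous_intros)+
        then show "(\<integral>x. cos (t * x) \<partial>\<nu> i) = (\<integral>x. cos (t * x) \<partial>distr (Q i) borel z)"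
          "(\<integral>x. sin (t * x) \<partial>\<nu> i) = (\<integral>x. sin (t * x) \<partial>distr (Q i) borel z)"
          using int_eq[of "\<lambda>x. cos (t * x)"] int_eq[of "\<lambda>x. sin (t * x)"] by (auto simp: integral_distr)
      qed
      then show "char (\<nu> i) t = char (distr (Q i) borel z) t"
        by (simp add: complex_eq_iff char_re_im rd)
    qed
  qed
qed

end


subsection \<open>Independent cycles\<close>

text \<open>The hypothesis \<open>renew\<close> says that c is independent of the path shifted by
  \<sigma> and that \<sigma> preserves Q; the latter is the case where G is the whole space.
  Induction on the number of cycles gives the finite-dimensional laws.\<close>

lemma iid_of_renewal:
  assumes Q: "prob_space Q" and c [measurable]: "c \<in> measurable Q M'" and \<sigma> [measurable]: "\<sigma> \<in> measurable Q Q"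
    and renew: "\<And>G H. G \<in> sets M' \<Longrightarrow> H \<in> sets Q \<Longrightarrow>
      emeasure Q ((c -` G \<inter> space Q) \<inter> (\<sigma> -` H \<inter> space Q)) = emeasure Q (c -` G \<inter> space Q) * emeasure Q H"
  shows "distr Q (PiM UNIV (\<lambda>_. M')) (\<lambda>\<omega> k. c ((\<sigma> ^^ k) \<omega>)) = PiM UNIV (\<lambda>_::nat. distr Q M' c)"
proof -
  interpret prob_space Q by fact
  have \<sigma>k [measurable]: "(\<sigma> ^^ k) \<in> measurable Q Q" for k
    by (induction k) (auto simp: comp_def)
  have c\<sigma>: "(\<lambda>\<omega>. c ((\<sigma> ^^ k) \<omega>)) \<in> measurable Q M'" for k
    using measurable_compose[OF \<sigma>k c] .
  have step: "emeasure Q {\<omega>\<in>space Q. \<forall>k<n. c ((\<sigma> ^^ k) \<omega>) \<in> F k} = (\<Prod>k<n. emeasure (distr Q M' c) (F k))"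
    if F: "\<And>k. F k \<in> sets M'" for n F
    using F
  proof (induction n arbitrary: F)
    case 0
    then show ?case by (simp add: emeasure_space_1)
  next
    case (Suc n)
    note [measurable] = Suc(2) c\<sigma>
    define H where "H = {\<omega>\<in>space Q. \<forall>k<n. c ((\<sigma> ^^ k) \<omega>) \<in> F (Suc k)}"
    have H: "H \<in> sets Q" unfolding H_def by measurable
    have "{\<omega>\<in>space Q. \<forall>k<Suc n. c ((\<sigma> ^^ k) \<omega>) \<in> F k} = (c -` F 0 \<inter> space Q) \<inter> (\<sigma> -` H \<inter> space Q)"
    proof -
      have sw: "(\<sigma> ^^ Suc k) \<omega> = (\<sigma> ^^ k) (\<sigma> \<omega>)" for k \<omega> by (simp add: funpow_swap1)
      have "(\<forall>k<Suc n. c ((\<sigma> ^^ k) \<omega>) \<in> F k) \<longleftrightarrow> c \<omega> \<in> F 0 \<and> (\<forall>k<n. c ((\<sigma> ^^ k) (\<sigma> \<omega>)) \<in> F (Suc k))" for \<omega>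
        unfolding All_less_Suc2 sw by simp
      then show ?thesis using measurable_space[OF \<sigma>] by (auto simp: H_def)
    qed
    then have "emeasure Q {\<omega>\<in>space Q. \<forall>k<Suc n. c ((\<sigma> ^^ k) \<omega>) \<in> F k} = emeasure Q (c -` F 0 \<inter> space Q) * emeasure Q H"
      using renew[OF Suc(2)[of 0] H] by simp
    also have "\<dots> = emeasure (distr Q M' c) (F 0) * (\<Prod>k<n. emeasure (distr Q M' c) (F (Suc k)))"
      unfolding H_def using Suc(1)[of "\<lambda>k. F (Suc k)"] Suc(2) by (simp add: emeasure_distr)
    finally show ?case unfolding prod.lessThan_Suc_shift .
  qed
  interpret M': prob_space "distr Q M' c" by (rule prob_space_distr) measurable
  interpret product_prob_space "\<lambda>_::nat. distr Q M' c" UNIV ..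
  show ?thesis
  proof (rule PiM_eq)
    show "sets (distr Q (PiM UNIV (\<lambda>_. M')) (\<lambda>\<omega> k. c ((\<sigma> ^^ k) \<omega>))) = sets (PiM UNIV (\<lambda>_::nat. distr Q M' c))"
      by (simp cong: sets_PiM_cong)
    fix J :: "nat set" and F
    assume J: "finite J" and "\<And>j. j \<in> J \<Longrightarrow> F j \<in> sets (distr Q M' c)"
    then have F: "\<And>j. j \<in> J \<Longrightarrow> F j \<in> sets M'" by simp
    obtain n where n: "J \<subseteq> {..<n}" using J finite_nat_iff_bounded by blast
    then have nD: "\<And>j. j \<in> J \<Longrightarrow> j < n" by auto
    \<comment> \<open>The finite index set J is padded to an initial segment with the whole space,
      which contributes factors 1.\<close>
    define G where "G k = (if k \<in> J then F k else space M')" for k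
    have G: "G k \<in> sets M'" for k using F by (auto simp: G_def)
    have C: "(\<lambda>\<omega> k. c ((\<sigma> ^^ k) \<omega>)) \<in> measurable Q (PiM UNIV (\<lambda>_. M'))"
      by (rule measurable_PiM_single') (use c\<sigma> measurable_space[OF c\<sigma>] in auto)
    have E: "prod_emb UNIV (\<lambda>_. distr Q M' c) J (Pi\<^sub>E J F) \<in> sets (PiM UNIV (\<lambda>_. M'))"
    proof -
      have "prod_emb UNIV (\<lambda>_. M') J (Pi\<^sub>E J F) \<in> sets (PiM UNIV (\<lambda>_. M'))"
        using J F by (intro sets_PiM_I) auto
      then show ?thesis by (simp add: prod_emb_def space_PiM)
    qed
    have "emeasure (distr Q (PiM UNIV (\<lambda>_. M')) (\<lambda>\<omega> k. c ((\<sigma> ^^ k) \<omega>))) (prod_emb UNIV (\<lambda>_. distr Q M' c) J (Pi\<^sub>E J F))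
      = emeasure Q {\<omega>\<in>space Q. \<forall>k<n. c ((\<sigma> ^^ k) \<omega>) \<in> G k}"
      unfolding emeasure_distr[OF C E]
      using nD measurable_space[OF c\<sigma>]
      by (intro arg_cong[where f = "emeasure Q"])
        (auto simp: prod_emb_def G_def PiE_iff space_PiM extensional_def split: if_splits)
    also have "\<dots> = (\<Prod>k<n. emeasure (distr Q M' c) (G k))" by (rule step[OF G])
    also have "\<dots> = (\<Prod>k\<in>J. emeasure (distr Q M' c) (G k))"
      using n M'.emeasure_space_1 by (intro prod.mono_neutral_right) (auto simp: G_def)
    also have "\<dots> = (\<Prod>k\<in>J. emeasure (distr Q M' c) (F k))" by (simp add: G_def)
    finally show "emeasure (distr Q (PiM UNIV (\<lambda>_. M')) (\<lambda>\<omega> k. c ((\<sigma> ^^ k) \<omega>))) (prod_emb UNIV (\<lambda>_. distr Q M' c) J (Pi\<^sub>E J F))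
      = (\<Prod>j\<in>J. emeasure (distr Q M' c) (F j))" .
  qed
qed

section \<open>Cycles between successive visits\<close>

definition cycle :: "'s \<Rightarrow> 's path \<Rightarrow> real \<times> real" where
  "cycle i \<omega> = path_aff (visit_time i 1 \<omega>) \<omega>"

definition cycle_shift :: "'s \<Rightarrow> 's path \<Rightarrow> 's path" where
  "cycle_shift i \<omega> = shift (visit_time i 1 \<omega>) \<omega>"

lemma cycle_measurable [measurable]: "cycle i \<in> borel_measurable path_space"
  unfolding cycle_def by (rule measurable_compose_countable[OF _ visit_time_measurable]) measurable

lemma cycle_shift_measurable [measurable]: "cycle_shift i \<in> measurable path_space path_space"
  unfolding cycle_shift_def by (rule measurable_compose_countable[OF _ visit_time_measurable]) measurable

lemma infinitely_many_visits_shift: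
  assumes "\<exists>\<^sub>\<infinity>n. st n \<omega> = i" shows "\<exists>\<^sub>\<infinity>n. st n (shift m \<omega>) = i"
  unfolding INFM_nat_le st_shift
proof
  fix k
  obtain n where "m + k \<le> n" "st n \<omega> = i" using assms unfolding INFM_nat_le by blast
  then show "\<exists>n\<ge>k. st (m + n) \<omega> = i" by (intro exI[of _ "n - m"]) auto
qed

text \<open>The witness t is the time of the n-th return. Only \<open>n \<le> t\<close> is recorded,
  which suffices to pass limits along visits to the cycles.\<close>

lemma path_aff_at_cycles:
  assumes "\<exists>\<^sub>\<infinity>n. st n \<omega> = i" "st 0 \<omega> = i"
  shows "\<exists>t\<ge>n. st t \<omega> = i \<and> Pi_prod ca t \<omega> = (\<Prod>k<n. fst (cycle i ((cycle_shift i ^^ k) \<omega>))) \<and>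
    perp_sum ca cb t \<omega> = (\<Sum>k<n. (\<Prod>l<k. fst (cycle i ((cycle_shift i ^^ l) \<omega>))) * snd (cycle i ((cycle_shift i ^^ k) \<omega>)))"
  using assms
proof (induction n arbitrary: \<omega>)
  case 0
  then show ?case by (intro exI[of _ 0]) simp
next
  case (Suc n)
  define T where "T = visit_time i 1 \<omega>"
  note vt = visit_time[OF Suc(2), of 1, folded T_def]
  define \<omega>' where "\<omega>' = cycle_shift i \<omega>"
  have \<omega>': "\<omega>' = shift T \<omega>" by (simp add: \<omega>'_def cycle_shift_def T_def)
  have "\<exists>\<^sub>\<infinity>n. st n \<omega>' = i" "st 0 \<omega>' = i"
    using infinitely_many_visits_shift[OF Suc(2)] vt by (simp_all add: \<omega>' st_shift)
  from Suc(1)[OF this] obtain t where t: "n \<le> t" "st t \<omega>' = i"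
    "Pi_prod ca t \<omega>' = (\<Prod>k<n. fst (cycle i ((cycle_shift i ^^ k) \<omega>')))"
    "perp_sum ca cb t \<omega>' = (\<Sum>k<n. (\<Prod>l<k. fst (cycle i ((cycle_shift i ^^ l) \<omega>'))) * snd (cycle i ((cycle_shift i ^^ k) \<omega>')))"
    by blast
  have sh: "(cycle_shift i ^^ k) \<omega>' = (cycle_shift i ^^ Suc k) \<omega>" for k
    by (simp add: \<omega>'_def funpow_swap1)
  have c: "Pi_prod ca T \<omega> = fst (cycle i \<omega>)" "perp_sum ca cb T \<omega> = snd (cycle i \<omega>)"
    by (simp_all add: cycle_def path_aff_def T_def)
  show ?case
  proof (intro exI[of _ "T + t"] conjI)
    show "Suc n \<le> T + t" using vt t by simp
    show "st (T + t) \<omega> = i" using t(2) by (simp add: \<omega>' st_shift)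
    show "Pi_prod ca (T + t) \<omega> = (\<Prod>k<Suc n. fst (cycle i ((cycle_shift i ^^ k) \<omega>)))"
      unfolding Pi_prod_shift \<omega>'[symmetric] t(3) prod.lessThan_Suc_shift sh c by simp
    show "perp_sum ca cb (T + t) \<omega> = (\<Sum>k<Suc n. (\<Prod>l<k. fst (cycle i ((cycle_shift i ^^ l) \<omega>))) * snd (cycle i ((cycle_shift i ^^ k) \<omega>)))"
      unfolding perp_sum_shift \<omega>'[symmetric] t(4) sum.lessThan_Suc_shift prod.lessThan_Suc_shift sh c
      by (simp add: sum_distrib_left mult.assoc)
  qed
qed

context path_chain begin

lemma cycle_renewal:
  assumes G [measurable]: "G \<in> sets borel" and H [measurable]: "H \<in> sets path_space"
  shows "emeasure (Q i) (cycle i -` G \<inter> cycle_shift i -` H) = emeasure (Q i) (cycle i -` G) * emeasure (Q i) H"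
proof -
  define D where "D n = first_visit i 1 n \<inter> path_aff n -` G" for n
  have D: "D n \<in> sets (hist n)" for n
    using first_visit_hist[of i 1 n] measurable_sets[OF path_aff_hist G, of n] by (auto simp: D_def)
  have D' [measurable]: "D n \<in> sets path_space" for n using D by (rule hist_le_path_space)
  have eq: "(\<omega> \<in> (\<Union>n. D n \<inter> shift n -` X)) \<longleftrightarrow> (\<omega> \<in> cycle i -` G \<inter> cycle_shift i -` X)"
    if "\<exists>\<^sub>\<infinity>n. st n \<omega> = i" for \<omega> X
    using visit_time[OF that, of 1] first_visit_unique[of \<omega> i 1]
    by (auto simp: D_def cycle_def cycle_shift_def)
  have [measurable]: "cycle i -` G \<in> sets path_space" "cycle_shift i -` H \<in> sets path_space"
    using measurable_sets[OF cycle_measurable G, of i] measurable_sets[OF cycle_shift_measurable H, of i] by simp_all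
  have e: "emeasure (Q i) (cycle i -` G \<inter> cycle_shift i -` X) = emeasure (Q i) (\<Union>n. D n \<inter> shift n -` X)"
    if [measurable]: "X \<in> sets path_space" "cycle_shift i -` X \<in> sets path_space" for X
  proof (rule emeasure_eq_AE)
    show "AE \<omega> in Q i. (\<omega> \<in> cycle i -` G \<inter> cycle_shift i -` X) = (\<omega> \<in> (\<Union>n. D n \<inter> shift n -` X))"
      using recurrent[where i = i and j = i] by eventually_elim (simp only: eq)
  qed (auto simp: sets_Q)
  have s: "emeasure (Q i) (\<Union>n. D n \<inter> shift n -` X) = emeasure (Q i) (\<Union>n. D n) * emeasure (Q i) X"
    if "X \<in> sets path_space" for X
  proof (rule strong_markov[OF D _ _ that])
    show "disjoint_family D" using disjoint_first_visit[of i 1] by (auto simp: disjoint_family_on_def D_def)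
  qed (auto simp: D_def first_visit_def)
  have "emeasure (Q i) (cycle i -` G) = emeasure (Q i) (\<Union>n. D n)"
    using e[of UNIV] sets.top[of path_space] by simp
  then show ?thesis using e[OF H] s[OF H] by simp
qed

lemma cycle_iid:
  "distr (Q i) (PiM UNIV (\<lambda>_. borel)) (\<lambda>\<omega> k. cycle i ((cycle_shift i ^^ k) \<omega>)) = PiM UNIV (\<lambda>_::nat. distr (Q i) borel (cycle i))"
proof (rule iid_of_renewal[OF prob_Q])
  show "cycle i \<in> borel_measurable (Q i)" "cycle_shift i \<in> measurable (Q i) (Q i)"
    by (simp_all add: measurable_cong_sets[OF sets_Q sets_Q] measurable_cong_sets[OF sets_Q refl])
  fix G :: "(real \<times> real) set" and H assume "G \<in> sets borel" "H \<in> sets (Q i)"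
  then show "emeasure (Q i) ((cycle i -` G \<inter> space (Q i)) \<inter> (cycle_shift i -` H \<inter> space (Q i))) =
    emeasure (Q i) (cycle i -` G \<inter> space (Q i)) * emeasure (Q i) H"
    using cycle_renewal[of G H i] by (simp add: sets_Q)
qed

text \<open>The translation part of a cycle, multiplied by the slope accumulated before it, is the
  difference of two consecutive values of the perpetuity at visits, hence bounded. Taking logarithms
  bounds \<open>ln |B|\<close> of that cycle by the sum of the \<open>- ln |A|\<close> of the
  previous ones plus a random constant. Replacing these by their positive parts gives a walk with
  nonnegative steps, for which \<open>J_integral_finite\<close> applies to the independent
  cycles.\<close>

lemma contractive_J_integral:
  assumes fp: "fixed_point p K \<nu>" and lev0: "AE \<omega> in Q i. lev i \<omega> = 0"
  defines "X \<equiv> \<lambda>\<omega>. max 0 (- ln \<bar>fst (cycle i \<omega>)\<bar>)" and "Y \<equiv> \<lambda>\<omega>. log_plus \<bar>snd (cycle i \<omega>)\<bar>"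
  shows "Q.prob i {\<omega>. - ln \<bar>fst (cycle i \<omega>)\<bar> \<le> 0} < 1"
    "(\<integral>\<^sup>+\<omega>. ennreal (if Y \<omega> = 0 then 1 else Y \<omega> / (\<integral>\<omega>'. min (X \<omega>') (Y \<omega>) \<partial>Q i)) \<partial>Q i) < \<infinity>"
proof -
  define \<mu> where "\<mu> = distr (Q i) borel (cycle i)"
  define C where "C \<omega> k = cycle i ((cycle_shift i ^^ k) \<omega>)" for \<omega> and k :: nat
  have iid: "distr (Q i) (PiM UNIV (\<lambda>_. borel)) C = PiM UNIV (\<lambda>_::nat. \<mu>)"
    using cycle_iid[of i] by (simp add: C_def[abs_def] \<mu>_def)
  have \<mu>_prob: "prob_space \<mu>" unfolding \<mu>_def by (rule Q.prob_space_distr) measurable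
  interpret \<mu>: prob_space \<mu> by fact
  interpret \<mu>: sequence_space \<mu> ..
  have \<mu>_sets [measurable_cong]: "sets \<mu> = sets borel" by (simp add: \<mu>_def)
  have fs [measurable]: "(fst :: real \<times> real \<Rightarrow> real) \<in> borel_measurable borel" "(snd :: real \<times> real \<Rightarrow> real) \<in> borel_measurable borel"
    by (auto intro!: borel_measurable_continuous_onI continuous_intros)
  define x where "x z = max 0 (- ln \<bar>fst z\<bar>)" for z :: "real \<times> real"
  define y where "y z = log_plus \<bar>snd z\<bar>" for z :: "real \<times> real"
  have [measurable]: "x \<in> borel_measurable borel" "y \<in> borel_measurable borel"
    unfolding x_def y_def log_plus_def by measurable
  have xm: "x \<in> borel_measurable \<mu>" and ym: "y \<in> borel_measurable \<mu>" by measurable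
  have nonneg: "0 \<le> x z" "0 \<le> y z" for z by (simp_all add: x_def y_def log_plus_def)
  have [measurable]: "(cycle_shift i ^^ k) \<in> measurable path_space path_space" for k
    by (induction k) (auto simp: comp_def)
  have C_meas: "C \<in> measurable (Q i) (PiM UNIV (\<lambda>_. borel))"
  proof -
    have "(\<lambda>\<omega> k. C \<omega> k) \<in> measurable (Q i) (PiM UNIV (\<lambda>_. borel))"
    proof (rule measurable_PiM_single')
      show "(\<lambda>\<omega>. C \<omega> k) \<in> borel_measurable (Q i)" for k
        unfolding C_def by (rule measurable_compose[OF _ cycle_measurable]) measurable
    qed auto
    then show ?thesis by simp
  qed
  \<comment> \<open>Almost sure statements pass between the product space of the cycle law and the
    cycles of a path.\<close>
  have transfer: "(AE s in PiM UNIV (\<lambda>_::nat. \<mu>). R s) \<longleftrightarrow> (AE \<omega> in Q i. R (C \<omega>))"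
    if "Measurable.pred (PiM UNIV (\<lambda>_::nat. borel)) R" for R
  proof -
    have "{s \<in> space (PiM UNIV (\<lambda>_::nat. borel :: (real \<times> real) measure)). R s} \<in> sets (PiM UNIV (\<lambda>_. borel))"
      using that by (simp add: pred_def)
    then show ?thesis unfolding iid[symmetric] by (rule AE_distr_iff[OF C_meas])
  qed
  define PA where "PA \<omega> n = (\<Prod>k<n. fst (C \<omega> k))" for \<omega> n
  define ZA where "ZA \<omega> n = (\<Sum>k<n. PA \<omega> k * snd (C \<omega> k))" for \<omega> n
  have at: "AE \<omega> in Q i. \<forall>n. \<exists>t\<ge>n. st t \<omega> = i \<and> Pi_prod ca t \<omega> = PA \<omega> n \<and> perp_sum ca cb t \<omega> = ZA \<omega> n"
    using recurrent[where i = i and j = i] st_0[of i]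
    by eventually_elim (unfold PA_def ZA_def C_def, intro allI path_aff_at_cycles)
  \<comment> \<open>If almost no cycle contracts, \<open>|\<Pi>|\<close> stays at least 1 along the
    returns, contrary to the upper limit 0.\<close>
  have pos: "emeasure \<mu> {z\<in>space \<mu>. 0 < x z} > 0"
  proof (rule ccontr)
    assume "\<not> ?thesis"
    then have "AE z in \<mu>. \<not> 0 < x z"
      by (subst AE_iff_measurable[OF _ refl]) (auto simp: zero_less_iff_neq_zero)
    then have "AE s in PiM UNIV (\<lambda>_::nat. \<mu>). \<not> 0 < x (s k)" for k by (rule \<mu>.AE_component[OF UNIV_I])
    then have "AE s in PiM UNIV (\<lambda>_::nat. \<mu>). \<forall>k. \<not> 0 < x (s k)" by (simp add: AE_all_countable)
    moreover have "Measurable.pred (PiM UNIV (\<lambda>_::nat. borel)) (\<lambda>s. \<forall>k. \<not> 0 < x (s k))"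
      unfolding not_less by measurable
    ultimately have "AE \<omega> in Q i. \<forall>k. \<not> 0 < x (C \<omega> k)" using transfer by blast
    with at lev0 Pi_prod_nonzero[of i] have "AE \<omega> in Q i. False"
    proof eventually_elim
      case (elim \<omega>)
      have PAnz: "PA \<omega> n \<noteq> 0" for n using elim(1,3) by metis
      have nz: "fst (C \<omega> k) \<noteq> 0" for k
        using PAnz[of "Suc k"] by (auto simp: PA_def)
      have ge: "1 \<le> \<bar>fst (C \<omega> k)\<bar>" for k
      proof -
        have "\<not> 0 < - ln \<bar>fst (C \<omega> k)\<bar>" using elim(4) by (auto simp: x_def less_max_iff_disj)
        then show ?thesis using nz[of k] by (simp add: not_less)
      qed
      have "1 \<le> \<bar>PA \<omega> n\<bar>" for n
        unfolding PA_def abs_prod using ge by (intro prod_ge_1) auto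
      moreover obtain N where N: "\<forall>n\<ge>N. st n \<omega> = i \<longrightarrow> \<bar>Pi_prod ca n \<omega>\<bar> < 1" using lev_0D[OF elim(2), of 1] by auto
      moreover obtain t where "t \<ge> N" "st t \<omega> = i" "Pi_prod ca t \<omega> = PA \<omega> N" using elim(1) by metis
      ultimately show False by (metis not_le)
    qed
    then show False using Q.emeasure_space_1[of i] by (simp add: AE_iff_null null_sets_def)
  qed
  show "Q.prob i {\<omega>. - ln \<bar>fst (cycle i \<omega>)\<bar> \<le> 0} < 1"
  proof (rule ccontr)
    assume "\<not> ?thesis"
    then have "Q.prob i {\<omega>. - ln \<bar>fst (cycle i \<omega>)\<bar> \<le> 0} = 1" using Q.prob_le_1 by (metis antisym not_less)
    moreover have "{\<omega>. - ln \<bar>fst (cycle i \<omega>)\<bar> \<le> 0} \<in> sets (Q i)" unfolding sets_Q by (rule path_Collect) measurable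
    ultimately have "AE \<omega> in Q i. - ln \<bar>fst (cycle i \<omega>)\<bar> \<le> 0" by (subst (asm) Q.prob_eq_1) auto
    then have "AE z in \<mu>. \<not> 0 < x z"
      unfolding \<mu>_def by (subst AE_distr_iff) (auto simp: x_def)
    then have "emeasure \<mu> {z\<in>space \<mu>. 0 < x z} = 0"
      by (subst (asm) AE_iff_measurable[OF _ refl]) auto
    with pos show False by simp
  qed
  have bdd: "AE s in PiM UNIV (\<lambda>_::nat. \<mu>). \<exists>C. \<forall>n. y (s n) \<le> \<mu>.walk x n s + C"
  proof -
    have "AE \<omega> in Q i. \<exists>L::nat. \<forall>n. y (C \<omega> n) \<le> (\<Sum>k<n. x (C \<omega> k)) + real L"
      using at visits_bounded[OF fp lev0] Pi_prod_nonzero[of i]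
    proof eventually_elim
      case (elim \<omega>)
      obtain B :: nat where B: "\<And>n. st n \<omega> = i \<Longrightarrow> \<bar>perp_sum ca cb n \<omega>\<bar> \<le> real B" using elim(2) by blast
      have PAnz: "PA \<omega> n \<noteq> 0" for n using elim(1,3) by metis
      have nz: "fst (C \<omega> k) \<noteq> 0" for k
        using PAnz[of "Suc k"] by (auto simp: PA_def)
      have ZB: "\<bar>ZA \<omega> n\<bar> \<le> real B" for n using elim(1) B by metis
      \<comment> \<open>The summand 1 makes \<open>ln b\<close> nonnegative, which covers
        \<open>snd (C \<omega> n) = 0\<close> and the truncation in \<open>log_plus\<close>.\<close>
      define b where "b = 2 * real B + 1"
      have b: "1 \<le> b" by (simp add: b_def)
      obtain L :: nat where L: "ln b \<le> real L" using real_arch_simple by blast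
      have "y (C \<omega> n) \<le> (\<Sum>k<n. x (C \<omega> k)) + real L" for n
      proof -
        have s0: "0 \<le> (\<Sum>k<n. x (C \<omega> k))" using nonneg by (intro sum_nonneg) auto
        have "ln \<bar>snd (C \<omega> n)\<bar> \<le> (\<Sum>k<n. x (C \<omega> k)) + ln b"
        proof (cases "snd (C \<omega> n) = 0")
          case True then show ?thesis using s0 b by simp
        next
          case False
          have "PA \<omega> n * snd (C \<omega> n) = ZA \<omega> (Suc n) - ZA \<omega> n" by (simp add: ZA_def)
          then have "\<bar>PA \<omega> n\<bar> * \<bar>snd (C \<omega> n)\<bar> \<le> b"
            using ZB[of n] ZB[of "Suc n"] by (simp add: abs_mult[symmetric] b_def)
          then have "ln (\<bar>PA \<omega> n\<bar> * \<bar>snd (C \<omega> n)\<bar>) \<le> ln b" using False PAnz[of n] b by (subst ln_le_cancel_iff) auto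
          then have le: "ln \<bar>snd (C \<omega> n)\<bar> \<le> - ln \<bar>PA \<omega> n\<bar> + ln b" using False PAnz[of n] by (simp add: ln_mult)
          have "- ln \<bar>PA \<omega> n\<bar> = (\<Sum>k<n. - ln \<bar>fst (C \<omega> k)\<bar>)"
            unfolding PA_def abs_prod using nz by (subst ln_prod) (auto simp: sum_negf)
          also have "\<dots> \<le> (\<Sum>k<n. x (C \<omega> k))" by (intro sum_mono) (simp add: x_def)
          finally show ?thesis using le by linarith
        qed
        then show ?thesis using s0 L b by (simp add: y_def log_plus_def)
      qed
      then show ?case by blast
    qed
    moreover have "Measurable.pred (PiM UNIV (\<lambda>_::nat. borel)) (\<lambda>s. \<exists>L::nat. \<forall>n. y (s n) \<le> (\<Sum>k<n. x (s k)) + real L)"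
      unfolding not_less[symmetric] by measurable
    ultimately have "AE s in PiM UNIV (\<lambda>_::nat. \<mu>). \<exists>L::nat. \<forall>n. y (s n) \<le> (\<Sum>k<n. x (s k)) + real L"
      using transfer by blast
    then show ?thesis by eventually_elim (auto simp: \<mu>.walk_def[OF xm nonneg(1)])
  qed
  have J: "(\<integral>\<^sup>+z. ennreal (if y z = 0 then 1 else y z / (\<integral>w. min (x w) (y z) \<partial>\<mu>)) \<partial>\<mu>) < \<infinity>"
    by (rule \<mu>.J_integral_finite[OF xm nonneg(1) ym nonneg(2) pos bdd])
  have in_eq: "(\<integral>w. min (x w) u \<partial>\<mu>) = (\<integral>\<omega>'. min (X \<omega>') u \<partial>Q i)" for u
    unfolding \<mu>_def X_def by (subst integral_distr) (auto simp: x_def)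
  have meas: "(\<lambda>z. ennreal (if y z = 0 then 1 else y z / (\<integral>w. min (x w) (y z) \<partial>\<mu>))) \<in> borel_measurable borel"
  proof -
    have "(\<lambda>(z, w). min (x w) (y z)) \<in> borel_measurable (borel \<Otimes>\<^sub>M \<mu>)" by measurable
    from sigma_finite_measure.borel_measurable_lebesgue_integral[OF prob_space_imp_sigma_finite[OF \<mu>_prob] this]
    have [measurable]: "(\<lambda>z. \<integral>w. min (x w) (y z) \<partial>\<mu>) \<in> borel_measurable borel" .
    show ?thesis by measurable
  qed
  have "(\<integral>\<^sup>+z. ennreal (if y z = 0 then 1 else y z / (\<integral>w. min (x w) (y z) \<partial>\<mu>)) \<partial>\<mu>)
    = (\<integral>\<^sup>+\<omega>. ennreal (if y (cycle i \<omega>) = 0 then 1 else y (cycle i \<omega>) / (\<integral>w. min (x w) (y (cycle i \<omega>)) \<partial>\<mu>)) \<partial>Q i)"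
  proof -
    have "cycle i \<in> measurable (Q i) borel" by measurable
    from nn_integral_distr[OF this, of "\<lambda>z. ennreal (if y z = 0 then 1 else y z / (\<integral>w. min (x w) (y z) \<partial>\<mu>))"]
    show ?thesis using meas by (simp add: \<mu>_def[symmetric])
  qed
  moreover have Y_eq: "Y = (\<lambda>\<omega>. y (cycle i \<omega>))" by (simp add: y_def Y_def fun_eq_iff)
  ultimately show "(\<integral>\<^sup>+\<omega>. ennreal (if Y \<omega> = 0 then 1 else Y \<omega> / (\<integral>\<omega>'. min (X \<omega>') (Y \<omega>) \<partial>Q i)) \<partial>Q i) < \<infinity>"
    using J unfolding in_eq Y_eq by simp
qed

end


subsection \<open>The four cases\<close>

text \<open>The identity, the linear part and the modulus of the linear part are homomorphisms. With
  them one coboundary argument serves for cycles that are trivial, have slope 1, or are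
  isometries.\<close>

definition aff_hom :: "(real \<times> real \<Rightarrow> real \<times> real) \<Rightarrow> bool" where
  "aff_hom H \<longleftrightarrow> H \<in> borel_measurable borel \<and> H (1, 0) = (1, 0) \<and> (\<forall>u v. H (aff u v) = aff (H u) (H v))"

lemma aff_hom_id: "aff_hom (\<lambda>u. u)"
  by (simp add: aff_hom_def)

lemma aff_hom_linear: "aff_hom (\<lambda>u. (fst u, 0))" and aff_hom_abs: "aff_hom (\<lambda>u. (\<bar>fst u\<bar>, 0))"
proof -
  have "(\<lambda>u :: real \<times> real. (fst u, 0 :: real)) \<in> borel_measurable borel"
    "(\<lambda>u :: real \<times> real. (\<bar>fst u\<bar>, 0 :: real)) \<in> borel_measurable borel"
    by (intro borel_measurable_continuous_onI continuous_intros)+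
  then show "aff_hom (\<lambda>u. (fst u, 0))" "aff_hom (\<lambda>u. (\<bar>fst u\<bar>, 0))"
    by (simp_all add: aff_hom_def aff_def abs_mult)
qed

lemma distr_affine_affine:
  assumes "sets L = sets borel"
  shows "distr (distr L borel (\<lambda>x :: real. a * x + b)) borel (\<lambda>x. c * x + d) = distr L borel (\<lambda>x. (c * a) * x + (c * b + d))"
proof -
  have [measurable_cong]: "sets L = sets borel" by fact
  show ?thesis by (subst distr_distr) (auto simp: comp_def algebra_simps)
qed

text \<open>The composition of reflections at c and at d is the translation by
  \<open>2 * d - 2 * c\<close>, which would preserve the law.\<close>

lemma reflection_center_unique:
  assumes L: "prob_space L" "sets L = sets borel"
    and "distr L borel (\<lambda>x. (- 1) * x + 2 * c) = L" "distr L borel (\<lambda>x. (- 1) * x + 2 * d) = L"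
  shows "c = (d :: real)"
proof -
  have "distr L borel (\<lambda>x. x + (2 * d - 2 * c)) = L"
    using distr_affine_affine[OF L(2), of "- 1" "2 * c" "- 1" "2 * d"] assms by (simp add: algebra_simps)
  then have "2 * d - 2 * c = 0" by (rule translation_invariant_prob[OF L])
  then show ?thesis by simp
qed

section \<open>Loops, cycles and coboundaries\<close>

context path_chain begin

lemma AE_shift_at:
  assumes R: "AE \<omega> in Q i. R \<omega>"
  shows "AE \<omega> in Q j. st n \<omega> = i \<longrightarrow> R (shift n \<omega>)"
proof -
  have "AE \<omega> in Q k. st 0 \<omega> = i \<longrightarrow> R \<omega>" for k
  proof (cases "k = i")
    case True then show ?thesis using R by (auto elim: eventually_mono)
  next
    case False then show ?thesis using st_0[of k] by (auto elim: eventually_mono)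
  qed
  from AE_shift_any[OF this, of n j] show ?thesis by (simp add: st_shift)
qed

text \<open>Strong induction on the length of the loop: removing the first cycle leaves a shorter
  loop at i, which is trivial from every start by the Markov property.\<close>

lemma cycle_loops:
  assumes H: "aff_hom H" and cyc: "AE \<omega> in Q i. H (cycle i \<omega>) = (1, 0)"
  shows "AE \<omega> in Q i. st n \<omega> = i \<longrightarrow> H (path_aff n \<omega>) = (1, 0)"
proof (induction n rule: less_induct)
  case (less n)
  have H1: "H (1, 0) = (1, 0)" and hom: "\<And>u v. H (aff u v) = aff (H u) (H v)" using H by (auto simp: aff_hom_def)
  show ?case
  proof (cases "n = 0")
    case True then show ?thesis using H1 by (simp add: path_aff_def)
  next
    case False
    have "AE \<omega> in Q i. \<forall>k. 0 < k \<and> k \<le> n \<longrightarrow> st k \<omega> = i \<longrightarrow> st (n - k) (shift k \<omega>) = i \<longrightarrow> H (path_aff (n - k) (shift k \<omega>)) = (1, 0)"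
      unfolding AE_all_countable
    proof
      fix k
      show "AE \<omega> in Q i. 0 < k \<and> k \<le> n \<longrightarrow> st k \<omega> = i \<longrightarrow> st (n - k) (shift k \<omega>) = i \<longrightarrow> H (path_aff (n - k) (shift k \<omega>)) = (1, 0)"
      proof (cases "0 < k \<and> k \<le> n")
        case True
        then have "n - k < n" by auto
        from AE_shift_at[OF less[OF this], of k i] show ?thesis by (auto elim: eventually_mono)
      qed auto
    qed
    with cyc recurrent[where i = i and j = i] show ?thesis
    proof eventually_elim
      case (elim \<omega>)
      show ?case
      proof
        assume n: "st n \<omega> = i"
        define T where "T = visit_time i 1 \<omega>"
        note vt = visit_time[OF elim(2), of 1, folded T_def]
        have Tn: "T \<le> n" using vt(3) n False by (auto simp: first_visit_def not_less[symmetric])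
        have "H (path_aff T \<omega>) = (1, 0)" using elim(1) by (simp add: cycle_def T_def)
        moreover have "H (path_aff (n - T) (shift T \<omega>)) = (1, 0)"
          using elim(3) vt Tn n by (simp add: st_shift)
        moreover have "path_aff n \<omega> = aff (path_aff T \<omega>) (path_aff (n - T) (shift T \<omega>))"
          using path_aff_shift[of T "n - T" \<omega>] Tn by simp
        moreover have "aff (1, 0) (1, 0) = (1, 0)" by (simp add: aff_def)
        ultimately show "H (path_aff n \<omega>) = (1, 0)" by (metis hom)
      qed
    qed
  qed
qed

lemma loops_coboundary:
  assumes H: "aff_hom H" and loop: "\<And>n. AE \<omega> in Q i. st n \<omega> = i \<longrightarrow> H (path_aff n \<omega>) = (1, 0)"
  obtains g where "\<And>j. fst (g j) \<noteq> 0" "\<And>j. AE \<omega> in Q j. \<forall>n. g (st n \<omega>) = aff (g j) (H (path_aff n \<omega>))"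
proof -
  have "H \<in> borel_measurable borel" "\<And>u v. H (aff u v) = aff (H u) (H v)" using H by (auto simp: aff_hom_def)
  from loops_trivial_coboundary[OF this loop] that show ?thesis by blast
qed

text \<open>With \<open>cycle_loops\<close> and \<open>loops_coboundary\<close> this carries
  triviality of the cycle maps from one state to all states.\<close>

lemma coboundary_cycle:
  assumes nz: "\<And>j. fst (g j) \<noteq> 0" and g: "\<And>j. AE \<omega> in Q j. \<forall>n. g (st n \<omega>) = aff (g j) (H (path_aff n \<omega>))"
  shows "AE \<omega> in Q j. H (cycle j \<omega>) = (1, 0)"
  using g[of j] recurrent[where i = j and j = j]
proof eventually_elim
  case (elim \<omega>)
  have "g j = aff (g j) (H (cycle j \<omega>))"
    using elim(1) visit_time(2)[OF elim(2), of 1] unfolding cycle_def by metis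
  then show ?case using nz[of j] by (auto simp: aff_def prod_eq_iff)
qed

lemma abs_coboundary:
  assumes loop: "\<And>n. AE \<omega> in Q i. st n \<omega> = i \<longrightarrow> \<bar>Pi_prod ca n \<omega>\<bar> = 1"
  obtains \<alpha> :: "'s \<Rightarrow> real" where "\<And>j. 0 < \<alpha> j" "\<And>j. AE \<omega> in Q j. \<forall>n. \<alpha> (st n \<omega>) = \<alpha> j * \<bar>Pi_prod ca n \<omega>\<bar>"
proof -
  have "AE \<omega> in Q i. st n \<omega> = i \<longrightarrow> (\<bar>fst (path_aff n \<omega>)\<bar>, 0) = (1, 0 :: real)" for n
    using loop[of n] by (simp add: path_aff_def)
  from loops_coboundary[OF aff_hom_abs this] obtain g where nz: "\<And>j. fst (g j) \<noteq> 0"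
    and g: "\<And>j. AE \<omega> in Q j. \<forall>n. g (st n \<omega>) = aff (g j) (\<bar>fst (path_aff n \<omega>)\<bar>, 0)" by blast
  show ?thesis
  proof
    show "0 < \<bar>fst (g j)\<bar>" for j using nz[of j] by simp
    show "AE \<omega> in Q j. \<forall>n. \<bar>fst (g (st n \<omega>))\<bar> = \<bar>fst (g j)\<bar> * \<bar>Pi_prod ca n \<omega>\<bar>" for j
      using g[of j] by eventually_elim (simp add: aff_def path_aff_def abs_mult)
  qed
qed

lemma abs_coboundary_lev:
  assumes \<alpha>: "\<And>j. 0 < \<alpha> j" "\<And>j. AE \<omega> in Q j. \<forall>n. \<alpha> (st n \<omega>) = \<alpha> j * \<bar>Pi_prod ca n \<omega>\<bar>"
  shows "AE \<omega> in Q j. lev i \<omega> \<noteq> \<infinity>"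
  using \<alpha>(2)[of j]
proof eventually_elim
  case (elim \<omega>)
  have "\<bar>Pi_prod ca n \<omega>\<bar> = \<alpha> i / \<alpha> j" if "st n \<omega> = i" for n
    using elim[rule_format, of n] that \<alpha>(1)[of j] by (simp add: field_simps)
  then have "\<not> (\<exists>n. st n \<omega> = i \<and> \<alpha> i / \<alpha> j < \<bar>Pi_prod ca n \<omega>\<bar>)" by auto
  then show ?case using lev_topD[of i \<omega> "\<alpha> i / \<alpha> j"] by auto
qed

lemma AE_nontrivial: "\<not> (AE \<omega> in Q i. False)"
  using Q.emeasure_space_1[of i] by (simp add: AE_iff_null null_sets_def)

text \<open>Some path of fixed length m leads from i to i' with \<open>|\<Pi>|\<close> above
  \<open>1 / (r + 1)\<close> and has probability \<delta> > 0. Started at a visit to i where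
  \<open>|\<Pi>|\<close> exceeds r + 1, it ends at a visit to i' where \<open>|\<Pi>|\<close>
  exceeds 1. As such starts occur after every time N, visits of the second kind recur infinitely
  often with probability at least \<delta>.\<close>

lemma lev_top_not_0:
  assumes top: "\<And>j. AE \<omega> in Q j. lev i \<omega> = \<infinity>" and zero: "\<And>j. AE \<omega> in Q j. lev i' \<omega> = 0"
  shows False
proof -
  obtain m where m: "emeasure (Q i) {\<omega>. st m \<omega> = i'} > 0" using reach by blast
  have "\<exists>r::nat. emeasure (Q i) {\<omega>. st m \<omega> = i' \<and> 1 / real (Suc r) < \<bar>Pi_prod ca m \<omega>\<bar>} > 0"
  proof (rule ccontr)
    assume "\<not> ?thesis"
    then have z: "emeasure (Q i) {\<omega>. st m \<omega> = i' \<and> 1 / real (Suc r) < \<bar>Pi_prod ca m \<omega>\<bar>} = 0" for r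
      by (simp add: zero_less_iff_neq_zero)
    have "AE \<omega> in Q i. \<not> (st m \<omega> = i' \<and> 1 / real (Suc r) < \<bar>Pi_prod ca m \<omega>\<bar>)" for r
    proof (rule AE_I')
      show "{\<omega>. st m \<omega> = i' \<and> 1 / real (Suc r) < \<bar>Pi_prod ca m \<omega>\<bar>} \<in> null_sets (Q i)"
        using z[of r] by (auto simp: null_sets_def sets_Q intro!: path_Collect)
    qed auto
    then have "AE \<omega> in Q i. \<forall>r. \<not> (st m \<omega> = i' \<and> 1 / real (Suc r) < \<bar>Pi_prod ca m \<omega>\<bar>)"
      unfolding AE_all_countable by blast
    with Pi_prod_nonzero[of i] have "AE \<omega> in Q i. st m \<omega> = i' \<longrightarrow> False"
    proof eventually_elim
      case (elim \<omega>)
      then have "0 < \<bar>Pi_prod ca m \<omega>\<bar>" by simp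
      then obtain r where "1 / real (Suc r) < \<bar>Pi_prod ca m \<omega>\<bar>"
        using reals_Archimedean by (metis inverse_eq_divide)
      with elim(2) show ?case by blast
    qed
    from AE_hit[OF this m] show False .
  qed
  then obtain r :: nat where r: "emeasure (Q i) {\<omega>. st m \<omega> = i' \<and> 1 / real (Suc r) < \<bar>Pi_prod ca m \<omega>\<bar>} > 0" by blast
  define B where "B = {\<omega>. st m \<omega> = i' \<and> 1 / real (Suc r) < \<bar>Pi_prod ca m \<omega>\<bar>}"
  have B [measurable]: "B \<in> sets path_space" unfolding B_def by (rule path_Collect) measurable
  define \<delta> where "\<delta> = Q.prob i B"
  have \<delta>: "0 < \<delta>" using r by (simp add: \<delta>_def B_def Q.emeasure_eq_measure)
  define V where "V N = {\<omega>. \<exists>n\<ge>N. st n \<omega> = i' \<and> 1 < \<bar>Pi_prod ca n \<omega>\<bar>}" for N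
  have V [measurable]: "V N \<in> sets path_space" for N unfolding V_def by (rule path_Collect) measurable
  have VN: "\<delta> \<le> Q.prob i (V N)" for N
  proof -
    \<comment> \<open>The first time with property \<open>L\<close> is the stopping time at which
      the connecting path is attached.\<close>
    define L where "L \<omega> n \<longleftrightarrow> N \<le> n \<and> st n \<omega> = i \<and> real (Suc r) < \<bar>Pi_prod ca n \<omega>\<bar>" for \<omega> and n
    define D where "D n = {\<omega>. L \<omega> n \<and> (\<forall>k<n. \<not> L \<omega> k)}" for n
    have Lset: "{\<omega> \<in> space (hist n). L \<omega> k} \<in> sets (hist n)" if "k \<le> n" for k n
    proof -
      note [measurable] = Pi_prod_hist[OF that] st_hist[OF that]
      show ?thesis unfolding L_def by measurable
    qed
    have D: "D n \<in> sets (hist n)" for n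
    proof -
      have "D n = {\<omega>\<in>space (hist n). L \<omega> n \<and> (\<forall>k\<in>{..<n}. \<not> L \<omega> k)}" by (auto simp: D_def)
      also have "\<dots> \<in> sets (hist n)"
        by (intro sets.sets_Collect_conj sets.sets_Collect_finite_All sets.sets_Collect_neg Lset) auto
      finally show ?thesis .
    qed
    have D' [measurable]: "D n \<in> sets path_space" for n using D by (rule hist_le_path_space)
    have disj: "disjoint_family D"
      unfolding disjoint_family_on_def D_def by (auto, metis linorder_neqE_nat)
    have "AE \<omega> in Q i. \<omega> \<in> (\<Union>n. D n)"
      using top[of i] recurrent[where i = i and j = i]
    proof eventually_elim
      case (elim \<omega>)
      have "\<exists>n. L \<omega> n"
      proof -
        \<comment> \<open>Exceeding all products up to time N forces the visit to come later than
          N.\<close>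
        define M where "M = Max ((\<lambda>n. \<bar>Pi_prod ca n \<omega>\<bar>) ` {..N})"
        obtain n where n: "st n \<omega> = i" "max M (real (Suc r)) < \<bar>Pi_prod ca n \<omega>\<bar>" using lev_topD[OF elim(1)] by blast
        have "\<not> n \<le> N"
        proof
          assume "n \<le> N"
          then have "\<bar>Pi_prod ca n \<omega>\<bar> \<le> M" unfolding M_def by (intro Max_ge) auto
          with n show False by simp
        qed
        with n show ?thesis unfolding L_def by (intro exI[of _ n]) auto
      qed
      from LeastI_ex[OF this] not_less_Least[of _ "L \<omega>"] show ?case unfolding D_def by blast
    qed
    then have "emeasure (Q i) (\<Union>n. D n) = 1" by (subst Q.emeasure_eq_1_AE) (auto simp: sets_Q)
    moreover have "emeasure (Q i) (\<Union>n. D n \<inter> shift n -` B) = emeasure (Q i) (\<Union>n. D n) * emeasure (Q i) B"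
      by (rule strong_markov[OF D _ disj B]) (auto simp: D_def L_def)
    ultimately have "\<delta> = Q.prob i (\<Union>n. D n \<inter> shift n -` B)" by (simp add: \<delta>_def Q.emeasure_eq_measure)
    also have "\<dots> \<le> Q.prob i (V N)"
    proof (rule Q.finite_measure_mono)
      show "(\<Union>n. D n \<inter> shift n -` B) \<subseteq> V N"
      proof
        fix \<omega> assume "\<omega> \<in> (\<Union>n. D n \<inter> shift n -` B)"
        then obtain n where n: "L \<omega> n" "shift n \<omega> \<in> B" by (auto simp: D_def)
        have "1 = real (Suc r) * (1 / real (Suc r))" by simp
        also have "\<dots> < \<bar>Pi_prod ca n \<omega>\<bar> * \<bar>Pi_prod ca m (shift n \<omega>)\<bar>"
          using n by (intro mult_strict_mono) (auto simp: L_def B_def intro: order_less_trans[of 0 "real (Suc r)"])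
        finally have "1 < \<bar>Pi_prod ca (n + m) \<omega>\<bar>" by (simp add: Pi_prod_shift abs_mult)
        moreover have "st (n + m) \<omega> = i'" using n by (simp add: B_def st_shift)
        ultimately show "\<omega> \<in> V N" using n by (auto simp: V_def L_def intro!: exI[of _ "n + m"])
      qed
    qed (auto simp: sets_Q)
    finally show ?thesis .
  qed
  have "(\<lambda>N. Q.prob i (V N)) \<longlonglongrightarrow> Q.prob i (\<Inter>N. V N)"
  proof (rule Q.finite_Lim_measure_decseq)
    show "decseq V" unfolding V_def by (rule antimonoI) (use order_trans in blast)
  qed (auto simp: sets_Q)
  then have "\<delta> \<le> Q.prob i (\<Inter>N. V N)" using VN by (intro LIMSEQ_le_const) auto
  moreover have "Q.prob i (\<Inter>N. V N) = 0"
  proof -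
    have "AE \<omega> in Q i. \<omega> \<notin> (\<Inter>N. V N)"
      using zero[of i]
    proof eventually_elim
      case (elim \<omega>)
      obtain N where "\<forall>n\<ge>N. st n \<omega> = i' \<longrightarrow> \<bar>Pi_prod ca n \<omega>\<bar> < 1" using lev_0D[OF elim, of 1] by auto
      then show ?case by (force simp: V_def)
    qed
    then show ?thesis by (subst Q.prob_eq_0) (auto simp: sets_Q)
  qed
  ultimately show False using \<delta> by simp
qed

text \<open>Scaling the law in state j by \<open>\<alpha> j\<close> turns the slope into
  \<open>\<alpha> M_0 * A / \<alpha> M_1\<close>, which has modulus 1.
  \<open>isometric_fixed_point\<close> applies to the scaled kernel, and its conclusion is scaled
  back.\<close>

lemma isometric_step:
  assumes fp: "fixed_point p K \<nu>" and \<alpha>: "\<And>j. 0 < \<alpha> j" "\<And>j. AE \<omega> in Q j. \<forall>n. \<alpha> (st n \<omega>) = \<alpha> j * \<bar>Pi_prod ca n \<omega>\<bar>"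
  shows "AE \<omega> in Q j. distr (\<nu> (st 1 \<omega>)) borel (\<lambda>x. ca 1 \<omega> * x + cb 1 \<omega>) = \<nu> j"
proof -
  have \<nu>: "\<nu> \<in> prob_kernels" using fp by (simp add: fixed_point_def)
  note D = prob_kernelsD[OF \<nu>]
  have mm: "(\<lambda>x. a * x + c) \<in> measurable (\<nu> j) borel" for a c j
    unfolding measurable_cong_sets[OF D(2) refl] by measurable
  have \<alpha>1: "AE \<omega> in Q j. \<alpha> (st 1 \<omega>) = \<alpha> j * \<bar>ca 1 \<omega>\<bar>" for j
    using \<alpha>(2)[of j] by eventually_elim (auto dest: spec[of _ 1] simp: Pi_prod_Suc)
  define \<nu>' where "\<nu>' j = distr (\<nu> j) borel (\<lambda>x. \<alpha> j * x + 0)" for j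
  have \<nu>': "\<nu>' \<in> prob_kernels"
  proof -
    have "prob_space (\<nu>' j)" for j unfolding \<nu>'_def by (rule prob_space.prob_space_distr[OF D(1) mm])
    then show ?thesis unfolding prob_kernels_def by (auto simp: space_prob_algebra \<nu>'_def)
  qed
  define e where "e \<omega> = \<alpha> (st 0 \<omega>) * ca 1 \<omega> / \<alpha> (st 1 \<omega>)" for \<omega>
  define b where "b \<omega> = \<alpha> (st 0 \<omega>) * cb 1 \<omega>" for \<omega>
  have \<alpha>m: "(\<lambda>\<omega>. \<alpha> (st n \<omega>)) \<in> borel_measurable path_space" for n
    by (rule measurable_compose[OF st_measurable]) simp
  note \<alpha>m[measurable]
  have eb [measurable]: "e \<in> borel_measurable path_space" "b \<in> borel_measurable path_space" unfolding e_def b_def by measurable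
  have iso: "AE \<omega> in Q j. \<bar>e \<omega>\<bar> = 1" for j
    using \<alpha>1[of j] st_0[of j]
  proof eventually_elim
    case (elim \<omega>)
    have "0 < \<alpha> (st 1 \<omega>)" by (rule \<alpha>(1))
    with elim have "ca 1 \<omega> \<noteq> 0" by auto
    then show ?case using elim \<alpha>(1)[of j] by (simp add: e_def abs_mult)
  qed
  have \<nu>'_mass: "emeasure (\<nu>' k) E = emeasure (\<nu> k) {x. \<alpha> k * x \<in> E}" if "E \<in> sets borel" for E k
    unfolding \<nu>'_def using mm[of "\<alpha> k" 0 k] that by (subst emeasure_distr) (auto simp: D(3) vimage_def)
  have fix_eq: "(\<integral>\<^sup>+\<omega>. emeasure (\<nu>' (st 1 \<omega>)) {x. e \<omega> * x + b \<omega> \<in> E} \<partial>Q j) = emeasure (\<nu>' j) E"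
    if E: "E \<in> sets borel" for j E
  proof -
    have E': "{y. \<alpha> j * y \<in> E} \<in> sets borel" using affine_preimage_borel[OF E, of "\<alpha> j" 0] by simp
    have "(\<integral>\<^sup>+\<omega>. emeasure (\<nu>' (st 1 \<omega>)) {x. e \<omega> * x + b \<omega> \<in> E} \<partial>Q j)
      = (\<integral>\<^sup>+\<omega>. emeasure (\<nu> (st 1 \<omega>)) {x. ca 1 \<omega> * x + cb 1 \<omega> \<in> {y. \<alpha> j * y \<in> E}} \<partial>Q j)"
      using st_0[of j]
    proof (intro nn_integral_cong_AE, eventually_elim)
      case (elim \<omega>)
      have nz: "\<alpha> (st 1 \<omega>) \<noteq> 0" using \<alpha>(1)[of "st 1 \<omega>"] by simp
      have eq: "e \<omega> * (\<alpha> (st 1 \<omega>) * x) + b \<omega> = \<alpha> j * (ca 1 \<omega> * x + cb 1 \<omega>)" for x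
        using nz elim by (simp add: e_def b_def distrib_left)
      have "emeasure (\<nu>' (st 1 \<omega>)) {x. e \<omega> * x + b \<omega> \<in> E} = emeasure (\<nu> (st 1 \<omega>)) {x. e \<omega> * (\<alpha> (st 1 \<omega>) * x) + b \<omega> \<in> E}"
        by (subst \<nu>'_mass[OF affine_preimage_borel[OF E]]) simp
      then show ?case unfolding eq by simp
    qed
    also have "\<dots> = emeasure (\<nu>' j) E" unfolding fixed_point_step[OF fp E'] \<nu>'_mass[OF E] ..
    finally show ?thesis .
  qed
  have "AE \<omega> in Q j. distr (\<nu>' (st 1 \<omega>)) borel (\<lambda>x. e \<omega> * x + b \<omega>) = \<nu>' j"
    by (rule isometric_fixed_point[OF \<nu>' eb iso fix_eq])
  with st_0[of j] show ?thesis
  proof eventually_elim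
    case (elim \<omega>)
    have nz: "\<alpha> (st 1 \<omega>) \<noteq> 0" "\<alpha> j \<noteq> 0" using \<alpha>(1)[of "st 1 \<omega>"] \<alpha>(1)[of j] by simp_all
    have "\<nu> j = distr (\<nu>' j) borel (\<lambda>x. (1 / \<alpha> j) * x + 0)"
      unfolding \<nu>'_def distr_affine_affine[OF D(2)] using nz distr_id2[OF D(2)[of j, symmetric]] by simp
    also have "\<dots> = distr (distr (\<nu>' (st 1 \<omega>)) borel (\<lambda>x. e \<omega> * x + b \<omega>)) borel (\<lambda>x. (1 / \<alpha> j) * x + 0)"
      unfolding elim(2) ..
    also have "\<dots> = distr (\<nu> (st 1 \<omega>)) borel (\<lambda>x. ca 1 \<omega> * x + cb 1 \<omega>)"
    proof -
      have s: "sets (\<nu>' (st 1 \<omega>)) = sets borel" by (simp add: \<nu>'_def)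
      have "(1 / \<alpha> j * e \<omega>) * \<alpha> (st 1 \<omega>) = ca 1 \<omega>" "1 / \<alpha> j * b \<omega> = cb 1 \<omega>"
        using nz elim(1) by (simp_all add: e_def b_def)
      then show ?thesis
        unfolding distr_affine_affine[OF s] unfolding \<nu>'_def distr_affine_affine[OF D(2)] by simp
    qed
    finally show ?case ..
  qed
qed

lemma isometric_iterate:
  assumes fp: "fixed_point p K \<nu>" and \<alpha>: "\<And>j. 0 < \<alpha> j" "\<And>j. AE \<omega> in Q j. \<forall>n. \<alpha> (st n \<omega>) = \<alpha> j * \<bar>Pi_prod ca n \<omega>\<bar>"
  shows "AE \<omega> in Q j. \<forall>n. distr (\<nu> (st n \<omega>)) borel (\<lambda>x. Pi_prod ca n \<omega> * x + perp_sum ca cb n \<omega>) = \<nu> j"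
proof -
  have \<nu>: "\<nu> \<in> prob_kernels" using fp by (simp add: fixed_point_def)
  note D = prob_kernelsD[OF \<nu>]
  have "AE \<omega> in Q j. distr (\<nu> (st 1 \<omega>)) borel (\<lambda>x. ca 1 \<omega> * x + cb 1 \<omega>) = \<nu> (st 0 \<omega>)" for j
    using isometric_step[OF fp \<alpha>, of j] st_0[of j] by eventually_elim simp
  from AE_shift_any[OF this]
  have "AE \<omega> in Q j. \<forall>n. distr (\<nu> (st (Suc n) \<omega>)) borel (\<lambda>x. ca (Suc n) \<omega> * x + cb (Suc n) \<omega>) = \<nu> (st n \<omega>)"
    unfolding AE_all_countable by (simp add: st_shift ca_shift cb_shift)
  with st_0[of j] show ?thesis
  proof eventually_elim
    case (elim \<omega>)
    have "distr (\<nu> (st n \<omega>)) borel (\<lambda>x. Pi_prod ca n \<omega> * x + perp_sum ca cb n \<omega>) = \<nu> j" for n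
    proof (induction n)
      case 0 then show ?case using elim(1) distr_id2[OF D(2)[of j, symmetric]] by simp
    next
      case (Suc n)
      have "distr (\<nu> (st (Suc n) \<omega>)) borel (\<lambda>x. Pi_prod ca (Suc n) \<omega> * x + perp_sum ca cb (Suc n) \<omega>)
        = distr (distr (\<nu> (st (Suc n) \<omega>)) borel (\<lambda>x. ca (Suc n) \<omega> * x + cb (Suc n) \<omega>)) borel (\<lambda>x. Pi_prod ca n \<omega> * x + perp_sum ca cb n \<omega>)"
        unfolding distr_affine_affine[OF D(2)] by (simp add: Pi_prod_Suc perp_sum_Suc add.commute)
      then show ?case using elim(2) Suc by simp
    qed
    then show ?case ..
  qed
qed

lemma isometric_cycle:
  assumes fp: "fixed_point p K \<nu>" and cyc: "\<And>i. AE \<omega> in Q i. \<bar>fst (cycle i \<omega>)\<bar> = 1"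
  shows "AE \<omega> in Q i. distr (\<nu> i) borel (\<lambda>x. fst (cycle i \<omega>) * x + snd (cycle i \<omega>)) = \<nu> i"
proof -
  have "AE \<omega> in Q i. (\<bar>fst (cycle i \<omega>)\<bar>, 0) = (1, 0 :: real)" using cyc by simp
  from cycle_loops[OF aff_hom_abs this] obtain \<alpha> :: "'s \<Rightarrow> real" where
    \<alpha>: "\<And>j. 0 < \<alpha> j" "\<And>j. AE \<omega> in Q j. \<forall>n. \<alpha> (st n \<omega>) = \<alpha> j * \<bar>Pi_prod ca n \<omega>\<bar>"
    using abs_coboundary[of i] by (auto simp: path_aff_def)
  from isometric_iterate[OF fp \<alpha>, of i] recurrent[where i = i and j = i] show ?thesis
  proof eventually_elim
    case (elim \<omega>)
    show ?case using elim(1)[rule_format, of "visit_time i 1 \<omega>"] visit_time(2)[OF elim(2), of 1]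
      by (simp add: cycle_def path_aff_def)
  qed
qed

text \<open>If \<open>|\<Pi>| = 1\<close> at all visits to one state, the cycles at all states are
  isometries; if those of one state have slope 1, so do all, and they are translations that preserve
  the fixed point, hence identities. Otherwise the trichotomy leaves the upper limits 0 and
  infinity, and these cannot be mixed.\<close>

lemma four_cases:
  assumes fp: "fixed_point p K \<nu>"
  obtains (contractive) "\<And>i j. AE \<omega> in Q j. lev i \<omega> = 0"
  | (unbounded) "\<And>i j. AE \<omega> in Q j. lev i \<omega> = \<infinity>"
  | (reflection) "\<And>i. AE \<omega> in Q i. \<bar>fst (cycle i \<omega>)\<bar> = 1" "\<And>i. \<not> (AE \<omega> in Q i. fst (cycle i \<omega>) = 1)"
  | (identity) "\<And>i. AE \<omega> in Q i. cycle i \<omega> = (1, 0)"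
proof (cases "\<exists>i. \<forall>n. AE \<omega> in Q i. st n \<omega> = i \<longrightarrow> \<bar>Pi_prod ca n \<omega>\<bar> = 1")
  case True
  then obtain i where i: "\<And>n. AE \<omega> in Q i. st n \<omega> = i \<longrightarrow> (\<bar>fst (path_aff n \<omega>)\<bar>, 0) = (1, 0 :: real)"
    by (auto simp: path_aff_def)
  obtain g where g: "\<And>j. fst (g j) \<noteq> 0" "\<And>j. AE \<omega> in Q j. \<forall>n. g (st n \<omega>) = aff (g j) (\<bar>fst (path_aff n \<omega>)\<bar>, 0)"
    using loops_coboundary[OF aff_hom_abs i] by blast
  have cyc: "AE \<omega> in Q j. \<bar>fst (cycle j \<omega>)\<bar> = 1" for j
    using coboundary_cycle[OF g, where j = j] by simp
  show ?thesis
  proof (cases "\<exists>j. AE \<omega> in Q j. fst (cycle j \<omega>) = 1")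
    case False then show ?thesis using reflection cyc by blast
  next
    case True
    then obtain j where "AE \<omega> in Q j. (fst (cycle j \<omega>), 0) = (1, 0 :: real)" by auto
    from loops_coboundary[OF aff_hom_linear cycle_loops[OF aff_hom_linear this]]
    obtain h where h: "\<And>j. fst (h j) \<noteq> 0" "\<And>j. AE \<omega> in Q j. \<forall>n. h (st n \<omega>) = aff (h j) (fst (path_aff n \<omega>), 0)" by blast
    have "AE \<omega> in Q k. cycle k \<omega> = (1, 0)" for k
      using coboundary_cycle[OF h, where j = k] isometric_cycle[OF fp cyc, of k]
    proof eventually_elim
      case (elim \<omega>)
      have "\<nu> \<in> prob_kernels" using fp by (simp add: fixed_point_def)
      then have "snd (cycle k \<omega>) = 0"
        using translation_invariant_prob[OF prob_kernelsD(1)[of \<nu> k] prob_kernelsD(2)[of \<nu> k]] elim by auto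
      with elim(1) show ?case by (simp add: prod_eq_iff)
    qed
    then show ?thesis by (rule identity)
  qed
next
  case False
  then have dich: "(\<forall>j. AE \<omega> in Q j. lev i \<omega> = 0) \<or> (\<forall>j. AE \<omega> in Q j. lev i \<omega> = \<infinity>)" for i
    using trichotomy[of i] by blast
  show ?thesis
  proof (cases "\<exists>i. \<forall>j. AE \<omega> in Q j. lev i \<omega> = \<infinity>")
    case True
    then have "\<forall>j. AE \<omega> in Q j. lev i \<omega> = \<infinity>" for i using dich[of i] lev_top_not_0 by blast
    then show ?thesis using unbounded by blast
  next
    case False then show ?thesis using dich contractive by blast
  qed
qed

end


subsection \<open>The structure of fixed points\<close>

context path_chain begin

lemma sets_Psi1: "\<nu> \<in> prob_kernels \<Longrightarrow> sets (Psi1 p K \<nu> i) = sets borel"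
  unfolding Psi1_def by (rule sets_bind) auto

lemma edge_prob: "j \<in> set_pmf (p i) \<Longrightarrow> emeasure (Q i) {\<omega>. st 1 \<omega> = j} > 0"
  unfolding emeasure_st by (simp add: bind_return_pmf set_pmf_iff pmf_positive)

text \<open>Some cycle has slope -1 and also preserves \<open>\<nu> i\<close>. Such a map
  \<open>x \<mapsto> - x + b\<close> is the reflection at \<open>b / 2\<close>.\<close>

lemma reflection_center:
  assumes fp: "fixed_point p K \<nu>" and cyc: "\<And>i. AE \<omega> in Q i. \<bar>fst (cycle i \<omega>)\<bar> = 1"
    and flip: "\<And>i. \<not> (AE \<omega> in Q i. fst (cycle i \<omega>) = 1)"
  shows "\<exists>c. distr (\<nu> i) borel (\<lambda>x. (- 1) * x + 2 * c) = \<nu> i"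
proof -
  have "\<exists>\<omega>. fst (cycle i \<omega>) = - 1 \<and> distr (\<nu> i) borel (\<lambda>x. fst (cycle i \<omega>) * x + snd (cycle i \<omega>)) = \<nu> i"
  proof (rule ccontr)
    assume no: "\<not> ?thesis"
    have "AE \<omega> in Q i. fst (cycle i \<omega>) = 1"
      using cyc[of i] isometric_cycle[OF fp cyc, of i]
    proof eventually_elim
      case (elim \<omega>)
      then have "fst (cycle i \<omega>) \<noteq> - 1" using no by blast
      then show ?case using elim(1) by (auto simp: abs_if split: if_splits)
    qed
    with flip show False by blast
  qed
  then obtain b where "distr (\<nu> i) borel (\<lambda>x. - 1 * x + b) = \<nu> i" by metis
  then show ?thesis by (intro exI[of _ "b / 2"]) simp
qed

text \<open>The sequence c consists of the centres of symmetry of the laws \<open>\<nu> i\<close>.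
  After centring and scaling by \<open>\<alpha>\<close>, neighbouring laws agree up to a sign, which
  symmetry absorbs; so all are one symmetric law.\<close>

theorem reflection_structure:
  assumes fp: "fixed_point p K \<nu>" and cyc: "\<And>i. AE \<omega> in Q i. \<bar>fst (cycle i \<omega>)\<bar> = 1"
    and flip: "\<And>i. \<not> (AE \<omega> in Q i. fst (cycle i \<omega>) = 1)"
  obtains c a :: "'s \<Rightarrow> real" and F where
    "\<And>c'. (\<forall>i. AE \<omega> in Q i. ca 1 \<omega> * c' (st 1 \<omega>) + cb 1 \<omega> = c' (st 0 \<omega>)) \<longleftrightarrow> c' = c"
    "\<And>i. 0 < a i" "symmetric_law F" "\<And>i. \<nu> i = distr F borel (\<lambda>x. a i * x + c i)"
proof -
  have \<nu>: "\<nu> \<in> prob_kernels" using fp by (simp add: fixed_point_def)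
  note D = prob_kernelsD[OF \<nu>]
  have mm: "(\<lambda>x. a * x + c) \<in> measurable (\<nu> j) borel" for a c j
    unfolding measurable_cong_sets[OF D(2) refl] by measurable
  have "\<forall>i. \<exists>c. distr (\<nu> i) borel (\<lambda>x. (- 1) * x + 2 * c) = \<nu> i" using reflection_center[OF fp cyc flip] by blast
  then obtain c where c: "\<And>i. distr (\<nu> i) borel (\<lambda>x. (- 1) * x + 2 * c i) = \<nu> i" by metis
  have "AE \<omega> in Q i. (\<bar>fst (cycle i \<omega>)\<bar>, 0) = (1, 0 :: real)" for i using cyc by simp
  from cycle_loops[OF aff_hom_abs this] obtain \<alpha> :: "'s \<Rightarrow> real" where
    \<alpha>: "\<And>j. 0 < \<alpha> j" "\<And>j. AE \<omega> in Q j. \<forall>n. \<alpha> (st n \<omega>) = \<alpha> j * \<bar>Pi_prod ca n \<omega>\<bar>"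
    using abs_coboundary[of undefined] by (auto simp: path_aff_def)
  have step: "AE \<omega> in Q j. distr (\<nu> (st 1 \<omega>)) borel (\<lambda>x. ca 1 \<omega> * x + cb 1 \<omega>) = \<nu> j" for j
    by (rule isometric_step[OF fp \<alpha>])
  \<comment> \<open>The step carries \<open>\<nu> M_1\<close> to \<open>\<nu> M_0\<close>, hence the
    centre of the first to a centre of the second, and the centre is unique.\<close>
  have c_step: "AE \<omega> in Q j. ca 1 \<omega> * c (st 1 \<omega>) + cb 1 \<omega> = c j" for j
    using step[of j]
  proof eventually_elim
    case (elim \<omega>)
    define k where "k = st 1 \<omega>"
    define A where "A = ca 1 \<omega>"
    define B where "B = cb 1 \<omega>"
    have e: "distr (\<nu> k) borel (\<lambda>x. A * x + B) = \<nu> j" using elim by (simp add: k_def A_def B_def)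
    have "distr (\<nu> j) borel (\<lambda>x. (- 1) * x + 2 * (A * c k + B)) = distr (\<nu> k) borel (\<lambda>x. (- 1 * A) * x + (- 1 * B + 2 * (A * c k + B)))"
      unfolding e[symmetric] by (rule distr_affine_affine[OF D(2)])
    also have "\<dots> = distr (\<nu> k) borel (\<lambda>x. (A * - 1) * x + (A * (2 * c k) + B))" by (simp add: algebra_simps)
    also have "\<dots> = distr (distr (\<nu> k) borel (\<lambda>x. (- 1) * x + 2 * c k)) borel (\<lambda>x. A * x + B)"
      by (rule distr_affine_affine[OF D(2), symmetric])
    also have "\<dots> = \<nu> j" unfolding c e ..
    finally have "A * c k + B = c j" using reflection_center_unique[OF D(1)[of j] D(2)[of j]] c[of j] by blast
    then show ?case by (simp add: k_def A_def B_def)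
  qed
  have unique: "(\<forall>i. AE \<omega> in Q i. ca 1 \<omega> * c' (st 1 \<omega>) + cb 1 \<omega> = c' (st 0 \<omega>)) \<longleftrightarrow> c' = c" for c'
  proof
    assume "c' = c"
    moreover have "AE \<omega> in Q i. ca 1 \<omega> * c (st 1 \<omega>) + cb 1 \<omega> = c (st 0 \<omega>)" for i
      using c_step[of i] st_0[of i] by eventually_elim simp
    ultimately show "\<forall>i. AE \<omega> in Q i. ca 1 \<omega> * c' (st 1 \<omega>) + cb 1 \<omega> = c' (st 0 \<omega>)" by simp
  next
    \<comment> \<open>The difference d of two solutions is transported by the linear parts alone. If
      it is nonzero at i, every cycle at i has slope 1, contrary to \<open>flip\<close>.\<close>
    assume c': "\<forall>i. AE \<omega> in Q i. ca 1 \<omega> * c' (st 1 \<omega>) + cb 1 \<omega> = c' (st 0 \<omega>)"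
    define d where "d j = c' j - c j" for j
    have "AE \<omega> in Q i. ca 1 \<omega> * d (st 1 \<omega>) = d (st 0 \<omega>)" for i
      using c'[rule_format, of i] c_step[of i] st_0[of i] by eventually_elim (auto simp: d_def algebra_simps)
    from AE_shift_any[OF this]
    have dn: "AE \<omega> in Q i. \<forall>n. ca (Suc n) \<omega> * d (st (Suc n) \<omega>) = d (st n \<omega>)" for i
      unfolding AE_all_countable by (simp add: st_shift ca_shift)
    show "c' = c"
    proof (rule ext, rule ccontr)
      fix i assume "c' i \<noteq> c i"
      then have di: "d i \<noteq> 0" by (simp add: d_def)
      have "AE \<omega> in Q i. fst (cycle i \<omega>) = 1"
        using dn[of i] st_0[of i] recurrent[where i = i and j = i]
      proof eventually_elim
        case (elim \<omega>)
        have "Pi_prod ca n \<omega> * d (st n \<omega>) = d (st 0 \<omega>)" for n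
          using elim(1) by (induction n) (simp_all add: Pi_prod_Suc mult.assoc)
        from this[of "visit_time i 1 \<omega>"] have "fst (cycle i \<omega>) * d i = d i"
          using visit_time(2)[OF elim(3), of 1] elim(2) by (simp add: cycle_def path_aff_def)
        then show ?case using di by simp
      qed
      with flip show False by blast
    qed
  qed
  define F where "F j = distr (\<nu> j) borel (\<lambda>x. \<alpha> j * x + - (\<alpha> j * c j))" for j
  have F_sets: "sets (F j) = sets borel" for j by (simp add: F_def)
  have F_sym: "distr (F j) borel (\<lambda>x. (- 1) * x + 0) = F j" for j
  proof -
    have "distr (F j) borel (\<lambda>x. (- 1) * x + 0) = distr (\<nu> j) borel (\<lambda>x. (\<alpha> j * - 1) * x + (\<alpha> j * (2 * c j) + - (\<alpha> j * c j)))"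
      unfolding F_def distr_affine_affine[OF D(2)] by (simp add: algebra_simps)
    also have "\<dots> = distr (distr (\<nu> j) borel (\<lambda>x. (- 1) * x + 2 * c j)) borel (\<lambda>x. \<alpha> j * x + - (\<alpha> j * c j))"
      by (rule distr_affine_affine[OF D(2), symmetric])
    finally show ?thesis unfolding c F_def .
  qed
  have F_step: "AE \<omega> in Q j. F (st 1 \<omega>) = F j" for j
    using step[of j] c_step[of j] \<alpha>(2)[of j]
  proof eventually_elim
    case (elim \<omega>)
    define k where "k = st 1 \<omega>"
    define A where "A = ca 1 \<omega>"
    define B where "B = cb 1 \<omega>"
    have e: "distr (\<nu> k) borel (\<lambda>x. A * x + B) = \<nu> j" using elim by (simp add: k_def A_def B_def)
    have cj: "c j = A * c k + B" using elim(2) by (simp add: k_def A_def B_def)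
    have "\<alpha> k = \<alpha> j * \<bar>A\<bar>" using elim(3)[rule_format, of 1] by (simp add: k_def A_def Pi_prod_Suc)
    then have sgn: "\<alpha> j * A = \<alpha> k \<or> \<alpha> j * A = - \<alpha> k" by (auto simp: abs_if split: if_splits)
    have "F j = distr (\<nu> k) borel (\<lambda>x. (\<alpha> j * A) * x + - (\<alpha> j * A * c k))"
      unfolding F_def e[symmetric] distr_affine_affine[OF D(2)] by (simp add: cj algebra_simps)
    moreover have "distr (\<nu> k) borel (\<lambda>x. - \<alpha> k * x + - (- \<alpha> k * c k)) = distr (F k) borel (\<lambda>x. (- 1) * x + 0)"
      unfolding F_def distr_affine_affine[OF D(2)] by simp
    ultimately have "F j = F k" using sgn F_sym[of k] by (auto simp: F_def[of k])
    then show ?case by (simp add: k_def)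
  qed
  have F_edge: "F k = F j" if "k \<in> set_pmf (p j)" for j k
  proof (rule AE_hit[OF _ edge_prob[OF that]])
    show "AE \<omega> in Q j. st 1 \<omega> = k \<longrightarrow> F k = F j" using F_step[of j] by eventually_elim auto
  qed
  have F_const: "F j = F undefined" for j by (rule const_of_edges[OF F_edge])
  show ?thesis
  proof (rule that[OF unique])
    show "0 < 1 / \<alpha> i" for i using \<alpha>(1)[of i] by simp
    have "prob_space (F undefined)" unfolding F_def by (rule prob_space.prob_space_distr[OF D(1) mm])
    then show "symmetric_law (F undefined)"
      using F_sym[of undefined] F_sets by (simp add: symmetric_law_def space_prob_algebra)
    show "\<nu> i = distr (F undefined) borel (\<lambda>x. 1 / \<alpha> i * x + c i)" for i
    proof -
      have "\<alpha> i \<noteq> 0" using \<alpha>(1)[of i] by simp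
      then have "distr (F i) borel (\<lambda>x. 1 / \<alpha> i * x + c i) = \<nu> i"
        unfolding F_def distr_affine_affine[OF D(2)] using distr_id2[OF D(2)[of i, symmetric]] by simp
      then show ?thesis by (simp add: F_const[of i])
    qed
  qed
qed

text \<open>The cocycle of affine maps itself is a coboundary, with components \<alpha> and \<beta>.
  The substitution \<open>x \<mapsto> \<alpha> i * x + \<beta> i\<close> removes the modulation, so
  that a fixed point becomes one law for all states and any law is allowed. The parameter r
  translates the reference law and produces the different sequences c.\<close>

theorem identity_structure:
  assumes fp: "fixed_point p K \<nu>" and cyc: "\<And>i. AE \<omega> in Q i. cycle i \<omega> = (1, 0)"
  obtains \<alpha> \<beta> :: "'s \<Rightarrow> real" where "\<And>i. \<alpha> i \<noteq> 0"
    "\<And>r. \<exists>F\<in>space (prob_algebra borel). \<forall>i. \<nu> i = distr F borel (\<lambda>x. 1 / \<alpha> i * x + (r - \<beta> i) / \<alpha> i)"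
    "\<And>r F. F \<in> space (prob_algebra borel) \<Longrightarrow> fixed_point p K (\<lambda>i. distr F borel (\<lambda>x. 1 / \<alpha> i * x + (r - \<beta> i) / \<alpha> i))"
proof -
  have \<nu>: "\<nu> \<in> prob_kernels" using fp by (simp add: fixed_point_def)
  note D = prob_kernelsD[OF \<nu>]
  have mm: "(\<lambda>x. a * x + c) \<in> measurable L borel" if "sets L = sets borel" for a c :: real and L
    unfolding measurable_cong_sets[OF that refl] by measurable
  obtain g where g: "\<And>j. fst (g j) \<noteq> 0" "\<And>j. AE \<omega> in Q j. \<forall>n. g (st n \<omega>) = aff (g j) (path_aff n \<omega>)"
    using loops_coboundary[OF aff_hom_id cycle_loops[OF aff_hom_id cyc[of undefined]]] by blast
  define \<alpha> where "\<alpha> j = fst (g j)" for j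
  define \<beta> where "\<beta> j = snd (g j)" for j
  have \<alpha>: "\<alpha> j \<noteq> 0" for j using g(1) by (simp add: \<alpha>_def)
  have step: "AE \<omega> in Q j. \<alpha> (st 1 \<omega>) = \<alpha> j * ca 1 \<omega> \<and> \<beta> (st 1 \<omega>) = \<alpha> j * cb 1 \<omega> + \<beta> j" for j
    using g(2)[of j] by eventually_elim
      (auto dest: spec[of _ 1] simp: \<alpha>_def \<beta>_def aff_def path_aff_def Pi_prod_Suc perp_sum_Suc)
  define \<nu>' where "\<nu>' j = distr (\<nu> j) borel (\<lambda>x. \<alpha> j * x + \<beta> j)" for j
  have \<nu>'_mass: "emeasure (\<nu>' k) E = emeasure (\<nu> k) {x. \<alpha> k * x + \<beta> k \<in> E}" if "E \<in> sets borel" for E k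
    unfolding \<nu>'_def using mm[OF D(2)[of k], of "\<alpha> k" "\<beta> k"] that by (subst emeasure_distr) (auto simp: D(3) vimage_def)
  have \<nu>'_prob: "prob_space (\<nu>' j)" and \<nu>'_sets: "sets (\<nu>' j) = sets borel" for j
    unfolding \<nu>'_def by (auto intro!: prob_space.prob_space_distr[OF D(1) mm] D)
  \<comment> \<open>For each Borel set, its mass under the substituted laws is a bounded harmonic
    function of the state.\<close>
  have \<nu>'_const: "\<nu>' j = \<nu>' k" for j k
  proof (rule measure_eqI)
    show "sets (\<nu>' j) = sets (\<nu>' k)" by (simp add: \<nu>'_sets)
    fix E assume "E \<in> sets (\<nu>' j)"
    then have E: "E \<in> sets borel" by (simp add: \<nu>'_sets)
    define h where "h i = measure (\<nu>' i) E" for i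
    have hE: "emeasure (\<nu>' i) E = ennreal (h i)" for i
      using \<nu>'_prob[of i] by (simp add: h_def finite_measure.emeasure_eq_measure prob_space_def)
    have h01: "0 \<le> h i" "h i \<le> 1" for i using prob_space.prob_le_1[OF \<nu>'_prob] by (simp_all add: h_def)
    have "(\<integral>i. h i \<partial>measure_pmf (p j)) = h j" for j
    proof -
      have E': "{y. \<alpha> j * y + \<beta> j \<in> E} \<in> sets borel" by (rule affine_preimage_borel[OF E])
      have "ennreal (h j) = emeasure (\<nu> j) {y. \<alpha> j * y + \<beta> j \<in> E}" by (simp add: hE[symmetric] \<nu>'_mass[OF E])
      also have "\<dots> = (\<integral>\<^sup>+\<omega>. emeasure (\<nu> (st 1 \<omega>)) {x. ca 1 \<omega> * x + cb 1 \<omega> \<in> {y. \<alpha> j * y + \<beta> j \<in> E}} \<partial>Q j)"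
        by (rule fixed_point_step[OF fp E', symmetric])
      also have "\<dots> = (\<integral>\<^sup>+\<omega>. ennreal (h (st 1 \<omega>)) \<partial>Q j)"
        using step[of j]
      proof (intro nn_integral_cong_AE, eventually_elim)
        case (elim \<omega>)
        have "\<alpha> j * (ca 1 \<omega> * x + cb 1 \<omega>) + \<beta> j = \<alpha> (st 1 \<omega>) * x + \<beta> (st 1 \<omega>)" for x
          using elim by (simp add: distrib_left)
        then show ?case by (simp add: hE[symmetric] \<nu>'_mass[OF E])
      qed
      also have "\<dots> = (\<integral>\<^sup>+i. ennreal (h i) \<partial>measure_pmf (p j))"
        using st_law[where f = "\<lambda>i. ennreal (h i)" and n = 1 and i = j] by (simp add: bind_return_pmf)
      also have "\<dots> = ennreal (\<integral>i. h i \<partial>measure_pmf (p j))"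
        using h01 by (intro nn_integral_eq_integral measure_pmf.integrable_const_bound[where B = 1]) auto
      finally have "ennreal (h j) = ennreal (\<integral>i. h i \<partial>measure_pmf (p j))" .
      moreover have "0 \<le> (\<integral>i. h i \<partial>measure_pmf (p j))" using h01 by (intro Bochner_Integration.integral_nonneg) auto
      ultimately show ?thesis using h01 by simp
    qed
    then have "h j = h k" using h01 by (intro harmonic_const[of h 1]) auto
    then show "emeasure (\<nu>' j) E = emeasure (\<nu>' k) E" by (simp add: hE)
  qed
  show ?thesis
  proof (rule that[OF \<alpha>])
    fix r :: real
    \<comment> \<open>The translation by -r compensates the r in the representing map.\<close>
    define F where "F = distr (\<nu>' undefined) borel (\<lambda>x. 1 * x + - r)"
    have "F \<in> space (prob_algebra borel)"
      unfolding F_def by (simp only: space_prob_algebra mem_Collect_eq sets_distr)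
        (intro conjI refl prob_space.prob_space_distr[OF \<nu>'_prob mm[OF \<nu>'_sets]])
    moreover have "\<nu> i = distr F borel (\<lambda>x. 1 / \<alpha> i * x + (r - \<beta> i) / \<alpha> i)" for i
    proof -
      have "distr F borel (\<lambda>x. 1 / \<alpha> i * x + (r - \<beta> i) / \<alpha> i) = distr (\<nu>' i) borel (\<lambda>x. 1 / \<alpha> i * x + (- (\<beta> i) / \<alpha> i))"
        unfolding F_def distr_affine_affine[OF \<nu>'_sets] \<nu>'_const[of undefined i]
        using \<alpha>[of i] by (simp add: diff_divide_distrib)
      also have "\<dots> = \<nu> i"
        unfolding \<nu>'_def distr_affine_affine[OF D(2)] using \<alpha>[of i] distr_id2[OF D(2)[of i, symmetric]] by simp
      finally show ?thesis ..
    qed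
    ultimately show "\<exists>F\<in>space (prob_algebra borel). \<forall>i. \<nu> i = distr F borel (\<lambda>x. 1 / \<alpha> i * x + (r - \<beta> i) / \<alpha> i)" by blast
  next
    fix r F assume "F \<in> space (prob_algebra (borel :: real measure))"
    then have F: "prob_space F" "sets F = sets borel" by (auto simp: space_prob_algebra)
    have spF: "space F = UNIV" using sets_eq_imp_space_eq[OF F(2)] by simp
    define \<kappa> where "\<kappa> i = distr F borel (\<lambda>x. 1 / \<alpha> i * x + (r - \<beta> i) / \<alpha> i)" for i
    have \<kappa>: "\<kappa> \<in> prob_kernels"
      unfolding prob_kernels_def \<kappa>_def
      by (simp only: space_prob_algebra mem_Collect_eq sets_distr)
        (intro allI conjI refl prob_space.prob_space_distr[OF F(1) mm[OF F(2)]])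
    have \<kappa>_mass: "emeasure (\<kappa> i) E = emeasure F {x. 1 / \<alpha> i * x + (r - \<beta> i) / \<alpha> i \<in> E}" if "E \<in> sets borel" for E i
      unfolding \<kappa>_def by (subst emeasure_distr[OF mm[OF F(2)] that]) (simp add: spF vimage_def)
    have "Psi1 p K \<kappa> i = \<kappa> i" for i
    proof (rule measure_eqI)
      show s: "sets (Psi1 p K \<kappa> i) = sets (\<kappa> i)" by (simp add: sets_Psi1[OF \<kappa>] \<kappa>_def)
      fix E assume "E \<in> sets (Psi1 p K \<kappa> i)"
      then have E: "E \<in> sets borel" by (simp add: s \<kappa>_def)
      have "emeasure (Psi1 p K \<kappa> i) E = (\<integral>\<^sup>+\<omega>. emeasure (\<kappa> (st 1 \<omega>)) {x. ca 1 \<omega> * x + cb 1 \<omega> \<in> E} \<partial>Q i)"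
        by (rule emeasure_Psi1_path[OF \<kappa> E])
      also have "\<dots> = (\<integral>\<^sup>+\<omega>. emeasure (\<kappa> i) E \<partial>Q i)"
        using step[of i] nonzero[of i]
      proof (intro nn_integral_cong_AE, eventually_elim)
        case (elim \<omega>)
        have "ca 1 \<omega> * (1 / \<alpha> (st 1 \<omega>) * x + (r - \<beta> (st 1 \<omega>)) / \<alpha> (st 1 \<omega>)) + cb 1 \<omega> = 1 / \<alpha> i * x + (r - \<beta> i) / \<alpha> i" for x
          using elim \<alpha>[of i] by (simp add: field_simps)
        then show ?case by (simp only: \<kappa>_mass[OF E] \<kappa>_mass[OF affine_preimage_borel[OF E]] mem_Collect_eq)
      qed
      also have "\<dots> = emeasure (\<kappa> i) E" using Q.emeasure_space_1[of i] by simp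
      finally show "emeasure (Psi1 p K \<kappa> i) E = emeasure (\<kappa> i) E" .
    qed
    then show "fixed_point p K (\<lambda>i. distr F borel (\<lambda>x. 1 / \<alpha> i * x + (r - \<beta> i) / \<alpha> i))"
      using \<kappa> unfolding fixed_point_def \<kappa>_def by blast
  qed
qed

text \<open>Every fixed point consists of point masses, and the fixed point equation at the first
  return says that cycle maps fix these points. Two different fixed points of the cycle maps at i
  would force slope 1, hence bounded products along the visits.\<close>

theorem unbounded_structure:
  assumes fp: "fixed_point p K \<nu>" and top: "\<And>i j. AE \<omega> in Q j. lev i \<omega> = \<infinity>"
  obtains c where "\<And>c'. (\<forall>i. AE \<omega> in Q i. fst (cycle i \<omega>) * c' i + snd (cycle i \<omega>) = c' i) \<longleftrightarrow> c' = c"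
    "\<And>i. \<nu> i = return borel (c i)" "\<And>\<kappa>. fixed_point p K \<kappa> \<Longrightarrow> \<kappa> = \<nu>"
proof -
  have dirac: "\<exists>d. (\<forall>i. \<kappa> i = return borel (d i)) \<and> (\<forall>i. AE \<omega> in Q i. fst (cycle i \<omega>) * d i + snd (cycle i \<omega>) = d i)"
    if fp: "fixed_point p K \<kappa>" for \<kappa>
  proof -
    have "\<forall>i. \<exists>c. \<kappa> i = return borel c" using unbounded_imp_dirac[OF fp top] by metis
    then obtain d where d: "\<And>i. \<kappa> i = return borel (d i)" by metis
    have "AE \<omega> in Q i. fst (cycle i \<omega>) * d i + snd (cycle i \<omega>) = d i" for i
    proof -
      define L where "L \<omega> = distr (\<kappa> i) borel (\<lambda>x. Pi_prod ca (visit_time i 1 \<omega>) \<omega> * x + perp_sum ca cb (visit_time i 1 \<omega>) \<omega>)" for \<omega>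
      have L_eq: "L \<omega> = return borel (fst (cycle i \<omega>) * d i + snd (cycle i \<omega>))" for \<omega>
        unfolding L_def d by (subst distr_return) (auto simp: cycle_def path_aff_def)
      have S: "{\<omega>. fst (cycle i \<omega>) * d i + snd (cycle i \<omega>) = d i} \<in> sets (Q i)"
      proof -
        have [measurable]: "(\<lambda>\<omega>. fst (cycle i \<omega>)) \<in> borel_measurable path_space" "(\<lambda>\<omega>. snd (cycle i \<omega>)) \<in> borel_measurable path_space"
          by (auto intro!: measurable_compose[OF cycle_measurable] borel_measurable_continuous_onI continuous_intros)
        show ?thesis unfolding sets_Q by (rule path_Collect) measurable
      qed
      note LQ = fixed_point_at_visit[OF fp, of i 1, folded L_def]
      have "emeasure (\<kappa> i) {d i} = (\<integral>\<^sup>+\<omega>. emeasure (L \<omega>) {d i} \<partial>Q i)"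
        unfolding LQ(2)[symmetric] by (rule emeasure_bind[OF _ LQ(1)]) auto
      also have "\<dots> = (\<integral>\<^sup>+\<omega>. indicator {\<omega>. fst (cycle i \<omega>) * d i + snd (cycle i \<omega>) = d i} \<omega> \<partial>Q i)"
        by (intro nn_integral_cong) (simp add: L_eq indicator_def)
      also have "\<dots> = emeasure (Q i) {\<omega>. fst (cycle i \<omega>) * d i + snd (cycle i \<omega>) = d i}"
        by (rule nn_integral_indicator[OF S])
      finally have "emeasure (Q i) {\<omega> \<in> space (Q i). fst (cycle i \<omega>) * d i + snd (cycle i \<omega>) = d i} = 1"
        by (simp add: d)
      then show ?thesis using S by (subst Q.AE_iff_emeasure_eq_1) (simp_all add: pred_def)
    qed
    with d show ?thesis by blast
  qed
  have unique: "c' = c" if c: "\<And>i. AE \<omega> in Q i. fst (cycle i \<omega>) * c i + snd (cycle i \<omega>) = c i"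
    and c': "\<And>i. AE \<omega> in Q i. fst (cycle i \<omega>) * c' i + snd (cycle i \<omega>) = c' i" for c c'
  proof (rule ext, rule ccontr)
    fix i assume ne: "c' i \<noteq> c i"
    have "AE \<omega> in Q i. (\<bar>fst (cycle i \<omega>)\<bar>, 0) = (1, 0 :: real)"
      using c[of i] c'[of i]
    proof eventually_elim
      case (elim \<omega>)
      then have "fst (cycle i \<omega>) * (c' i - c i) = c' i - c i" by (simp add: algebra_simps)
      then show ?case using ne by simp
    qed
    from cycle_loops[OF aff_hom_abs this] obtain \<alpha> :: "'s \<Rightarrow> real" where
      \<alpha>: "\<And>j. 0 < \<alpha> j" "\<And>j. AE \<omega> in Q j. \<forall>n. \<alpha> (st n \<omega>) = \<alpha> j * \<bar>Pi_prod ca n \<omega>\<bar>"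
      using abs_coboundary[of i] by (auto simp: path_aff_def)
    have "AE \<omega> in Q i. False" using abs_coboundary_lev[OF \<alpha>, of i i] top[of i i] by eventually_elim auto
    then show False using AE_nontrivial by blast
  qed
  obtain c where c: "\<And>i. \<nu> i = return borel (c i)" "\<And>i. AE \<omega> in Q i. fst (cycle i \<omega>) * c i + snd (cycle i \<omega>) = c i"
    using dirac[OF fp] by blast
  show ?thesis
  proof (rule that)
    show "(\<forall>i. AE \<omega> in Q i. fst (cycle i \<omega>) * c' i + snd (cycle i \<omega>) = c' i) \<longleftrightarrow> c' = c" for c'
      using c(2) unique by blast
    show "\<nu> i = return borel (c i)" for i by (rule c(1))
    show "\<kappa> = \<nu>" if fk: "fixed_point p K \<kappa>" for \<kappa>
    proof -
      obtain d where d: "\<And>i. \<kappa> i = return borel (d i)" "\<And>i. AE \<omega> in Q i. fst (cycle i \<omega>) * d i + snd (cycle i \<omega>) = d i"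
        using dirac[OF fk] by blast
      have "d = c" using unique c(2) d(2) by blast
      then show ?thesis using c(1) d(1) by (simp add: fun_eq_iff)
    qed
  qed
qed

end


subsection \<open>Return times and the law of the path\<close>

lemma ret_Suc_Least:
  "ret M i (Suc n) w = (if \<exists>k. ret M i n w < enat k \<and> M k w = i
     then enat (LEAST k. ret M i n w < enat k \<and> M k w = i) else \<infinity>)"
proof (cases "\<exists>k. ret M i n w < enat k \<and> M k w = i")
  case True
  define m where "m = (LEAST k. ret M i n w < enat k \<and> M k w = i)"
  have m: "ret M i n w < enat m \<and> M m w = i" unfolding m_def using LeastI_ex[OF True] .
  have "Inf {enat k | k. ret M i n w < enat k \<and> M k w = i} = enat m"
  proof (rule antisym)
    show "Inf {enat k | k. ret M i n w < enat k \<and> M k w = i} \<le> enat m" using m by (intro Inf_lower) auto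
    show "enat m \<le> Inf {enat k | k. ret M i n w < enat k \<and> M k w = i}"
      by (intro Inf_greatest) (auto simp: m_def intro: Least_le)
  qed
  then show ?thesis using True by (simp add: m_def)
next
  case False
  then have "{enat k | k. ret M i n w < enat k \<and> M k w = i} = {}" by auto
  moreover have "Inf {} = (\<infinity> :: enat)" by (simp add: top_enat_def)
  ultimately show ?thesis unfolding ret.simps using False by (simp only: if_False)
qed

declare ret.simps(2) [simp del]

lemma ret_measurable:
  assumes [measurable]: "\<And>k. M k \<in> measurable L (count_space UNIV)"
  shows "ret M i n \<in> measurable L (count_space UNIV)"
proof (induction n)
  case 0
  have "ret M i 0 = (\<lambda>_. 0)" by (simp add: fun_eq_iff)
  then show ?case by simp
next
  case (Suc n)
  note [measurable] = Suc
  have [measurable]: "Measurable.pred L (\<lambda>w. ret M i n w < enat k)" for k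
    by (rule measurable_compose[OF Suc]) simp
  have "(\<lambda>w. if \<exists>k. ret M i n w < enat k \<and> M k w = i
     then enat (LEAST k. ret M i n w < enat k \<and> M k w = i) else \<infinity>) \<in> measurable L (count_space UNIV)"
    by measurable
  moreover have "ret M i (Suc n) = (\<lambda>w. if \<exists>k. ret M i n w < enat k \<and> M k w = i
     then enat (LEAST k. ret M i n w < enat k \<and> M k w = i) else \<infinity>)"
    by (rule ext) (rule ret_Suc_Least)
  ultimately show ?case by (simp only:)
qed

lemma ret_nat_measurable:
  assumes "\<And>k. M k \<in> measurable L (count_space UNIV)"
  shows "ret_nat M i n \<in> measurable L (count_space UNIV)"
  unfolding ret_nat_def by (rule measurable_compose[OF ret_measurable[OF assms]]) simp

section \<open>Return times on a path with infinitely many visits\<close>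

context
  fixes M :: "nat \<Rightarrow> 'w \<Rightarrow> 's" and i :: 's and w :: 'w
  assumes inf: "\<exists>\<^sub>\<infinity>n. M n w = i"
begin

lemma ret_finite: "ret M i n w = enat (ret_nat M i n w)"
proof -
  have "\<exists>m. ret M i n w = enat m"
  proof (induction n)
    case 0 then show ?case by (auto simp: zero_enat_def)
  next
    case (Suc n)
    then obtain m where "ret M i n w = enat m" by blast
    moreover obtain k where "m < k" "M k w = i" using inf unfolding INFM_nat by blast
    ultimately have "\<exists>k. ret M i n w < enat k \<and> M k w = i" by auto
    then show ?case by (simp add: ret_Suc_Least)
  qed
  then show ?thesis by (auto simp: ret_nat_def)
qed

lemma ret_nat_0: "ret_nat M i 0 w = 0"
  by (simp add: ret_nat_def zero_enat_def)

lemma ret_nat_Suc: "ret_nat M i (Suc n) w = (LEAST k. ret_nat M i n w < k \<and> M k w = i)"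
proof -
  obtain k where "ret_nat M i n w < k" "M k w = i" using inf unfolding INFM_nat by blast
  then have "\<exists>k. ret M i n w < enat k \<and> M k w = i" by (auto simp: ret_finite)
  then have "ret M i (Suc n) w = enat (LEAST k. ret M i n w < enat k \<and> M k w = i)" by (simp add: ret_Suc_Least)
  then show ?thesis by (simp add: ret_finite)
qed

lemma ret_nat_Suc_props:
  "ret_nat M i n w < ret_nat M i (Suc n) w" "M (ret_nat M i (Suc n) w) w = i"
  "ret_nat M i n w < k \<Longrightarrow> k < ret_nat M i (Suc n) w \<Longrightarrow> M k w \<noteq> i"
proof -
  have "\<exists>k. ret_nat M i n w < k \<and> M k w = i" using inf unfolding INFM_nat by blast
  from LeastI_ex[OF this] show "ret_nat M i n w < ret_nat M i (Suc n) w" "M (ret_nat M i (Suc n) w) w = i"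
    by (simp_all add: ret_nat_Suc)
  show "ret_nat M i n w < k \<Longrightarrow> k < ret_nat M i (Suc n) w \<Longrightarrow> M k w \<noteq> i"
    unfolding ret_nat_Suc using not_less_Least by blast
qed

lemma strict_mono_ret_nat: "strict_mono (\<lambda>n. ret_nat M i n w)"
  using ret_nat_Suc_props(1) by (simp add: strict_mono_Suc_iff)

lemma ret_nat_covers:
  assumes "1 \<le> k" "M k w = i" shows "\<exists>n. k = ret_nat M i (Suc n) w"
proof -
  have "k \<le> ret_nat M i k w" by (rule seq_suble[OF strict_mono_ret_nat])
  then have ex: "\<exists>n. k \<le> ret_nat M i n w" by blast
  define m where "m = (LEAST n. k \<le> ret_nat M i n w)"
  have m: "k \<le> ret_nat M i m w" unfolding m_def by (rule LeastI_ex[OF ex])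
  have "m \<noteq> 0" using m assms by (cases m) (auto simp: ret_nat_0)
  then obtain n where n: "m = Suc n" by (cases m) auto
  have "ret_nat M i n w < k" using not_less_Least[of n "\<lambda>n. k \<le> ret_nat M i n w"] n by (simp add: m_def)
  then have "\<not> k < ret_nat M i (Suc n) w" using ret_nat_Suc_props(3) assms by blast
  then show ?thesis using m n by auto
qed

lemma tendsto_ret_nat:
  assumes "\<And>\<epsilon>. 0 < \<epsilon> \<Longrightarrow> \<exists>N. \<forall>n\<ge>N. M n w = i \<longrightarrow> \<bar>f n - z\<bar> \<le> (\<epsilon> :: real)"
  shows "(\<lambda>n. f (ret_nat M i n w)) \<longlonglongrightarrow> z"
proof (rule LIMSEQ_I)
  fix r :: real assume "0 < r"
  then obtain N where N: "\<And>n. N \<le> n \<Longrightarrow> M n w = i \<Longrightarrow> \<bar>f n - z\<bar> \<le> r / 2" using assms[of "r / 2"] by auto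
  \<comment> \<open>Index 0 is skipped because \<open>ret_nat\<close> is 0 there whether or not the
    path starts in i.\<close>
  have "norm (f (ret_nat M i n w) - z) < r" if n: "Suc N \<le> n" for n
  proof -
    obtain m where m: "n = Suc m" using n by (cases n) auto
    have "n \<le> ret_nat M i n w" by (rule seq_suble[OF strict_mono_ret_nat])
    then have "\<bar>f (ret_nat M i n w) - z\<bar> \<le> r / 2" using n ret_nat_Suc_props(2)[of m] m by (intro N) auto
    then show ?thesis using \<open>0 < r\<close> by simp
  qed
  then show "\<exists>no. \<forall>n\<ge>no. norm (f (ret_nat M i n w) - z) < r" by blast
qed

text \<open>Identifies \<open>lev\<close> with the upper limit over the return times. In one
  direction the return times form a subsequence; in the other they exhaust all positive times spent
  at i.\<close>

lemma limsup_ret_nat: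
  assumes g: "\<And>n. 0 \<le> g n"
  shows "limsup (\<lambda>n. ereal (if M n w = i then g n else 0)) = limsup (\<lambda>n. ereal (g (ret_nat M i n w)))"
proof (rule antisym)
  let ?u = "\<lambda>n. ereal (if M n w = i then g n else 0)" and ?r = "\<lambda>n. ret_nat M i n w"
  have "eventually (\<lambda>n. ereal (g (?r n)) = ?u (?r n)) sequentially"
    unfolding eventually_sequentially
  proof (intro exI[of _ 1] allI impI)
    fix n :: nat assume "1 \<le> n"
    then obtain m where "n = Suc m" by (cases n) auto
    then show "ereal (g (?r n)) = ?u (?r n)" using ret_nat_Suc_props(2)[of m] by simp
  qed
  then have "limsup (\<lambda>n. ereal (g (?r n))) = limsup (?u \<circ> ?r)" by (intro Limsup_eq) (simp add: comp_def)
  also have "\<dots> \<le> limsup ?u" by (rule limsup_subseq_mono[OF strict_mono_ret_nat])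
  finally show "limsup (\<lambda>n. ereal (g (?r n))) \<le> limsup ?u" .
  show "limsup ?u \<le> limsup (\<lambda>n. ereal (g (?r n)))"
  proof (rule dense_ge)
    \<comment> \<open>Such a y is positive because g is nonnegative, so it also dominates the zeros
      at the times off i.\<close>
    fix y assume y: "limsup (\<lambda>n. ereal (g (?r n))) < y"
    have "0 \<le> limsup (\<lambda>n. ereal (g (?r n)))" by (intro le_Limsup always_eventually allI) (simp_all add: g)
    then have y0: "0 < y" using y by simp
    obtain N where N: "\<And>n. N \<le> n \<Longrightarrow> ereal (g (?r n)) < y"
      using Limsup_lessD[OF y] unfolding eventually_sequentially by blast
    show "limsup ?u \<le> y"
    proof (rule Limsup_bounded, unfold eventually_sequentially, intro exI[of _ "Suc (?r N)"] allI impI)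
      fix m assume m: "Suc (?r N) \<le> m"
      show "?u m \<le> y"
      proof (cases "M m w = i")
        case True
        then obtain n where n: "m = ?r (Suc n)" using ret_nat_covers[of m] m by auto
        have "N < Suc n" using m n strict_mono_less[OF strict_mono_ret_nat, of N "Suc n"] by simp
        then show ?thesis using N[of "Suc n"] True n by simp
      next
        case False then show ?thesis using y0 by (simp add: zero_ereal_def[symmetric] less_imp_le)
      qed
    qed
  qed
qed

end

lemma ret_nat_1_visit_time:
  assumes "\<exists>\<^sub>\<infinity>n. st n \<omega> = i" shows "ret_nat st i 1 \<omega> = visit_time i 1 \<omega>"
  using ret_nat_Suc[where M = st and w = \<omega> and i = i and n = 0, OF assms]
    ret_nat_0[where M = st and w = \<omega> and i = i, OF assms]
  by (simp add: visit_time_def Suc_le_eq)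

section \<open>The law of the trajectory\<close>

definition path_of :: "(nat \<Rightarrow> 'w \<Rightarrow> 's) \<Rightarrow> (nat \<Rightarrow> 'w \<Rightarrow> real) \<Rightarrow> (nat \<Rightarrow> 'w \<Rightarrow> real) \<Rightarrow> 'w \<Rightarrow> 's path" where
  "path_of M A B w k = (M k w, if k = 0 then (0, 0) else (A k w, B k w))"

lemma path_of_simps:
  "st k (path_of M A B w) = M k w" "0 < k \<Longrightarrow> ca k (path_of M A B w) = A k w" "0 < k \<Longrightarrow> cb k (path_of M A B w) = B k w"
  by (simp_all add: path_of_def st_def ca_def cb_def)

lemma Pi_prod_path_of: "Pi_prod ca n (path_of M A B w) = Pi_prod A n w"
  by (induction n) (simp_all add: Pi_prod_Suc path_of_simps)

lemma perp_sum_path_of: "perp_sum ca cb n (path_of M A B w) = perp_sum A B n w"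
  by (induction n) (simp_all add: perp_sum_Suc path_of_simps Pi_prod_path_of)

lemma ret_path_of: "ret st i n (path_of M A B w) = ret M i n w"
  by (induction n) (simp_all add: ret_Suc_Least path_of_simps)

lemma ret_nat_path_of: "ret_nat st i n (path_of M A B w) = ret_nat M i n w"
  by (simp add: ret_nat_def ret_path_of)

context markov_modulated begin

abbreviation "traj \<equiv> path_of M A B"

lemma path_measurable [measurable]: "traj \<in> measurable Pr path_space"
proof (rule measurable_into_path_space)
  show "(\<lambda>w. fst (traj w k)) \<in> measurable Pr (count_space UNIV)" for k
    using M_measurable[of k] by (simp add: path_of_def)
  show "(\<lambda>w. snd (traj w k)) \<in> borel_measurable Pr" for k
    using A_measurable[of k] B_measurable[of k] by (cases "k = 0") (auto simp: path_of_def intro!: borel_measurable_Pair)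
qed

lemma M_sets [measurable]: "{w \<in> space Pr. M n w = i} \<in> sets Pr"
  using measurable_sets[OF M_measurable[of n], of "{i}"] by (simp add: vimage_def Int_def conj_commute)

lemma prob_M: "prob {w \<in> space Pr. \<forall>k\<le>n. M k w = x k} = pmf \<pi> (x 0) * (\<Prod>k<n. pmf (p (x k)) (x (Suc k)))"
proof (induction n)
  case 0
  have "pmf \<pi> (x 0) = measure (distr Pr (count_space UNIV) (M 0)) {x 0}"
    by (simp add: initial_law measure_pmf_single)
  also have "\<dots> = prob {w \<in> space Pr. M 0 w = x 0}"
    by (subst measure_distr[OF M_measurable]) (auto simp: vimage_def Int_def conj_commute)
  finally show ?case by simp
next
  case (Suc n)
  then show ?case using markov[of n x] by simp
qed

text \<open>The conditional law is integrated over the event D that the chain follows the word x.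
  This event belongs to the sigma-algebra of the chain, and on it the product of the kernels is the
  constant c.\<close>

lemma prob_path:
  assumes E: "\<And>k. E k \<in> sets borel"
  shows "prob {w \<in> space Pr. (\<forall>k\<le>n. M k w = x k) \<and> (\<forall>k\<in>{1..n}. (A k w, B k w) \<in> E k)} =
    pmf \<pi> (x 0) * (\<Prod>k<n. pmf (p (x k)) (x (Suc k)) * measure (K (x k) (x (Suc k))) (E (Suc k)))"
proof -
  define f where "f w = (\<lambda>k. M k w)" for w
  define F where "F = vimage_algebra (space Pr) f (PiM UNIV (\<lambda>_. count_space UNIV))"
  have f: "f \<in> measurable Pr (PiM UNIV (\<lambda>_. count_space UNIV))"
    unfolding f_def using M_measurable by (intro measurable_PiM_single') auto
  have sF: "sets F = {f -` X \<inter> space Pr | X. X \<in> sets (PiM UNIV (\<lambda>_. count_space UNIV))}"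
    unfolding F_def by (rule sets_vimage_algebra2) (use measurable_space[OF f] in auto)
  have "subalgebra Pr F"
    unfolding subalgebra_def using measurable_sets[OF f] by (auto simp: sF) (simp add: F_def)+
  then interpret FS: finite_measure_subalgebra Pr F
    by (simp add: finite_measure_subalgebra_def finite_measure_subalgebra_axioms_def finite_measure_axioms)
  define D where "D = {w \<in> space Pr. \<forall>k\<le>n. M k w = x k}"
  define G where "G = {w \<in> space Pr. \<forall>k\<in>{1..n}. (A k w, B k w) \<in> E k}"
  have DF: "D \<in> sets F"
  proof -
    have "{\<omega> \<in> space (PiM UNIV (\<lambda>_. count_space UNIV)). \<forall>k\<le>n. \<omega> k = x k} \<in> sets (PiM UNIV (\<lambda>_::nat. count_space (UNIV :: 's set)))"
      by measurable
    moreover have "D = f -` {\<omega> \<in> space (PiM UNIV (\<lambda>_. count_space UNIV)). \<forall>k\<le>n. \<omega> k = x k} \<inter> space Pr"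
      by (auto simp: D_def f_def space_PiM)
    ultimately show ?thesis unfolding sF by blast
  qed
  have D: "D \<in> sets Pr" unfolding D_def using M_measurable[measurable] by measurable
  have G: "G \<in> sets Pr"
  proof -
    have "{w \<in> space Pr. (A k w, B k w) \<in> E k} \<in> sets Pr" if "k \<in> {1..n}" for k
    proof -
      have "(\<lambda>w. (A k w, B k w)) \<in> borel_measurable Pr" using that A_measurable[of k] B_measurable[of k] by (intro borel_measurable_Pair) auto
      from measurable_sets[OF this E[of k]] show ?thesis by (simp add: vimage_def Int_def conj_commute)
    qed
    then show ?thesis unfolding G_def by (intro sets.sets_Collect_finite_All) auto
  qed
  define c where "c = (\<Prod>k=1..n. measure (K (x (k - 1)) (x k)) (E k))"
  have "prob (D \<inter> G) = (LINT w:D|Pr. indicator G w)"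
    unfolding set_lebesgue_integral_def using D G by (simp add: indicator_inter_arith[symmetric] sets.Int)
  also have "\<dots> = (LINT w:D|Pr. real_cond_exp Pr F (indicator G) w)"
    using G DF by (intro FS.real_cond_exp_intA integrable_real_indicator) (auto simp: less_top[symmetric])
  also have "\<dots> = (\<integral>w. c * indicator D w \<partial>Pr)"
    unfolding set_lebesgue_integral_def
  proof (rule integral_cong_AE)
    show "AE w in Pr. indicator D w *\<^sub>R real_cond_exp Pr F (indicator G) w = c * indicator D w"
      using conditional_law[of E n, OF E, folded f_def F_def G_def]
    proof eventually_elim
      case (elim w)
      show ?case
      proof (cases "w \<in> D")
        case True
        then have "(\<Prod>k=1..n. measure (K (M (k - 1) w) (M k w)) (E k)) = c"
          unfolding c_def by (intro prod.cong) (auto simp: D_def)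
        with True elim show ?thesis by (simp add: F_def)
      qed simp
    qed
  qed (use D in auto)
  also have "\<dots> = prob D * c" using D by simp
  finally have "prob (D \<inter> G) = prob D * c" .
  moreover have "c = (\<Prod>k<n. measure (K (x k) (x (Suc k))) (E (Suc k)))"
    unfolding c_def by (simp add: prod.atLeast1_atMost_eq)
  moreover have "prob D = pmf \<pi> (x 0) * (\<Prod>k<n. pmf (p (x k)) (x (Suc k)))" unfolding D_def by (rule prob_M)
  moreover have "D \<inter> G = {w \<in> space Pr. (\<forall>k\<le>n. M k w = x k) \<and> (\<forall>k\<in>{1..n}. (A k w, B k w) \<in> E k)}"
    by (auto simp: D_def G_def)
  ultimately show ?thesis by (simp add: prod.distrib)
qed

lemma start_prob: "prob {w \<in> space Pr. M 0 w = i} = pmf \<pi> i" "0 < pmf \<pi> i"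
proof -
  show "prob {w \<in> space Pr. M 0 w = i} = pmf \<pi> i" using prob_M[of 0 "\<lambda>_. i"] by simp
  show "0 < pmf \<pi> i" using stationary_support[OF stationary irreducible] by (simp add: pmf_positive)
qed

lemma start_emeasure: "emeasure Pr {w \<in> space Pr. M 0 w = i} \<noteq> 0" "emeasure Pr {w \<in> space Pr. M 0 w = i} < \<infinity>"
  using start_prob[of i] by (simp_all add: emeasure_eq_measure)

lemma sets_start_at [measurable_cong]: "sets (start_at Pr M i) = sets Pr"
  by (simp add: start_at_def)

lemma space_start_at [simp]: "space (start_at Pr M i) = space Pr"
  by (simp add: start_at_def)

lemma prob_space_start_at: "prob_space (start_at Pr M i)"
  unfolding start_at_def using start_emeasure[of i] by (intro prob_space_uniform_measure) auto

lemma AE_start_at: "(AE w in start_at Pr M i. R w) \<longleftrightarrow> (AE w in Pr. M 0 w = i \<longrightarrow> R w)"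
proof -
  have "(AE w in start_at Pr M i. R w) \<longleftrightarrow> (AE w in Pr. w \<in> {w \<in> space Pr. M 0 w = i} \<longrightarrow> R w)"
    unfolding start_at_def by (rule AE_uniform_measure[OF start_emeasure])
  also have "\<dots> \<longleftrightarrow> (AE w in Pr. M 0 w = i \<longrightarrow> R w)" by (intro AE_cong) auto
  finally show ?thesis .
qed

lemma AE_iff_start_at: "(AE w in Pr. R w) \<longleftrightarrow> (\<forall>i. AE w in start_at Pr M i. R w)"
proof -
  have "(\<forall>i. AE w in Pr. M 0 w = i \<longrightarrow> R w) \<longleftrightarrow> (AE w in Pr. \<forall>i. M 0 w = i \<longrightarrow> R w)"
    by (simp only: AE_all_countable)
  then show ?thesis by (simp add: AE_start_at)
qed

definition path_law :: "'s \<Rightarrow> 's path measure" where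
  "path_law i = distr (start_at Pr M i) path_space traj"

lemma path_measurable_start_at [measurable]: "traj \<in> measurable (start_at Pr M i) path_space"
  using path_measurable by (simp add: measurable_cong_sets[OF sets_start_at refl])

text \<open>Conditioning on the starting state cancels the factor \<open>pmf \<pi> i\<close> in
  \<open>prob_path\<close>, and the dummy mark in \<open>path_of\<close> yields the condition on
  \<open>E 0\<close>.\<close>

lemma path_law_path_chain:
  assumes A_nonzero: "prob {w \<in> space Pr. A 1 w = 0} = 0"
  shows "path_chain path_law p K \<pi>"
proof -
  have 1: "prob_space (path_law i)" for i
    unfolding path_law_def by (rule prob_space.prob_space_distr[OF prob_space_start_at]) simp
  have 2: "sets (path_law i) = sets path_space" for i by (simp add: path_law_def)
  have 3: "AE \<omega> in path_law i. ca 1 \<omega> \<noteq> 0" for i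
  proof -
    have "{w \<in> space Pr. A 1 w = 0} \<in> sets Pr" using A_measurable[of 1, measurable] by measurable
    then have "AE w in Pr. A 1 w \<noteq> 0" using A_nonzero by (subst (asm) prob_eq_0) (auto elim!: eventually_mono)
    then have "AE w in start_at Pr M i. ca 1 (traj w) \<noteq> 0"
      unfolding AE_start_at by eventually_elim (simp add: path_of_simps)
    moreover have "{\<omega> \<in> space path_space. ca 1 \<omega> \<noteq> 0} \<in> sets (path_space :: 's path measure)" by measurable
    ultimately show ?thesis unfolding path_law_def by (subst AE_distr_iff) auto
  qed
  have 4: "emeasure (path_law i) (cyl n x E) = (if x 0 = i \<and> (0, 0) \<in> E 0 then 1 else 0) *
      (\<Prod>k<n. ennreal (pmf (p (x k)) (x (Suc k))) * emeasure (K (x k) (x (Suc k))) (E (Suc k)))"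
    if E: "\<And>k. E k \<in> sets borel" for i n x and E :: "nat \<Rightarrow> (real \<times> real) set"
  proof -
    let ?W = "\<Prod>k<n. pmf (p (x k)) (x (Suc k)) * measure (K (x k) (x (Suc k))) (E (Suc k))"
    let ?I = "{w \<in> space Pr. M 0 w = i}"
    have K: "emeasure (K j k) X = ennreal (measure (K j k) X)" for j k X
      using K_kernel[of j k] by (auto simp: space_prob_algebra prob_space_def finite_measure.emeasure_eq_measure)
    have W: "(\<Prod>k<n. ennreal (pmf (p (x k)) (x (Suc k))) * emeasure (K (x k) (x (Suc k))) (E (Suc k))) = ennreal ?W"
      by (simp add: K ennreal_mult[symmetric] prod_ennreal)
    have C: "traj -` cyl n x E \<inter> space Pr \<in> sets Pr"
      by (rule measurable_sets[OF path_measurable cyl_sets[OF E]])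
    have "emeasure (path_law i) (cyl n x E) = emeasure (start_at Pr M i) (traj -` cyl n x E \<inter> space Pr)"
      unfolding path_law_def by (subst emeasure_distr) (use cyl_sets[OF E] in auto)
    also have "\<dots> = emeasure Pr (?I \<inter> (traj -` cyl n x E \<inter> space Pr)) / emeasure Pr ?I"
      unfolding start_at_def using C by (rule emeasure_uniform_measure[OF M_sets])
    also have "\<dots> = ennreal (prob (?I \<inter> (traj -` cyl n x E \<inter> space Pr)) / pmf \<pi> i)"
      using start_prob[of i] by (simp add: emeasure_eq_measure divide_ennreal)
    also have "\<dots> = (if x 0 = i \<and> (0, 0) \<in> E 0 then 1 else 0) * ennreal ?W"
    proof (cases "x 0 = i \<and> (0, 0) \<in> E 0")
      case True
      have "?I \<inter> (traj -` cyl n x E \<inter> space Pr) = {w \<in> space Pr. (\<forall>k\<le>n. M k w = x k) \<and> (\<forall>k\<in>{1..n}. (A k w, B k w) \<in> E k)}"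
        using True by (auto simp: cyl_def path_of_def)
      then have "prob (?I \<inter> (traj -` cyl n x E \<inter> space Pr)) = pmf \<pi> i * ?W"
        using True by (simp only: prob_path[OF E])
      then show ?thesis using True start_prob(2)[of i] by simp
    next
      case False
      then have "?I \<inter> (traj -` cyl n x E \<inter> space Pr) = {}" by (auto simp: cyl_def path_of_def)
      then show ?thesis using False by auto
    qed
    finally show ?thesis unfolding W .
  qed
  show ?thesis by (rule path_chain.intro[OF 1 2 4 K_kernel stationary irreducible 3])
qed

lemma AE_path_law: "AE \<omega> in path_law i. R \<omega> \<Longrightarrow> AE w in start_at Pr M i. R (traj w)"
  unfolding path_law_def by (rule AE_distrD[OF path_measurable_start_at])

lemma AE_path_law_iff:
  "Measurable.pred path_space R \<Longrightarrow> (AE \<omega> in path_law i. R \<omega>) \<longleftrightarrow> (AE w in start_at Pr M i. R (traj w))"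
  unfolding path_law_def by (rule AE_distr_iff) (simp_all add: pred_def)

text \<open>Solving for X gives a variable with law F under the conditional measure of every
  starting state. A conditional law that does not depend on the starting state is at once the law of
  X and its independence of \<open>M 0\<close>.\<close>

lemma affine_representationI:
  assumes R: "conditional_law_given_start Pr M R P" and F: "F \<in> space (prob_algebra borel)"
    and P: "\<And>i. P i = distr F borel (\<lambda>x. g i * x + c i)" and g: "\<And>i. g i \<noteq> 0"
  shows "affine_representation Pr M R g c F"
proof -
  have Rm [measurable]: "R \<in> borel_measurable Pr" and RP: "\<And>i. distr (start_at Pr M i) borel R = P i"
    using R by (auto simp: conditional_law_given_start_def)
  have F': "prob_space F" and Fs [measurable_cong]: "sets F = sets borel" using F by (auto simp: space_prob_algebra)
  note [measurable] = M_measurable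
  have gc [measurable]: "(\<lambda>w. g (M 0 w)) \<in> borel_measurable Pr" "(\<lambda>w. c (M 0 w)) \<in> borel_measurable Pr"
    by (rule measurable_compose[OF M_measurable]; simp)+
  define X where "X w = (R w - c (M 0 w)) / g (M 0 w)" for w
  have X [measurable]: "X \<in> borel_measurable Pr" unfolding X_def by measurable
  have XF: "emeasure (start_at Pr M i) (X -` E \<inter> space Pr) = emeasure F E" if E [measurable]: "E \<in> sets borel" for i E
  proof -
    have E' [measurable]: "{y. (y - c i) / g i \<in> E} \<in> sets borel"
    proof -
      have "{y \<in> space borel. (y - c i) / g i \<in> E} \<in> sets borel" by measurable
      then show ?thesis by simp
    qed
    have "emeasure (start_at Pr M i) (X -` E \<inter> space Pr) = emeasure (start_at Pr M i) (R -` {y. (y - c i) / g i \<in> E} \<inter> space Pr)"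
    proof (rule emeasure_eq_AE)
      have "AE w in start_at Pr M i. M 0 w = i" by (simp add: AE_start_at)
      then show "AE w in start_at Pr M i. (w \<in> X -` E \<inter> space Pr) = (w \<in> R -` {y. (y - c i) / g i \<in> E} \<inter> space Pr)"
        by eventually_elim (simp add: X_def)
    qed (auto simp: sets_start_at)
    also have "\<dots> = emeasure (distr (start_at Pr M i) borel R) {y. (y - c i) / g i \<in> E}"
      by (subst emeasure_distr) auto
    also have "\<dots> = emeasure (distr F borel (\<lambda>x. g i * x + c i)) {y. (y - c i) / g i \<in> E}"
      by (simp only: RP P)
    also have "\<dots> = emeasure F E"
      using g[of i] sets_eq_imp_space_eq[OF Fs] by (subst emeasure_distr) (auto simp: vimage_def)
    finally show ?thesis .
  qed
  have joint: "emeasure Pr ({w \<in> space Pr. M 0 w \<in> S} \<inter> (X -` E \<inter> space Pr)) = emeasure Pr {w \<in> space Pr. M 0 w \<in> S} * emeasure F E"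
    if E [measurable]: "E \<in> sets borel" for S E
  proof -
    have piece: "emeasure Pr ({w \<in> space Pr. M 0 w = i} \<inter> (X -` E \<inter> space Pr)) = emeasure Pr {w \<in> space Pr. M 0 w = i} * emeasure F E" for i
    proof -
      have XE: "X -` E \<inter> space Pr \<in> sets Pr" by measurable
      have "emeasure F E = emeasure Pr ({w \<in> space Pr. M 0 w = i} \<inter> (X -` E \<inter> space Pr)) / emeasure Pr {w \<in> space Pr. M 0 w = i}"
        using XF[OF E, of i] emeasure_uniform_measure[OF M_sets XE, of 0 i] by (simp add: start_at_def)
      then have "emeasure F E = ennreal (prob ({w \<in> space Pr. M 0 w = i} \<inter> (X -` E \<inter> space Pr)) / pmf \<pi> i)"
        using start_prob[of i] by (simp add: emeasure_eq_measure divide_ennreal)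
      then show ?thesis
        using start_prob[of i] by (simp add: emeasure_eq_measure ennreal_mult[symmetric])
    qed
    have "emeasure Pr ({w \<in> space Pr. M 0 w \<in> S} \<inter> (X -` E \<inter> space Pr)) = emeasure Pr (\<Union>i\<in>S. {w \<in> space Pr. M 0 w = i} \<inter> (X -` E \<inter> space Pr))"
      by (intro arg_cong[where f = "emeasure Pr"]) auto
    also have "\<dots> = (\<integral>\<^sup>+i. emeasure Pr ({w \<in> space Pr. M 0 w = i} \<inter> (X -` E \<inter> space Pr)) \<partial>count_space S)"
      by (rule emeasure_UN_countable) (auto simp: disjoint_family_on_def)
    also have "\<dots> = (\<integral>\<^sup>+i. emeasure Pr {w \<in> space Pr. M 0 w = i} \<partial>count_space S) * emeasure F E"
      unfolding piece by (rule nn_integral_multc) simp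
    also have "(\<integral>\<^sup>+i. emeasure Pr {w \<in> space Pr. M 0 w = i} \<partial>count_space S) = emeasure Pr (\<Union>i\<in>S. {w \<in> space Pr. M 0 w = i})"
      by (rule emeasure_UN_countable[symmetric]) (auto simp: disjoint_family_on_def)
    also have "(\<Union>i\<in>S. {w \<in> space Pr. M 0 w = i}) = {w \<in> space Pr. M 0 w \<in> S}" by auto
    finally show ?thesis .
  qed
  have law: "emeasure Pr (X -` E \<inter> space Pr) = emeasure F E" if E: "E \<in> sets borel" for E
    using joint[OF E, of UNIV] emeasure_space_1 by (simp add: Int_absorb1)
  have dX: "distr Pr borel X = F"
    by (rule measure_eqI) (simp_all add: Fs emeasure_distr law)
  have ind: "indep_set (sets (vimage_algebra (space Pr) (M 0) (count_space UNIV))) (sets (vimage_algebra (space Pr) X borel))"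
  proof (rule indep_setI)
    have sM: "sets (vimage_algebra (space Pr) (M 0) (count_space UNIV)) = {M 0 -` S \<inter> space Pr | S. True}"
      by (subst sets_vimage_algebra2) auto
    have sX: "sets (vimage_algebra (space Pr) X borel) = {X -` E \<inter> space Pr | E. E \<in> sets borel}"
      by (subst sets_vimage_algebra2) auto
    show "sets (vimage_algebra (space Pr) (M 0) (count_space UNIV)) \<subseteq> events"
      unfolding sM using measurable_sets[OF M_measurable[of 0]] by auto
    show "sets (vimage_algebra (space Pr) X borel) \<subseteq> events"
      unfolding sX using measurable_sets[OF X] by auto
    fix a b assume "a \<in> sets (vimage_algebra (space Pr) (M 0) (count_space UNIV))" "b \<in> sets (vimage_algebra (space Pr) X borel)"
    then obtain S E where a: "a = {w \<in> space Pr. M 0 w \<in> S}" and b: "b = X -` E \<inter> space Pr" and E: "E \<in> sets borel"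
      unfolding sM sX by auto
    have "emeasure Pr (a \<inter> b) = emeasure Pr a * emeasure Pr b" unfolding a b joint[OF E] law[OF E] ..
    then show "prob (a \<inter> b) = prob a * prob b"
      by (simp add: emeasure_eq_measure ennreal_mult[symmetric])
  qed
  show ?thesis
    unfolding affine_representation_def
  proof (intro bexI[of _ X] conjI)
    show "AE w in Pr. R w = g (M 0 w) * X w + c (M 0 w)" using g by (simp add: X_def)
  qed (use dX ind in auto)
qed

end


subsection \<open>Transfer to the modulated sequence\<close>

context markov_modulated begin

context
  assumes A_nonzero: "prob {w \<in> space Pr. A 1 w = 0} = 0"
begin

interpretation C: path_chain path_law p K \<pi>
  by (rule path_law_path_chain[OF A_nonzero])

lemma AE_recurrent_start_at: "AE w in start_at Pr M i. \<exists>\<^sub>\<infinity>n. M n w = j"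
  using AE_path_law[OF C.recurrent[where i = i and j = j]] by (simp add: path_of_simps)

lemma AE_recurrent: "AE w in Pr. \<exists>\<^sub>\<infinity>n. M n w = j"
  unfolding AE_iff_start_at using AE_recurrent_start_at by blast

lemma lev_traj:
  "\<exists>\<^sub>\<infinity>n. M n w = i \<Longrightarrow> lev i (traj w) = limsup (\<lambda>n. ereal \<bar>Pi_prod A (ret_nat M i n w) w\<bar>)"
  unfolding lev_def path_of_simps Pi_prod_path_of by (rule limsup_ret_nat) simp_all

lemma cycle_traj:
  assumes "\<exists>\<^sub>\<infinity>n. M n w = i"
  shows "cycle i (traj w) = (cycle_A M A i w, cycle_B M A B i w)"
proof -
  have "ret_nat M i 1 w = visit_time i 1 (traj w)"
    using ret_nat_1_visit_time[of "traj w" i] assms by (simp add: ret_nat_path_of path_of_simps)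
  then show ?thesis
    by (simp add: cycle_def path_aff_def cycle_A_def cycle_B_def Pi_prod_path_of perp_sum_path_of)
qed

lemma Pi_prod_Pr [measurable]: "Pi_prod A n \<in> borel_measurable Pr"
  unfolding Pi_prod_def using A_measurable by (intro borel_measurable_prod) auto

lemma perp_sum_Pr [measurable]: "perp_sum A B n \<in> borel_measurable Pr"
  unfolding perp_sum_def using B_measurable by (intro borel_measurable_sum borel_measurable_times) auto

lemma cycle_Pr [measurable]: "cycle_A M A i \<in> borel_measurable Pr" "cycle_B M A B i \<in> borel_measurable Pr"
  unfolding cycle_A_def cycle_B_def
  by (rule measurable_compose_countable[OF _ ret_nat_measurable[OF M_measurable]]; measurable)+

lemma fst_snd_cycle [measurable]:
  "(\<lambda>\<omega>. fst (cycle i \<omega>)) \<in> borel_measurable path_space" "(\<lambda>\<omega>. snd (cycle i \<omega>)) \<in> borel_measurable path_space"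
  by (auto intro!: measurable_compose[OF cycle_measurable] borel_measurable_continuous_onI continuous_intros)

lemma AE_cycle:
  assumes "Measurable.pred path_space (\<lambda>\<omega>. R (fst (cycle i \<omega>)) (snd (cycle i \<omega>)))"
  shows "(AE \<omega> in path_law i. R (fst (cycle i \<omega>)) (snd (cycle i \<omega>))) \<longleftrightarrow>
    (AE w in start_at Pr M i. R (cycle_A M A i w) (cycle_B M A B i w))"
proof -
  have "(AE \<omega> in path_law i. R (fst (cycle i \<omega>)) (snd (cycle i \<omega>))) \<longleftrightarrow>
    (AE w in start_at Pr M i. R (fst (cycle i (traj w))) (snd (cycle i (traj w))))"
    using assms by (rule AE_path_law_iff)
  also have "\<dots> \<longleftrightarrow> (AE w in start_at Pr M i. R (cycle_A M A i w) (cycle_B M A B i w))"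
  proof (rule eventually_cong)
    show "AE w in start_at Pr M i. (cycle_A M A i w, cycle_B M A B i w) = cycle i (traj w)"
      using AE_recurrent_start_at[where i = i and j = i] by eventually_elim (simp add: cycle_traj)
    show "R (fst (cycle i (traj w))) (snd (cycle i (traj w))) \<longleftrightarrow> R (cycle_A M A i w) (cycle_B M A B i w)"
      if "(cycle_A M A i w, cycle_B M A B i w) = cycle i (traj w)" for w
      unfolding that[symmetric] by simp
  qed
  finally show ?thesis .
qed

lemma prob_start_at_eq_1:
  assumes "Measurable.pred Pr R"
  shows "\<P>(w in start_at Pr M i. R w) = 1 \<longleftrightarrow> (AE w in start_at Pr M i. R w)"
proof (rule prob_space.prob_Collect_eq_1[OF prob_space_start_at])
  show "{w \<in> space (start_at Pr M i). R w} \<in> sets (start_at Pr M i)"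
    using assms by (simp add: pred_def sets_start_at)
qed

section \<open>The four cases in terms of path laws\<close>

lemma contractive_case_lev:
  assumes "contractive_case Pr M A B"
  shows "AE \<omega> in path_law j. lev i \<omega> = 0"
proof -
  have "AE w in Pr. (\<lambda>n. Pi_prod A (ret_nat M i n w) w) \<longlonglongrightarrow> 0"
    using assms by (simp add: contractive_case_def)
  then have "AE w in start_at Pr M j. (\<lambda>n. Pi_prod A (ret_nat M i n w) w) \<longlonglongrightarrow> 0"
    by (simp add: AE_iff_start_at)
  then have "AE w in start_at Pr M j. lev i (traj w) = 0"
    using AE_recurrent_start_at[where i = j and j = i]
  proof eventually_elim
    case (elim w)
    have "(\<lambda>n. ereal \<bar>Pi_prod A (ret_nat M i n w) w\<bar>) \<longlonglongrightarrow> 0"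
      using tendsto_ereal[OF tendsto_rabs_zero[OF elim(1)]] by (simp add: zero_ereal_def)
    then show ?case
      unfolding lev_traj[OF elim(2)] by (rule lim_imp_Limsup[OF trivial_limit_sequentially])
  qed
  then show ?thesis by (subst AE_path_law_iff) measurable
qed

lemma unbounded_case_lev: "unbounded_case Pr M A \<longleftrightarrow> (\<forall>i j. AE \<omega> in path_law j. lev i \<omega> = \<infinity>)"
proof -
  have "(AE w in Pr. limsup (\<lambda>n. ereal \<bar>Pi_prod A (ret_nat M i n w) w\<bar>) = \<infinity>) \<longleftrightarrow> (\<forall>j. AE \<omega> in path_law j. lev i \<omega> = \<infinity>)" for i
  proof -
    have "(AE w in Pr. limsup (\<lambda>n. ereal \<bar>Pi_prod A (ret_nat M i n w) w\<bar>) = \<infinity>) \<longleftrightarrow> (AE w in Pr. lev i (traj w) = \<infinity>)"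
      using AE_recurrent[of i] by (rule eventually_cong) (simp add: lev_traj)
    also have "\<dots> \<longleftrightarrow> (\<forall>j. AE \<omega> in path_law j. lev i \<omega> = \<infinity>)"
      unfolding AE_iff_start_at by (intro all_cong1 AE_path_law_iff[symmetric]) measurable
    finally show ?thesis .
  qed
  then show ?thesis by (simp add: unbounded_case_def)
qed

text \<open>When the modulus is almost surely 1, the strict inequality of probabilities says exactly
  that slope 1 is not almost sure.\<close>

lemma reflection_case_cycle:
  "reflection_case Pr M A \<longleftrightarrow>
    (\<forall>i. (AE \<omega> in path_law i. \<bar>fst (cycle i \<omega>)\<bar> = 1) \<and> \<not> (AE \<omega> in path_law i. fst (cycle i \<omega>) = 1))"
proof -
  have 1: "\<P>(w in start_at Pr M i. \<bar>cycle_A M A i w\<bar> = 1) = 1 \<longleftrightarrow> (AE \<omega> in path_law i. \<bar>fst (cycle i \<omega>)\<bar> = 1)" for i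
    using AE_cycle[of "\<lambda>a b. \<bar>a\<bar> = 1" i] prob_start_at_eq_1[of "\<lambda>w. \<bar>cycle_A M A i w\<bar> = 1" i] by simp
  have 2: "\<P>(w in start_at Pr M i. cycle_A M A i w = 1) = 1 \<longleftrightarrow> (AE \<omega> in path_law i. fst (cycle i \<omega>) = 1)" for i
    using AE_cycle[of "\<lambda>a b. a = 1" i] prob_start_at_eq_1[of "\<lambda>w. cycle_A M A i w = 1" i] by simp
  have lt1: "\<P>(w in start_at Pr M i. cycle_A M A i w = 1) < 1 \<longleftrightarrow> \<P>(w in start_at Pr M i. cycle_A M A i w = 1) \<noteq> 1" for i
    using prob_space.prob_le_1[OF prob_space_start_at] by (simp add: less_le)
  show ?thesis unfolding reflection_case_def 1[symmetric] 2[symmetric]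
  proof (intro all_cong1)
    fix i
    let ?P = "\<lambda>R. \<P>(w in start_at Pr M i. R w)"
    show "?P (\<lambda>w. cycle_A M A i w = 1) < ?P (\<lambda>w. \<bar>cycle_A M A i w\<bar> = 1) \<and> ?P (\<lambda>w. \<bar>cycle_A M A i w\<bar> = 1) = 1 \<longleftrightarrow>
      ?P (\<lambda>w. \<bar>cycle_A M A i w\<bar> = 1) = 1 \<and> ?P (\<lambda>w. cycle_A M A i w = 1) \<noteq> 1"
      using lt1[of i] by argo
  qed
qed

lemma identity_case_cycle:
  "identity_case Pr M A B \<longleftrightarrow> (\<forall>i. AE \<omega> in path_law i. cycle i \<omega> = (1, 0))"
proof -
  have "\<P>(w in start_at Pr M i. cycle_A M A i w = 1 \<and> cycle_B M A B i w = 0) = 1 \<longleftrightarrow> (AE \<omega> in path_law i. cycle i \<omega> = (1, 0))" for i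
    using AE_cycle[of "\<lambda>a b. a = 1 \<and> b = 0" i] prob_start_at_eq_1[of "\<lambda>w. cycle_A M A i w = 1 \<and> cycle_B M A B i w = 0" i]
    by (simp add: prod_eq_iff)
  then show ?thesis by (simp add: identity_case_def)
qed

text \<open>Both the inner truncated mean and the outer expectation are pushed to path space. The
  cycle quantities on the two sides are identified where the visits to i never end, hence almost
  surely.\<close>

lemma contractive_caseI:
  assumes fp: "fixed_point p K P" and lev0: "\<And>i j. AE \<omega> in path_law j. lev i \<omega> = 0"
  shows "contractive_case Pr M A B"
  unfolding contractive_case_def
proof (intro allI conjI)
  fix i
  have "AE w in start_at Pr M j. (\<lambda>n. Pi_prod A (ret_nat M i n w) w) \<longlonglongrightarrow> 0" for j
    using AE_path_law[OF lev0[of i j]] AE_recurrent_start_at[where i = j and j = i]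
  proof eventually_elim
    case (elim w)
    show ?case
    proof (rule tendsto_ret_nat[where M = M and i = i and w = w, OF elim(2)])
      fix \<epsilon> :: real assume "0 < \<epsilon>"
      from lev_0D[OF elim(1) this] show "\<exists>N. \<forall>n\<ge>N. M n w = i \<longrightarrow> \<bar>Pi_prod A n w - 0\<bar> \<le> \<epsilon>"
        by (auto simp: path_of_simps Pi_prod_path_of intro: less_imp_le)
    qed
  qed
  then show "AE w in Pr. (\<lambda>n. Pi_prod A (ret_nat M i n w) w) \<longlonglongrightarrow> 0" by (simp add: AE_iff_start_at)
  define X where "X \<omega> = max 0 (- ln \<bar>fst (cycle i \<omega>)\<bar>)" for \<omega> :: "'s path"
  define Y where "Y \<omega> = log_plus \<bar>snd (cycle i \<omega>)\<bar>" for \<omega> :: "'s path"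
  have [measurable]: "X \<in> borel_measurable path_space" "Y \<in> borel_measurable path_space"
    unfolding X_def Y_def log_plus_def by measurable
  note J = C.contractive_J_integral[OF fp lev0, of i, folded X_def Y_def]
  have cyc: "AE w in start_at Pr M i. cycle i (traj w) = (cycle_A M A i w, cycle_B M A B i w)"
    using AE_recurrent_start_at[where i = i and j = i] by eventually_elim (rule cycle_traj)
  have S: "S_walk A (ret_nat M i 1 w) w = - ln \<bar>cycle_A M A i w\<bar>" for w
    by (simp add: S_walk_def cycle_A_def)
  have "\<P>(w in start_at Pr M i. S_walk A (ret_nat M i 1 w) w \<le> 0) = measure (path_law i) {\<omega>. - ln \<bar>fst (cycle i \<omega>)\<bar> \<le> 0}"
  proof -
    have N: "{\<omega> :: 's path. - ln \<bar>fst (cycle i \<omega>)\<bar> \<le> 0} \<in> sets path_space" by (rule path_Collect) measurable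
    have "measure (path_law i) {\<omega>. - ln \<bar>fst (cycle i \<omega>)\<bar> \<le> 0} = measure (start_at Pr M i) (traj -` {\<omega>. - ln \<bar>fst (cycle i \<omega>)\<bar> \<le> 0} \<inter> space Pr)"
      unfolding path_law_def by (subst measure_distr) (use N in auto)
    also have "\<dots> = measure (start_at Pr M i) {w \<in> space (start_at Pr M i). - ln \<bar>cycle_A M A i w\<bar> \<le> 0}"
    proof (rule measure_eq_AE)
      show "AE w in start_at Pr M i. (w \<in> traj -` {\<omega>. - ln \<bar>fst (cycle i \<omega>)\<bar> \<le> 0} \<inter> space Pr) = (w \<in> {w \<in> space (start_at Pr M i). - ln \<bar>cycle_A M A i w\<bar> \<le> 0})"
        using cyc by eventually_elim auto
      show "traj -` {\<omega>. - ln \<bar>fst (cycle i \<omega>)\<bar> \<le> 0} \<inter> space Pr \<in> sets (start_at Pr M i)"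
        using measurable_sets[OF path_measurable N] by (simp add: sets_start_at)
      show "{w \<in> space (start_at Pr M i). - ln \<bar>cycle_A M A i w\<bar> \<le> 0} \<in> sets (start_at Pr M i)" by measurable
    qed
    finally show ?thesis by (simp only: S space_start_at)
  qed
  then have lt: "\<P>(w in start_at Pr M i. S_walk A (ret_nat M i 1 w) w \<le> 0) < 1" using J(1) by simp
  have trunc: "(\<integral>w. min (max 0 (S_walk A (ret_nat M i 1 w) w)) u \<partial>start_at Pr M i) = (\<integral>\<omega>. min (X \<omega>) u \<partial>path_law i)" for u
  proof -
    have "(\<integral>\<omega>. min (X \<omega>) u \<partial>path_law i) = (\<integral>w. min (X (traj w)) u \<partial>start_at Pr M i)"
      unfolding path_law_def by (rule integral_distr) measurable
    also have "\<dots> = (\<integral>w. min (max 0 (S_walk A (ret_nat M i 1 w) w)) u \<partial>start_at Pr M i)"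
    proof (rule integral_cong_AE)
      show "AE w in start_at Pr M i. min (X (traj w)) u = min (max 0 (S_walk A (ret_nat M i 1 w) w)) u"
        using cyc by eventually_elim (simp add: X_def S[simplified])
      show "(\<lambda>w. min (X (traj w)) u) \<in> borel_measurable (start_at Pr M i)" by measurable
      show "(\<lambda>w. min (max 0 (S_walk A (ret_nat M i 1 w) w)) u) \<in> borel_measurable (start_at Pr M i)"
        unfolding S by measurable
    qed
    finally show ?thesis ..
  qed
  define G where "G u = ennreal (if u = 0 then 1 else u / (\<integral>\<omega>. min (X \<omega>) u \<partial>path_law i))" for u
  have G: "G \<in> borel_measurable borel"
  proof -
    have "(\<lambda>(u, \<omega>). min (X \<omega>) u) \<in> borel_measurable (borel \<Otimes>\<^sub>M path_law i)" by measurable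
    from sigma_finite_measure.borel_measurable_lebesgue_integral[OF C.sigma_finite_Q this]
    have [measurable]: "(\<lambda>u. \<integral>\<omega>. min (X \<omega>) u \<partial>path_law i) \<in> borel_measurable borel" .
    show ?thesis unfolding G_def by measurable
  qed
  \<comment> \<open>The strict inequality \<open>lt\<close> selects the branch of
    \<open>J_fun\<close> with the truncated mean.\<close>
  have J_fun: "ennreal (J_fun Pr M A i u) = G u" for u
    using lt by (simp only: J_fun_def G_def trunc if_True)
  have "(\<integral>\<^sup>+w. ennreal (J_fun Pr M A i (log_plus \<bar>cycle_B M A B i w\<bar>)) \<partial>start_at Pr M i) = (\<integral>\<^sup>+w. G (Y (traj w)) \<partial>start_at Pr M i)"
    using cyc unfolding J_fun by (intro nn_integral_cong_AE, eventually_elim) (simp add: Y_def)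
  also have "\<dots> = (\<integral>\<^sup>+\<omega>. G (Y \<omega>) \<partial>path_law i)"
  proof -
    have "(\<lambda>\<omega>. G (Y \<omega>)) \<in> borel_measurable path_space" by (rule measurable_compose[OF _ G]) measurable
    then show ?thesis unfolding path_law_def by (subst nn_integral_distr) auto
  qed
  finally show "(\<integral>\<^sup>+w. ennreal (J_fun Pr M A i (log_plus \<bar>cycle_B M A B i w\<bar>)) \<partial>start_at Pr M i) < \<infinity>"
    unfolding G_def by (rule ord_eq_less_trans) (rule J(2))
qed

lemma contractive_conclusion:
  assumes fp: "fixed_point p K \<nu>" and con: "contractive_case Pr M A B"
  shows "AE w in start_at Pr M i. convergent (\<lambda>n. perp_sum A B (ret_nat M i n w) w)"
    "\<nu> i = distr (start_at Pr M i) borel (\<lambda>w. lim (\<lambda>n. perp_sum A B (ret_nat M i n w) w))"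
proof -
  note lev0 = contractive_case_lev[OF con]
  \<comment> \<open>\<open>lim\<close> is measurable as a total function; its unspecified value
    where the sequence diverges matters only on a null set.\<close>
  define z where "z \<omega> = lim (\<lambda>n. perp_sum ca cb (ret_nat st i n \<omega>) \<omega>)" for \<omega> :: "'s path"
  have z_traj: "z (traj w) = lim (\<lambda>n. perp_sum A B (ret_nat M i n w) w)" for w
    by (simp add: z_def perp_sum_path_of ret_nat_path_of)
  have z [measurable]: "z \<in> borel_measurable path_space"
    unfolding z_def
  proof (rule borel_measurable_lim_metric)
    show "(\<lambda>\<omega>. perp_sum ca cb (ret_nat st i n \<omega>) \<omega>) \<in> borel_measurable path_space" for n
      by (rule measurable_compose_countable[OF _ ret_nat_measurable[OF st_measurable]]; measurable)
  qed
  have conv: "AE \<omega> in path_law i. visit_limit i \<omega> (z \<omega>) \<and> convergent (\<lambda>n. perp_sum ca cb (ret_nat st i n \<omega>) \<omega>)"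
    using C.visit_limit_exists[OF fp lev0, of i] C.recurrent[where i = i and j = i]
  proof eventually_elim
    case (elim \<omega>)
    then obtain y where y: "visit_limit i \<omega> y" by blast
    have "(\<lambda>n. perp_sum ca cb (ret_nat st i n \<omega>) \<omega>) \<longlonglongrightarrow> y"
      by (rule tendsto_ret_nat[where M = st and i = i and w = \<omega>, OF elim(2)]) (use y in \<open>auto simp: visit_limit_def\<close>)
    then show ?case using y limI by (auto simp: z_def convergent_def)
  qed
  from AE_path_law[OF conv] show "AE w in start_at Pr M i. convergent (\<lambda>n. perp_sum A B (ret_nat M i n w) w)"
    by eventually_elim (simp add: perp_sum_path_of ret_nat_path_of)
  have "\<nu> i = distr (path_law i) borel z"
    by (rule C.fixed_point_perpetuity[OF fp lev0 z]) (use conv in \<open>auto elim: eventually_mono\<close>)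
  also have "\<dots> = distr (start_at Pr M i) borel (\<lambda>w. z (traj w))"
    unfolding path_law_def by (subst distr_distr) (auto simp: comp_def)
  finally show "\<nu> i = distr (start_at Pr M i) borel (\<lambda>w. lim (\<lambda>n. perp_sum A B (ret_nat M i n w) w))"
    by (simp add: z_traj)
qed

lemma reflection_conclusion:
  assumes fp: "fixed_point p K P" and refl: "reflection_case Pr M A"
  shows "\<exists>c :: 's \<Rightarrow> real.
    (\<forall>c'. \<P>(w in Pr. A 1 w * c' (M 1 w) + B 1 w = c' (M 0 w)) = 1 \<longleftrightarrow> c' = c) \<and>
    (\<exists>(a :: 's \<Rightarrow> real) F. (\<forall>i. a i > 0) \<and> symmetric_law F \<and>
       (\<forall>i. P i = distr F borel (\<lambda>x. a i * x + c i)) \<and>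
       (\<forall>R. conditional_law_given_start Pr M R P \<longrightarrow> affine_representation Pr M R a c F))"
proof -
  obtain c a F where c: "\<And>c'. (\<forall>i. AE \<omega> in path_law i. ca 1 \<omega> * c' (st 1 \<omega>) + cb 1 \<omega> = c' (st 0 \<omega>)) \<longleftrightarrow> c' = c"
    and a: "\<And>i. 0 < a i" and F: "symmetric_law F" and P: "\<And>i. P i = distr F borel (\<lambda>x. a i * x + c i)"
    using C.reflection_structure[OF fp] refl unfolding reflection_case_cycle by blast
  have "\<P>(w in Pr. A 1 w * c' (M 1 w) + B 1 w = c' (M 0 w)) = 1 \<longleftrightarrow> c' = c" for c'
  proof -
    have cm [measurable]: "(\<lambda>w. c' (M n w)) \<in> borel_measurable Pr" "(\<lambda>\<omega>. c' (st n \<omega>)) \<in> borel_measurable path_space" for n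
      by (rule measurable_compose[OF M_measurable], simp) (rule measurable_compose[OF st_measurable], simp)
    have [measurable]: "A 1 \<in> borel_measurable Pr" "B 1 \<in> borel_measurable Pr" using A_measurable B_measurable by auto
    have "\<P>(w in Pr. A 1 w * c' (M 1 w) + B 1 w = c' (M 0 w)) = 1 \<longleftrightarrow> (AE w in Pr. A 1 w * c' (M 1 w) + B 1 w = c' (M 0 w))"
      by (rule prob_Collect_eq_1) measurable
    also have "\<dots> \<longleftrightarrow> (\<forall>i. AE w in start_at Pr M i. ca 1 (traj w) * c' (st 1 (traj w)) + cb 1 (traj w) = c' (st 0 (traj w)))"
      by (simp add: AE_iff_start_at path_of_simps)
    also have "\<dots> \<longleftrightarrow> (\<forall>i. AE \<omega> in path_law i. ca 1 \<omega> * c' (st 1 \<omega>) + cb 1 \<omega> = c' (st 0 \<omega>))"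
      by (intro all_cong1 AE_path_law_iff[symmetric]) measurable
    finally show ?thesis by (simp only: c)
  qed
  moreover have "affine_representation Pr M R a c F" if "conditional_law_given_start Pr M R P" for R
    by (rule affine_representationI[OF that _ P]) (use F a in \<open>auto simp: symmetric_law_def less_imp_neq[symmetric]\<close>)
  ultimately show ?thesis using a F P by blast
qed

lemma identity_conclusion:
  assumes fp: "fixed_point p K P" and ide: "identity_case Pr M A B"
  shows "\<exists>(C :: ('s \<Rightarrow> real) set) (a :: 's \<Rightarrow> real) (\<sigma> :: 's \<Rightarrow> real).
    infinite C \<and> (\<forall>i0 r. \<exists>!c. c \<in> C \<and> c i0 = r) \<and> (\<forall>i. a i > 0) \<and> (\<forall>i. \<sigma> i \<in> {1, -1}) \<and>
    (\<forall>c\<in>C.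
      (\<exists>F \<in> space (prob_algebra borel).
         (\<forall>i. P i = distr F borel (\<lambda>x. a i * \<sigma> i * x + c i)) \<and>
         (\<forall>R. conditional_law_given_start Pr M R P \<longrightarrow> affine_representation Pr M R (\<lambda>i. a i * \<sigma> i) c F)) \<and>
      (\<forall>F \<in> space (prob_algebra borel). fixed_point p K (\<lambda>i. distr F borel (\<lambda>x. a i * \<sigma> i * x + c i))))"
proof -
  obtain \<alpha> \<beta> :: "'s \<Rightarrow> real" where \<alpha>: "\<And>i. \<alpha> i \<noteq> 0"
    and P: "\<And>r. \<exists>F\<in>space (prob_algebra borel). \<forall>i. P i = distr F borel (\<lambda>x. 1 / \<alpha> i * x + (r - \<beta> i) / \<alpha> i)"
    and fix_all: "\<And>r F. F \<in> space (prob_algebra borel) \<Longrightarrow> fixed_point p K (\<lambda>i. distr F borel (\<lambda>x. 1 / \<alpha> i * x + (r - \<beta> i) / \<alpha> i))"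
    using C.identity_structure[OF fp] ide unfolding identity_case_cycle by blast
  \<comment> \<open>The factor \<open>1 / \<alpha> i\<close> is split into modulus and sign.\<close>
  define a where "a i = 1 / \<bar>\<alpha> i\<bar>" for i
  define \<sigma> where "\<sigma> i = sgn (\<alpha> i)" for i
  have a\<sigma>: "a i * \<sigma> i = 1 / \<alpha> i" for i by (simp add: a_def \<sigma>_def sgn_real_def)
  \<comment> \<open>As \<open>\<alpha> i\<close> is nonzero, r can be recovered from any single
    entry of \<open>\<gamma> r\<close>; hence the parametrization by the value at an arbitrary
    state.\<close>
  define \<gamma> where "\<gamma> r i = (r - \<beta> i) / \<alpha> i" for r i
  have \<gamma>_iff: "\<gamma> r i = s \<longleftrightarrow> r = \<alpha> i * s + \<beta> i" for r i s
    using \<alpha>[of i] by (auto simp: \<gamma>_def field_simps)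
  have "infinite (range \<gamma>)"
  proof -
    have "inj \<gamma>" by (rule injI) (metis \<gamma>_iff)
    then show ?thesis using infinite_UNIV_char_0[where 'a = real] by (simp add: finite_image_iff)
  qed
  moreover have "\<exists>!c. c \<in> range \<gamma> \<and> c i0 = r" for i0 r
  proof (rule ex1I[of _ "\<gamma> (\<alpha> i0 * r + \<beta> i0)"])
    show "\<gamma> (\<alpha> i0 * r + \<beta> i0) \<in> range \<gamma> \<and> \<gamma> (\<alpha> i0 * r + \<beta> i0) i0 = r" by (simp add: \<gamma>_iff)
    show "c = \<gamma> (\<alpha> i0 * r + \<beta> i0)" if "c \<in> range \<gamma> \<and> c i0 = r" for c
    proof -
      from that obtain s where "c = \<gamma> s" "\<gamma> s i0 = r" by blast
      then show ?thesis using \<gamma>_iff[THEN iffD1, of s i0 r] by simp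
    qed
  qed
  moreover have "a i > 0" "\<sigma> i \<in> {1, -1}" for i using \<alpha>[of i] by (auto simp: a_def \<sigma>_def sgn_real_def)
  moreover have "\<exists>F \<in> space (prob_algebra borel).
         (\<forall>i. P i = distr F borel (\<lambda>x. a i * \<sigma> i * x + c i)) \<and>
         (\<forall>R. conditional_law_given_start Pr M R P \<longrightarrow> affine_representation Pr M R (\<lambda>i. a i * \<sigma> i) c F)"
    if c: "c \<in> range \<gamma>" for c
  proof -
    obtain r where r: "c = \<gamma> r" using c by blast
    obtain F where F: "F \<in> space (prob_algebra borel)" "\<And>i. P i = distr F borel (\<lambda>x. a i * \<sigma> i * x + c i)"
      using P[of r] unfolding r \<gamma>_def a\<sigma> by blast
    have "affine_representation Pr M R (\<lambda>i. a i * \<sigma> i) c F" if "conditional_law_given_start Pr M R P" for R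
      by (rule affine_representationI[OF that F]) (simp add: a\<sigma> \<alpha>)
    with F show ?thesis by blast
  qed
  moreover have "fixed_point p K (\<lambda>i. distr F borel (\<lambda>x. a i * \<sigma> i * x + c i))"
    if "c \<in> range \<gamma>" "F \<in> space (prob_algebra borel)" for c F
    using that fix_all unfolding a\<sigma> by (auto simp: \<gamma>_def)
  ultimately show ?thesis
    by (intro exI[of _ "range \<gamma>"] exI[of _ a] exI[of _ \<sigma>] conjI allI ballI) simp_all
qed

lemma unbounded_conclusion:
  assumes fp: "fixed_point p K P" and unb: "unbounded_case Pr M A"
  shows "\<exists>c :: 's \<Rightarrow> real.
    (\<forall>c'. (\<forall>i. \<P>(w in start_at Pr M i. cycle_A M A i w * c' i + cycle_B M A B i w = c' i) = 1) \<longleftrightarrow> c' = c) \<and>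
    (\<forall>i. P i = return borel (c i)) \<and> (\<forall>Q. fixed_point p K Q \<longrightarrow> Q = P)"
proof -
  obtain c where c: "\<And>c'. (\<forall>i. AE \<omega> in path_law i. fst (cycle i \<omega>) * c' i + snd (cycle i \<omega>) = c' i) \<longleftrightarrow> c' = c"
    and P: "\<And>i. P i = return borel (c i)" "\<And>\<kappa>. fixed_point p K \<kappa> \<Longrightarrow> \<kappa> = P"
    using C.unbounded_structure[OF fp] unb unfolding unbounded_case_lev by blast
  have "\<P>(w in start_at Pr M i. cycle_A M A i w * c' i + cycle_B M A B i w = c' i) = 1
    \<longleftrightarrow> (AE \<omega> in path_law i. fst (cycle i \<omega>) * c' i + snd (cycle i \<omega>) = c' i)" for c' i
    using AE_cycle[of "\<lambda>a b. a * c' i + b = c' i" i]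
      prob_start_at_eq_1[of "\<lambda>w. cycle_A M A i w * c' i + cycle_B M A B i w = c' i" i] by simp
  then show ?thesis using c P by (intro exI[of _ c]) simp
qed

lemma four_cases_Pr:
  assumes fp: "fixed_point p K P"
  shows "contractive_case Pr M A B \<or> reflection_case Pr M A \<or> identity_case Pr M A B \<or> unbounded_case Pr M A"
proof (rule C.four_cases[OF fp])
  show ?thesis if "\<And>i j. AE \<omega> in path_law j. lev i \<omega> = 0" using contractive_caseI[OF fp that] by simp
  show ?thesis if "\<And>i j. AE \<omega> in path_law j. lev i \<omega> = \<infinity>" using that by (simp add: unbounded_case_lev)
  show ?thesis if "\<And>i. AE \<omega> in path_law i. \<bar>fst (cycle i \<omega>)\<bar> = 1" "\<And>i. \<not> (AE \<omega> in path_law i. fst (cycle i \<omega>) = 1)"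
    using that by (simp add: reflection_case_cycle)
  show ?thesis if "\<And>i. AE \<omega> in path_law i. cycle i \<omega> = (1, 0)" using that by (simp add: identity_case_cycle)
qed

end

end

theorem theorem3p10:
  fixes Pr :: "'w measure"
    and M :: "nat \<Rightarrow> 'w \<Rightarrow> 's::countable"
    and A B :: "nat \<Rightarrow> 'w \<Rightarrow> real"
    and p :: "'s \<Rightarrow> 's pmf"
    and K :: "'s \<Rightarrow> 's \<Rightarrow> (real \<times> real) measure"
    and \<pi> :: "'s pmf"
    and P :: "'s \<Rightarrow> real measure"
  assumes modulated: "markov_modulated Pr M A B p K \<pi>"
    and A_nonzero: "\<P>(w in Pr. A 1 w = 0) = 0"
    and B_nonzero: "\<P>(w in Pr. B 1 w = 0) < 1"
    and fixed: "fixed_point p K P"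
  shows
    "(contractive_case Pr M A B \<or> reflection_case Pr M A \<or>
      identity_case Pr M A B \<or> unbounded_case Pr M A)
   \<and> (contractive_case Pr M A B \<longrightarrow>
        (\<forall>Q. fixed_point p K Q \<longrightarrow> Q = P) \<and>
        (\<forall>i. (AE w in start_at Pr M i. convergent (\<lambda>n. perp_sum A B (ret_nat M i n w) w)) \<and>
             P i = distr (start_at Pr M i) borel (\<lambda>w. lim (\<lambda>n. perp_sum A B (ret_nat M i n w) w))))
   \<and> (reflection_case Pr M A \<longrightarrow>
        (\<exists>c :: 's \<Rightarrow> real.
           (\<forall>c'. \<P>(w in Pr. A 1 w * c' (M 1 w) + B 1 w = c' (M 0 w)) = 1 \<longleftrightarrow> c' = c) \<and>
           (\<exists>(a :: 's \<Rightarrow> real) F. (\<forall>i. a i > 0) \<and> symmetric_law F \<and>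
              (\<forall>i. P i = distr F borel (\<lambda>x. a i * x + c i)) \<and>
              (\<forall>R. conditional_law_given_start Pr M R P \<longrightarrow>
                 affine_representation Pr M R a c F))))
   \<and> (identity_case Pr M A B \<longrightarrow>
        (\<exists>(C :: ('s \<Rightarrow> real) set) (a :: 's \<Rightarrow> real) (\<sigma> :: 's \<Rightarrow> real).
           infinite C \<and> (\<forall>i0 r. \<exists>!c. c \<in> C \<and> c i0 = r) \<and>
           (\<forall>i. a i > 0) \<and> (\<forall>i. \<sigma> i \<in> {1, -1}) \<and>
           (\<forall>c\<in>C.
              (\<exists>F \<in> space (prob_algebra borel).
                 (\<forall>i. P i = distr F borel (\<lambda>x. a i * \<sigma> i * x + c i)) \<and>
                 (\<forall>R. conditional_law_given_start Pr M R P \<longrightarrow>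
                    affine_representation Pr M R (\<lambda>i. a i * \<sigma> i) c F)) \<and>
              (\<forall>F \<in> space (prob_algebra borel).
                 fixed_point p K (\<lambda>i. distr F borel (\<lambda>x. a i * \<sigma> i * x + c i))))))
   \<and> (unbounded_case Pr M A \<longrightarrow>
        (\<exists>c :: 's \<Rightarrow> real.
           (\<forall>c'. (\<forall>i. \<P>(w in start_at Pr M i.
                     cycle_A M A i w * c' i + cycle_B M A B i w = c' i) = 1) \<longleftrightarrow> c' = c) \<and>
           (\<forall>i. P i = return borel (c i)) \<and>
           (\<forall>Q. fixed_point p K Q \<longrightarrow> Q = P)))"
proof -
  interpret markov_modulated Pr M A B p K \<pi> by (rule modulated)
  note cases = four_cases_Pr[OF A_nonzero fixed]
  have con: "(\<forall>Q. fixed_point p K Q \<longrightarrow> Q = P) \<and>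
    (\<forall>i. (AE w in start_at Pr M i. convergent (\<lambda>n. perp_sum A B (ret_nat M i n w) w)) \<and>
      P i = distr (start_at Pr M i) borel (\<lambda>w. lim (\<lambda>n. perp_sum A B (ret_nat M i n w) w)))"
    if "contractive_case Pr M A B"
  proof (intro conjI allI impI ext)
    fix Q i assume "fixed_point p K Q"
    \<comment> \<open>The law of the limit does not involve the fixed point, so both fixed points
      are rewritten into it.\<close>
    then show "Q i = P i"
      by (subst contractive_conclusion(2)[OF A_nonzero fixed that],
          subst contractive_conclusion(2)[OF A_nonzero _ that]) simp_all
  qed (use contractive_conclusion[OF A_nonzero fixed that] in simp_all)
  show ?thesis
    by (intro conjI cases impI[OF con] impI[OF reflection_conclusion[OF A_nonzero fixed]]
        impI[OF identity_conclusion[OF A_nonzero fixed]] impI[OF unbounded_conclusion[OF A_nonzero fixed]])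
qed

end
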